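(* $\mathcal{NMSO}_{\mathrm{ed}}=\mathcal{MREL}\circ\mathcal{DGSM}$ and $\mathcal{NMSO}_{\mathrm{nd}}=\mathcal{REL}\circ\mathcal{DGSM}_\varepsilon$.
   Context: Graphs over node alphabet $\Sigma$ and edge alphabet $\Gamma$ are triples $(V,E,\mathrm{lab})$, $E\subseteq V\times\Gamma\times V$, $\mathrm{lab}:V\to\Sigma$; $*$ denotes "unlabelled". $\mathrm{MSO}(\Sigma,\Gamma)$ is monadic second-order logic with node and node-set variables and atomic formulas $\mathrm{lab}_\sigma(x)$, $\mathrm{edge}_\gamma(x,y)$, $x=y$, $x\in X$. A nondeterministic mso definable graph transduction is given by a domain formula $\varphi_{\mathrm{dom}}$, a finite copy set $C$, node formulas $\varphi^c_\sigma(x)$ and edge formulas $\varphi^{c_1,c_2}_\gamma(x,y)$, all with common free node-set variables (parameters) $X_1,\dots,X_k$; for each input $g$ and each assignment of node sets of $g$ to the parameters satisfying $\varphi_{\mathrm{dom}}$, the output has nodes $(u,c)$ for which exactly one label $\sigma$ satisfies $\varphi^c_\sigma(u)$ (labelled $\sigma$) and edges $((u,c_1),\gamma,(v,c_2))$ between such nodes iff $\varphi^{c_1,c_2}_\gamma(u,v)$ holds; the transduction is the relation of all such pairs (input, output). String representations: for $w$ of length $k$, $\mathrm{nd}(w)$ has $k$ nodes labelled by the letters of $w$ and $k-1$ unlabelled successor edges; $\mathrm{ed}(w)$ has $k+1$ unlabelled nodes forming a path whose $k$ edges are labelled by the letters of $w$. $\mathcal{NMSO}_{\mathrm{nd}}$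 (resp. $\mathcal{NMSO}_{\mathrm{ed}}$) is the family of string transductions $m$ such that $\{(\mathrm{nd}(w),\mathrm{nd}(z))\mid(w,z)\in m\}$ (resp. with $\mathrm{ed}$) is a nondeterministic mso definable graph transduction. A 2gsm is $M=(Q,\Sigma_1,\Sigma_2,\delta,q_{in},q_f)$ with instructions $(p,\sigma,q_1,\alpha_1,\epsilon_1,q_0,\alpha_0,\epsilon_0)$, $p\neq q_f$, $\sigma\in\Sigma_1\cup\{\vdash,\dashv\}$, $\alpha_i\in\Sigma_2^*$, $\epsilon_i\in\{-1,0,+1\}$; on input $w$ the read-only tape is $\vdash w\dashv$ (positions $0..|w|+1$), start in $q_{in}$ at position 0; in state $p$ an instruction starting with $p$ is executed: if the scanned symbol is $\sigma$, go to $q_1$, append $\alpha_1$ to the output, move by $\epsilon_1$, else use $(q_0,\alpha_0,\epsilon_0)$; the head may not leave the tape. The realized relation consists of $(w,z)$ such that some computation reaches $q_f$ with output $z$. $M$ is deterministic if each state has at most one instruction. $\mathcal{DGSM}$: transductions realized by deterministic 2gsm's; $\mathcal{DGSM}_\varepsilon$: those $m\in\mathcal{DGSM}$ with $(\varepsilon,z)\in m\Rightarrow z=\varepsilon$. A string relabelling given by $R\subseteq\Delta_1\times\Delta_2$ maps $\sigma_1\cdots\sigma_n$ to all $\tau_1\cdots\tau_n$ with $\tau_i\in R(\sigma_i)$; $\mathcal{REL}$ is their family. A marked string relabelling maps $w$ to $\vdash w\dashv$ and then applies a string relabelling; $\mathcal{MREL}$ is their family. Composition: $R_1\circ R_2=\{(a,c)\mid\exists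 b:(a,b)\in R_1,(b,c)\in R_2\}$, extended to families elementwise. *)

theory Defs
  imports Main
begin

(* Letters of all alphabets are natural numbers; an alphabet is a finite set of nats.
   Labels of graphs are "option nat": None is the "unlabelled" symbol *. *)

record 'v graph =
  gV :: "'v set"
  gE :: "('v \<times> nat option \<times> 'v) set"
  glab :: "'v \<Rightarrow> nat option"

definition graph_over :: "nat option set \<Rightarrow> nat option set \<Rightarrow> 'v graph \<Rightarrow> bool" where
  "graph_over NS ES g \<longleftrightarrow> finite (gV g) \<and> gE g \<subseteq> gV g \<times> ES \<times> gV g
     \<and> (\<forall>v\<in>gV g. glab g v \<in> NS)"

definition graph_iso :: "'a graph \<Rightarrow> 'b graph \<Rightarrow> bool" where
  "graph_iso g h \<longleftrightarrow> (\<exists>f. bij_betw f (gV g) (gV h)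
     \<and> (\<forall>v\<in>gV g. glab h (f v) = glab g v)
     \<and> gE h = (\<lambda>(u,a,v). (f u, a, f v)) ` gE g)"

definition nd :: "nat list \<Rightarrow> nat graph" where
  "nd w = \<lparr> gV = {0..<length w},
            gE = {(i, None, Suc i) | i. Suc i < length w},
            glab = (\<lambda>i. Some (w ! i)) \<rparr>"

definition ed :: "nat list \<Rightarrow> nat graph" where
  "ed w = \<lparr> gV = {0..length w},
            gE = {(i, Some (w ! i), Suc i) | i. i < length w},
            glab = (\<lambda>_. None) \<rparr>"

text \<open>Node variables and node-set variables are both indexed by nats (separate name spaces).
  Other connectives and the universal quantifier are definable from these.\<close>

datatype mso =
    Lab "nat option" nat
  | Edg "nat option" nat nat
  | Eq nat nat
  | Mem nat nat
  | Neg mso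
  | Conj mso mso
  | ExN nat mso
  | ExS nat mso

fun sat :: "'v graph \<Rightarrow> (nat \<Rightarrow> 'v) \<Rightarrow> (nat \<Rightarrow> 'v set) \<Rightarrow> mso \<Rightarrow> bool" where
  "sat g n s (Lab \<sigma> x) = (glab g (n x) = \<sigma>)"
| "sat g n s (Edg \<gamma> x y) = ((n x, \<gamma>, n y) \<in> gE g)"
| "sat g n s (Eq x y) = (n x = n y)"
| "sat g n s (Mem x X) = (n x \<in> s X)"
| "sat g n s (Neg \<phi>) = (\<not> sat g n s \<phi>)"
| "sat g n s (Conj \<phi> \<psi>) = (sat g n s \<phi> \<and> sat g n s \<psi>)"
| "sat g n s (ExN x \<phi>) = (\<exists>v\<in>gV g. sat g (n(x := v)) s \<phi>)"
| "sat g n s (ExS X \<phi>) = (\<exists>S\<subseteq>gV g. sat g n (s(X := S)) \<phi>)"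

fun fvn :: "mso \<Rightarrow> nat set" where
  "fvn (Lab \<sigma> x) = {x}"
| "fvn (Edg \<gamma> x y) = {x, y}"
| "fvn (Eq x y) = {x, y}"
| "fvn (Mem x X) = {x}"
| "fvn (Neg \<phi>) = fvn \<phi>"
| "fvn (Conj \<phi> \<psi>) = fvn \<phi> \<union> fvn \<psi>"
| "fvn (ExN x \<phi>) = fvn \<phi> - {x}"
| "fvn (ExS X \<phi>) = fvn \<phi>"

fun fvs :: "mso \<Rightarrow> nat set" where
  "fvs (Lab \<sigma> x) = {}"
| "fvs (Edg \<gamma> x y) = {}"
| "fvs (Eq x y) = {}"
| "fvs (Mem x X) = {X}"
| "fvs (Neg \<phi>) = fvs \<phi>"
| "fvs (Conj \<phi> \<psi>) = fvs \<phi> \<union> fvs \<psi>"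
| "fvs (ExN x \<phi>) = fvs \<phi>"
| "fvs (ExS X \<phi>) = fvs \<phi> - {X}"

text \<open>Parameters X_1..X_k are the set variables 0..k-1. In node formulas the free node
  variable x is node variable 0; in edge formulas x, y are node variables 0 and 1.
  Output node labels range over \<open>onalph\<close>, output edge labels over \<open>oealph\<close>.\<close>

record mso_trans =
  tdom :: mso
  npar :: nat
  copies :: "nat set"
  nodef :: "nat \<Rightarrow> nat option \<Rightarrow> mso"
  edgef :: "nat \<Rightarrow> nat \<Rightarrow> nat option \<Rightarrow> mso"
  onalph :: "nat option set"
  oealph :: "nat option set"

definition wf_trans :: "mso_trans \<Rightarrow> bool" where
  "wf_trans T \<longleftrightarrow> finite (copies T) \<and> finite (onalph T) \<and> finite (oealph T)
     \<and> fvn (tdom T) = {} \<and> fvs (tdom T) \<subseteq> {..<npar T}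
     \<and> (\<forall>c\<in>copies T. \<forall>\<sigma>\<in>onalph T.
           fvn (nodef T c \<sigma>) \<subseteq> {0} \<and> fvs (nodef T c \<sigma>) \<subseteq> {..<npar T})
     \<and> (\<forall>c1\<in>copies T. \<forall>c2\<in>copies T. \<forall>\<gamma>\<in>oealph T.
           fvn (edgef T c1 c2 \<gamma>) \<subseteq> {0, 1} \<and> fvs (edgef T c1 c2 \<gamma>) \<subseteq> {..<npar T})"

definition out_nodes :: "mso_trans \<Rightarrow> 'v graph \<Rightarrow> (nat \<Rightarrow> 'v set) \<Rightarrow> ('v \<times> nat) set" where
  "out_nodes T g P = {(u, c). u \<in> gV g \<and> c \<in> copies T
      \<and> (\<exists>!\<sigma>. \<sigma> \<in> onalph T \<and> sat g (\<lambda>_. u) P (nodef T c \<sigma>))}"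

definition out_graph :: "mso_trans \<Rightarrow> 'v graph \<Rightarrow> (nat \<Rightarrow> 'v set) \<Rightarrow> ('v \<times> nat) graph" where
  "out_graph T g P = \<lparr> gV = out_nodes T g P,
     gE = {((u, c1), \<gamma>, (v, c2)) | u c1 \<gamma> v c2.
             (u, c1) \<in> out_nodes T g P \<and> (v, c2) \<in> out_nodes T g P \<and> \<gamma> \<in> oealph T
             \<and> sat g ((\<lambda>_. u)(1 := v)) P (edgef T c1 c2 \<gamma>)},
     glab = (\<lambda>(u, c). THE \<sigma>. \<sigma> \<in> onalph T \<and> sat g (\<lambda>_. u) P (nodef T c \<sigma>)) \<rparr>"

definition outputs :: "mso_trans \<Rightarrow> 'v graph \<Rightarrow> ('v \<times> nat) graph set" where
  "outputs T g = {out_graph T g P | P. (\<forall>i. P i \<subseteq> gV g) \<and> sat g (\<lambda>_. undefined) P (tdom T)}"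

text \<open>A string transduction m (over finite input alphabet S1 and output alphabet S2) is in
  NMSO w.r.t. representation rep (nd or ed) if the graph relation
  {(rep w, rep z) | (w,z) \<in> m} coincides, up to isomorphism of graphs, with the graph
  transduction defined by some T on graphs over the input alphabets.\<close>

definition NMSO_via :: "(nat list \<Rightarrow> nat graph) \<Rightarrow> (nat set \<Rightarrow> nat option set)
     \<Rightarrow> (nat set \<Rightarrow> nat option set) \<Rightarrow> (nat list \<times> nat list) set set" where
  "NMSO_via rep NA EA = {m. \<exists>S1 S2 T. finite S1 \<and> finite S2 \<and> wf_trans T
      \<and> onalph T = NA S2 \<and> oealph T = EA S2
      \<and> m \<subseteq> lists S1 \<times> lists S2
      \<and> (\<forall>g :: nat graph. graph_over (NA S1) (EA S1) g \<longrightarrow>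
            (\<forall>h\<in>outputs T g. \<exists>w z. (w, z) \<in> m \<and> graph_iso g (rep w) \<and> graph_iso h (rep z)))
      \<and> (\<forall>(w, z)\<in>m. \<exists>h\<in>outputs T (rep w). graph_iso h (rep z))}"

definition NMSO_nd :: "(nat list \<times> nat list) set set" where
  "NMSO_nd = NMSO_via nd (\<lambda>S. Some ` S) (\<lambda>S. {None})"

definition NMSO_ed :: "(nat list \<times> nat list) set set" where
  "NMSO_ed = NMSO_via ed (\<lambda>S. {None}) (\<lambda>S. Some ` S)"

datatype tsym = LM | RM | Sym nat

type_synonym instr = "nat \<times> tsym \<times> nat \<times> nat list \<times> int \<times> nat \<times> nat list \<times> int"

record gsm =
  states :: "nat set"
  inalph :: "nat set"
  outalph :: "nat set"
  instrs :: "instr set"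
  qin :: nat
  qf :: nat

definition wf_gsm :: "gsm \<Rightarrow> bool" where
  "wf_gsm M \<longleftrightarrow> finite (states M) \<and> finite (inalph M) \<and> finite (outalph M)
     \<and> finite (instrs M) \<and> qin M \<in> states M \<and> qf M \<in> states M
     \<and> (\<forall>(p, \<sigma>, q1, \<alpha>1, e1, q0, \<alpha>0, e0) \<in> instrs M.
          p \<in> states M \<and> p \<noteq> qf M \<and> \<sigma> \<in> {LM, RM} \<union> Sym ` inalph M
          \<and> q1 \<in> states M \<and> q0 \<in> states M \<and> \<alpha>1 \<in> lists (outalph M) \<and> \<alpha>0 \<in> lists (outalph M)
          \<and> e1 \<in> {-1, 0, 1} \<and> e0 \<in> {-1, 0, 1})"

definition deterministic :: "gsm \<Rightarrow> bool" where
  "deterministic M \<longleftrightarrow> (\<forall>t1\<in>instrs M. \<forall>t2\<in>instrs M. fst t1 = fst t2 \<longrightarrow> t1 = t2)"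

definition tape :: "nat list \<Rightarrow> int \<Rightarrow> tsym" where
  "tape w i = (if i = 0 then LM else if i = int (length w) + 1 then RM else Sym (w ! nat (i - 1)))"

definition gstep :: "gsm \<Rightarrow> nat list \<Rightarrow> nat \<times> int \<times> nat list \<Rightarrow> nat \<times> int \<times> nat list \<Rightarrow> bool" where
  "gstep M w c c' \<longleftrightarrow> (\<exists>p i out \<sigma> q1 \<alpha>1 e1 q0 \<alpha>0 e0 q \<alpha> e.
      c = (p, i, out) \<and> (p, \<sigma>, q1, \<alpha>1, e1, q0, \<alpha>0, e0) \<in> instrs M
      \<and> (q, \<alpha>, e) = (if tape w i = \<sigma> then (q1, \<alpha>1, e1) else (q0, \<alpha>0, e0))
      \<and> 0 \<le> i + e \<and> i + e \<le> int (length w) + 1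
      \<and> c' = (q, i + e, out @ \<alpha>))"

definition realized :: "gsm \<Rightarrow> (nat list \<times> nat list) set" where
  "realized M = {(w, z). w \<in> lists (inalph M)
      \<and> (\<exists>i. (gstep M w)\<^sup>*\<^sup>* (qin M, 0, []) (qf M, i, z))}"

definition DGSM :: "(nat list \<times> nat list) set set" where
  "DGSM = {realized M | M. wf_gsm M \<and> deterministic M}"

definition DGSM_eps :: "(nat list \<times> nat list) set set" where
  "DGSM_eps = {m \<in> DGSM. \<forall>z. ([], z) \<in> m \<longrightarrow> z = []}"

definition relabel :: "('a \<times> 'b) set \<Rightarrow> ('a list \<times> 'b list) set" where
  "relabel R = {(w, z). list_all2 (\<lambda>a b. (a, b) \<in> R) w z}"

text \<open>R is a finite relation, i.e. a subset of \<Delta>1 \<times> \<Delta>2 for finite alphabets.\<close>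
definition REL :: "(nat list \<times> nat list) set set" where
  "REL = {relabel R | R :: (nat \<times> nat) set. finite R}"

definition MREL :: "(nat list \<times> nat list) set set" where
  "MREL = {{(w, z). ([LM] @ map Sym w @ [RM], z) \<in> relabel R} | R :: (tsym \<times> nat) set. finite R}"

definition fam_comp :: "('a \<times> 'b) set set \<Rightarrow> ('b \<times> 'c) set set \<Rightarrow> ('a \<times> 'c) set set"
    (infixl "\<circ>\<^sub>F" 55) where
  "F1 \<circ>\<^sub>F F2 = {m1 O m2 | m1 m2. m1 \<in> F1 \<and> m2 \<in> F2}"

end

theory Submission
  imports Defs "HOL-Library.Nat_Bijection"
begin

text \<open>
  From logic to machines: by the Ehrenfeucht-Fraisse (composition) method, the set of all words
  with marked positions that satisfy a formula is a union of classes of a congruence of finite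
  index. The nondeterministic relabelling guesses, at every position, the parameters, the classes
  of the prefix and of the suffix, and for every copy the copy and direction of its successor in
  the output graph. The guesses of classes are locally checkable, so one sweep of a deterministic
  two-way machine verifies them together with the domain formula. The machine then follows the
  path of the output graph: it walks in the guessed direction carrying the class of the part of
  the word containing the marked source, and combines it with the guessed class on the other side
  to recognize the target. Because the relabelling may guess, no look-around and no composition
  of two-way machines is needed.

  From machines to logic: the parameters guess the relabelled word. A deterministic computation
  that accepts never repeats a configuration, so the output positions are the visited
  configurations that emit a letter, and the edges are given by reachability through silent
  configurations, which is definable by quantifying over one set of nodes per local configuration.
\<close>

text \<open>The representations differ by one node: \<open>ed\<close> has a node for the left end
  marker even for the empty word, whereas \<open>nd\<close> of the empty word has no node. Hence
  \<open>MREL\<close> for \<open>ed\<close>; and for \<open>nd\<close> the empty graph can only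
  produce the empty graph, which is the restriction in \<open>DGSM_eps\<close>. Treating both as
  graphs of letter lists makes one construction serve both equalities.

  Only the guessed classes are verified by the sweep. A wrong successor guess needs no check: the
  edge formula is evaluated at the target, so the walk finds a true edge or blocks, and on a path
  the edge found is the only one leaving its source.

  In the converse direction the tape has more cells than the graph has nodes; the end markers, and
  for \<open>ed\<close> the letter replacing the right marker, are absorbed into the blocks of the
  first and the last node. Membership in \<open>NMSO\<close> quantifies over all graphs over the
  alphabets, so the domain formula has to define the word graphs and the semantics is transported
  along isomorphisms.\<close>

section \<open>The composition method for MSO on words\<close>

text \<open>Both representations of strings are paths whose \<open>i\<close>-th node carries a letter that is shown
  either as its node label (\<open>nd\<close>) or as the label of its incoming edge (\<open>ed\<close>); in the latter
  case the first node carries the dummy letter \<open>None\<close>.\<close>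

definition word_graph :: "(nat option \<Rightarrow> nat option) \<Rightarrow> (nat option \<Rightarrow> nat option) \<Rightarrow> nat option list \<Rightarrow> nat graph \<Rightarrow> bool" where
  "word_graph lab inc ws g \<longleftrightarrow> gV g = {0..<length ws}
     \<and> gE g = {(i, inc (ws ! Suc i), Suc i) | i. Suc i < length ws}
     \<and> (\<forall>i<length ws. glab g i = lab (ws ! i))"

lemma word_graph_nd: "word_graph id (\<lambda>_. None) (map Some w) (nd w)"
  by (auto simp: word_graph_def nd_def)

lemma word_graph_ed: "word_graph (\<lambda>_. None) id (None # map Some w) (ed w)"
  by (auto simp: word_graph_def ed_def)

lemma sat_cong:
  "(\<forall>x\<in>fvn \<phi>. n x = n' x) \<Longrightarrow> (\<forall>X\<in>fvs \<phi>. s X = s' X) \<Longrightarrow> sat g n s \<phi> = sat g n' s' \<phi>"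
proof (induction \<phi> arbitrary: n n' s s')
  case (Conj \<phi> \<psi>)
  then show ?case by (metis UnCI fvn.simps(6) fvs.simps(6) sat.simps(6))
next
  case (ExN x \<phi>)
  have "sat g (n(x := v)) s \<phi> = sat g (n'(x := v)) s' \<phi>" for v
    by (rule ExN.IH) (use ExN.prems in auto)
  then show ?case by simp
next
  case (ExS X \<phi>)
  have "sat g n (s(X := S)) \<phi> = sat g n' (s'(X := S)) \<phi>" for S
    by (rule ExS.IH) (use ExS.prems in auto)
  then show ?case by simp
qed auto

text \<open>A letter together with the variables that are marked at its position: node variable \<open>x\<close> is
  coded as \<open>2 * x\<close> and set variable \<open>X\<close> as \<open>2 * X + 1\<close>.\<close>

type_synonym letter = "nat option \<times> nat set"

section \<open>Atomic information and Ehrenfeucht-Fraisse equivalence of marked words\<close>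

definition marks :: "letter list \<Rightarrow> nat set" where
  "marks u = (\<Union>l\<in>set u. snd l)"

fun twice :: "letter list \<Rightarrow> nat set" where
  "twice [] = {}"
| "twice (l # u) = twice u \<union> (snd l \<inter> marks u)"

definition first :: "'a list \<Rightarrow> 'a option" where
  "first u = (if u = [] then None else Some (hd u))"

definition final :: "'a list \<Rightarrow> 'a option" where
  "final u = (if u = [] then None else Some (last u))"

definition adj :: "'a list \<Rightarrow> ('a \<times> 'a) set" where
  "adj u = {(u ! i, u ! Suc i) | i. Suc i < length u}"

text \<open>The letters decide the atoms about one position, and \<open>adj\<close> decides edges.
  The first and the last letter are recorded because the adjacent pair created at the seam of a
  concatenation depends on them.\<close>

definition atinfo where
  "atinfo u = (set u, adj u, first u, final u, twice u)"

definition ext :: "nat \<Rightarrow> letter list \<Rightarrow> letter list \<Rightarrow> bool" where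
  "ext m = list_all2 (\<lambda>l l'. fst l = fst l' \<and> snd l - {m} = snd l' - {m})"

text \<open>Duplicator wins \<open>k\<close> rounds of the Ehrenfeucht-Fraisse game in which a move re-marks one of the
  variables below \<open>K\<close>. Moves of node variables need no separate clause, since \<open>twice\<close> and the
  set of letters determine whether a variable marks exactly one position.\<close>

fun ef :: "nat \<Rightarrow> nat \<Rightarrow> letter list \<Rightarrow> letter list \<Rightarrow> bool" where
  "ef K 0 u v \<longleftrightarrow> atinfo u = atinfo v"
| "ef K (Suc k) u v \<longleftrightarrow> atinfo u = atinfo v \<and> (\<forall>m<K.
     (\<forall>u'. ext m u u' \<longrightarrow> (\<exists>v'. ext m v v' \<and> ef K k u' v')) \<and>
     (\<forall>v'. ext m v v' \<longrightarrow> (\<exists>u'. ext m u u' \<and> ef K k u' v')))"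

lemma marks_append [simp]: "marks (u @ v) = marks u \<union> marks v"
  by (auto simp: marks_def)

lemma twice_append: "twice (u @ v) = twice u \<union> twice v \<union> (marks u \<inter> marks v)"
  by (induction u) (auto simp: marks_def)

lemma adj_Cons: "adj (x # u) = (if u = [] then {} else insert (x, hd u) (adj u))"
proof (cases u)
  case Nil
  then show ?thesis by (simp add: adj_def)
next
  case (Cons y v)
  have "p \<in> adj (x # u) \<longleftrightarrow> p = (x, y) \<or> p \<in> adj u" for p
  proof
    assume "p \<in> adj (x # u)"
    then obtain i where "p = ((x # u) ! i, (x # u) ! Suc i)" "Suc i < length (x # u)"
      by (auto simp: adj_def)
    then show "p = (x, y) \<or> p \<in> adj u"
      by (cases i) (auto simp: adj_def Cons)
  next
    assume "p = (x, y) \<or> p \<in> adj u"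
    then show "p \<in> adj (x # u)"
    proof
      assume "p = (x, y)"
      then show ?thesis unfolding adj_def Cons by (auto intro!: exI[of _ 0])
    next
      assume "p \<in> adj u"
      then obtain i where "p = (u ! i, u ! Suc i)" "Suc i < length u" by (auto simp: adj_def)
      then show ?thesis unfolding adj_def by (auto intro!: exI[of _ "Suc i"])
    qed
  qed
  then show ?thesis using Cons by auto
qed

lemma adj_append: "adj (u @ v) = adj u \<union> adj v \<union> (if u = [] \<or> v = [] then {} else {(last u, hd v)})"
proof (induction u)
  case Nil
  then show ?case by (simp add: adj_def)
next
  case (Cons a u)
  have [simp]: "adj ([] :: 'a list) = {}" by (simp add: adj_def)
  from Cons show ?case by (cases u) (auto simp: adj_Cons)
qed

lemma atinfo_eqD:
  assumes "atinfo u = atinfo v"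
  shows "set u = set v" "adj u = adj v" "twice u = twice v" "marks u = marks v"
    "u = [] \<longleftrightarrow> v = []" "u \<noteq> [] \<Longrightarrow> hd u = hd v" "u \<noteq> [] \<Longrightarrow> last u = last v"
proof -
  show *: "set u = set v" and "adj u = adj v" "twice u = twice v"
    using assms by (simp_all add: atinfo_def)
  show "marks u = marks v" unfolding marks_def * by simp
  show e: "u = [] \<longleftrightarrow> v = []" using * by auto
  have "first u = first v" "final u = final v" using assms by (simp_all add: atinfo_def)
  then show "hd u = hd v" "last u = last v" if "u \<noteq> []"
    using that e by (simp_all add: first_def final_def)
qed

text \<open>Only the seam matters: concatenation adds one adjacent pair, given by
  \<open>last\<close> and \<open>hd\<close>, and makes a mark double if it occurs in both factors.
  An empty factor has no seam and is treated separately.\<close>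

lemma atinfo_append:
  assumes "atinfo u1 = atinfo v1" "atinfo u2 = atinfo v2"
  shows "atinfo (u1 @ u2) = atinfo (v1 @ v2)"
proof (cases "u1 = [] \<or> u2 = []")
  case True
  then show ?thesis using assms atinfo_eqD(5)[OF assms(1)] atinfo_eqD(5)[OF assms(2)] by auto
next
  case False
  then have ne: "u1 \<noteq> []" "u2 \<noteq> []" "v1 \<noteq> []" "v2 \<noteq> []"
    using atinfo_eqD(5)[OF assms(1)] atinfo_eqD(5)[OF assms(2)] by auto
  note * = atinfo_eqD(1-4)[OF assms(1)] atinfo_eqD(1-4)[OF assms(2)]
    atinfo_eqD(6,7)[OF assms(1) ne(1)] atinfo_eqD(6,7)[OF assms(2) ne(2)]
  show ?thesis
    using * ne by (simp add: atinfo_def twice_append adj_append first_def final_def)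
qed

lemma ext_append: "ext m (u1 @ u2) u' \<longleftrightarrow> (\<exists>a b. u' = a @ b \<and> ext m u1 a \<and> ext m u2 b)"
proof
  show "ext m (u1 @ u2) u' \<Longrightarrow> \<exists>a b. u' = a @ b \<and> ext m u1 a \<and> ext m u2 b"
    unfolding ext_def list_all2_append1 by blast
next
  show "\<exists>a b. u' = a @ b \<and> ext m u1 a \<and> ext m u2 b \<Longrightarrow> ext m (u1 @ u2) u'"
    unfolding ext_def by (elim exE conjE) (simp add: list_all2_appendI)
qed

lemma ef_atinfo: "ef K k u v \<Longrightarrow> atinfo u = atinfo v"
  by (cases k) auto

lemma ef_SucI:
  assumes "atinfo u = atinfo v"
    and "\<And>m u'. m < K \<Longrightarrow> ext m u u' \<Longrightarrow> \<exists>v'. ext m v v' \<and> ef K k u' v'"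
    and "\<And>m v'. m < K \<Longrightarrow> ext m v v' \<Longrightarrow> \<exists>u'. ext m u u' \<and> ef K k u' v'"
  shows "ef K (Suc k) u v"
  using assms by simp

lemma ef_SucD:
  assumes "ef K (Suc k) u v" "m < K"
  shows "ext m u u' \<Longrightarrow> \<exists>v'. ext m v v' \<and> ef K k u' v'"
    and "ext m v v' \<Longrightarrow> \<exists>u'. ext m u u' \<and> ef K k u' v'"
  using assms by simp_all

lemma ef_refl: "ef K k u u"
  by (induction k arbitrary: u) auto

lemma ef_sym: "ef K k u v \<Longrightarrow> ef K k v u"
proof (induction k arbitrary: u v)
  case (Suc k)
  show ?case
  proof (rule ef_SucI)
    show "atinfo v = atinfo u" using Suc.prems ef_atinfo by simp
  next
    fix m u' assume "m < K" "ext m v u'"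
    then show "\<exists>v'. ext m u v' \<and> ef K k u' v'"
      using ef_SucD(2)[OF Suc.prems] Suc.IH by blast
  next
    fix m v' assume "m < K" "ext m u v'"
    then show "\<exists>u'. ext m v u' \<and> ef K k u' v'"
      using ef_SucD(1)[OF Suc.prems] Suc.IH by blast
  qed
qed simp

lemma ef_trans: "ef K k u v \<Longrightarrow> ef K k v w \<Longrightarrow> ef K k u w"
proof (induction k arbitrary: u v w)
  case (Suc k)
  show ?case
  proof (rule ef_SucI)
    show "atinfo u = atinfo w" using Suc.prems ef_atinfo by metis
  next
    fix m u' assume m: "m < K" "ext m u u'"
    obtain v' where "ext m v v'" "ef K k u' v'" using ef_SucD(1)[OF Suc.prems(1) m] by blast
    moreover from this obtain w' where "ext m w w'" "ef K k v' w'"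
      using ef_SucD(1)[OF Suc.prems(2) m(1)] by blast
    ultimately show "\<exists>v'. ext m w v' \<and> ef K k u' v'" using Suc.IH by blast
  next
    fix m w' assume m: "m < K" "ext m w w'"
    obtain v' where "ext m v v'" "ef K k v' w'" using ef_SucD(2)[OF Suc.prems(2) m] by blast
    moreover from this obtain u' where "ext m u u'" "ef K k u' v'"
      using ef_SucD(2)[OF Suc.prems(1) m(1)] by blast
    ultimately show "\<exists>u'. ext m u u' \<and> ef K k u' w'" using Suc.IH by blast
  qed
qed simp

text \<open>A move in a concatenation is a pair of moves in the factors (\<open>ext_append\<close>),
  so Duplicator answers in each factor by the given strategy and joins the answers. This is why
  classes of prefix and suffix carry enough information.\<close>

lemma ef_append: "ef K k u1 v1 \<Longrightarrow> ef K k u2 v2 \<Longrightarrow> ef K k (u1 @ u2) (v1 @ v2)"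
proof (induction k arbitrary: u1 v1 u2 v2)
  case 0
  then show ?case unfolding ef.simps(1) by (rule atinfo_append)
next
  case (Suc k)
  note D1 = ef_SucD[OF Suc.prems(1)] and D2 = ef_SucD[OF Suc.prems(2)]
  show ?case
  proof (rule ef_SucI)
    show "atinfo (u1 @ u2) = atinfo (v1 @ v2)"
      by (intro atinfo_append ef_atinfo[OF Suc.prems(1)] ef_atinfo[OF Suc.prems(2)])
  next
    fix m u' assume m: "m < K" "ext m (u1 @ u2) u'"
    obtain a b where ab: "u' = a @ b" "ext m u1 a" "ext m u2 b" using m(2) ext_append by blast
    obtain a' where a: "ext m v1 a'" "ef K k a a'" using D1(1)[OF m(1) ab(2)] by blast
    obtain b' where b: "ext m v2 b'" "ef K k b b'" using D2(1)[OF m(1) ab(3)] by blast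
    show "\<exists>v'. ext m (v1 @ v2) v' \<and> ef K k u' v'"
      unfolding ext_append ab(1) using Suc.IH[OF a(2) b(2)] a(1) b(1) by blast
  next
    fix m v' assume m: "m < K" "ext m (v1 @ v2) v'"
    obtain a b where ab: "v' = a @ b" "ext m v1 a" "ext m v2 b" using m(2) ext_append by blast
    obtain a' where a: "ext m u1 a'" "ef K k a' a" using D1(2)[OF m(1) ab(2)] by blast
    obtain b' where b: "ext m u2 b'" "ef K k b' b" using D2(2)[OF m(1) ab(3)] by blast
    show "\<exists>u'. ext m (u1 @ u2) u' \<and> ef K k u' v'"
      unfolding ext_append ab(1) using Suc.IH[OF a(2) b(2)] a(1) b(1) by blast
  qed
qed

declare ef.simps(2) [simp del]

section \<open>Finite index of the equivalence and normal forms of its classes\<close>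

definition alph :: "nat option set \<Rightarrow> nat \<Rightarrow> letter set" where
  "alph A K = A \<times> Pow {..<K}"

lemma finite_alph: "finite A \<Longrightarrow> finite (alph A K)"
  by (simp add: alph_def)

lemma ext_alph: "m < K \<Longrightarrow> ext m u u' \<Longrightarrow> u \<in> lists (alph A K) \<Longrightarrow> u' \<in> lists (alph A K)"
proof -
  assume m: "m < K" and e: "ext m u u'" and u: "u \<in> lists (alph A K)"
  from e[unfolded ext_def] u show ?thesis
  proof (induction rule: list_all2_induct)
    case (Cons l ls l' ls')
    then have 1: "snd l' \<subseteq> insert m (snd l)" "fst l' = fst l" "l \<in> alph A K" by auto
    then have "snd l' \<subseteq> {..<K}" "fst l' \<in> A"
      using m by (auto simp: alph_def dest!: subsetD[of "snd l'"])
    then have "l' \<in> alph A K" by (simp add: alph_def mem_Times_iff)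
    with Cons show ?case by simp
  qed auto
qed

lemma finite_atinfo:
  assumes "finite B" "snd ` B \<subseteq> Pow {..<K}"
  shows "finite (atinfo ` lists B)"
proof (rule finite_subset)
  have tw: "twice u \<subseteq> {..<K}" if "u \<in> lists B" for u
  proof -
    have "snd l \<subseteq> {..<K}" if "l \<in> B" for l using assms(2) that by blast
    with that show ?thesis by (induction u) (simp_all, blast)
  qed
  have ad: "adj u \<subseteq> B \<times> B" if "u \<in> lists B" for u
    using that by (auto simp: adj_def in_lists_conv_set)
  show "atinfo ` lists B \<subseteq> Pow B \<times> Pow (B \<times> B) \<times> insert None (Some ` B) \<times> insert None (Some ` B) \<times> Pow {..<K}"
  proof
    fix y assume "y \<in> atinfo ` lists B"
    then obtain u where u: "u \<in> lists B" "y = atinfo u" by blast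
    then have "first u \<in> insert None (Some ` B)" "final u \<in> insert None (Some ` B)" "set u \<subseteq> B"
      by (auto simp: first_def final_def in_lists_conv_set)
    then show "y \<in> Pow B \<times> Pow (B \<times> B) \<times> insert None (Some ` B) \<times> insert None (Some ` B) \<times> Pow {..<K}"
      using tw[OF u(1)] ad[OF u(1)] u(2) by (simp add: atinfo_def)
  qed
  show "finite (Pow B \<times> Pow (B \<times> B) \<times> insert None (Some ` B) \<times> insert None (Some ` B) \<times> Pow {..<K})"
    using assms by simp
qed

lemma finite_image_factor:
  assumes "finite (f ` B)" "\<And>u v. u \<in> B \<Longrightarrow> v \<in> B \<Longrightarrow> f u = f v \<Longrightarrow> h u = h v"
  shows "finite (h ` B)"
proof -
  have "h u = h (inv_into B f (f u))" if "u \<in> B" for u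
    by (rule assms(2)) (use that in \<open>auto simp: inv_into_into f_inv_into_f\<close>)
  then have "h ` B \<subseteq> (\<lambda>y. h (inv_into B f y)) ` f ` B" by blast
  then show ?thesis using assms(1) by (rule finite_subset[OF _ finite_imageI])
qed

definition ef_class :: "nat option set \<Rightarrow> nat \<Rightarrow> nat \<Rightarrow> letter list \<Rightarrow> letter list set" where
  "ef_class A K k u = {v \<in> lists (alph A K). ef K k u v}"

lemma ef_class_eqI: "ef K k u v \<Longrightarrow> ef_class A K k u = ef_class A K k v"
  unfolding ef_class_def by (auto intro: ef_trans ef_sym)

lemma ef_class_eqD: "v \<in> lists (alph A K) \<Longrightarrow> ef_class A K k u = ef_class A K k v \<Longrightarrow> ef K k u v"
  unfolding ef_class_def by (auto intro: ef_refl)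

text \<open>Induction on the number of rounds: a class for \<open>Suc k\<close> rounds is determined
  by the atomic information and by the classes for \<open>k\<close> rounds that each mark can move
  to, and there are finitely many such descriptions.\<close>

lemma finite_ef_class: "finite A \<Longrightarrow> finite (ef_class A K k ` lists (alph A K))"
proof (induction k)
  case 0
  show ?case
    by (rule finite_image_factor[OF finite_atinfo[of _ K]])
      (use 0 in \<open>auto simp: finite_alph alph_def intro!: ef_class_eqI\<close>)
next
  case (Suc k)
  let ?W = "lists (alph A K)"
  define D where "D u = (atinfo u, {(m, ef_class A K k u') | m u'. m < K \<and> ext m u u'})" for u
  have "finite (atinfo ` ?W)"
    by (rule finite_atinfo[of _ K]) (use Suc in \<open>auto simp: finite_alph alph_def\<close>)
  then have "finite (atinfo ` ?W \<times> Pow ({..<K} \<times> ef_class A K k ` ?W))"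
    using Suc by simp
  moreover have "D ` ?W \<subseteq> atinfo ` ?W \<times> Pow ({..<K} \<times> ef_class A K k ` ?W)"
    unfolding D_def using ext_alph by blast
  ultimately have fin: "finite (D ` ?W)" by (rule rev_finite_subset)
  show ?case
  proof (rule finite_image_factor[OF fin])
    fix u v assume uv: "u \<in> ?W" "v \<in> ?W" "D u = D v"
    have half: "\<exists>v'. ext m v v' \<and> ef K k u' v'"
      if "m < K" "ext m u u'" "D u = D v" "v \<in> ?W" for m u u' v
    proof -
      have "(m, ef_class A K k u') \<in> snd (D u)" unfolding D_def using that(1,2) by auto
      then have "(m, ef_class A K k u') \<in> snd (D v)" using that(3) by simp
      then obtain v' where "ext m v v'" "ef_class A K k u' = ef_class A K k v'"
        unfolding D_def snd_conv by blast
      moreover from this have "v' \<in> ?W" using ext_alph that by blast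
      ultimately show ?thesis using ef_class_eqD by blast
    qed
    have "ef K (Suc k) u v"
    proof (rule ef_SucI)
      show "atinfo u = atinfo v" using uv(3) by (simp add: D_def)
    next
      fix m u' assume "m < K" "ext m u u'"
      then show "\<exists>v'. ext m v v' \<and> ef K k u' v'" by (rule half) (use uv in auto)
    next
      fix m v' assume "m < K" "ext m v v'"
      then have "\<exists>u'. ext m u u' \<and> ef K k v' u'" by (rule half) (use uv in auto)
      then show "\<exists>u'. ext m u u' \<and> ef K k u' v'" using ef_sym by blast
    qed
    then show "ef_class A K (Suc k) u = ef_class A K (Suc k) v" by (rule ef_class_eqI)
  qed
qed

text \<open>The representative is chosen from the class as a set, so equivalent words have equal
  normal forms. Machine states and annotations can therefore store words and compare classes by
  equality.\<close>

definition nform :: "nat option set \<Rightarrow> nat \<Rightarrow> nat \<Rightarrow> letter list \<Rightarrow> letter list" where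
  "nform A K k u = (SOME v. v \<in> ef_class A K k u)"

lemma nform: "u \<in> lists (alph A K) \<Longrightarrow> nform A K k u \<in> lists (alph A K) \<and> ef K k u (nform A K k u)"
proof -
  assume "u \<in> lists (alph A K)"
  then have "u \<in> ef_class A K k u" by (simp add: ef_class_def ef_refl)
  then have "nform A K k u \<in> ef_class A K k u" unfolding nform_def by (rule someI)
  then show ?thesis by (simp add: ef_class_def)
qed

lemma finite_nform: "finite A \<Longrightarrow> finite (nform A K k ` lists (alph A K))"
  unfolding nform_def by (rule finite_image_factor[OF finite_ef_class[of A K k]]) simp_all

text \<open>A node variable whose value lies outside the word leaves no mark; the valuation that is
  constantly \<open>length ws\<close> thus encodes the word with its set variables only.\<close>

definition enc :: "nat \<Rightarrow> nat option list \<Rightarrow> (nat \<Rightarrow> nat) \<Rightarrow> (nat \<Rightarrow> nat set) \<Rightarrow> letter list" where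
  "enc K ws n s = map (\<lambda>i. (ws ! i, ({2 * x | x. n x = i} \<union> {Suc (2 * X) | X. i \<in> s X}) \<inter> {..<K})) [0..<length ws]"

lemma length_enc [simp]: "length (enc K ws n s) = length ws"
  by (simp add: enc_def)

lemma nth_enc: "i < length ws \<Longrightarrow> enc K ws n s ! i =
    (ws ! i, ({2 * x | x. n x = i} \<union> {Suc (2 * X) | X. i \<in> s X}) \<inter> {..<K})"
  by (simp add: enc_def)

lemma double_neq_Suc_double [simp]: "2 * (x :: nat) \<noteq> Suc (2 * y)" "Suc (2 * y) \<noteq> 2 * (x :: nat)"
  by presburger+

lemma fst_enc [simp]: "i < length ws \<Longrightarrow> fst (enc K ws n s ! i) = ws ! i"
  by (simp add: nth_enc)

lemma snd_enc: "i < length ws \<Longrightarrow> snd (enc K ws n s ! i) =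
    ({2 * x | x. n x = i} \<union> {Suc (2 * X) | X. i \<in> s X}) \<inter> {..<K}"
  by (simp add: nth_enc)

lemma node_mark [simp]:
  assumes "i < length ws" "2 * x < K"
  shows "2 * x \<in> snd (enc K ws n s ! i) \<longleftrightarrow> n x = i"
proof -
  have "2 * x \<noteq> Suc (2 * X)" for X by presburger
  then show ?thesis using assms by (auto simp: nth_enc)
qed

lemma set_mark [simp]:
  assumes "i < length ws" "Suc (2 * X) < K"
  shows "Suc (2 * X) \<in> snd (enc K ws n s ! i) \<longleftrightarrow> i \<in> s X"
proof -
  have "Suc (2 * X) \<noteq> 2 * x" for x by presburger
  then show ?thesis using assms by (auto simp: nth_enc)
qed

section \<open>Formulas cannot separate equivalent encodings\<close>

fun mrank :: "mso \<Rightarrow> nat" where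
  "mrank (Neg \<phi>) = mrank \<phi>"
| "mrank (Conj \<phi> \<psi>) = max (mrank \<phi>) (mrank \<psi>)"
| "mrank (ExN x \<phi>) = Suc (mrank \<phi>)"
| "mrank (ExS x \<phi>) = Suc (mrank \<phi>)"
| "mrank _ = 0"

text \<open>The code of variable \<open>x\<close> is \<open>2 * x\<close> or
  \<open>2 * x + 1\<close>. The bound \<open>2 * x + 2\<close> exceeds both, so below
  \<open>K\<close> every variable of the formula can be marked.\<close>

fun mbound :: "mso \<Rightarrow> nat" where
  "mbound (Lab \<sigma> x) = 2 * x + 2"
| "mbound (Edg \<gamma> x y) = max (2 * x + 2) (2 * y + 2)"
| "mbound (Eq x y) = max (2 * x + 2) (2 * y + 2)"
| "mbound (Mem x X) = max (2 * x + 2) (2 * X + 2)"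
| "mbound (Neg \<phi>) = mbound \<phi>"
| "mbound (Conj \<phi> \<psi>) = max (mbound \<phi>) (mbound \<psi>)"
| "mbound (ExN x \<phi>) = max (2 * x + 2) (mbound \<phi>)"
| "mbound (ExS X \<phi>) = max (2 * X + 2) (mbound \<phi>)"

lemma ext_enc_set: "ext (Suc (2 * X)) (enc K ws n s) (enc K ws n (s(X := S)))"
  unfolding ext_def list_all2_conv_all_nth by (auto simp: nth_enc)

lemma ext_enc_node: "ext (2 * x) (enc K ws n s) (enc K ws (n(x := v)) s)"
  unfolding ext_def list_all2_conv_all_nth by (auto simp: nth_enc)

text \<open>Every re-marking of a set variable comes from a set of positions, so moves of set
  variables correspond to set quantifiers without a side condition.\<close>

lemma ext_enc_setD:
  assumes "ext (Suc (2 * X)) (enc K ws n s) u" "Suc (2 * X) < K"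
  shows "\<exists>S\<subseteq>{0..<length ws}. u = enc K ws n (s(X := S))"
proof (intro exI conjI)
  let ?S = "{i. i < length ws \<and> Suc (2 * X) \<in> snd (u ! i)}"
  show "?S \<subseteq> {0..<length ws}" by auto
  have len: "length u = length ws" using assms(1) by (auto simp: ext_def dest: list_all2_lengthD)
  show "u = enc K ws n (s(X := ?S))"
  proof (rule nth_equalityI)
    fix i assume "i < length u"
    then have i: "i < length ws" using len by simp
    then have *: "fst (enc K ws n s ! i) = fst (u ! i)"
      "snd (enc K ws n s ! i) - {Suc (2 * X)} = snd (u ! i) - {Suc (2 * X)}"
      using assms(1) unfolding ext_def list_all2_conv_all_nth by auto
    have "c \<in> snd (u ! i) \<longleftrightarrow> c \<in> snd (enc K ws n (s(X := ?S)) ! i)" for c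
    proof (cases "c = Suc (2 * X)")
      case True
      then show ?thesis using i assms(2) by simp
    next
      case False
      then have "c \<in> snd (u ! i) \<longleftrightarrow> c \<in> snd (enc K ws n s ! i)" using *(2) by blast
      also have "\<dots> \<longleftrightarrow> c \<in> snd (enc K ws n (s(X := ?S)) ! i)"
        using False i by (auto simp: snd_enc)
      finally show ?thesis .
    qed
    then have "snd (u ! i) = snd (enc K ws n (s(X := ?S)) ! i)" by blast
    then show "u ! i = enc K ws n (s(X := ?S)) ! i"
      using *(1) i by (intro prod_eqI) simp_all
  qed (use len in auto)
qed

lemma marks_iff: "m \<in> marks u \<longleftrightarrow> (\<exists>j<length u. m \<in> snd (u ! j))"
  unfolding marks_def UN_iff Bex_def in_set_conv_nth by blast

lemma twice_iff: "m \<in> twice u \<longleftrightarrow> (\<exists>i j. i < j \<and> j < length u \<and> m \<in> snd (u ! i) \<and> m \<in> snd (u ! j))"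
proof (induction u)
  case (Cons l u)
  have "m \<in> twice (l # u) \<longleftrightarrow> (\<exists>i j. i < j \<and> j < length u \<and> m \<in> snd (u ! i) \<and> m \<in> snd (u ! j))
      \<or> m \<in> snd l \<and> (\<exists>j<length u. m \<in> snd (u ! j))"
    unfolding twice.simps Un_iff Int_iff marks_iff Cons by blast
  also have "\<dots> \<longleftrightarrow> (\<exists>i j. i < j \<and> j < length (l # u) \<and> m \<in> snd ((l # u) ! i) \<and> m \<in> snd ((l # u) ! j))"
    (is "?L \<longleftrightarrow> ?R")
  proof
    assume ?L
    then show ?R
    proof (elim disjE exE conjE)
      fix i j assume "i < j" "j < length u" "m \<in> snd (u ! i)" "m \<in> snd (u ! j)"
      then show ?R by (intro exI[of _ "Suc i"] exI[of _ "Suc j"]) simp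
    next
      fix j assume "m \<in> snd l" "j < length u" "m \<in> snd (u ! j)"
      then show ?R by (intro exI[of _ 0] exI[of _ "Suc j"]) simp
    qed
  next
    assume ?R
    then obtain i j where ij: "i < j" "j < length (l # u)" "m \<in> snd ((l # u) ! i)" "m \<in> snd ((l # u) ! j)"
      by blast
    then obtain j' where "j = Suc j'" by (cases j) auto
    with ij show ?L by (cases i) auto
  qed
  finally show ?case .
qed simp

text \<open>For a node variable a re-marking is a legal move only if exactly one position is marked,
  which membership in \<open>marks\<close> but not in \<open>twice\<close> expresses.\<close>

lemma ext_enc_nodeD:
  assumes "ext (2 * x) (enc K ws n s) u" "2 * x < K" "2 * x \<in> marks u" "2 * x \<notin> twice u"
  shows "\<exists>v<length ws. u = enc K ws (n(x := v)) s"
proof -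
  have len: "length u = length ws" using assms(1) by (auto simp: ext_def dest: list_all2_lengthD)
  obtain v where v: "v < length ws" "2 * x \<in> snd (u ! v)" using assms(3) len by (auto simp: marks_iff)
  have uniq: "j = v" if "j < length ws" "2 * x \<in> snd (u ! j)" for j
    using assms(4) len v that unfolding twice_iff by (metis linorder_neqE_nat)
  have "u = enc K ws (n(x := v)) s"
  proof (rule nth_equalityI)
    fix i assume "i < length u"
    then have i: "i < length ws" using len by simp
    then have *: "fst (enc K ws n s ! i) = fst (u ! i)"
      "snd (enc K ws n s ! i) - {2 * x} = snd (u ! i) - {2 * x}"
      using assms(1) unfolding ext_def list_all2_conv_all_nth by auto
    have "c \<in> snd (u ! i) \<longleftrightarrow> c \<in> snd (enc K ws (n(x := v)) s ! i)" for c
    proof (cases "c = 2 * x")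
      case True
      have "2 * x \<in> snd (u ! i) \<longleftrightarrow> i = v" using uniq v i by blast
      moreover have "2 * x \<in> snd (enc K ws (n(x := v)) s ! i) \<longleftrightarrow> i = v"
        using i assms(2) by auto
      ultimately show ?thesis using True by simp
    next
      case False
      then have "c \<in> snd (u ! i) \<longleftrightarrow> c \<in> snd (enc K ws n s ! i)" using *(2) by blast
      also have "\<dots> \<longleftrightarrow> c \<in> snd (enc K ws (n(x := v)) s ! i)"
        using False i by (auto simp: snd_enc)
      finally show ?thesis .
    qed
    then have "snd (u ! i) = snd (enc K ws (n(x := v)) s ! i)" by blast
    then show "u ! i = enc K ws (n(x := v)) s ! i"
      using *(1) i by (intro prod_eqI) simp_all
  qed (use len in auto)
  then show ?thesis using v by blast
qed

lemma marks_enc: "2 * x < K \<Longrightarrow> 2 * x \<in> marks (enc K ws n s) \<longleftrightarrow> n x < length ws"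
  by (auto simp: marks_iff)

lemma twice_enc: "2 * x < K \<Longrightarrow> 2 * x \<notin> twice (enc K ws n s)"
  by (auto simp: twice_iff)


lemma ex_set_enc: "(\<exists>l\<in>set (enc K ws n s). Q l) \<longleftrightarrow> (\<exists>i<length ws. Q (enc K ws n s ! i))"
  by (metis in_set_conv_nth length_enc)

lemma ex_adj: "(\<exists>p\<in>adj u. Q p) \<longleftrightarrow> (\<exists>i. Suc i < length u \<and> Q (u ! i, u ! Suc i))"
  unfolding adj_def by blast

text \<open>The values of free node variables lie inside the word, so each atom is an existence
  statement about letters or adjacent pairs of the encoding, and each quantifier costs one round.
  This is one half of the Ehrenfeucht-Fraisse theorem.\<close>

lemma sat_ef:
  assumes "word_graph lab inc ws g" "word_graph lab inc ws' g'"
    and "ef K k (enc K ws n s) (enc K ws' n' s')" "mrank \<phi> \<le> k" "mbound \<phi> \<le> K"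
    and "\<forall>x\<in>fvn \<phi>. n x < length ws \<and> n' x < length ws'"
  shows "sat g n s \<phi> \<longleftrightarrow> sat g' n' s' \<phi>"
  using assms(3-)
proof (induction \<phi> arbitrary: k n s n' s')
  case (Lab \<sigma> x)
  let ?Q = "\<lambda>l :: letter. 2 * x \<in> snd l \<and> lab (fst l) = \<sigma>"
  have "sat g n s (Lab \<sigma> x) \<longleftrightarrow> (\<exists>l\<in>set (enc K ws n s). ?Q l)"
    unfolding ex_set_enc using Lab.prems assms(1) by (auto simp: word_graph_def)
  moreover have "sat g' n' s' (Lab \<sigma> x) \<longleftrightarrow> (\<exists>l\<in>set (enc K ws' n' s'). ?Q l)"
    unfolding ex_set_enc using Lab.prems assms(2) by (auto simp: word_graph_def)
  ultimately show ?case using atinfo_eqD(1)[OF ef_atinfo[OF Lab.prems(1)]] by simp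
next
  case (Edg \<gamma> x y)
  let ?Q = "\<lambda>p :: letter \<times> letter. 2 * x \<in> snd (fst p) \<and> 2 * y \<in> snd (snd p) \<and> inc (fst (snd p)) = \<gamma>"
  have "sat g n s (Edg \<gamma> x y) \<longleftrightarrow> (\<exists>p\<in>adj (enc K ws n s). ?Q p)"
    unfolding ex_adj using Edg.prems assms(1) by (auto simp: word_graph_def)
  moreover have "sat g' n' s' (Edg \<gamma> x y) \<longleftrightarrow> (\<exists>p\<in>adj (enc K ws' n' s'). ?Q p)"
    unfolding ex_adj using Edg.prems assms(2) by (auto simp: word_graph_def)
  ultimately show ?case using atinfo_eqD(2)[OF ef_atinfo[OF Edg.prems(1)]] by simp
next
  case (Eq x y)
  let ?Q = "\<lambda>l :: letter. 2 * x \<in> snd l \<and> 2 * y \<in> snd l"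
  have "sat g n s (Eq x y) \<longleftrightarrow> (\<exists>l\<in>set (enc K ws n s). ?Q l)"
    unfolding ex_set_enc using Eq.prems by auto
  moreover have "sat g' n' s' (Eq x y) \<longleftrightarrow> (\<exists>l\<in>set (enc K ws' n' s'). ?Q l)"
    unfolding ex_set_enc using Eq.prems by auto
  ultimately show ?case using atinfo_eqD(1)[OF ef_atinfo[OF Eq.prems(1)]] by simp
next
  case (Mem x X)
  let ?Q = "\<lambda>l :: letter. 2 * x \<in> snd l \<and> Suc (2 * X) \<in> snd l"
  have "sat g n s (Mem x X) \<longleftrightarrow> (\<exists>l\<in>set (enc K ws n s). ?Q l)"
    unfolding ex_set_enc using Mem.prems by auto
  moreover have "sat g' n' s' (Mem x X) \<longleftrightarrow> (\<exists>l\<in>set (enc K ws' n' s'). ?Q l)"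
    unfolding ex_set_enc using Mem.prems by auto
  ultimately show ?case using atinfo_eqD(1)[OF ef_atinfo[OF Mem.prems(1)]] by simp
next
  case (Neg \<phi>)
  then show ?case by simp
next
  case (Conj \<phi> \<psi>)
  then have "sat g n s \<phi> \<longleftrightarrow> sat g' n' s' \<phi>" "sat g n s \<psi> \<longleftrightarrow> sat g' n' s' \<psi>" by simp_all
  then show ?case by simp
next
  case (ExN x \<phi>)
  obtain k' where k: "k = Suc k'" using ExN.prems(2) by (cases k) auto
  have xK: "2 * x < K" using ExN.prems(3) by simp
  note D = ef_SucD[OF ExN.prems(1)[unfolded k] xK]
  have V: "gV g = {0..<length ws}" "gV g' = {0..<length ws'}"
    using assms(1,2) by (auto simp: word_graph_def)
  have step: "sat g (n(x := v)) s \<phi> \<longleftrightarrow> sat g' (n'(x := v')) s' \<phi>"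
    if "ef K k' (enc K ws (n(x := v)) s) (enc K ws' (n'(x := v')) s')" "v < length ws" "v' < length ws'" for v v'
    by (rule ExN.IH[OF that(1)]) (use that(2,3) ExN.prems k in auto)
  show ?case
  proof
    assume "sat g n s (ExN x \<phi>)"
    then obtain v where v: "v < length ws" "sat g (n(x := v)) s \<phi>" using V by auto
    obtain u where u: "ext (2 * x) (enc K ws' n' s') u" "ef K k' (enc K ws (n(x := v)) s) u"
      using D(1)[OF ext_enc_node] by blast
    \<comment> \<open>Duplicator's answer could mark any set of positions; agreement in
      \<open>marks\<close> and \<open>twice\<close> with Spoiler's move forces it to mark exactly
      one.\<close>
    have "2 * x \<in> marks u" "2 * x \<notin> twice u"
      unfolding atinfo_eqD(3,4)[OF ef_atinfo[OF u(2)], symmetric] marks_enc[OF xK]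
      using twice_enc[OF xK] v(1) by simp_all
    then obtain v' where v': "v' < length ws'" "u = enc K ws' (n'(x := v')) s'"
      using ext_enc_nodeD[OF u(1) xK] by blast
    have "sat g' (n'(x := v')) s' \<phi>" using step[OF u(2)[unfolded v'(2)] v(1) v'(1)] v(2) by blast
    then show "sat g' n' s' (ExN x \<phi>)" using v'(1) V by auto
  next
    assume "sat g' n' s' (ExN x \<phi>)"
    then obtain v where v: "v < length ws'" "sat g' (n'(x := v)) s' \<phi>" using V by auto
    obtain u where u: "ext (2 * x) (enc K ws n s) u" "ef K k' u (enc K ws' (n'(x := v)) s')"
      using D(2)[OF ext_enc_node] by blast
    have "2 * x \<in> marks u" "2 * x \<notin> twice u"
      unfolding atinfo_eqD(3,4)[OF ef_atinfo[OF u(2)]] marks_enc[OF xK]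
      using twice_enc[OF xK] v(1) by simp_all
    then obtain v' where v': "v' < length ws" "u = enc K ws (n(x := v')) s"
      using ext_enc_nodeD[OF u(1) xK] by blast
    have "sat g (n(x := v')) s \<phi>" using step[OF u(2)[unfolded v'(2)] v'(1) v(1)] v(2) by blast
    then show "sat g n s (ExN x \<phi>)" using v'(1) V by auto
  qed
next
  case (ExS X \<phi>)
  obtain k' where k: "k = Suc k'" using ExS.prems(2) by (cases k) auto
  have xK: "Suc (2 * X) < K" using ExS.prems(3) by simp
  note D = ef_SucD[OF ExS.prems(1)[unfolded k] xK]
  have V: "gV g = {0..<length ws}" "gV g' = {0..<length ws'}"
    using assms(1,2) by (auto simp: word_graph_def)
  have step: "sat g n (s(X := S)) \<phi> \<longleftrightarrow> sat g' n' (s'(X := S')) \<phi>"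
    if "ef K k' (enc K ws n (s(X := S))) (enc K ws' n' (s'(X := S')))" for S S'
    by (rule ExS.IH[OF that]) (use ExS.prems k in auto)
  show ?case
  proof
    assume "sat g n s (ExS X \<phi>)"
    then obtain S where S: "sat g n (s(X := S)) \<phi>" by auto
    obtain u where u: "ext (Suc (2 * X)) (enc K ws' n' s') u" "ef K k' (enc K ws n (s(X := S))) u"
      using D(1)[OF ext_enc_set] by blast
    then obtain S' where S': "S' \<subseteq> gV g'" "u = enc K ws' n' (s'(X := S'))"
      using ext_enc_setD[OF u(1) xK] V by auto
    have "sat g' n' (s'(X := S')) \<phi>" using step[OF u(2)[unfolded S'(2)]] S by blast
    then show "sat g' n' s' (ExS X \<phi>)" using S'(1) by auto
  next
    assume "sat g' n' s' (ExS X \<phi>)"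
    then obtain S where S: "sat g' n' (s'(X := S)) \<phi>" by auto
    obtain u where u: "ext (Suc (2 * X)) (enc K ws n s) u" "ef K k' u (enc K ws' n' (s'(X := S)))"
      using D(2)[OF ext_enc_set] by blast
    then obtain S' where S': "S' \<subseteq> gV g" "u = enc K ws n (s(X := S'))"
      using ext_enc_setD[OF u(1) xK] V by auto
    have "sat g n (s(X := S')) \<phi>" using step[OF u(2)[unfolded S'(2)]] S by blast
    then show "sat g n s (ExS X \<phi>)" using S'(1) by auto
  qed
qed

section \<open>Two-way machines with transition functions\<close>

text \<open>Tape and right bound \<open>b\<close> are arbitrary, so that the same machine can run on
  the tape of a gsm, on a decoded tape and on a concatenation of blocks.\<close>

definition mstep :: "('q \<Rightarrow> 's \<Rightarrow> ('q \<times> 'o list \<times> int) option) \<Rightarrow> (int \<Rightarrow> 's) \<Rightarrow> int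
    \<Rightarrow> 'q \<times> int \<times> 'o list \<Rightarrow> 'q \<times> int \<times> 'o list \<Rightarrow> bool" where
  "mstep \<delta> tp b c c' \<longleftrightarrow> (\<exists>q i out q' \<alpha> e. c = (q, i, out) \<and> \<delta> q (tp i) = Some (q', \<alpha>, e)
     \<and> c' = (q', i + e, out @ \<alpha>) \<and> 0 \<le> i + e \<and> i + e \<le> b)"

lemma mstepI: "\<delta> q (tp i) = Some (q', \<alpha>, e) \<Longrightarrow> 0 \<le> i + e \<Longrightarrow> i + e \<le> b \<Longrightarrow> j = i + e \<Longrightarrow> out' = out @ \<alpha> \<Longrightarrow>
   mstep \<delta> tp b (q, i, out) (q', j, out')"
  unfolding mstep_def by blast

lemma mstepE:
  assumes "mstep \<delta> tp b (q, i, out) c'"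
  obtains q' \<alpha> e where "\<delta> q (tp i) = Some (q', \<alpha>, e)" "c' = (q', i + e, out @ \<alpha>)" "0 \<le> i + e" "i + e \<le> b"
  using assms unfolding mstep_def by blast

lemma tape_in:
  assumes "w \<in> lists S" "0 \<le> i" "i \<le> int (length w) + 1"
  shows "tape w i \<in> {LM, RM} \<union> Sym ` S"
proof -
  have "nat (i - 1) < length w" if "i \<noteq> 0" "i \<noteq> int (length w) + 1" using assms that by linarith
  then show ?thesis using assms(1) by (auto simp: tape_def in_lists_conv_set)
qed

lemma gstepI:
  assumes "(p, \<sigma>, q1, \<alpha>1, e1, q2, \<alpha>2, e2) \<in> instrs M"
    "(q, \<alpha>, e) = (if tape w i = \<sigma> then (q1, \<alpha>1, e1) else (q2, \<alpha>2, e2))"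
    "0 \<le> i + e" "i + e \<le> int (length w) + 1"
  shows "gstep M w (p, i, out) (q, i + e, out @ \<alpha>)"
  unfolding gstep_def
  apply (rule exI[of _ p], rule exI[of _ i], rule exI[of _ out], rule exI[of _ \<sigma>], rule exI[of _ q1], rule exI[of _ \<alpha>1], rule exI[of _ e1])
  apply (rule exI[of _ q2], rule exI[of _ \<alpha>2], rule exI[of _ e2], rule exI[of _ q], rule exI[of _ \<alpha>], rule exI[of _ e])
  using assms by simp

locale two_way =
  fixes \<delta> :: "'q \<Rightarrow> tsym \<Rightarrow> ('q \<times> nat list \<times> int) option"
    and Q :: "'q set" and Sg Oa :: "nat set" and q0 qe :: 'q
  assumes finQ: "finite Q" and finS: "finite Sg" and finO: "finite Oa"
    and q0: "q0 \<in> Q" and qe: "qe \<in> Q" and stop: "\<And>\<sigma>. \<delta> qe \<sigma> = None"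
    and closed: "\<And>q \<sigma> q' \<alpha> e. q \<in> Q \<Longrightarrow> \<sigma> \<in> {LM, RM} \<union> Sym ` Sg \<Longrightarrow> \<delta> q \<sigma> = Some (q', \<alpha>, e) \<Longrightarrow>
        q' \<in> Q \<and> \<alpha> \<in> lists Oa \<and> e \<in> {-1, 0, 1}"
begin

definition syms :: "tsym list" where
  "syms = (SOME xs. set xs = {LM, RM} \<union> Sym ` Sg)"

lemma set_syms: "set syms = {LM, RM} \<union> Sym ` Sg"
proof -
  have "finite ({LM, RM} \<union> Sym ` Sg)" using finS by simp
  then have "\<exists>xs. set xs = {LM, RM} \<union> Sym ` Sg" by (rule finite_list)
  then show ?thesis unfolding syms_def by (rule someI_ex)
qed

lemma syms_pos: "0 < length syms"
  using set_syms by (metis empty_iff empty_set insertI1 UnI1 length_greater_0_conv)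

definition cd :: "'q \<Rightarrow> nat" where
  "cd = (SOME f. inj_on f Q)"

lemma inj_cd: "inj_on cd Q"
proof -
  have "\<exists>f :: 'q \<Rightarrow> nat. inj_on f Q" using finite_imp_inj_to_nat_seg[OF finQ] by blast
  then show ?thesis unfolding cd_def by (rule someI_ex)
qed

text \<open>An instruction of a gsm tests only one symbol, so state \<open>st q k\<close> is state \<open>q\<close>
  after the first \<open>k\<close> tape symbols have been tested without success; 0 is a dead state.\<close>

definition st :: "'q \<Rightarrow> nat \<Rightarrow> nat" where
  "st q k = Suc (prod_encode (cd q, k))"

lemma st_inj: "q \<in> Q \<Longrightarrow> q' \<in> Q \<Longrightarrow> st q k = st q' k' \<longleftrightarrow> q = q' \<and> k = k'"
  using inj_cd by (auto simp: st_def inj_on_def dest: injD[OF inj_prod_encode])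

text \<open>Where the transition is undefined the simulation enters state 0, which has no
  instruction because \<open>st\<close> never takes the value 0.\<close>

definition succ where
  "succ q \<sigma> = (case \<delta> q \<sigma> of None \<Rightarrow> (0, [], 0) | Some (q', \<alpha>, e) \<Rightarrow> (st q' 0, \<alpha>, e))"

definition instr_of :: "'q \<Rightarrow> nat \<Rightarrow> instr" where
  "instr_of q k = (st q k, syms ! k, fst (succ q (syms ! k)), fst (snd (succ q (syms ! k))), snd (snd (succ q (syms ! k))),
     if Suc k < length syms then st q (Suc k) else 0, [], 0)"

definition gsm_of :: gsm where
  "gsm_of = \<lparr>states = insert 0 ((\<lambda>(q, k). st q k) ` (Q \<times> {..<length syms})), inalph = Sg, outalph = Oa,
     instrs = {instr_of q k | q k. q \<in> Q - {qe} \<and> k \<in> {..<length syms}}, qin = st q0 0, qf = st qe 0\<rparr>"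

lemma in_instrs: "t \<in> instrs gsm_of \<longleftrightarrow> (\<exists>q k. t = instr_of q k \<and> q \<in> Q \<and> q \<noteq> qe \<and> k < length syms)"
  unfolding gsm_of_def gsm.simps by blast

lemma instr_of_in: "q \<in> Q \<Longrightarrow> q \<noteq> qe \<Longrightarrow> k < length syms \<Longrightarrow> instr_of q k \<in> instrs gsm_of"
  unfolding in_instrs by (rule exI[of _ q], rule exI[of _ k]) simp

lemma finite_instrs: "finite (instrs gsm_of)"
  unfolding gsm_of_def gsm.simps using finQ by (intro finite_image_set2) simp_all

lemma succ_ok:
  assumes "q \<in> Q" "k < length syms"
  shows "case succ q (syms ! k) of (p, \<alpha>, e) \<Rightarrow> p \<in> states gsm_of \<and> \<alpha> \<in> lists Oa \<and> e \<in> {-1, 0, 1}"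
proof (cases "\<delta> q (syms ! k)")
  case None
  then show ?thesis by (simp add: succ_def gsm_of_def)
next
  case (Some t)
  obtain q' \<alpha> e where t: "t = (q', \<alpha>, e)" by (cases t)
  have "syms ! k \<in> {LM, RM} \<union> Sym ` Sg" using assms(2) set_syms nth_mem by blast
  then have *: "q' \<in> Q \<and> \<alpha> \<in> lists Oa \<and> e \<in> {-1, 0, 1}" using closed assms(1) Some t by blast
  then have "st q' 0 \<in> (\<lambda>(q, k). st q k) ` (Q \<times> {..<length syms})" using syms_pos by force
  then show ?thesis using * Some t by (simp add: succ_def gsm_of_def)
qed

lemma wf_gsm_of: "wf_gsm gsm_of"
proof -
  have st: "st q k \<in> states gsm_of" if "q \<in> Q" "k < length syms" for q k
    using that by (force simp: gsm_of_def)
  have "case t of (p, \<sigma>, q1, \<alpha>1, e1, q0, \<alpha>0, e0) \<Rightarrow>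
          p \<in> states gsm_of \<and> p \<noteq> qf gsm_of \<and> \<sigma> \<in> {LM, RM} \<union> Sym ` inalph gsm_of
          \<and> q1 \<in> states gsm_of \<and> q0 \<in> states gsm_of \<and> \<alpha>1 \<in> lists (outalph gsm_of) \<and> \<alpha>0 \<in> lists (outalph gsm_of)
          \<and> e1 \<in> {-1, 0, 1} \<and> e0 \<in> {-1, 0, 1}"
    if mem: "t \<in> instrs gsm_of" for t
  proof -
    obtain q k where t: "t = instr_of q k" "q \<in> Q" "q \<noteq> qe" "k < length syms"
      using mem unfolding in_instrs by blast
    have [simp]: "inalph gsm_of = Sg" "outalph gsm_of = Oa" "qf gsm_of = st qe 0" by (simp_all add: gsm_of_def)
    have "syms ! k \<in> {LM, RM} \<union> Sym ` Sg" using t(4) set_syms nth_mem by blast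
    moreover have "st q k \<noteq> st qe 0" using t st_inj qe by blast
    moreover have "0 \<in> states gsm_of" by (simp add: gsm_of_def)
    ultimately show ?thesis
      using succ_ok[OF t(2,4)] st t(2,4) unfolding t(1) instr_of_def prod.case
      by (simp add: split_beta)
  qed
  then have "\<forall>t\<in>instrs gsm_of. case t of (p, \<sigma>, q1, \<alpha>1, e1, q0, \<alpha>0, e0) \<Rightarrow>
          p \<in> states gsm_of \<and> p \<noteq> qf gsm_of \<and> \<sigma> \<in> {LM, RM} \<union> Sym ` inalph gsm_of
          \<and> q1 \<in> states gsm_of \<and> q0 \<in> states gsm_of \<and> \<alpha>1 \<in> lists (outalph gsm_of) \<and> \<alpha>0 \<in> lists (outalph gsm_of)
          \<and> e1 \<in> {-1, 0, 1} \<and> e0 \<in> {-1, 0, 1}" by (rule ballI)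
  moreover have "finite (states gsm_of)" "finite (inalph gsm_of)" "finite (outalph gsm_of)" "finite (instrs gsm_of)"
    using finQ finS finO finite_instrs by (simp_all add: gsm_of_def)
  moreover have "qin gsm_of \<in> states gsm_of" "qf gsm_of \<in> states gsm_of"
    using st[OF q0 syms_pos] st[OF qe syms_pos] by (simp_all add: gsm_of_def)
  ultimately show ?thesis unfolding wf_gsm_def by (intro conjI)
qed

lemma det_gsm_of: "deterministic gsm_of"
  unfolding deterministic_def
proof (intro ballI impI)
  fix t1 t2 assume mem: "t1 \<in> instrs gsm_of" "t2 \<in> instrs gsm_of" "fst t1 = fst t2"
    obtain q k where t: "t1 = instr_of q k" "q \<in> Q"
      using mem unfolding in_instrs by blast
    obtain q' k' where t': "t2 = instr_of q' k'" "q' \<in> Q"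
      using mem unfolding in_instrs by blast
    have "st q k = st q' k'" using mem(3) t t' by (simp add: instr_of_def)
  then have "q = q' \<and> k = k'" using st_inj[OF t(2) t'(2)] by simp
  then show "t1 = t2" unfolding t(1) t'(1) by simp
qed

lemma gstep_test:
  assumes "q \<in> Q" "q \<noteq> qe" "0 \<le> i" "i \<le> int (length w) + 1" "tape w i \<noteq> syms ! k" "Suc k < length syms"
  shows "gstep gsm_of w (st q k, i, out) (st q (Suc k), i, out)"
proof -
  have "instr_of q k \<in> instrs gsm_of" by (rule instr_of_in) (use assms in auto)
  from gstepI[OF this[unfolded instr_of_def], of "st q (Suc k)" "[]" 0 w i out] assms show ?thesis by simp
qed

lemma gstep_move:
  assumes "q \<in> Q" "k < length syms" "tape w i = syms ! k" "\<delta> q (tape w i) = Some (q', \<alpha>, e)"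
    "0 \<le> i + e" "i + e \<le> int (length w) + 1"
  shows "gstep gsm_of w (st q k, i, out) (st q' 0, i + e, out @ \<alpha>)"
proof -
  have "q \<noteq> qe" using assms(4) stop by auto
  then have "instr_of q k \<in> instrs gsm_of" using instr_of_in assms by simp
  moreover have "succ q (syms ! k) = (st q' 0, \<alpha>, e)" using assms by (simp add: succ_def)
  ultimately have "(st q k, syms ! k, st q' 0, \<alpha>, e, if Suc k < length syms then st q (Suc k) else 0, [], 0) \<in> instrs gsm_of"
    by (simp add: instr_of_def)
  from gstepI[OF this, of "st q' 0" \<alpha> e w i out] assms show ?thesis by simp
qed

text \<open>The emitted string is written as \<open>drop (length out) out'\<close>, so that a step
  can be read off its two configurations without a further existential.\<close>

lemma gstepD:
  assumes "gstep gsm_of w c (p', i', out')" "c = (p, i, out)"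
  obtains q k where "q \<in> Q" "k < length syms" "p = st q k"
    "tape w i = syms ! k \<Longrightarrow> succ q (syms ! k) = (p', drop (length out) out', i' - i) \<and> out' = out @ drop (length out) out'"
    "tape w i \<noteq> syms ! k \<Longrightarrow> i' = i \<and> out' = out \<and> (p' = 0 \<or> p' = st q (Suc k) \<and> Suc k < length syms)"
    "0 \<le> i'" "i' \<le> int (length w) + 1"
proof -
  obtain \<sigma> q1 \<alpha>1 e1 q0' \<alpha>0 e0 q \<alpha> e where *: "(p, \<sigma>, q1, \<alpha>1, e1, q0', \<alpha>0, e0) \<in> instrs gsm_of"
    "(q, \<alpha>, e) = (if tape w i = \<sigma> then (q1, \<alpha>1, e1) else (q0', \<alpha>0, e0))"
    "0 \<le> i + e" "i + e \<le> int (length w) + 1" "p' = q" "i' = i + e" "out' = out @ \<alpha>"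
    using assms unfolding gstep_def by blast
  obtain r k where rk: "r \<in> Q" "k < length syms" "(p, \<sigma>, q1, \<alpha>1, e1, q0', \<alpha>0, e0) = instr_of r k"
    using *(1) unfolding in_instrs by blast
  have eqs: "p = st r k" "\<sigma> = syms ! k" "(q1, \<alpha>1, e1) = succ r (syms ! k)"
    "(q0', \<alpha>0, e0) = (if Suc k < length syms then st r (Suc k) else 0, [], 0)"
    using rk(3) by (simp_all add: instr_of_def)
  show ?thesis
  proof (rule that[OF rk(1,2) eqs(1)])
    show "succ r (syms ! k) = (p', drop (length out) out', i' - i) \<and> out' = out @ drop (length out) out'"
      if "tape w i = syms ! k"
      using that * eqs by simp
    show "i' = i \<and> out' = out \<and> (p' = 0 \<or> p' = st r (Suc k) \<and> Suc k < length syms)"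
      if "tape w i \<noteq> syms ! k"
      using that * eqs by (simp split: if_splits)
    show "0 \<le> i'" "i' \<le> int (length w) + 1" using * by simp_all
  qed
qed

lemma sim1:
  assumes "w \<in> lists Sg" "mstep \<delta> (tape w) (int (length w) + 1) (q, i, out) (q', i', out')"
    "q \<in> Q" "0 \<le> i" "i \<le> int (length w) + 1"
  shows "(gstep gsm_of w)\<^sup>*\<^sup>* (st q 0, i, out) (st q' 0, i', out')"
proof -
  obtain \<alpha> e where d: "\<delta> q (tape w i) = Some (q', \<alpha>, e)" "i' = i + e" "out' = out @ \<alpha>" "0 \<le> i + e" "i + e \<le> int (length w) + 1"
    using assms(2) unfolding mstep_def by blast
  have "\<exists>k. k < length syms \<and> syms ! k = tape w i"
    using tape_in[OF assms(1,4,5)] set_syms by (metis in_set_conv_nth)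
  \<comment> \<open>\<open>syms\<close> may list a symbol more than once; the series of tests stops
    at its first occurrence, hence the least index.\<close>
  then obtain k where k: "k < length syms" "syms ! k = tape w i" "\<And>j. j < k \<Longrightarrow> syms ! j \<noteq> tape w i"
    unfolding exists_least_iff[of "\<lambda>k. k < length syms \<and> syms ! k = tape w i"]
    by (metis order_less_trans)
  have ne: "q \<noteq> qe" using d stop by auto
  have "(gstep gsm_of w)\<^sup>*\<^sup>* (st q 0, i, out) (st q j, i, out)" if "j \<le> k" for j
    using that
  proof (induction j)
    case (Suc j)
    have "gstep gsm_of w (st q j, i, out) (st q (Suc j), i, out)"
    proof (rule gstep_test[OF assms(3) ne assms(4,5)])
      show "tape w i \<noteq> syms ! j" using k(3)[of j] Suc.prems by fastforce
      show "Suc j < length syms" using k(1) Suc.prems by simp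
    qed
    then show ?case using Suc by simp
  qed simp
  from this[of k] gstep_move[OF assms(3) k(1) k(2)[symmetric] d(1,4,5)] show ?thesis
    unfolding d(2,3) by (simp add: rtranclp.rtrancl_into_rtrancl)
qed

lemma run_Q:
  assumes "w \<in> lists Sg" "(mstep \<delta> (tape w) (int (length w) + 1))\<^sup>*\<^sup>* (q0, 0, []) c"
  shows "(gstep gsm_of w)\<^sup>*\<^sup>* (st q0 0, 0, []) (st (fst c) 0, snd c) \<and> fst c \<in> Q
     \<and> 0 \<le> fst (snd c) \<and> fst (snd c) \<le> int (length w) + 1"
  using assms(2)
proof (induction rule: rtranclp_induct)
  case base
  then show ?case using q0 by simp
next
  case (step c c')
  obtain q i out where c: "c = (q, i, out)" by (cases c)
  obtain q' i' out' where c': "c' = (q', i', out')" by (cases c')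
  have "q \<in> Q" "0 \<le> i" "i \<le> int (length w) + 1" using step.IH c by simp_all
  moreover from this have "tape w i \<in> {LM, RM} \<union> Sym ` Sg" using tape_in[OF assms(1)] by blast
  moreover obtain \<alpha> e where "\<delta> q (tape w i) = Some (q', \<alpha>, e)" "0 \<le> i'" "i' \<le> int (length w) + 1"
    using step.hyps(2) unfolding c c' mstep_def by blast
  ultimately show ?case
    using step.IH sim1[OF assms(1) step.hyps(2)[unfolded c c']] closed[of q "tape w i" q']
    unfolding c c' by simp
qed

text \<open>The induction has to cover runs that end within a series of tests, where the simulated
  machine has not moved yet, and runs that are stuck in the dead state 0.\<close>

lemma sim2:
  assumes "w \<in> lists Sg" "(gstep gsm_of w)\<^sup>*\<^sup>* (st q0 0, 0, []) (p, i, out)"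
  shows "0 \<le> i \<and> i \<le> int (length w) + 1 \<and> (p = 0 \<or> (\<exists>q\<in>Q. \<exists>k. p = st q k \<and>
     (mstep \<delta> (tape w) (int (length w) + 1))\<^sup>*\<^sup>* (q0, 0, []) (q, i, out)))"
  using assms(2)
proof (induction "(p, i, out)" arbitrary: p i out rule: rtranclp_induct)
  case base
  then show ?case using q0 by auto
next
  case (step c)
  obtain p' i' out' where c: "c = (p', i', out')" by (cases c)
  from step.hyps(2) c show ?case
  proof (cases rule: gstepD)
    case (1 q k)
    have "p' \<noteq> 0" using 1(3) by (simp add: st_def)
    with step.hyps(3)[OF c] obtain q2 k2 where "q2 \<in> Q" "p' = st q2 k2" and
      run: "(mstep \<delta> (tape w) (int (length w) + 1))\<^sup>*\<^sup>* (q0, 0, []) (q2, i', out')" by blast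
    then have q2: "q2 = q" using st_inj 1 by blast
    show ?thesis
    proof (cases "tape w i' = syms ! k")
      case False
      then show ?thesis using 1 run q2 by auto
    next
      case True
      show ?thesis
      proof (cases "\<delta> q (syms ! k)")
        case None
        then show ?thesis using 1(4)[OF True] 1(6,7) by (simp add: succ_def)
      next
        case (Some t)
        obtain q' \<alpha> e where t: "t = (q', \<alpha>, e)" by (cases t)
        have p: "p = st q' 0" "i = i' + e" "out = out' @ \<alpha>"
          using 1(4)[OF True] Some t by (simp_all add: succ_def)
        have "mstep \<delta> (tape w) (int (length w) + 1) (q, i', out') (q', i, out)"
          by (rule mstepI[where \<alpha>=\<alpha> and e=e]) (use Some t True p 1(6,7) in simp_all)
        then have "(mstep \<delta> (tape w) (int (length w) + 1))\<^sup>*\<^sup>* (q0, 0, []) (q', i, out)"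
          using run q2 by simp
        moreover have "q' \<in> Q"
        proof -
          have "syms ! k \<in> {LM, RM} \<union> Sym ` Sg" using 1(2) set_syms nth_mem by blast
          from closed[OF 1(1) this Some[unfolded t]] show ?thesis by simp
        qed
        ultimately show ?thesis using p(1) 1(6,7) by blast
      qed
    qed
  qed
qed

theorem realized_gsm_of:
  "realized gsm_of = {(w, z). w \<in> lists Sg \<and> (\<exists>i. (mstep \<delta> (tape w) (int (length w) + 1))\<^sup>*\<^sup>* (q0, 0, []) (qe, i, z))}"
proof -
  have "(\<exists>i. (gstep gsm_of w)\<^sup>*\<^sup>* (st q0 0, 0, []) (st qe 0, i, z)) \<longleftrightarrow>
        (\<exists>i. (mstep \<delta> (tape w) (int (length w) + 1))\<^sup>*\<^sup>* (q0, 0, []) (qe, i, z))" if "w \<in> lists Sg" for w z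
  proof
    assume "\<exists>i. (gstep gsm_of w)\<^sup>*\<^sup>* (st q0 0, 0, []) (st qe 0, i, z)"
    then obtain i where "(gstep gsm_of w)\<^sup>*\<^sup>* (st q0 0, 0, []) (st qe 0, i, z)" by blast
    from sim2[OF that this] st_inj qe show "\<exists>i. (mstep \<delta> (tape w) (int (length w) + 1))\<^sup>*\<^sup>* (q0, 0, []) (qe, i, z)"
      by (metis Suc_not_Zero st_def)
  next
    assume "\<exists>i. (mstep \<delta> (tape w) (int (length w) + 1))\<^sup>*\<^sup>* (q0, 0, []) (qe, i, z)"
    then show "\<exists>i. (gstep gsm_of w)\<^sup>*\<^sup>* (st q0 0, 0, []) (st qe 0, i, z)"
      using run_Q[OF that] by fastforce
  qed
  moreover have "inalph gsm_of = Sg" "qin gsm_of = st q0 0" "qf gsm_of = st qe 0"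
    by (simp_all add: gsm_of_def)
  ultimately show ?thesis by (simp only: realized_def cong: conj_cong)
qed

end

section \<open>Formulas describing the output graph\<close>

text \<open>Unsatisfiable in every graph, including the empty one, where quantification over nodes
  has no witness at all.\<close>

definition FF :: mso where
  "FF = ExN 0 (Neg (Eq 0 0))"

definition Or :: "mso \<Rightarrow> mso \<Rightarrow> mso" where
  "Or \<phi> \<psi> = Neg (Conj (Neg \<phi>) (Neg \<psi>))"

fun or_list :: "mso list \<Rightarrow> mso" where
  "or_list [] = FF"
| "or_list (\<phi> # \<phi>s) = Or \<phi> (or_list \<phi>s)"

definition OrS :: "'a set \<Rightarrow> ('a \<Rightarrow> mso) \<Rightarrow> mso" where
  "OrS S F = or_list (map F (SOME xs. set xs = S))"

definition AndS :: "'a set \<Rightarrow> ('a \<Rightarrow> mso) \<Rightarrow> mso" where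
  "AndS S F = Neg (OrS S (\<lambda>x. Neg (F x)))"

lemma sat_FF [simp]: "\<not> sat g n s FF" and fv_FF [simp]: "fvn FF = {}" "fvs FF = {}"
  by (auto simp: FF_def)

lemma sat_Or [simp]: "sat g n s (Or \<phi> \<psi>) \<longleftrightarrow> sat g n s \<phi> \<or> sat g n s \<psi>"
  and fv_Or [simp]: "fvn (Or \<phi> \<psi>) = fvn \<phi> \<union> fvn \<psi>" "fvs (Or \<phi> \<psi>) = fvs \<phi> \<union> fvs \<psi>"
  by (auto simp: Or_def)

lemma or_list: "sat g n s (or_list \<phi>s) \<longleftrightarrow> (\<exists>\<phi>\<in>set \<phi>s. sat g n s \<phi>)"
  "fvn (or_list \<phi>s) = (\<Union>\<phi>\<in>set \<phi>s. fvn \<phi>)" "fvs (or_list \<phi>s) = (\<Union>\<phi>\<in>set \<phi>s. fvs \<phi>)"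
  by (induction \<phi>s) auto

lemma some_list: "finite S \<Longrightarrow> set (SOME xs. set xs = S) = S"
  by (rule someI_ex[OF finite_list])

lemma sat_OrS [simp]: "finite S \<Longrightarrow> sat g n s (OrS S F) \<longleftrightarrow> (\<exists>x\<in>S. sat g n s (F x))"
  and fvn_OrS [simp]: "finite S \<Longrightarrow> fvn (OrS S F) = (\<Union>x\<in>S. fvn (F x))"
  and fvs_OrS [simp]: "finite S \<Longrightarrow> fvs (OrS S F) = (\<Union>x\<in>S. fvs (F x))"
  by (simp_all add: OrS_def or_list some_list)

lemma sat_AndS [simp]: "finite S \<Longrightarrow> sat g n s (AndS S F) \<longleftrightarrow> (\<forall>x\<in>S. sat g n s (F x))"
  and fvn_AndS [simp]: "finite S \<Longrightarrow> fvn (AndS S F) = (\<Union>x\<in>S. fvn (F x))"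
  and fvs_AndS [simp]: "finite S \<Longrightarrow> fvs (AndS S F) = (\<Union>x\<in>S. fvs (F x))"
  by (simp_all add: AndS_def)

lemma gV_out_graph [simp]: "gV (out_graph T g P) = out_nodes T g P"
  by (simp add: out_graph_def)

lemma gE_out_graph: "((u, c), \<gamma>, (v, c')) \<in> gE (out_graph T g P) \<longleftrightarrow>
    (u, c) \<in> out_nodes T g P \<and> (v, c') \<in> out_nodes T g P \<and> \<gamma> \<in> oealph T
      \<and> sat g ((\<lambda>_. u)(1 := v)) P (edgef T c c' \<gamma>)"
  by (simp add: out_graph_def)

lemma glab_out_graph: "glab (out_graph T g P) (u, c) = (THE \<sigma>. \<sigma> \<in> onalph T \<and> sat g (\<lambda>_. u) P (nodef T c \<sigma>))"
  by (simp add: out_graph_def)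

lemma out_nodes_iff: "(u, c) \<in> out_nodes T g P \<longleftrightarrow> u \<in> gV g \<and> c \<in> copies T
      \<and> (\<exists>!\<sigma>. \<sigma> \<in> onalph T \<and> sat g (\<lambda>_. u) P (nodef T c \<sigma>))"
  by (simp add: out_nodes_def)

lemma gE_out_graphD: "((u, c), \<gamma>, (v, c')) \<in> gE (out_graph T g P) \<Longrightarrow>
    c \<in> copies T \<and> c' \<in> copies T \<and> \<gamma> \<in> oealph T"
  by (simp add: gE_out_graph out_nodes_iff)

definition nodeF :: "mso_trans \<Rightarrow> nat \<Rightarrow> mso" where
  "nodeF T c = OrS (onalph T) (\<lambda>\<sigma>. Conj (nodef T c \<sigma>) (AndS (onalph T - {\<sigma>}) (\<lambda>\<tau>. Neg (nodef T c \<tau>))))"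

text \<open>The formula is evaluated under a constant valuation: rebinding variable 0 to a
  predecessor leaves the node itself in variable 1, which is the target variable of edge
  formulas.\<close>

definition firstF :: "mso_trans \<Rightarrow> nat \<Rightarrow> mso" where
  "firstF T c = Conj (nodeF T c)
     (Neg (OrS (copies T \<times> oealph T) (\<lambda>(c', \<gamma>). ExN 0 (Conj (nodeF T c') (edgef T c' c \<gamma>)))))"

text \<open>Node formulas speak about variable 0, but the successor has to be variable 1. The inner
  quantifier shadows 0 by a copy of 1, which replaces a substitution in \<open>nodeF T c'\<close>;
  outside it variable 0 still is the source for the edge formula.\<close>

definition lastF :: "mso_trans \<Rightarrow> nat \<Rightarrow> mso" where
  "lastF T c = Neg (OrS (copies T \<times> oealph T)
     (\<lambda>(c', \<gamma>). ExN 1 (Conj (ExN 0 (Conj (Eq 0 1) (nodeF T c'))) (edgef T c c' \<gamma>))))"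

context
  fixes T assumes wfT: "wf_trans T"
begin

lemma fin_T: "finite (copies T)" "finite (onalph T)" "finite (oealph T)"
  using wfT by (simp_all add: wf_trans_def)

lemma fvn_T: "fvn (tdom T) = {}"
  "c \<in> copies T \<Longrightarrow> \<sigma> \<in> onalph T \<Longrightarrow> fvn (nodef T c \<sigma>) \<subseteq> {0}"
  "c \<in> copies T \<Longrightarrow> c' \<in> copies T \<Longrightarrow> \<gamma> \<in> oealph T \<Longrightarrow> fvn (edgef T c c' \<gamma>) \<subseteq> {0, 1}"
  using wfT by (simp_all add: wf_trans_def)

lemma sat_nodeF:
  assumes "c \<in> copies T" "n 0 \<in> gV g"
  shows "sat g n P (nodeF T c) \<longleftrightarrow> (n 0, c) \<in> out_nodes T g P"
proof -
  have "sat g n P (nodef T c \<sigma>) \<longleftrightarrow> sat g (\<lambda>_. n 0) P (nodef T c \<sigma>)" if "\<sigma> \<in> onalph T" for \<sigma>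
    by (rule sat_cong) (use fvn_T(2)[OF assms(1) that] in auto)
  then have "sat g n P (nodeF T c) \<longleftrightarrow> (\<exists>\<sigma>\<in>onalph T. sat g (\<lambda>_. n 0) P (nodef T c \<sigma>) \<and>
      (\<forall>\<tau>\<in>onalph T - {\<sigma>}. \<not> sat g (\<lambda>_. n 0) P (nodef T c \<tau>)))"
    unfolding nodeF_def using fin_T by simp
  also have "\<dots> \<longleftrightarrow> (\<exists>!\<sigma>. \<sigma> \<in> onalph T \<and> sat g (\<lambda>_. n 0) P (nodef T c \<sigma>))"
    unfolding Ex1_def by blast
  finally show ?thesis using assms by (simp add: out_nodes_iff)
qed

lemma sat_edgef:
  assumes "c \<in> copies T" "c' \<in> copies T" "\<gamma> \<in> oealph T"
  shows "sat g n P (edgef T c c' \<gamma>) \<longleftrightarrow> sat g ((\<lambda>_. n 0)(1 := n 1)) P (edgef T c c' \<gamma>)"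
  by (rule sat_cong) (use fvn_T(3)[OF assms] in auto)

lemma sat_pred:
  assumes "c' \<in> copies T" "\<gamma> \<in> oealph T" "(u, c) \<in> out_nodes T g P"
  shows "sat g (\<lambda>_. u) P (ExN 0 (Conj (nodeF T c') (edgef T c' c \<gamma>))) \<longleftrightarrow>
    (\<exists>v. ((v, c'), \<gamma>, (u, c)) \<in> gE (out_graph T g P))"
proof -
  have c: "c \<in> copies T" using assms(3) by (simp add: out_nodes_iff)
  have "sat g ((\<lambda>_. u)(0 := v)) P (edgef T c' c \<gamma>) \<longleftrightarrow> sat g ((\<lambda>_. v)(1 := u)) P (edgef T c' c \<gamma>)" for v
    using sat_edgef[OF assms(1) c assms(2), of g "(\<lambda>_. u)(0 := v)" P] by simp
  moreover have "sat g ((\<lambda>_. u)(0 := v)) P (nodeF T c') \<longleftrightarrow> (v, c') \<in> out_nodes T g P" if "v \<in> gV g" for v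
    using sat_nodeF[OF assms(1), of "(\<lambda>_. u)(0 := v)" g P] that by simp
  moreover have "v \<in> gV g" if "(v, c') \<in> out_nodes T g P" for v using that by (simp add: out_nodes_iff)
  ultimately show ?thesis unfolding sat.simps gE_out_graph using assms(2,3) by metis
qed

lemma sat_succ:
  assumes "c' \<in> copies T" "\<gamma> \<in> oealph T" "(u, c) \<in> out_nodes T g P"
  shows "sat g (\<lambda>_. u) P (ExN 1 (Conj (ExN 0 (Conj (Eq 0 1) (nodeF T c'))) (edgef T c c' \<gamma>))) \<longleftrightarrow>
    (\<exists>v. ((u, c), \<gamma>, (v, c')) \<in> gE (out_graph T g P))"
proof -
  have "sat g ((\<lambda>_. u)(1 := v)) P (ExN 0 (Conj (Eq 0 1) (nodeF T c'))) \<longleftrightarrow> (v, c') \<in> out_nodes T g P"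
    if "v \<in> gV g" for v
    using sat_nodeF[OF assms(1), of "(\<lambda>_. u)(1 := v, 0 := v)" g P] that by (auto simp del: fun_upd_apply) (simp_all)
  moreover have "v \<in> gV g" if "(v, c') \<in> out_nodes T g P" for v using that by (simp add: out_nodes_iff)
  ultimately show ?thesis
    unfolding sat.simps(6) sat.simps(7)[where x="1 :: nat"] gE_out_graph using assms(2,3) by metis
qed

lemma sat_firstF:
  assumes "u \<in> gV g" "c \<in> copies T"
  shows "sat g (\<lambda>_. u) P (firstF T c) \<longleftrightarrow>
    (u, c) \<in> out_nodes T g P \<and> \<not> (\<exists>x \<gamma>. (x, \<gamma>, (u, c)) \<in> gE (out_graph T g P))"
proof (cases "(u, c) \<in> out_nodes T g P")
  case True
  have "(\<exists>x \<gamma>. (x, \<gamma>, (u, c)) \<in> gE (out_graph T g P)) \<longleftrightarrow>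
      (\<exists>c'\<in>copies T. \<exists>\<gamma>\<in>oealph T. \<exists>v. ((v, c'), \<gamma>, (u, c)) \<in> gE (out_graph T g P))"
    unfolding split_paired_Ex by (metis gE_out_graphD)
  also have "\<dots> \<longleftrightarrow> (\<exists>c'\<in>copies T. \<exists>\<gamma>\<in>oealph T.
      sat g (\<lambda>_. u) P (ExN 0 (Conj (nodeF T c') (edgef T c' c \<gamma>))))"
    by (intro bex_cong refl) (simp only: sat_pred[OF _ _ True])
  finally show ?thesis
    unfolding firstF_def using True assms fin_T sat_nodeF[of c "\<lambda>_. u" g P] by (simp del: sat.simps(7))
next
  case False
  then show ?thesis unfolding firstF_def using assms sat_nodeF[of c "\<lambda>_. u" g P] by simp
qed

lemma sat_lastF:
  assumes "(u, c) \<in> out_nodes T g P"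
  shows "sat g (\<lambda>_. u) P (lastF T c) \<longleftrightarrow> \<not> (\<exists>x \<gamma>. ((u, c), \<gamma>, x) \<in> gE (out_graph T g P))"
proof -
  have "(\<exists>x \<gamma>. ((u, c), \<gamma>, x) \<in> gE (out_graph T g P)) \<longleftrightarrow>
      (\<exists>c'\<in>copies T. \<exists>\<gamma>\<in>oealph T. \<exists>v. ((u, c), \<gamma>, (v, c')) \<in> gE (out_graph T g P))"
    unfolding split_paired_Ex by (metis gE_out_graphD)
  also have "\<dots> \<longleftrightarrow> (\<exists>c'\<in>copies T. \<exists>\<gamma>\<in>oealph T.
      sat g (\<lambda>_. u) P (ExN 1 (Conj (ExN 0 (Conj (Eq 0 1) (nodeF T c'))) (edgef T c c' \<gamma>))))"
    by (intro bex_cong refl) (simp only: sat_succ[OF _ _ assms])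
  finally show ?thesis
    unfolding lastF_def using fin_T by (simp del: sat.simps(7))
qed

end

section \<open>The machine that walks along the output graph\<close>

text \<open>The guess made at a position: its marked letter, the normal forms of the words before and
  after it, and for each copy \<open>c\<close> the direction, copy and edge label of the successor of that
  copy of the position in the output graph.\<close>

datatype ann = Ann (aL: letter) (aP: "letter list") (aS: "letter list") (aN: "nat \<Rightarrow> int \<times> nat \<times> nat option")

datatype asym = AL | AR | AA ann

text \<open>\<open>Chk\<close> checks the guesses in a left-to-right sweep, \<open>Rew\<close> returns to the left end, \<open>Fst\<close>
  searches for the first output node, \<open>At c\<close> stands on output node \<open>c\<close> of the scanned position.
  \<open>WR c c' \<gamma> L\<close> walks to the right from the last visited output node to its \<open>\<gamma>\<close>-successor, where
  \<open>L\<close> is the normal form of the word to the left of the head with the source marked; \<open>WL\<close> is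
  its mirror image.\<close>

datatype mst = Chk "ann option" | Rew | Fst | At nat | WR nat nat "nat option" "letter list"
  | WL nat nat "nat option" "letter list" | Fin

section \<open>Path graphs and their enumerations\<close>

definition is_path :: "('v, 'z) graph_scheme \<Rightarrow> (nat \<Rightarrow> 'v) \<Rightarrow> (nat \<Rightarrow> nat option) \<Rightarrow> nat \<Rightarrow> bool" where
  "is_path h v \<gamma> N \<longleftrightarrow> gV h = v ` {..<N} \<and> inj_on v {..<N} \<and> gE h = {(v i, \<gamma> i, v (Suc i)) | i. Suc i < N}"

lemma is_path_edge:
  assumes "is_path h v \<gamma> N" "(v k, \<gamma>', y) \<in> gE h" "k < N"
  shows "Suc k < N" "\<gamma>' = \<gamma> k" "y = v (Suc k)"
proof -
  obtain i where i: "Suc i < N" "v k = v i" "\<gamma>' = \<gamma> i" "y = v (Suc i)"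
    using assms(1,2) unfolding is_path_def by auto
  have "k = i" using assms(1,3) i unfolding is_path_def by (auto dest: inj_onD)
  then show "Suc k < N" "\<gamma>' = \<gamma> k" "y = v (Suc k)" using i by simp_all
qed

lemma is_path_last:
  assumes "is_path h v \<gamma> N" "k < N"
  shows "(\<exists>x \<gamma>. (v k, \<gamma>, x) \<in> gE h) \<longleftrightarrow> Suc k < N"
  using is_path_edge[OF assms(1) _ assms(2)] assms(1) unfolding is_path_def by blast

lemma is_path_first:
  assumes "is_path h v \<gamma> N" "k < N"
  shows "(\<exists>x \<gamma>. (x, \<gamma>, v k) \<in> gE h) \<longleftrightarrow> k \<noteq> 0"
proof
  assume "\<exists>x \<gamma>. (x, \<gamma>, v k) \<in> gE h"
  then obtain i where i: "Suc i < N" "v k = v (Suc i)" using assms(1) unfolding is_path_def by auto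
  then have "k = Suc i" using assms unfolding is_path_def by (auto dest: inj_onD)
  then show "k \<noteq> 0" by simp
next
  assume "k \<noteq> 0"
  then obtain i where "k = Suc i" using not0_implies_Suc by blast
  then show "\<exists>x \<gamma>. (x, \<gamma>, v k) \<in> gE h" using assms unfolding is_path_def by blast
qed

definition prev :: "'a list \<Rightarrow> nat \<Rightarrow> 'a option" where
  "prev as i = (if i = 0 then None else Some (as ! (i - 1)))"

lemma prev_0 [simp]: "prev as 0 = None" and prev_Suc [simp]: "prev as (Suc i) = Some (as ! i)"
  by (simp_all add: prev_def)

text \<open>The emission functions abstract from the representation of the output:
  \<open>em0\<close> is the contribution of the first output node, \<open>em1\<close> that of an
  edge together with its target. For \<open>nd\<close> both spell node labels, for \<open>ed\<close>
  only edges spell a letter.\<close>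

locale walker =
  fixes lab inc :: "nat option \<Rightarrow> nat option" and A :: "nat option set" and T :: mso_trans
    and em0 :: "nat option \<Rightarrow> nat list" and em1 :: "nat option \<Rightarrow> nat option \<Rightarrow> nat list"
  assumes finA: "finite A" and wfT: "wf_trans T"
begin

definition Fs :: "mso set" where
  "Fs = {tdom T} \<union> (\<Union>c\<in>copies T. {nodeF T c, firstF T c, lastF T c} \<union> nodef T c ` onalph T
      \<union> (\<Union>c'\<in>copies T. edgef T c c' ` oealph T))"

text \<open>The summand 4 leaves room for the marks 0 and 2 of the two node variables, whatever
  variables the formulas mention.\<close>

definition K :: nat where "K = Max (mbound ` Fs) + 4"
definition rk :: nat where "rk = Max (mrank ` Fs)"

lemma Fs_bounds: "\<phi> \<in> Fs \<Longrightarrow> mbound \<phi> \<le> K" "\<phi> \<in> Fs \<Longrightarrow> mrank \<phi> \<le> rk"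
proof -
  have "finite Fs" using fin_T[OF wfT] unfolding Fs_def by simp
  then show "\<phi> \<in> Fs \<Longrightarrow> mbound \<phi> \<le> K" "\<phi> \<in> Fs \<Longrightarrow> mrank \<phi> \<le> rk"
    by (auto simp: K_def rk_def intro: trans_le_add1)
qed

abbreviation W :: "letter list set" where "W \<equiv> lists (alph A K)"
abbreviation nf :: "letter list \<Rightarrow> letter list" where "nf \<equiv> nform A K rk"
abbreviation eqv :: "letter list \<Rightarrow> letter list \<Rightarrow> bool" (infix "\<approx>" 50) where "u \<approx> v \<equiv> ef K rk u v"

lemma nf: "u \<in> W \<Longrightarrow> nf u \<in> W" "u \<in> W \<Longrightarrow> nf u \<approx> u" 
  using nform ef_sym by blast+

lemma nf_cong: "u \<approx> v \<Longrightarrow> nf u = nf v"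
  unfolding nform_def using ef_class_eqI by metis

lemma K4: "4 \<le> K" by (simp add: K_def)

text \<open>The truth value of a formula depends only on the class of the encoded word, hence it can be
  read off any representative.\<close>

definition tv :: "mso \<Rightarrow> letter list \<Rightarrow> bool" where
  "tv \<phi> u \<longleftrightarrow> (\<exists>ws n s g. word_graph lab inc ws g \<and> u \<approx> enc K ws n s \<and> (\<forall>x\<in>fvn \<phi>. n x < length ws) \<and> sat g n s \<phi>)"

lemma tv: "\<phi> \<in> Fs \<Longrightarrow> word_graph lab inc ws g \<Longrightarrow> u \<approx> enc K ws n s \<Longrightarrow> \<forall>x\<in>fvn \<phi>. n x < length ws \<Longrightarrow>
    tv \<phi> u \<longleftrightarrow> sat g n s \<phi>"
proof -
  assume *: "\<phi> \<in> Fs" "word_graph lab inc ws g" "u \<approx> enc K ws n s" "\<forall>x\<in>fvn \<phi>. n x < length ws"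
  have "sat g' n' s' \<phi> \<longleftrightarrow> sat g n s \<phi>"
    if "word_graph lab inc ws' g'" "u \<approx> enc K ws' n' s'" "\<forall>x\<in>fvn \<phi>. n' x < length ws'" for ws' n' s' g'
    by (rule sat_ef[OF that(1) *(2) _ Fs_bounds(2,1)]) (use * that ef_sym ef_trans in blast)+
  then show ?thesis unfolding tv_def using * by blast
qed

text \<open>The node variables other than 1 are all interpreted by the source node, exactly as in
  \<open>out_graph\<close>.\<close>

definition mkx :: "letter \<Rightarrow> letter" where
  "mkx l = (fst l, snd l \<union> {2 * x | x. x \<noteq> 1} \<inter> {..<K})"
definition mky :: "letter \<Rightarrow> letter" where
  "mky l = (fst l, insert 2 (snd l))"
definition mkxy :: "letter \<Rightarrow> letter" where
  "mkxy l = (fst l, snd l \<union> {2 * x | x. True} \<inter> {..<K})"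

lemma mk_alph: "l \<in> alph A K \<Longrightarrow> mkx l \<in> alph A K" "l \<in> alph A K \<Longrightarrow> mky l \<in> alph A K" "l \<in> alph A K \<Longrightarrow> mkxy l \<in> alph A K"
  using K4 by (cases l; force simp: mkx_def mky_def mkxy_def alph_def)+

text \<open>Node marks are added afterwards to an encoding that has none. The machine works in this
  way: it stores letters without node marks and marks source or target only when it evaluates a
  formula.\<close>

lemma enc_mark1:
  assumes "u < length ws"
  shows "enc K ws (\<lambda>_. u) P = (enc K ws (\<lambda>_. length ws) P)[u := mkxy (enc K ws (\<lambda>_. length ws) P ! u)]"
proof (rule nth_equalityI)
  fix i assume i: "i < length (enc K ws (\<lambda>_. u) P)"
  show "enc K ws (\<lambda>_. u) P ! i = (enc K ws (\<lambda>_. length ws) P)[u := mkxy (enc K ws (\<lambda>_. length ws) P ! u)] ! i"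
  proof (cases "i = u")
    case True
    then show ?thesis using assms by (simp add: nth_enc mkxy_def) blast
  next
    case False
    then show ?thesis using i by (simp add: nth_enc)
  qed
qed simp

lemma enc_mark2:
  assumes "u < length ws" "v < length ws" "u \<noteq> v"
  shows "enc K ws ((\<lambda>_. u)(1 := v)) P =
    (enc K ws (\<lambda>_. length ws) P)[u := mkx (enc K ws (\<lambda>_. length ws) P ! u), v := mky (enc K ws (\<lambda>_. length ws) P ! v)]"
    (is "?l = ?r")
proof (rule nth_equalityI)
  fix i assume i: "i < length ?l"
  have K2: "2 < K" using K4 by simp
  consider "i = u" | "i = v" | "i \<noteq> u" "i \<noteq> v" by blast
  then show "?l ! i = ?r ! i"
  proof cases
    case 1
    then have "{2 * x | x :: nat. ((\<lambda>_. u)(1 := v)) x = i} = {2 * x | x :: nat. x \<noteq> 1}" using assms(3) by auto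
    then show ?thesis using assms 1 by (simp add: nth_enc mkx_def del: fun_upd_apply) blast
  next
    case 2
    then have "{2 * x | x :: nat. ((\<lambda>_. u)(1 := v)) x = i} = {2}" using assms(3) by auto
    then show ?thesis using assms 2 K2 by (simp add: nth_enc mky_def del: fun_upd_apply)
  next
    case 3
    then have "{2 * x | x :: nat. ((\<lambda>_. u)(1 := v)) x = i} = {}" by auto
    then show ?thesis using assms 3 i by (simp add: nth_enc del: fun_upd_apply)
  qed
qed simp

definition tv1 :: "mso \<Rightarrow> ann \<Rightarrow> bool" where
  "tv1 \<phi> a \<longleftrightarrow> tv \<phi> (aP a @ mkxy (aL a) # aS a)"

definition labtv :: "nat \<Rightarrow> ann \<Rightarrow> nat option" where
  "labtv c a = (THE \<sigma>. \<sigma> \<in> onalph T \<and> tv1 (nodef T c \<sigma>) a)"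

text \<open>On a path exactly one node has no predecessor, so for valid annotations the choice is
  forced.\<close>

definition pick :: "ann \<Rightarrow> nat" where
  "pick a = (SOME c. c \<in> copies T \<and> tv1 (firstF T c) a)"

lemma pick:
  assumes "\<exists>c\<in>copies T. tv1 (firstF T c) a"
  shows "pick a \<in> copies T" "tv1 (firstF T (pick a)) a"
proof -
  have "\<exists>c. c \<in> copies T \<and> tv1 (firstF T c) a" using assms by blast
  from someI_ex[OF this] show "pick a \<in> copies T" "tv1 (firstF T (pick a)) a"
    unfolding pick_def by blast+
qed

text \<open>Prefix classes are determined from the left, one by the other. Suffix classes are
  determined from the right, so a left-to-right sweep can only compare the guess at the previous
  position with what the current guess implies for it.\<close>

fun okp :: "ann option \<Rightarrow> ann \<Rightarrow> bool" where
  "okp None a \<longleftrightarrow> aP a = nf []"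
| "okp (Some b) a \<longleftrightarrow> aP a = nf (aP b @ [aL b]) \<and> aS b = nf (aL a # aS a)"

text \<open>At the right end the recursion of the suffix classes gets its base case, and the class
  of the whole word, obtained from the last prefix class and the last letter, decides the domain
  formula.\<close>

fun okend :: "ann option \<Rightarrow> bool" where
  "okend None \<longleftrightarrow> tv (tdom T) []"
| "okend (Some b) \<longleftrightarrow> aS b = nf [] \<and> tv (tdom T) (aP b @ [aL b])"

text \<open>The tests on \<open>c'\<close> and \<open>\<gamma>\<close> keep the walking states in a
  finite set. A direction other than 1 and -1 means that the target lies at the scanned position,
  where \<open>tv1\<close> gives both node variables the same value. Undefined transitions block the
  machine, which is how inconsistent guesses are rejected.\<close>

fun dl :: "mst \<Rightarrow> asym \<Rightarrow> (mst \<times> nat list \<times> int) option" where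
  "dl (Chk p) AL = Some (Chk p, [], 1)"
| "dl (Chk p) (AA a) = (if okp p a then Some (Chk (Some a), [], 1) else None)"
| "dl (Chk p) AR = (if okend p then Some (Rew, [], -1) else None)"
| "dl Rew (AA a) = Some (Rew, [], -1)"
| "dl Rew AL = Some (Fst, [], 1)"
| "dl Fst (AA a) = (if \<exists>c\<in>copies T. tv1 (firstF T c) a
     then Some (At (pick a), em0 (labtv (pick a) a), 0)
     else Some (Fst, [], 1))"
| "dl Fst AR = Some (Fin, [], 0)"
| "dl (At c) (AA a) = (if tv1 (lastF T c) a then Some (Fin, [], 0) else
     case aN a c of (d, c', \<gamma>) \<Rightarrow>
       if c' \<notin> copies T \<or> \<gamma> \<notin> oealph T then None
       else if d = 1 then Some (WR c c' \<gamma> (nf (aP a @ [mkx (aL a)])), [], 1)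
       else if d = -1 then Some (WL c c' \<gamma> (nf (mkx (aL a) # aS a)), [], -1)
       else if tv1 (nodeF T c') a \<and> tv1 (edgef T c c' \<gamma>) a then Some (At c', em1 \<gamma> (labtv c' a), 0)
       else None)"
| "dl (WR c c' \<gamma> L) (AA a) =
     (if tv1 (nodeF T c') a \<and> tv (edgef T c c' \<gamma>) (L @ mky (aL a) # aS a) then Some (At c', em1 \<gamma> (labtv c' a), 0)
      else Some (WR c c' \<gamma> (nf (L @ [aL a])), [], 1))"
| "dl (WL c c' \<gamma> R) (AA a) =
     (if tv1 (nodeF T c') a \<and> tv (edgef T c c' \<gamma>) (aP a @ mky (aL a) # R) then Some (At c', em1 \<gamma> (labtv c' a), 0)
      else Some (WL c c' \<gamma> (nf (aL a # R)), [], -1))"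
| "dl _ _ = None"

text \<open>Only odd codes, those of set variables, may be guessed: the guess fixes the parameters
  and leaves node marks to the evaluation of formulas. The default triple stands for a missing
  successor, and fixing it outside \<open>copies T\<close> makes the successor functions finite in
  number.\<close>

definition Anns :: "ann set" where
  "Anns = {Ann l p s f | l p s f. l \<in> A \<times> Pow {c. c < K \<and> odd c} \<and> p \<in> nf ` W \<and> s \<in> nf ` W \<and>
     (\<forall>c. (c \<in> copies T \<longrightarrow> f c \<in> insert (0, 0, None) ({-1, 0, 1} \<times> copies T \<times> oealph T)) \<and>
          (c \<notin> copies T \<longrightarrow> f c = (0, 0, None)))}"

lemma finite_Anns: "finite Anns"
proof -
  let ?F = "{f. \<forall>c. (c \<in> copies T \<longrightarrow> f c \<in> insert (0, 0, None) ({-1, 0, 1 :: int} \<times> copies T \<times> oealph T)) \<and>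
          (c \<notin> copies T \<longrightarrow> f c = (0, 0, None))}"
  have 1: "finite ?F"
    by (rule finite_set_of_finite_funs) (use fin_T[OF wfT] in auto)
  have 2: "finite (A \<times> Pow {c. c < K \<and> odd c})" using finA by simp
  have "Anns \<subseteq> (\<lambda>(l, p, s, f). Ann l p s f) ` ((A \<times> Pow {c. c < K \<and> odd c}) \<times> nf ` W \<times> nf ` W \<times> ?F)"
  proof
    fix a assume "a \<in> Anns"
    then obtain l p s f where "a = Ann l p s f" "l \<in> A \<times> Pow {c. c < K \<and> odd c}" "p \<in> nf ` W" "s \<in> nf ` W" "f \<in> ?F"
      unfolding Anns_def by blast
    then show "a \<in> (\<lambda>(l, p, s, f). Ann l p s f) ` ((A \<times> Pow {c. c < K \<and> odd c}) \<times> nf ` W \<times> nf ` W \<times> ?F)"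
      by (intro image_eqI[of _ _ "(l, p, s, f)"]) simp_all
  qed
  then show ?thesis using 1 2 finite_nform[OF finA] by (meson finite_SigmaI finite_imageI finite_subset)
qed

lemma AnnsD:
  assumes "a \<in> Anns"
  shows "aL a \<in> alph A K" "aP a \<in> W" "aS a \<in> W" "fst (aL a) \<in> A" "snd (aL a) \<subseteq> {c. c < K \<and> odd c}"
proof -
  obtain l p s f where a: "a = Ann l p s f" "l \<in> A \<times> Pow {c. c < K \<and> odd c}" "p \<in> nf ` W" "s \<in> nf ` W"
    using assms unfolding Anns_def by blast
  show "aP a \<in> W" "aS a \<in> W" using a nf by auto
  show "fst (aL a) \<in> A" "snd (aL a) \<subseteq> {c. c < K \<and> odd c}" using a(1,2) by auto
  then show "aL a \<in> alph A K" by (auto simp: alph_def mem_Times_iff)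
qed

definition States :: "mst set" where
  "States = {Rew, Fst, Fin} \<union> Chk ` insert None (Some ` Anns) \<union> At ` copies T
     \<union> (\<lambda>(c, c', \<gamma>, L). WR c c' \<gamma> L) ` (copies T \<times> copies T \<times> oealph T \<times> nf ` W)
     \<union> (\<lambda>(c, c', \<gamma>, L). WL c c' \<gamma> L) ` (copies T \<times> copies T \<times> oealph T \<times> nf ` W)"

lemma finite_States: "finite States"
  unfolding States_def using fin_T[OF wfT] finite_Anns finite_nform[OF finA] by simp

lemma States_intros: 
  "Rew \<in> States" "Fst \<in> States" "Fin \<in> States" "Chk None \<in> States" "a \<in> Anns \<Longrightarrow> Chk (Some a) \<in> States"
  "c \<in> copies T \<Longrightarrow> At c \<in> States"
  "c \<in> copies T \<Longrightarrow> c' \<in> copies T \<Longrightarrow> \<gamma> \<in> oealph T \<Longrightarrow> u \<in> W \<Longrightarrow> WR c c' \<gamma> (nf u) \<in> States"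
  "c \<in> copies T \<Longrightarrow> c' \<in> copies T \<Longrightarrow> \<gamma> \<in> oealph T \<Longrightarrow> u \<in> W \<Longrightarrow> WL c c' \<gamma> (nf u) \<in> States"
  unfolding States_def by (simp_all add: image_iff) blast+

lemma States_cases:
  assumes "q \<in> States"
  shows "case q of WR c c' \<gamma> L \<Rightarrow> c \<in> copies T \<and> c' \<in> copies T \<and> \<gamma> \<in> oealph T \<and> L \<in> W
     | WL c c' \<gamma> L \<Rightarrow> c \<in> copies T \<and> c' \<in> copies T \<and> \<gamma> \<in> oealph T \<and> L \<in> W
     | At c \<Rightarrow> c \<in> copies T | _ \<Rightarrow> True"
  using assms nf unfolding States_def by (auto split: mst.splits)

definition Outs :: "nat set" where
  "Outs = (\<Union>c\<in>copies T. \<Union>a\<in>Anns. set (em0 (labtv c a)) \<union> (\<Union>\<gamma>\<in>oealph T. set (em1 \<gamma> (labtv c a))))"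

lemma finite_Outs: "finite Outs"
  unfolding Outs_def using fin_T[OF wfT] finite_Anns by simp

lemma Outs_intros:
  "c \<in> copies T \<Longrightarrow> a \<in> Anns \<Longrightarrow> em0 (labtv c a) \<in> lists Outs"
  "c \<in> copies T \<Longrightarrow> a \<in> Anns \<Longrightarrow> \<gamma> \<in> oealph T \<Longrightarrow> em1 \<gamma> (labtv c a) \<in> lists Outs"
  unfolding Outs_def by auto

lemma dl_closed:
  assumes "q \<in> States" "x \<in> {AL, AR} \<union> AA ` Anns" "dl q x = Some (q', \<alpha>, e)"
  shows "q' \<in> States \<and> \<alpha> \<in> lists Outs \<and> e \<in> {-1, 0, 1}"
proof (cases x)
  case AL
  then show ?thesis using assms by (cases q) (auto simp: States_intros)
next
  case AR
  then show ?thesis using assms by (cases q) (auto simp: States_intros split: if_splits)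
next
  case (AA a)
  then have a: "a \<in> Anns" using assms(2) by auto
  note aD = AnnsD[OF a] mk_alph[OF AnnsD(1)[OF a]]
  note q = States_cases[OF assms(1)]
  note d = assms(3)[unfolded AA]
  show ?thesis
  proof (cases q)
    case (Chk p)
    then show ?thesis using d a by (auto simp: States_intros split: if_splits)
  next
    case Rew
    then show ?thesis using d by (auto simp: States_intros)
  next
    case Fst
    show ?thesis
    proof (cases "\<exists>c\<in>copies T. tv1 (firstF T c) a")
      case True
      have "q' = At (pick a) \<and> \<alpha> = em0 (labtv (pick a) a) \<and> e = 0"
        using d Fst True by simp
      then show ?thesis using a pick[OF True] by (simp add: States_intros Outs_intros del: in_lists_conv_set)
    next
      case False
      then show ?thesis using d Fst by (simp add: States_intros)
    qed
  next
    case (At c)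
    obtain r c' \<gamma> where n: "aN a c = (r, c', \<gamma>)" by (cases "aN a c")
    show ?thesis
      using d q a aD unfolding At
      by (simp add: n split: if_splits del: in_lists_conv_set)
        (elim conjE; hypsubst; simp add: States_intros Outs_intros del: in_lists_conv_set)+
  next
    case (WR c c' \<gamma> L)
    then show ?thesis using d q a aD
      by (simp split: if_splits del: in_lists_conv_set)
        (elim conjE; hypsubst; simp add: States_intros Outs_intros del: in_lists_conv_set)+
  next
    case (WL c c' \<gamma> R)
    then show ?thesis using d q a aD
      by (simp split: if_splits del: in_lists_conv_set)
        (elim conjE; hypsubst; simp add: States_intros Outs_intros del: in_lists_conv_set)+
  next
    case Fin
    then show ?thesis using d by simp
  qed
qed

end

section \<open>Truth of the formulas along an annotated tape\<close>

lemma tdom_env: "wf_trans T \<Longrightarrow> sat g n P (tdom T) \<longleftrightarrow> sat g n' P (tdom T)"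
  by (rule sat_cong) (simp_all add: fvn_T)

text \<open>By \<open>bs_eq\<close> the guessed letters encode the word with parameters
  \<open>P\<close> and without node marks. The right bound may lie beyond the end symbol, so that
  the tape can continue after it.\<close>

locale walk_run = walker +
  fixes ws g P as tp b
  assumes wg: "word_graph lab inc ws g"
    and as: "as \<in> lists Anns" and bs_eq: "map aL as = enc K ws (\<lambda>_. length ws) P"
    and tape0: "tp 0 = AL" and tape1: "\<And>i. i < length as \<Longrightarrow> tp (1 + int i) = AA (as ! i)"
    and tape2: "tp (1 + int (length as)) = AR" and bnd: "1 + int (length as) \<le> b"
begin

abbreviation bs where "bs \<equiv> map aL as"
abbreviation H where "H \<equiv> out_graph T g P"

lemma len: "length ws = length as"
  using arg_cong[OF bs_eq, of length] by simp

lemma gV: "gV g = {0..<length as}"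
  using wg len by (simp add: word_graph_def)

lemma asD: "i < length as \<Longrightarrow> as ! i \<in> Anns"
  using as by (simp add: in_lists_conv_set)

definition chain where
  "chain \<longleftrightarrow> (\<forall>i<length as. okp (prev as i) (as ! i))"

definition valid where
  "valid \<longleftrightarrow> chain \<and> okend (prev as (length as))"

lemma valid_chain: "valid \<Longrightarrow> chain"
  by (simp add: valid_def)

declare ef_trans [trans]

text \<open>Forward induction: each prefix annotation is the normal form of the previous one
  extended by a letter, and the equivalence is a congruence.\<close>

lemma pre_eqv: "chain \<Longrightarrow> i < length as \<Longrightarrow> aP (as ! i) \<approx> take i bs"
proof (induction i)
  case 0
  then have "aP (as ! 0) = nf []" unfolding chain_def by (metis okp.simps(1) prev_0)
  then show ?case using nf(2)[of "[]"] by simp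
next
  case (Suc i)
  then have "aP (as ! Suc i) = nf (aP (as ! i) @ [aL (as ! i)])"
    unfolding chain_def by (metis okp.simps(2) prev_Suc)
  also have "\<dots> \<approx> aP (as ! i) @ [aL (as ! i)]"
    by (rule nf(2)) (use AnnsD[OF asD[of i]] Suc.prems in simp)
  also have "\<dots> \<approx> take i bs @ [bs ! i]"
    using Suc by (intro ef_append) (simp_all add: ef_refl)
  also have "\<dots> = take (Suc i) bs" using Suc.prems by (simp add: take_Suc_conv_app_nth)
  finally show ?case .
qed

text \<open>Backward induction, which starts at the last position. Its suffix class is fixed by
  \<open>okend\<close>, hence the hypothesis \<open>valid\<close> instead of
  \<open>chain\<close>.\<close>

lemma suf_eqv: "valid \<Longrightarrow> i < length as \<Longrightarrow> aS (as ! i) \<approx> drop (Suc i) bs"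
proof (induction "length as - i" arbitrary: i rule: less_induct)
  case less
  show ?case
  proof (cases "Suc i = length as")
    case True
    then have "aS (as ! i) = nf []" using less.prems unfolding valid_def chain_def by (metis okend.simps(2) prev_Suc)
    then show ?thesis using nf(2)[of "[]"] True by simp
  next
    case False
    then have i: "Suc i < length as" using less.prems by simp
    then have "aS (as ! i) = nf (aL (as ! Suc i) # aS (as ! Suc i))"
      using less.prems unfolding valid_def chain_def by (metis okp.simps(2) prev_Suc)
    also have "\<dots> \<approx> [aL (as ! Suc i)] @ aS (as ! Suc i)"
      using nf(2)[of "aL (as ! Suc i) # aS (as ! Suc i)"] AnnsD[OF asD[OF i]] by simp
    also have "\<dots> \<approx> [aL (as ! Suc i)] @ drop (Suc (Suc i)) bs"
      using less.hyps[of "Suc i"] less.prems i by (intro ef_append) (simp_all add: ef_refl)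
    also have "\<dots> = drop (Suc i) bs"
      using i Cons_nth_drop_Suc[of "Suc i" bs] by simp
    finally show ?thesis .
  qed
qed

lemma tdom_Fs: "tdom T \<in> Fs"
  and nodeF_Fs: "c \<in> copies T \<Longrightarrow> nodeF T c \<in> Fs"
  and firstF_Fs: "c \<in> copies T \<Longrightarrow> firstF T c \<in> Fs"
  and lastF_Fs: "c \<in> copies T \<Longrightarrow> lastF T c \<in> Fs"
  and nodef_Fs: "c \<in> copies T \<Longrightarrow> \<sigma> \<in> onalph T \<Longrightarrow> nodef T c \<sigma> \<in> Fs"
  and edgef_Fs: "c \<in> copies T \<Longrightarrow> c' \<in> copies T \<Longrightarrow> \<gamma> \<in> oealph T \<Longrightarrow> edgef T c c' \<gamma> \<in> Fs"
  unfolding Fs_def by blast+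

lemma okend_iff:
  assumes chain
  shows "okend (prev as (length as)) \<longleftrightarrow> sat g n P (tdom T) \<and> (as \<noteq> [] \<longrightarrow> aS (last as) = nf [])"
proof (cases "as = []")
  case True
  then show ?thesis
    using tv[OF tdom_Fs wg, of "[]" "\<lambda>_. length ws" P] bs_eq ef_refl fvn_T(1)[OF wfT] tdom_env[OF wfT]
    by simp
next
  case False
  then obtain i where i: "length as = Suc i" by (cases as) auto
  have "aP (as ! i) @ [aL (as ! i)] \<approx> take i bs @ [bs ! i]"
    using pre_eqv[OF assms, of i] i by (intro ef_append) (simp_all add: ef_refl)
  also have "take i bs @ [bs ! i] = bs" using take_Suc_conv_app_nth[of i bs] i by simp
  finally have "tv (tdom T) (aP (as ! i) @ [aL (as ! i)]) \<longleftrightarrow> sat g (\<lambda>_. length ws) P (tdom T)"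
    unfolding bs_eq by (intro tv[OF tdom_Fs wg]) (simp_all add: fvn_T(1)[OF wfT])
  moreover have "last as = as ! i" using i False by (simp add: last_conv_nth)
  ultimately show ?thesis using i False tdom_env[OF wfT] by simp blast
qed

lemma valid_dom: "valid \<Longrightarrow> sat g n P (tdom T)"
  using okend_iff unfolding valid_def by blast

lemma tv1_sat:
  assumes "valid" "i < length as" "\<phi> \<in> Fs"
  shows "tv1 \<phi> (as ! i) \<longleftrightarrow> sat g (\<lambda>_. i) P \<phi>"
proof -
  have "aP (as ! i) @ [mkxy (aL (as ! i))] @ aS (as ! i) \<approx> take i bs @ [mkxy (bs ! i)] @ drop (Suc i) bs"
    using assms by (intro ef_append pre_eqv suf_eqv valid_chain) (simp_all add: ef_refl)
  also have "\<dots> = bs[i := mkxy (bs ! i)]" using assms(2) by (simp add: upd_conv_take_nth_drop)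
  also have "\<dots> = enc K ws (\<lambda>_. i) P" unfolding bs_eq using assms(2) len by (simp add: enc_mark1)
  finally show ?thesis unfolding tv1_def using tv[OF assms(3) wg] len assms(2) by simp
qed

text \<open>At the head the word splits into the carried part with the source marked, the scanned
  letter with the target marked, and the guessed suffix. By the congruence these three classes
  determine the class of the doubly marked word.\<close>

lemma right_sat:
  assumes "valid" "u < j" "j < length as" "\<phi> \<in> Fs" "L \<approx> take j (bs[u := mkx (bs ! u)])"
  shows "tv \<phi> (L @ mky (aL (as ! j)) # aS (as ! j)) \<longleftrightarrow> sat g ((\<lambda>_. u)(1 := j)) P \<phi>"
proof -
  let ?B = "bs[u := mkx (bs ! u)]"
  have "L @ [mky (aL (as ! j))] @ aS (as ! j) \<approx> take j ?B @ [mky (bs ! j)] @ drop (Suc j) ?B"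
    using assms suf_eqv[OF assms(1,3)] by (intro ef_append) (simp_all add: ef_refl)
  also have "\<dots> = ?B[j := mky (bs ! j)]" using assms(3) by (simp add: upd_conv_take_nth_drop)
  also have "\<dots> = enc K ws ((\<lambda>_. u)(1 := j)) P"
    unfolding bs_eq using assms(2,3) len by (subst enc_mark2) simp_all
  finally show ?thesis using tv[OF assms(4) wg] len assms(2,3) by simp
qed

lemma left_sat:
  assumes "valid" "j < u" "u < length as" "\<phi> \<in> Fs" "R \<approx> drop (Suc j) (bs[u := mkx (bs ! u)])"
  shows "tv \<phi> (aP (as ! j) @ mky (aL (as ! j)) # R) \<longleftrightarrow> sat g ((\<lambda>_. u)(1 := j)) P \<phi>"
proof -
  let ?B = "bs[u := mkx (bs ! u)]"
  have "aP (as ! j) @ [mky (aL (as ! j))] @ R \<approx> take j ?B @ [mky (bs ! j)] @ drop (Suc j) ?B"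
    using assms pre_eqv[OF valid_chain[OF assms(1)], of j] by (intro ef_append) (simp_all add: ef_refl)
  also have "\<dots> = ?B[j := mky (bs ! j)]" using assms(2,3) by (simp add: upd_conv_take_nth_drop)
  also have "\<dots> = enc K ws ((\<lambda>_. u)(1 := j)) P"
    unfolding bs_eq using assms(2,3) len by (subst enc_mark2) simp_all
  finally show ?thesis using tv[OF assms(4) wg] len assms(2,3) by simp
qed

lemma gVD: "(i, c) \<in> gV H \<Longrightarrow> i < length as \<and> c \<in> copies T"
  by (simp add: gV out_nodes_iff)

lemma node_tv1: "valid \<Longrightarrow> i < length as \<Longrightarrow> c \<in> copies T \<Longrightarrow> tv1 (nodeF T c) (as ! i) \<longleftrightarrow> (i, c) \<in> gV H"
  using tv1_sat[OF _ _ nodeF_Fs] sat_nodeF[OF wfT, of c "\<lambda>_. i" g P] by (simp add: gV)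

lemma first_tv1: "valid \<Longrightarrow> i < length as \<Longrightarrow> c \<in> copies T \<Longrightarrow> tv1 (firstF T c) (as ! i) \<longleftrightarrow>
    (i, c) \<in> gV H \<and> \<not> (\<exists>x \<gamma>. (x, \<gamma>, (i, c)) \<in> gE H)"
  using tv1_sat[OF _ _ firstF_Fs] sat_firstF[OF wfT, of i g c P] by (simp add: gV)

lemma last_tv1: "valid \<Longrightarrow> (i, c) \<in> gV H \<Longrightarrow> tv1 (lastF T c) (as ! i) \<longleftrightarrow>
    \<not> (\<exists>x \<gamma>. ((i, c), \<gamma>, x) \<in> gE H)"
  using tv1_sat[OF _ _ lastF_Fs, of i c] sat_lastF[OF wfT, of i c g P] gVD[of i c] by simp

lemma labtv_glab: "valid \<Longrightarrow> i < length as \<Longrightarrow> c \<in> copies T \<Longrightarrow> labtv c (as ! i) = glab H (i, c)"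
  unfolding labtv_def glab_out_graph
  by (intro arg_cong[where f = The] ext conj_cong refl) (simp add: tv1_sat nodef_Fs)

lemma stay_edge:
  assumes "valid" "(u, c) \<in> gV H" "c' \<in> copies T" "\<gamma> \<in> oealph T"
  shows "tv1 (nodeF T c') (as ! u) \<and> tv1 (edgef T c c' \<gamma>) (as ! u) \<longleftrightarrow> ((u, c), \<gamma>, (u, c')) \<in> gE H"
proof -
  have u: "u < length as" "c \<in> copies T" using gVD[OF assms(2)] by simp_all
  have [simp]: "(\<lambda>_. u)(Suc 0 := u) = (\<lambda>_ :: nat. u)" by auto
  show ?thesis
    using node_tv1[OF assms(1) u(1) assms(3)] tv1_sat[OF assms(1) u(1) edgef_Fs[OF u(2) assms(3,4)]] assms u
    by (auto simp: gE_out_graph)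
qed

lemma right_edge:
  assumes "valid" "(u, c) \<in> gV H" "c' \<in> copies T" "\<gamma> \<in> oealph T" "u < j" "j < length as"
    "L \<approx> take j (bs[u := mkx (bs ! u)])"
  shows "tv1 (nodeF T c') (as ! j) \<and> tv (edgef T c c' \<gamma>) (L @ mky (aL (as ! j)) # aS (as ! j))
     \<longleftrightarrow> ((u, c), \<gamma>, (j, c')) \<in> gE H"
  using node_tv1[OF assms(1,6,3)] right_sat[OF assms(1,5,6) edgef_Fs assms(7), of c c' \<gamma>] gVD[OF assms(2)] assms
  by (auto simp: gE_out_graph)

lemma left_edge:
  assumes "valid" "(u, c) \<in> gV H" "c' \<in> copies T" "\<gamma> \<in> oealph T" "j < u"
    "R \<approx> drop (Suc j) (bs[u := mkx (bs ! u)])"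
  shows "tv1 (nodeF T c') (as ! j) \<and> tv (edgef T c c' \<gamma>) (aP (as ! j) @ mky (aL (as ! j)) # R)
     \<longleftrightarrow> ((u, c), \<gamma>, (j, c')) \<in> gE H"
proof -
  have u: "u < length as" "c \<in> copies T" using gVD[OF assms(2)] by simp_all
  then have j: "j < length as" using assms(5) by simp
  show ?thesis
    using node_tv1[OF assms(1) j assms(3)] left_sat[OF assms(1,5) u(1) edgef_Fs assms(6), of c c' \<gamma>] u assms
    by (auto simp: gE_out_graph)
qed

lemma right_step:
  assumes "u < j" "j < length as" "L \<in> W" "L \<approx> take j (bs[u := mkx (bs ! u)])"
  shows "nf (L @ [aL (as ! j)]) \<in> W" "nf (L @ [aL (as ! j)]) \<approx> take (Suc j) (bs[u := mkx (bs ! u)])"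
proof -
  have W: "L @ [aL (as ! j)] \<in> W" using assms AnnsD(1)[OF asD[OF assms(2)]] by simp
  then show "nf (L @ [aL (as ! j)]) \<in> W" by (rule nf)
  have "L @ [aL (as ! j)] \<approx> take j (bs[u := mkx (bs ! u)]) @ [bs ! j]"
    using assms by (intro ef_append) (simp_all add: ef_refl)
  also have "\<dots> = take (Suc j) (bs[u := mkx (bs ! u)])"
    using assms by (simp add: take_Suc_conv_app_nth)
  finally show "nf (L @ [aL (as ! j)]) \<approx> take (Suc j) (bs[u := mkx (bs ! u)])"
    by (rule ef_trans[OF nf(2)[OF W]])
qed

lemma right_start:
  assumes "valid" "u < length as"
  shows "nf (aP (as ! u) @ [mkx (aL (as ! u))]) \<in> W"
    "nf (aP (as ! u) @ [mkx (aL (as ! u))]) \<approx> take (Suc u) (bs[u := mkx (bs ! u)])"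
proof -
  have W: "aP (as ! u) @ [mkx (aL (as ! u))] \<in> W"
    using AnnsD(1,2)[OF asD[OF assms(2)]] by (simp add: mk_alph)
  then show "nf (aP (as ! u) @ [mkx (aL (as ! u))]) \<in> W" by (rule nf)
  have "aP (as ! u) @ [mkx (aL (as ! u))] \<approx> take u bs @ [mkx (bs ! u)]"
    using assms pre_eqv[OF valid_chain] by (intro ef_append) (simp_all add: ef_refl)
  also have "\<dots> = take (Suc u) (bs[u := mkx (bs ! u)])"
    using assms by (simp add: take_Suc_conv_app_nth)
  finally show "nf (aP (as ! u) @ [mkx (aL (as ! u))]) \<approx> take (Suc u) (bs[u := mkx (bs ! u)])"
    by (rule ef_trans[OF nf(2)[OF W]])
qed

lemma left_step:
  assumes "j < u" "u < length as" "R \<in> W" "R \<approx> drop (Suc j) (bs[u := mkx (bs ! u)])"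
  shows "nf (aL (as ! j) # R) \<in> W" "nf (aL (as ! j) # R) \<approx> drop j (bs[u := mkx (bs ! u)])"
proof -
  have W: "[aL (as ! j)] @ R \<in> W" using assms AnnsD(1)[OF asD[of j]] by simp
  then show "nf (aL (as ! j) # R) \<in> W" using nf by simp
  have "[aL (as ! j)] @ R \<approx> [bs ! j] @ drop (Suc j) (bs[u := mkx (bs ! u)])"
    using assms by (intro ef_append) (simp_all add: ef_refl)
  also have "\<dots> = drop j (bs[u := mkx (bs ! u)])"
    using assms Cons_nth_drop_Suc[of j "bs[u := mkx (bs ! u)]"] by simp
  finally show "nf (aL (as ! j) # R) \<approx> drop j (bs[u := mkx (bs ! u)])"
    using ef_trans[OF nf(2)[OF W]] by simp
qed

lemma left_start:
  assumes "valid" "u < length as"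
  shows "nf (mkx (aL (as ! u)) # aS (as ! u)) \<in> W"
    "nf (mkx (aL (as ! u)) # aS (as ! u)) \<approx> drop u (bs[u := mkx (bs ! u)])"
proof -
  have W: "[mkx (aL (as ! u))] @ aS (as ! u) \<in> W"
    using AnnsD(1,3)[OF asD[OF assms(2)]] by (simp add: mk_alph)
  then show "nf (mkx (aL (as ! u)) # aS (as ! u)) \<in> W" using nf by simp
  have "[mkx (aL (as ! u))] @ aS (as ! u) \<approx> [mkx (bs ! u)] @ drop (Suc u) (bs[u := mkx (bs ! u)])"
    using assms suf_eqv by (intro ef_append) (simp_all add: ef_refl)
  also have "\<dots> = drop u (bs[u := mkx (bs ! u)])"
    using assms Cons_nth_drop_Suc[of u "bs[u := mkx (bs ! u)]"] by simp
  finally show "nf (mkx (aL (as ! u)) # aS (as ! u)) \<approx> drop u (bs[u := mkx (bs ! u)])"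
    using ef_trans[OF nf(2)[OF W]] by simp
qed

end

section \<open>Output along a path and soundness of the walk\<close>

definition path_out where
  "path_out em0 em1 h v \<gamma> k = em0 (glab h (v 0)) @ concat (map (\<lambda>i. em1 (\<gamma> i) (glab h (v (Suc i)))) [0..<k])"

definition path_total where
  "path_total em0 em1 h v \<gamma> N = (if N = 0 then [] else path_out em0 em1 h v \<gamma> (N - 1))"

text \<open>The output graph is known to be a path only for valid annotations. The assumption is
  conditional because soundness starts from an arbitrary accepting run, whose validity is
  established only by its checking sweep.\<close>

locale path_run = walk_run +
  fixes v :: "nat \<Rightarrow> nat \<times> nat" and \<gamma> :: "nat \<Rightarrow> nat option" and N :: nat
  assumes path: "valid \<Longrightarrow> is_path H v \<gamma> N"
begin

abbreviation outp where "outp \<equiv> path_out em0 em1 H v \<gamma>"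
abbreviation total where "total \<equiv> path_total em0 em1 H v \<gamma> N"

text \<open>In \<open>Chk\<close>, truncated subtraction lets positions 0 and 1 share the state
  \<open>Chk None\<close>, as no annotation has been read at either. In the walking states
  \<open>take j\<close> and \<open>drop j\<close> end just before the scanned position, on the side
  from which the head comes, and contain the marked source.\<close>

definition inv :: "mst \<Rightarrow> int \<Rightarrow> nat list \<Rightarrow> bool" where
  "inv q i z \<longleftrightarrow> (case q of
     Chk p \<Rightarrow> z = [] \<and> (\<exists>j. i = int j \<and> j \<le> Suc (length as) \<and> p = prev as (j - 1) \<and> (\<forall>i<j - 1. okp (prev as i) (as ! i)))
   | Rew \<Rightarrow> valid \<and> z = [] \<and> (\<exists>j\<le>length as. i = int j)
   | Fst \<Rightarrow> valid \<and> z = [] \<and> (\<exists>j\<le>length as. i = 1 + int j \<and> (\<forall>j'<j. \<not> (\<exists>c\<in>copies T. tv1 (firstF T c) (as ! j'))))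
   | At c \<Rightarrow> valid \<and> (\<exists>u k. k < N \<and> i = 1 + int u \<and> v k = (u, c) \<and> z = outp k)
   | WR c c' \<gamma>' L \<Rightarrow> valid \<and> (\<exists>u k j. k < N \<and> i = 1 + int j \<and> u < j \<and> j \<le> length as \<and> v k = (u, c) \<and> z = outp k
       \<and> c' \<in> copies T \<and> \<gamma>' \<in> oealph T \<and> L \<in> W \<and> L \<approx> take j (bs[u := mkx (bs ! u)]))
   | WL c c' \<gamma>' R \<Rightarrow> valid \<and> (\<exists>u k j. k < N \<and> i = int j \<and> j \<le> u \<and> v k = (u, c) \<and> z = outp k
       \<and> c' \<in> copies T \<and> \<gamma>' \<in> oealph T \<and> R \<in> W \<and> R \<approx> drop j (bs[u := mkx (bs ! u)]))
   | Fin \<Rightarrow> valid \<and> z = total)"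

lemma vD: "valid \<Longrightarrow> k < N \<Longrightarrow> v k = (u, c) \<Longrightarrow> (u, c) \<in> gV H \<and> u < length as \<and> c \<in> copies T"
  using path gVD[of u c] unfolding is_path_def by (metis image_eqI lessThan_iff)

text \<open>On a path any edge leaving the current node leads to the next node, whatever was
  guessed. Hence each arrival extends the output by the right piece.\<close>

lemma arrive:
  assumes "valid" "k < N" "v k = (u, c)" "((u, c), \<gamma>', (j, c')) \<in> gE H"
  shows "Suc k < N" "v (Suc k) = (j, c')" "\<gamma>' = \<gamma> k" "j < length as"
    "outp (Suc k) = outp k @ em1 \<gamma>' (labtv c' (as ! j))"
proof -
  note e = is_path_edge[OF path[OF assms(1)] assms(4)[folded assms(3)] assms(2)]
  then show "Suc k < N" "v (Suc k) = (j, c')" "\<gamma>' = \<gamma> k" by simp_all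
  then have "j < length as \<and> c' \<in> copies T" using vD[OF assms(1)] by blast
  then show "j < length as" "outp (Suc k) = outp k @ em1 \<gamma>' (labtv c' (as ! j))"
    using labtv_glab[OF assms(1), of j c'] e(2,3) by (simp_all add: path_out_def)
qed

lemma inv_At: "valid \<Longrightarrow> k < N \<Longrightarrow> v k = (u, c) \<Longrightarrow> inv (At c) (1 + int u) (outp k)"
  unfolding inv_def by auto

lemma inv_arrive:
  assumes "valid" "k < N" "v k = (u, c)" "((u, c), \<gamma>', (j, c')) \<in> gE H"
  shows "inv (At c') (1 + int j) (outp k @ em1 \<gamma>' (labtv c' (as ! j)))"
  using inv_At[OF assms(1) arrive(1,2)[OF assms]] arrive(5)[OF assms] by simp

lemma first_iff:
  assumes "valid" "i < length as" "c \<in> copies T"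
  shows "tv1 (firstF T c) (as ! i) \<longleftrightarrow> 0 < N \<and> v 0 = (i, c)"
proof -
  note p = path[OF assms(1)]
  have V: "gV H = v ` {..<N}" using p unfolding is_path_def by (rule conjunct1)
  show ?thesis
    unfolding first_tv1[OF assms]
  proof
    assume a: "(i, c) \<in> gV H \<and> \<not> (\<exists>x \<gamma>. (x, \<gamma>, (i, c)) \<in> gE H)"
    then obtain k where k: "k < N" "(i, c) = v k" unfolding V by blast
    have "k = 0" using is_path_first[OF p k(1)] a unfolding k(2) by blast
    then show "0 < N \<and> v 0 = (i, c)" using k by simp
  next
    assume a: "0 < N \<and> v 0 = (i, c)"
    then have "(i, c) \<in> gV H" unfolding V by (metis image_eqI lessThan_iff)
    then show "(i, c) \<in> gV H \<and> \<not> (\<exists>x \<gamma>. (x, \<gamma>, (i, c)) \<in> gE H)"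
      using is_path_first[OF p, of 0] a by simp
  qed
qed

lemma last_iff:
  assumes "valid" "k < N" "v k = (u, c)"
  shows "tv1 (lastF T c) (as ! u) \<longleftrightarrow> Suc k = N"
proof -
  have "tv1 (lastF T c) (as ! u) \<longleftrightarrow> \<not> (\<exists>x \<gamma>. (v k, \<gamma>, x) \<in> gE H)"
    unfolding assms(3) by (rule last_tv1) (use assms(1) vD[OF assms] in blast)+
  also have "\<dots> \<longleftrightarrow> \<not> Suc k < N" using is_path_last[OF path[OF assms(1)] assms(2)] by simp
  finally show ?thesis using assms(2) by auto
qed

lemma total_Suc: "Suc k = N \<Longrightarrow> total = outp k"
  by (auto simp: path_total_def)

lemma inv_step_walk:
  assumes "inv (WR c c' \<gamma>' L) i z" "dl (WR c c' \<gamma>' L) (tp i) = Some (q', \<alpha>, e)"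
  shows "inv q' (i + e) (z @ \<alpha>)"
proof -
  obtain u k j where *: "valid" "k < N" "i = 1 + int j" "u < j" "j \<le> length as" "v k = (u, c)" "z = outp k"
    "c' \<in> copies T" "\<gamma>' \<in> oealph T" "L \<in> W" "L \<approx> take j (bs[u := mkx (bs ! u)])"
    using assms(1) unfolding inv_def mst.case by blast
  have j: "j < length as" using assms(2) *(3,5) tape2 by (cases "j = length as") auto
  have t: "tp i = AA (as ! j)" using tape1[OF j] *(3) by simp
  have V: "(u, c) \<in> gV H" using vD * by blast
  note edge = right_edge[OF *(1) V *(8,9,4) j *(11)]
  show ?thesis
  proof (cases "((u, c), \<gamma>', (j, c')) \<in> gE H")
    case True
    then have "q' = At c'" "\<alpha> = em1 \<gamma>' (labtv c' (as ! j))" "e = 0"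
      using edge assms(2) t by auto
    then show ?thesis using inv_arrive[OF *(1,2,6) True] * by simp
  next
    case False
    then have q': "q' = WR c c' \<gamma>' (nf (L @ [aL (as ! j)]))" "\<alpha> = []" "e = 1"
      using edge assms(2) t by auto
    show ?thesis unfolding q' inv_def mst.case
      using *(1) by (intro conjI exI[of _ u] exI[of _ k] exI[of _ "Suc j"])
        (use * j right_step[OF *(4) j *(10,11)] in simp_all)
  qed
qed

lemma inv_step_walk':
  assumes "inv (WL c c' \<gamma>' R) i z" "dl (WL c c' \<gamma>' R) (tp i) = Some (q', \<alpha>, e)"
  shows "inv q' (i + e) (z @ \<alpha>)"
proof -
  obtain u k j where *: "valid" "k < N" "i = int j" "j \<le> u" "v k = (u, c)" "z = outp k"
    "c' \<in> copies T" "\<gamma>' \<in> oealph T" "R \<in> W" "R \<approx> drop j (bs[u := mkx (bs ! u)])"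
    using assms(1) unfolding inv_def mst.case by blast
  have V: "(u, c) \<in> gV H" "u < length as" using vD[OF *(1,2,5)] by simp_all
  obtain j' where j: "j = Suc j'" using assms(2) *(3) tape0 by (cases j) auto
  then have j': "j' < u" "j' < length as" using *(4) V by simp_all
  have t: "tp i = AA (as ! j')" using tape1[OF j'(2)] *(3) j by simp
  note edge = left_edge[OF *(1) V(1) *(7,8) j'(1) *(10)[unfolded j]]
  show ?thesis
  proof (cases "((u, c), \<gamma>', (j', c')) \<in> gE H")
    case True
    then have "q' = At c'" "\<alpha> = em1 \<gamma>' (labtv c' (as ! j'))" "e = 0"
      using edge assms(2) t by auto
    then show ?thesis using inv_arrive[OF *(1,2,5) True] * j by simp
  next
    case False
    then have q': "q' = WL c c' \<gamma>' (nf (aL (as ! j') # R))" "\<alpha> = []" "e = -1"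
      using edge assms(2) t by auto
    show ?thesis unfolding q' inv_def mst.case
      using *(1) by (intro conjI exI[of _ u] exI[of _ k] exI[of _ j'])
        (use * j j' left_step[OF j'(1) V(2) *(9) *(10)[unfolded j]] in simp_all)
  qed
qed

lemma inv_step_At:
  assumes "inv (At c) i z" "dl (At c) (tp i) = Some (q', \<alpha>, e)"
  shows "inv q' (i + e) (z @ \<alpha>)"
proof -
  obtain u k where *: "valid" "k < N" "i = 1 + int u" "v k = (u, c)" "z = outp k"
    using assms(1) unfolding inv_def mst.case by blast
  have V: "(u, c) \<in> gV H" "u < length as" using vD[OF *(1,2,4)] by simp_all
  have t: "tp i = AA (as ! u)" using tape1[OF V(2)] *(3) by simp
  obtain d c' \<gamma>' where n: "aN (as ! u) c = (d, c', \<gamma>')" by (cases "aN (as ! u) c")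
  show ?thesis
  proof (cases "tv1 (lastF T c) (as ! u)")
    case True
    then have "q' = Fin" "\<alpha> = []" using assms(2) t by auto
    then show ?thesis using total_Suc last_iff[OF *(1,2,4)] True * by (simp add: inv_def)
  next
    case False
    then have c': "c' \<in> copies T" "\<gamma>' \<in> oealph T" using assms(2) t n by (auto split: if_splits)
    consider "d = 1" | "d = -1" | "d \<noteq> 1" "d \<noteq> -1" by blast
    then show ?thesis
    proof cases
      case 1
      then have q': "q' = WR c c' \<gamma>' (nf (aP (as ! u) @ [mkx (aL (as ! u))]))" "\<alpha> = []" "e = 1"
        using assms(2) t n False c' by auto
      show ?thesis unfolding q' inv_def mst.case
        using *(1) by (intro conjI exI[of _ u] exI[of _ k] exI[of _ "Suc u"])
          (use * V c' right_start[OF *(1) V(2)] in simp_all)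
    next
      case 2
      then have q': "q' = WL c c' \<gamma>' (nf (mkx (aL (as ! u)) # aS (as ! u)))" "\<alpha> = []" "e = -1"
        using assms(2) t n False c' by auto
      show ?thesis unfolding q' inv_def mst.case
        using *(1) by (intro conjI exI[of _ u] exI[of _ k] exI[of _ u])
          (use * V c' left_start[OF *(1) V(2)] in simp_all)
    next
      case 3
      then have q': "tv1 (nodeF T c') (as ! u) \<and> tv1 (edgef T c c' \<gamma>') (as ! u)"
        "q' = At c'" "\<alpha> = em1 \<gamma>' (labtv c' (as ! u))" "e = 0"
        using assms(2) t n False c' by (auto split: if_splits)
      then have "((u, c), \<gamma>', (u, c')) \<in> gE H" using stay_edge[OF *(1) V(1) c'] by simp
      then show ?thesis using inv_arrive[OF *(1,2,4)] q' * by simp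
    qed
  qed
qed

lemma inv_step:
  assumes "inv q i z" "dl q (tp i) = Some (q', \<alpha>, e)"
  shows "inv q' (i + e) (z @ \<alpha>)"
proof (cases q)
  case (Chk p)
  obtain j where j: "i = int j" "j \<le> Suc (length as)" "p = prev as (j - 1)" "\<forall>i<j - 1. okp (prev as i) (as ! i)" "z = []"
    using assms(1) unfolding Chk inv_def mst.case by blast
  consider "j = 0" | j' where "j = Suc j'" "j' < length as" | "j = Suc (length as)"
    using j(2) by (cases j) (auto simp: less_Suc_eq_le le_less)
  then show ?thesis
  proof cases
    case 1
    then have "q' = Chk p" "\<alpha> = []" "e = 1" using assms(2) j tape0 Chk by auto
    then show ?thesis using 1 j unfolding inv_def by (auto intro!: exI[of _ 1])
  next
    case 2
    then have "tp i = AA (as ! j')" using tape1 j by simp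
    then have q': "q' = Chk (Some (as ! j'))" "\<alpha> = []" "e = 1" "okp p (as ! j')"
      using assms(2) Chk by (auto split: if_splits)
    show ?thesis unfolding q' inv_def mst.case
      by (intro conjI exI[of _ "Suc j"]) (use q' j 2 in \<open>auto simp: less_Suc_eq\<close>)
  next
    case 3
    then have "tp i = AR" using tape2 j by simp
    then have q': "q' = Rew" "\<alpha> = []" "e = -1" "okend p"
      using assms(2) Chk by (auto split: if_splits)
    have "valid" unfolding valid_def chain_def using j 3 q' by simp
    then show ?thesis unfolding q' inv_def mst.case using j 3 by auto
  qed
next
  case Rew
  obtain j where j: "i = int j" "j \<le> length as" "z = []" "valid"
    using assms(1) unfolding Rew inv_def mst.case by blast
  show ?thesis
  proof (cases j)
    case 0
    then have "q' = Fst" "\<alpha> = []" "e = 1" using assms(2) j tape0 Rew by auto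
    then show ?thesis using 0 j unfolding inv_def by (auto intro!: exI[of _ 0])
  next
    case (Suc j')
    then have "q' = Rew" "\<alpha> = []" "e = -1" using assms(2) j tape1[of j'] Rew by auto
    then show ?thesis using Suc j unfolding inv_def by (auto intro!: exI[of _ j'])
  qed
next
  case Fst
  obtain j where j: "valid" "z = []" "j \<le> length as" "i = 1 + int j"
      "\<forall>j'<j. \<not> (\<exists>c\<in>copies T. tv1 (firstF T c) (as ! j'))"
    using assms(1) unfolding Fst inv_def mst.case by blast
  show ?thesis
  proof (cases "j = length as")
    case True
    then have q': "q' = Fin" "\<alpha> = []" using assms(2) tape2 j Fst by auto
    have "N = 0"
    \<comment> \<open>A nonempty path would have a first node, and the search over all positions
      would have found it.\<close>
    proof (rule ccontr)
      assume "N \<noteq> 0"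
      then have "0 < N" by simp
      moreover obtain u c where uc: "v 0 = (u, c)" by (cases "v 0")
      ultimately have "u < length as \<and> c \<in> copies T" using vD[OF j(1)] by blast
      then show False using j(5) True first_iff[OF j(1), of u c] uc \<open>0 < N\<close> by auto
    qed
    then show ?thesis unfolding q' inv_def mst.case path_total_def using j(1,2) by simp
  next
    case False
    then have jl: "j < length as" using j by simp
    have t: "tp i = AA (as ! j)" using tape1[OF jl] j by simp
    show ?thesis
    proof (cases "\<exists>c\<in>copies T. tv1 (firstF T c) (as ! j)")
      case True
      let ?c = "pick (as ! j)"
      have q': "q' = At ?c" "\<alpha> = em0 (labtv ?c (as ! j))" "e = 0" using assms(2) t Fst True by auto
      have v0: "0 < N" "v 0 = (j, ?c)" using first_iff[OF j(1) jl] pick[OF True] by auto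
      have "outp 0 = em0 (labtv ?c (as ! j))"
        using labtv_glab[OF j(1) jl] pick[OF True] v0 by (simp add: path_out_def)
      then show ?thesis using inv_At[OF j(1) v0] q' j by simp
    next
      case False
      then have q': "q' = Fst" "\<alpha> = []" "e = 1" using assms(2) t Fst by auto
      show ?thesis unfolding q' inv_def mst.case
        by (intro conjI exI[of _ "Suc j"]) (use j False jl in \<open>auto simp: less_Suc_eq\<close>)
    qed
  qed
next
  case (At c)
  then show ?thesis using inv_step_At assms by blast
next
  case (WR c c' \<gamma> L)
  then show ?thesis using inv_step_walk assms by blast
next
  case (WL c c' \<gamma> L)
  then show ?thesis using inv_step_walk' assms by blast
next
  case Fin
  then show ?thesis using assms by simp
qed

abbreviation step where "step \<equiv> mstep dl tp b"

theorem sound: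
  assumes "step\<^sup>*\<^sup>* (Chk None, 0, []) (Fin, i, z)"
  shows "valid \<and> z = total"
proof -
  have "inv q i z" if "step\<^sup>*\<^sup>* (Chk None, 0, []) (q, i, z)" for q i z
    using that
  proof (induction "(q, i, z)" arbitrary: q i z rule: rtranclp_induct)
    case base
    then show ?case by (simp add: inv_def)
  next
    case (step c)
    obtain q' i' z' where c: "c = (q', i', z')" by (cases c)
    obtain \<alpha> e where "dl q' (tp i') = Some (q, \<alpha>, e)" "i = i' + e" "z = z' @ \<alpha>"
      using step.hyps(2) unfolding c mstep_def by blast
    then show ?case using inv_step[OF step.hyps(3)[OF c]] by simp
  qed
  from this[OF assms] show ?thesis by (simp add: inv_def)
qed

end

section \<open>Completeness of the walk\<close>

context path_run
begin

lemma stepI: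
  assumes "dl q (tp i) = Some (q', \<alpha>, e)" "0 \<le> i + e" "i + e \<le> 1 + int (length as)" "j = i + e" "z' = z @ \<alpha>"
  shows "step (q, i, z) (q', j, z')"
  by (rule mstepI) (use assms bnd in auto)

lemma check_run:
  assumes "chain" "j \<le> length as"
  shows "step\<^sup>*\<^sup>* (Chk None, 0, []) (Chk (prev as j), 1 + int j, [])"
  using assms(2)
proof (induction j)
  case 0
  have "step (Chk None, 0, []) (Chk None, 1, [])" by (rule stepI) (use tape0 in auto)
  then show ?case by simp
next
  case (Suc j)
  have "step (Chk (prev as j), 1 + int j, []) (Chk (Some (as ! j)), 1 + int (Suc j), [])"
    by (rule stepI[where \<alpha> = "[]" and e = 1]) (use tape1[of j] assms Suc.prems in \<open>auto simp: chain_def\<close>)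
  then show ?case using Suc by simp
qed

lemma rewind_run:
  assumes "j \<le> length as"
  shows "step\<^sup>*\<^sup>* (Rew, int j, []) (Fst, 1, [])"
  using assms
proof (induction j)
  case 0
  have "step (Rew, 0, []) (Fst, 1, [])" by (rule stepI) (use tape0 in auto)
  then show ?case by simp
next
  case (Suc j)
  have "step (Rew, int (Suc j), []) (Rew, int j, [])"
    by (rule stepI[where \<alpha> = "[]" and e = "-1"]) (use tape1[of j] Suc.prems in auto)
  then show ?case using Suc by (meson Suc_leD converse_rtranclp_into_rtranclp)
qed

lemma start_run:
  assumes "valid"
  shows "step\<^sup>*\<^sup>* (Chk None, 0, []) (Fst, 1, [])"
proof -
  have "step\<^sup>*\<^sup>* (Chk None, 0, []) (Chk (prev as (length as)), 1 + int (length as), [])"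
    by (rule check_run) (use assms valid_chain in auto)
  also have "step (Chk (prev as (length as)), 1 + int (length as), []) (Rew, int (length as), [])"
    by (rule stepI[where \<alpha> = "[]" and e = "-1"]) (use assms tape2 in \<open>auto simp: valid_def\<close>)
  also have "step\<^sup>*\<^sup>* (Rew, int (length as), []) (Fst, 1, [])"
    by (rule rewind_run) simp
  finally show ?thesis .
qed

lemma search_run:
  assumes "j \<le> length as" "\<And>i. i < j \<Longrightarrow> \<not> (\<exists>c\<in>copies T. tv1 (firstF T c) (as ! i))"
  shows "step\<^sup>*\<^sup>* (Fst, 1, []) (Fst, 1 + int j, [])"
  using assms
proof (induction j)
  case (Suc j)
  have "step (Fst, 1 + int j, []) (Fst, 1 + int (Suc j), [])"
    by (rule stepI[where \<alpha> = "[]" and e = 1]) (use tape1[of j] Suc.prems in auto)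
  then show ?case using Suc by simp
qed simp

lemma empty_run:
  assumes "valid" "N = 0"
  shows "\<exists>i. step\<^sup>*\<^sup>* (Fst, 1, []) (Fin, i, total)"
proof -
  have "step\<^sup>*\<^sup>* (Fst, 1, []) (Fst, 1 + int (length as), [])"
    by (rule search_run) (use first_iff[OF assms(1)] assms(2) in auto)
  also have "step (Fst, 1 + int (length as), []) (Fin, 1 + int (length as), [])"
    by (rule stepI[where \<alpha> = "[]" and e = 0]) (use tape2 in auto)
  finally show ?thesis using assms(2) by (auto simp: path_total_def)
qed

lemma first_run:
  assumes "valid" "0 < N" "v 0 = (u, c)"
  shows "step\<^sup>*\<^sup>* (Fst, 1, []) (At c, 1 + int u, outp 0)"
proof -
  have u: "u < length as" "c \<in> copies T" using vD[OF assms] by simp_all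
  have ex: "\<exists>c\<in>copies T. tv1 (firstF T c) (as ! u)" using first_iff[OF assms(1) u] assms u by blast
  have p: "pick (as ! u) = c" using first_iff[OF assms(1) u(1)] pick[OF ex] assms by auto
  have "step\<^sup>*\<^sup>* (Fst, 1, []) (Fst, 1 + int u, [])"
    by (rule search_run) (use first_iff[OF assms(1)] assms(3) u in auto)
  also have "step (Fst, 1 + int u, []) (At c, 1 + int u, outp 0)"
  proof (rule stepI)
    show "dl Fst (tp (1 + int u)) = Some (At c, em0 (labtv c (as ! u)), 0)"
      using tape1[OF u(1)] ex p by simp
    show "outp 0 = [] @ em0 (labtv c (as ! u))"
      using labtv_glab[OF assms(1) u] assms(3) by (simp add: path_out_def)
  qed (use u in auto)
  finally show ?thesis .
qed

lemma edge_next: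
  assumes "valid" "Suc k < N" "v k = (u, c)" "v (Suc k) = (u', c')"
  shows "((u, c), \<gamma> k, (u', c')) \<in> gE H" "\<gamma> k \<in> oealph T" "c' \<in> copies T"
    "(u, c) \<in> gV H" "u < length as" "c \<in> copies T" "u' < length as"
proof -
  show e: "((u, c), \<gamma> k, (u', c')) \<in> gE H"
    unfolding assms(3,4)[symmetric] using path[OF assms(1)] assms(2) unfolding is_path_def by blast
  then show "\<gamma> k \<in> oealph T" by (simp add: gE_out_graph)
  show "c' \<in> copies T" "u' < length as" using vD[OF assms(1,2,4)] by simp_all
  show "(u, c) \<in> gV H" "u < length as" "c \<in> copies T" using vD[OF assms(1) _ assms(3)] assms(2) by simp_all
qed

text \<open>This keeps the walk from stopping too early: no other position has a node of copy
  \<open>c'\<close> to which the current edge leads.\<close>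

lemma edge_unique:
  assumes "valid" "Suc k < N" "v k = (u, c)" "v (Suc k) = (u', c')" "((u, c), \<gamma> k, (j, c')) \<in> gE H"
  shows "j = u'"
  using arrive(2)[OF assms(1) _ assms(3,5)] assms(2,4) by simp

lemma walk_right:
  assumes "valid" "Suc k < N" "v k = (u, c)" "v (Suc k) = (u', c')"
    and "u < j" "j \<le> u'" "L \<in> W" "L \<approx> take j (bs[u := mkx (bs ! u)])"
  shows "step\<^sup>*\<^sup>* (WR c c' (\<gamma> k) L, 1 + int j, outp k) (At c', 1 + int u', outp (Suc k))"
  using assms(5-)
proof (induction "u' - j" arbitrary: j L)
  note E = edge_next[OF assms(1-4)]
  case (0 j L)
  then have j: "j = u'" by simp
  have "step (WR c c' (\<gamma> k) L, 1 + int j, outp k) (At c', 1 + int u', outp (Suc k))"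
  proof (rule stepI)
    show "dl (WR c c' (\<gamma> k) L) (tp (1 + int j)) = Some (At c', em1 (\<gamma> k) (labtv c' (as ! u')), 0)"
      using right_edge[OF assms(1) E(4,3,2) 0(2) _ 0(5)] E(1,7) tape1[OF E(7)] j by simp
    show "outp (Suc k) = outp k @ em1 (\<gamma> k) (labtv c' (as ! u'))"
      by (rule arrive(5)[OF assms(1) _ assms(3) E(1)]) (use assms(2) in simp)
  qed (use j E(7) in auto)
  then show ?case by simp
next
  note E = edge_next[OF assms(1-4)]
  case (Suc x j L)
  then have j: "j < u'" "j < length as" using E(7) by auto
  have "((u, c), \<gamma> k, (j, c')) \<notin> gE H" using edge_unique[OF assms(1-4)] j(1) by blast
  then have "step (WR c c' (\<gamma> k) L, 1 + int j, outp k) (WR c c' (\<gamma> k) (nf (L @ [aL (as ! j)])), 1 + int (Suc j), outp k)"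
    by (intro stepI[where \<alpha> = "[]" and e = 1])
      (use right_edge[OF assms(1) E(4,3,2) Suc(3) j(2) Suc(6)] tape1[OF j(2)] j(2) in auto)
  moreover have "step\<^sup>*\<^sup>* (WR c c' (\<gamma> k) (nf (L @ [aL (as ! j)])), 1 + int (Suc j), outp k) (At c', 1 + int u', outp (Suc k))"
    by (rule Suc.hyps(1)) (use Suc right_step[OF Suc(3) j(2) Suc(5,6)] j in auto)
  ultimately show ?case by (rule converse_rtranclp_into_rtranclp)
qed

lemma walk_left:
  assumes "valid" "Suc k < N" "v k = (u, c)" "v (Suc k) = (u', c')"
    and "u' < j" "j \<le> u" "R \<in> W" "R \<approx> drop j (bs[u := mkx (bs ! u)])"
  shows "step\<^sup>*\<^sup>* (WL c c' (\<gamma> k) R, int j, outp k) (At c', 1 + int u', outp (Suc k))"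
  using assms(5-)
proof (induction "j - Suc u'" arbitrary: j R)
  note E = edge_next[OF assms(1-4)]
  case (0 j R)
  then have j: "j = Suc u'" by simp
  have "step (WL c c' (\<gamma> k) R, int j, outp k) (At c', 1 + int u', outp (Suc k))"
  proof (rule stepI)
    show "dl (WL c c' (\<gamma> k) R) (tp (int j)) = Some (At c', em1 (\<gamma> k) (labtv c' (as ! u')), 0)"
      using left_edge[OF assms(1) E(4,3,2), of u' R] 0 E(1,7) tape1[OF E(7)] j by simp
    show "outp (Suc k) = outp k @ em1 (\<gamma> k) (labtv c' (as ! u'))"
      by (rule arrive(5)[OF assms(1) _ assms(3) E(1)]) (use assms(2) in simp)
  qed (use j E(7) in auto)
  then show ?case by simp
next
  note E = edge_next[OF assms(1-4)]
  case (Suc x j R)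
  then obtain j' where j': "j = Suc j'" "u' < j'" by (cases j) auto
  then have j: "j' < u" "j' < length as" using E(5) Suc by auto
  have "((u, c), \<gamma> k, (j', c')) \<notin> gE H" using edge_unique[OF assms(1-4)] j'(2) by blast
  then have "step (WL c c' (\<gamma> k) R, int j, outp k) (WL c c' (\<gamma> k) (nf (aL (as ! j') # R)), int j', outp k)"
    by (intro stepI[where \<alpha> = "[]" and e = "-1"])
      (use left_edge[OF assms(1) E(4,3,2) j(1), of R] Suc(6) tape1[OF j(2)] j(2) j' in auto)
  moreover have "step\<^sup>*\<^sup>* (WL c c' (\<gamma> k) (nf (aL (as ! j') # R)), int j', outp k) (At c', 1 + int u', outp (Suc k))"
    by (rule Suc.hyps(1)) (use Suc j' left_step[OF j(1) E(5) Suc(5), unfolded j'(1)[symmetric]] j in auto)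
  ultimately show ?case by (rule converse_rtranclp_into_rtranclp)
qed

lemma next_run:
  assumes "valid" "Suc k < N" "v k = (u, c)" "v (Suc k) = (u', c')"
    and nx: "aN (as ! u) c = (sgn (int u' - int u), c', \<gamma> k)"
  shows "step\<^sup>*\<^sup>* (At c, 1 + int u, outp k) (At c', 1 + int u', outp (Suc k))"
proof -
  note E = edge_next[OF assms(1-4)]
  have k: "k < N" using assms(2) by simp
  have last: "\<not> tv1 (lastF T c) (as ! u)" using last_iff[OF assms(1) k assms(3)] assms(2) by simp
  note t = tape1[OF E(5)]
  consider "u < u'" | "u' < u" | "u' = u" by linarith
  then show ?thesis
  proof cases
    case 1
    let ?L = "nf (aP (as ! u) @ [mkx (aL (as ! u))])"
    have "step (At c, 1 + int u, outp k) (WR c c' (\<gamma> k) ?L, 1 + int (Suc u), outp k)"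
      by (rule stepI[where \<alpha> = "[]" and e = 1]) (use t last nx 1 E in auto)
    also have "step\<^sup>*\<^sup>* (WR c c' (\<gamma> k) ?L, 1 + int (Suc u), outp k) (At c', 1 + int u', outp (Suc k))"
      by (rule walk_right[OF assms(1-4)]) (use 1 right_start[OF assms(1) E(5)] in auto)
    finally show ?thesis .
  next
    case 2
    let ?R = "nf (mkx (aL (as ! u)) # aS (as ! u))"
    have "step (At c, 1 + int u, outp k) (WL c c' (\<gamma> k) ?R, int u, outp k)"
      by (rule stepI[where \<alpha> = "[]" and e = "-1"]) (use t last nx 2 E in auto)
    also have "step\<^sup>*\<^sup>* (WL c c' (\<gamma> k) ?R, int u, outp k) (At c', 1 + int u', outp (Suc k))"
      by (rule walk_left[OF assms(1-4)]) (use 2 left_start[OF assms(1) E(5)] in auto)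
    finally show ?thesis .
  next
    case 3
    have "step (At c, 1 + int u, outp k) (At c', 1 + int u', outp (Suc k))"
    proof (rule stepI)
      show "dl (At c) (tp (1 + int u)) = Some (At c', em1 (\<gamma> k) (labtv c' (as ! u')), 0)"
        using stay_edge[OF assms(1) E(4,3,2)] E t last nx 3 by simp
      show "outp (Suc k) = outp k @ em1 (\<gamma> k) (labtv c' (as ! u'))"
        by (rule arrive(5)[OF assms(1) k assms(3) E(1)])
    qed (use 3 E in auto)
    then show ?thesis by simp
  qed
qed

text \<open>The successor guesses are consulted only at the nodes of the path, in state
  \<open>At\<close>, so correctness along the path suffices for an accepting run.\<close>

theorem complete:
  assumes "valid"
    and nx: "\<And>k. Suc k < N \<Longrightarrow> aN (as ! fst (v k)) (snd (v k)) =
       (sgn (int (fst (v (Suc k))) - int (fst (v k))), snd (v (Suc k)), \<gamma> k)"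
  shows "\<exists>i. step\<^sup>*\<^sup>* (Chk None, 0, []) (Fin, i, total)"
proof (cases "N = 0")
  case True
  then show ?thesis using start_run empty_run assms(1) by (meson rtranclp_trans)
next
  case False
  have run: "step\<^sup>*\<^sup>* (Fst, 1, []) (At (snd (v k)), 1 + int (fst (v k)), outp k)" if "k < N" for k
    using that
  proof (induction k)
    case 0
    then show ?case by (intro first_run assms(1)) auto
  next
    case (Suc k)
    have "step\<^sup>*\<^sup>* (At (snd (v k)), 1 + int (fst (v k)), outp k) (At (snd (v (Suc k))), 1 + int (fst (v (Suc k))), outp (Suc k))"
      by (rule next_run[OF assms(1) Suc.prems]) (use nx[OF Suc.prems] in auto)
    then show ?case using Suc by (meson Suc_lessD rtranclp_trans)
  qed
  obtain k where k: "N = Suc k" using False by (cases N) auto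
  obtain u c where uc: "v k = (u, c)" by (cases "v k")
  have u: "u < length as" using vD[OF assms(1) _ uc] k by simp
  have "step (At c, 1 + int u, outp k) (Fin, 1 + int u, outp k)"
    by (rule stepI[where \<alpha> = "[]" and e = 0])
      (use tape1[OF u] last_iff[OF assms(1) _ uc] k u in auto)
  moreover have "step\<^sup>*\<^sup>* (Fst, 1, []) (At c, 1 + int u, outp k)" using run[of k] k uc by simp
  ultimately have "step\<^sup>*\<^sup>* (Chk None, 0, []) (Fin, 1 + int u, outp k)"
    using start_run[OF assms(1)] by (meson rtranclp.rtrancl_into_rtrancl rtranclp_trans)
  then show ?thesis using total_Suc[of k] k by auto
qed

end

section \<open>Transductions with string output as relabelled two-way machines\<close>

text \<open>The inverse of the isomorphism enumerates the nodes. Edges have to stay within the node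
  set, because only there does the inverse recover endpoints.\<close>

lemma iso_word_graph:
  assumes "word_graph lab inc zs r" "graph_iso h r" "gE h \<subseteq> gV h \<times> UNIV \<times> gV h"
  shows "\<exists>v. is_path h v (\<lambda>i. inc (zs ! Suc i)) (length zs) \<and> (\<forall>i<length zs. glab h (v i) = lab (zs ! i))"
proof -
  obtain f where f: "bij_betw f (gV h) (gV r)" "\<forall>v\<in>gV h. glab r (f v) = glab h v"
    "gE r = (\<lambda>(u, a, v). (f u, a, f v)) ` gE h"
    using assms(2) unfolding graph_iso_def by blast
  have Vr: "gV r = {0..<length zs}" and Er: "gE r = {(i, inc (zs ! Suc i), Suc i) | i. Suc i < length zs}"
    and Lr: "\<forall>i<length zs. glab r i = lab (zs ! i)"
    using assms(1) by (auto simp: word_graph_def)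
  define v where "v = inv_into (gV h) f"
  have v: "bij_betw v {0..<length zs} (gV h)" unfolding v_def using bij_betw_inv_into[OF f(1)] Vr by simp
  have fv: "f (v i) = i" if "i < length zs" for i
    unfolding v_def using f(1) Vr that by (simp add: bij_betw_inv_into_right)
  have vf: "v (f x) = x" if "x \<in> gV h" for x
    unfolding v_def using f(1) that by (simp add: bij_betw_inv_into_left)
  have vV: "v i \<in> gV h" if "i < length zs" for i using v that by (auto simp: bij_betw_def)
  have "(x, a, y) \<in> gE h \<longleftrightarrow> (\<exists>i. Suc i < length zs \<and> x = v i \<and> a = inc (zs ! Suc i) \<and> y = v (Suc i))" for x a y
  proof
    assume e: "(x, a, y) \<in> gE h"
    then have "(f x, a, f y) \<in> gE r" unfolding f(3) by force
    then obtain i where "f x = i" "a = inc (zs ! Suc i)" "f y = Suc i" "Suc i < length zs" unfolding Er by auto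
    moreover have "x \<in> gV h" "y \<in> gV h" using e assms(3) by auto
    ultimately show "\<exists>i. Suc i < length zs \<and> x = v i \<and> a = inc (zs ! Suc i) \<and> y = v (Suc i)"
      using vf by metis
  next
    assume "\<exists>i. Suc i < length zs \<and> x = v i \<and> a = inc (zs ! Suc i) \<and> y = v (Suc i)"
    then obtain i where i: "Suc i < length zs" "x = v i" "a = inc (zs ! Suc i)" "y = v (Suc i)" by blast
    then have "(i, a, Suc i) \<in> gE r" unfolding Er by blast
    then obtain x' y' where "(x', a, y') \<in> gE h" "i = f x'" "Suc i = f y'" unfolding f(3) by auto
    moreover from this have "x' \<in> gV h" "y' \<in> gV h" using assms(3) by auto
    ultimately show "(x, a, y) \<in> gE h" using i vf by metis
  qed
  then have "gE h = {(v i, inc (zs ! Suc i), v (Suc i)) | i. Suc i < length zs}" by auto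
  then have "is_path h v (\<lambda>i. inc (zs ! Suc i)) (length zs)"
    using v unfolding is_path_def bij_betw_def by (auto simp: atLeast0LessThan)
  moreover have "glab h (v i) = lab (zs ! i)" if "i < length zs" for i
    using f(2) vV[OF that] fv[OF that] Lr that by metis
  ultimately show ?thesis by blast
qed

text \<open>A path graph determines its enumeration: the first node is the one without incoming
  edge, and each edge leads to the next node. Hence a word can be recovered from any isomorphic copy
  of its graph.\<close>

lemma is_path_unique:
  assumes "is_path h v \<gamma> N" "is_path h v' \<gamma>' N'"
  shows "N = N'" "i < N \<Longrightarrow> v i = v' i" "Suc i < N \<Longrightarrow> \<gamma> i = \<gamma>' i"
proof -
  have V: "gV h = v ` {..<N}" "gV h = v' ` {..<N'}" "inj_on v {..<N}" "inj_on v' {..<N'}"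
    using assms by (auto simp: is_path_def)
  show N: "N = N'" using card_image[OF V(3)] card_image[OF V(4)] V(1,2) by simp
  show vv: "i < N \<Longrightarrow> v i = v' i" for i
  proof (induction i)
    case 0
    then have "v 0 \<in> v' ` {..<N'}" using V by (metis image_eqI lessThan_iff)
    then obtain k where k: "v 0 = v' k" "k < N'" by blast
    have "\<not> (\<exists>x \<gamma>. (x, \<gamma>, v 0) \<in> gE h)" using is_path_first[OF assms(1) 0] by simp
    then show ?case using is_path_first[OF assms(2) k(2)] k(1) by simp
  next
    case (Suc i)
    have "(v i, \<gamma> i, v (Suc i)) \<in> gE h" using assms(1) Suc.prems unfolding is_path_def by blast
    then show ?case using is_path_edge(3)[OF assms(2), of i] Suc N by simp
  qed
  show "\<gamma> i = \<gamma>' i" if "Suc i < N"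
  proof -
    have "(v i, \<gamma> i, v (Suc i)) \<in> gE h" using assms(1) that unfolding is_path_def by blast
    then show ?thesis using is_path_edge(2)[OF assms(2), of i] vv[of i] that N by simp
  qed
qed

lemma word_graph_path: "word_graph lab inc ws g \<Longrightarrow> is_path g id (\<lambda>i. inc (ws ! Suc i)) (length ws)"
  by (auto simp: word_graph_def is_path_def)

lemma word_graph_iso_eq:
  assumes "word_graph lab inc ws g" "word_graph lab inc ws' g'" "graph_iso g g'"
  shows "length ws = length ws'" "i < length ws \<Longrightarrow> lab (ws ! i) = lab (ws' ! i)"
    "Suc i < length ws \<Longrightarrow> inc (ws ! Suc i) = inc (ws' ! Suc i)"
proof -
  have "gE g \<subseteq> gV g \<times> UNIV \<times> gV g" using assms(1) by (auto simp: word_graph_def)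
  from iso_word_graph[OF assms(2,3) this] obtain v where
    v: "is_path g v (\<lambda>i. inc (ws' ! Suc i)) (length ws')" "\<forall>i<length ws'. glab g (v i) = lab (ws' ! i)" by blast
  note u = is_path_unique[OF word_graph_path[OF assms(1)] v(1)]
  show len: "length ws = length ws'" by (rule u(1))
  show "Suc i < length ws \<Longrightarrow> inc (ws ! Suc i) = inc (ws' ! Suc i)" by (rule u(3))
  show "i < length ws \<Longrightarrow> lab (ws ! i) = lab (ws' ! i)"
    using u(2)[of i] v(2) len assms(1) by (auto simp: word_graph_def)
qed

lemma nd_iso_eq: "graph_iso (nd w) (nd w') \<Longrightarrow> w = w'"
  using word_graph_iso_eq[OF word_graph_nd word_graph_nd, of w w'] by (auto intro!: nth_equalityI)

lemma ed_iso_eq: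
  assumes "graph_iso (ed w) (ed w')"
  shows "w = w'"
proof -
  note e = word_graph_iso_eq[OF word_graph_ed word_graph_ed assms]
  have "length w = length w'" using e(1) by simp
  moreover have "w ! i = w' ! i" if "i < length w" for i using e(3)[of i] that calculation by simp
  ultimately show ?thesis by (simp add: list_eq_iff_nth_eq)
qed

lemma gE_out_graph_sub: "gE (out_graph T g P) \<subseteq> gV (out_graph T g P) \<times> UNIV \<times> gV (out_graph T g P)"
  by (auto simp: out_graph_def)

text \<open>Nodes carry the letters here, so \<open>k\<close> edges spell \<open>k + 1\<close>
  letters, and the empty path falls under the separate clause of \<open>path_total\<close>. In
  \<open>total_ed\<close> the first node spells nothing.\<close>

lemma total_nd:
  assumes "graph_iso h (nd z)" "gE h \<subseteq> gV h \<times> UNIV \<times> gV h"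
  shows "\<exists>v \<gamma> N. is_path h v \<gamma> N \<and> path_total (\<lambda>\<sigma>. [the \<sigma>]) (\<lambda>\<gamma> \<sigma>. [the \<sigma>]) h v \<gamma> N = z"
proof -
  obtain v where v: "is_path h v (\<lambda>i. None) (length z)" "\<forall>i<length z. glab h (v i) = Some (z ! i)"
    using iso_word_graph[OF word_graph_nd assms] by auto
  have "path_out (\<lambda>\<sigma>. [the \<sigma>]) (\<lambda>\<gamma> \<sigma>. [the \<sigma>]) h v (\<lambda>i. None) k = take (Suc k) z" if "k < length z" for k
    using that
  proof (induction k)
    case 0
    then show ?case using v(2) by (cases z) (auto simp: path_out_def)
  next
    case (Suc k)
    then have "path_out (\<lambda>\<sigma>. [the \<sigma>]) (\<lambda>\<gamma> \<sigma>. [the \<sigma>]) h v (\<lambda>i. None) (Suc k) = take (Suc k) z @ [z ! Suc k]"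
      using v(2) by (simp add: path_out_def)
    then show ?case using Suc.prems by (simp add: take_Suc_conv_app_nth)
  qed
  from this[of "length z - 1"] have "path_total (\<lambda>\<sigma>. [the \<sigma>]) (\<lambda>\<gamma> \<sigma>. [the \<sigma>]) h v (\<lambda>i. None) (length z) = z"
    by (auto simp: path_total_def)
  then show ?thesis using v(1) by blast
qed

lemma total_ed:
  assumes "graph_iso h (ed z)" "gE h \<subseteq> gV h \<times> UNIV \<times> gV h"
  shows "\<exists>v \<gamma> N. is_path h v \<gamma> N \<and> path_total (\<lambda>\<sigma>. []) (\<lambda>\<gamma> \<sigma>. [the \<gamma>]) h v \<gamma> N = z"
proof -
  obtain v where v: "is_path h v (\<lambda>i. map Some z ! i) (Suc (length z))"
    using iso_word_graph[OF word_graph_ed assms] by auto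
  have "path_out (\<lambda>\<sigma>. []) (\<lambda>\<gamma> \<sigma>. [the \<gamma>]) h v (\<lambda>i. map Some z ! i) k = take k z" if "k \<le> length z" for k
    using that
  proof (induction k)
    case 0
    then show ?case by (auto simp: path_out_def)
  next
    case (Suc k)
    then have "path_out (\<lambda>\<sigma>. []) (\<lambda>\<gamma> \<sigma>. [the \<gamma>]) h v (\<lambda>i. map Some z ! i) (Suc k) = take k z @ [z ! k]"
      by (simp add: path_out_def)
    then show ?case using Suc.prems by (simp add: take_Suc_conv_app_nth)
  qed
  from this[of "length z"] have "path_total (\<lambda>\<sigma>. []) (\<lambda>\<gamma> \<sigma>. [the \<gamma>]) h v (\<lambda>i. map Some z ! i) (Suc (length z)) = z"
    by (auto simp: path_total_def)
  then show ?thesis using v by blast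
qed

section \<open>Annotated words and the tapes that carry them\<close>

lemma (in walker) AnnsI:
  assumes "l \<in> A \<times> Pow {c. c < K \<and> odd c}" "p \<in> W" "s \<in> W"
    "\<And>c. (c \<in> copies T \<longrightarrow> f c \<in> insert (0, 0, None) ({-1, 0, 1} \<times> copies T \<times> oealph T)) \<and>
          (c \<notin> copies T \<longrightarrow> f c = (0, 0, None))"
  shows "Ann l (nf p) (nf s) f \<in> Anns"
  unfolding Anns_def
  apply (rule CollectI)
  apply (rule exI[of _ l], rule exI[of _ "nf p"], rule exI[of _ "nf s"], rule exI[of _ f])
  apply (intro conjI refl imageI assms(1-3))
  apply (rule allI)
  apply (rule assms(4))
  done

text \<open>What the two representations share: \<open>en\<close> is the letter list of the input
  graph, and \<open>tot\<close> states that \<open>em0\<close> and \<open>em1\<close> spell the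
  output string along the output path.\<close>

locale transducer = walker +
  fixes rep :: "nat list \<Rightarrow> nat graph" and en :: "nat list \<Rightarrow> nat option list" and S1 :: "nat set"
    and m :: "(nat list \<times> nat list) set"
  assumes rep: "word_graph lab inc (en w) (rep w)"
    and enA: "w \<in> lists S1 \<Longrightarrow> set (en w) \<subseteq> A"
    and out: "\<lbrakk>w \<in> lists S1; h \<in> outputs T (rep w)\<rbrakk> \<Longrightarrow> \<exists>z. (w, z) \<in> m \<and> graph_iso h (rep z)"
    and mout: "(w, z) \<in> m \<Longrightarrow> \<exists>h\<in>outputs T (rep w). graph_iso h (rep z)"
    and tot: "\<And>(h :: (nat \<times> nat) graph) z. graph_iso h (rep z) \<Longrightarrow> gE h \<subseteq> gV h \<times> UNIV \<times> gV h \<Longrightarrow>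
        \<exists>v \<gamma> N. is_path h v \<gamma> N \<and> path_total em0 em1 h v \<gamma> N = z"
begin

text \<open>The cells to the right of the end symbol are left open. For \<open>ed\<close> the letter
  0 ends the tape one cell before the real marker, and the same predicate admits this.\<close>

definition tape_ok where
  "tape_ok as tp b \<longleftrightarrow> tp 0 = AL \<and> (\<forall>i<length as. tp (1 + int i) = AA (as ! i)) \<and> tp (1 + int (length as)) = AR
     \<and> 1 + int (length as) \<le> (b :: int)"

lemma tape_okD:
  assumes "tape_ok as tp b"
  shows "tp 0 = AL" "i < length as \<Longrightarrow> tp (1 + int i) = AA (as ! i)" "tp (1 + int (length as)) = AR"
    "1 + int (length as) \<le> b"
  using assms unfolding tape_ok_def by blast+

lemma outputs_iff: "h \<in> outputs T g \<longleftrightarrow> (\<exists>P. h = out_graph T g P \<and> (\<forall>i. P i \<subseteq> gV g) \<and> sat g (\<lambda>_. undefined) P (tdom T))"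
  unfolding outputs_def by blast

theorem run_m:
  assumes "w \<in> lists S1" "as \<in> lists Anns" "map (\<lambda>a. fst (aL a)) as = en w" "tape_ok as tp b"
    and "(mstep dl tp b)\<^sup>*\<^sup>* (Chk None, 0, []) (Fin, i, z)"
  shows "(w, z) \<in> m"
proof -
  \<comment> \<open>The odd marks of the guessed letters are the parameters.\<close>
  define P where "P X = {i. i < length as \<and> Suc (2 * X) \<in> snd (aL (as ! i))}" for X
  have len: "length (en w) = length as" using assms(3) by (metis length_map)
  have bs: "map aL as = enc K (en w) (\<lambda>_. length (en w)) P"
  proof (rule nth_equalityI)
    fix i assume "i < length (map aL as)"
    then have i: "i < length as" by simp
    have a: "as ! i \<in> Anns" using assms(2) i by (simp add: in_lists_conv_set)
    have "c \<in> snd (aL (as ! i)) \<longleftrightarrow> c \<in> {Suc (2 * X) | X. i \<in> P X} \<inter> {..<K}" for c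
      using AnnsD(5)[OF a] i by (auto simp: P_def elim!: oddE)
    then have "snd (aL (as ! i)) = {Suc (2 * X) | X. i \<in> P X} \<inter> {..<K}" by blast
    moreover have "fst (aL (as ! i)) = en w ! i" using assms(3) i by (metis nth_map)
    ultimately show "map aL as ! i = enc K (en w) (\<lambda>_. length (en w)) P ! i"
      using i len by (intro prod_eqI) (simp_all add: snd_enc)
  qed (use len in simp)
  interpret W: walk_run lab inc A T em0 em1 "en w" "rep w" P as tp b
    by unfold_locales
      (rule rep, rule assms(2), rule bs, rule tape_okD(1)[OF assms(4)], erule tape_okD(2)[OF assms(4)],
       rule tape_okD(3)[OF assms(4)], rule tape_okD(4)[OF assms(4)])
  have P: "P X \<subseteq> gV (rep w)" for X unfolding W.gV P_def by auto
  let ?H = "out_graph T (rep w) P"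
  \<comment> \<open>Validity of the annotations is not known yet. The enumeration of the output path
    is therefore chosen under the condition of validity, which is what \<open>path_run\<close> asks
    for.\<close>
  have "\<exists>v \<gamma> N z'. (W.valid \<longrightarrow> (w, z') \<in> m \<and> is_path ?H v \<gamma> N \<and> path_total em0 em1 ?H v \<gamma> N = z')"
  proof (cases W.valid)
    case True
    then have "?H \<in> outputs T (rep w)" unfolding outputs_iff using P W.valid_dom by blast
    then obtain z' where z': "(w, z') \<in> m" "graph_iso ?H (rep z')" using out[OF assms(1)] by blast
    from tot[OF z'(2) gE_out_graph_sub] z'(1) show ?thesis by blast
  qed simp
  then obtain v \<gamma> N z' where z': "W.valid \<Longrightarrow> (w, z') \<in> m \<and> is_path ?H v \<gamma> N \<and> path_total em0 em1 ?H v \<gamma> N = z'" by blast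
  interpret R: path_run lab inc A T em0 em1 "en w" "rep w" P as tp b v \<gamma> N
    by unfold_locales (use z' in blast)
  show ?thesis using R.sound[OF assms(5)] z' by auto
qed

text \<open>Each position is annotated with its true letter, the normal forms of its true prefix and
  suffix, and the true successors. Tapes are quantified after the annotation, so that one annotation
  serves both tape formats.\<close>

theorem m_run:
  assumes "(w, z) \<in> m" "w \<in> lists S1"
  shows "\<exists>as\<in>lists Anns. map (\<lambda>a. fst (aL a)) as = en w \<and>
    (\<forall>tp b. tape_ok as tp b \<longrightarrow> (\<exists>i. (mstep dl tp b)\<^sup>*\<^sup>* (Chk None, 0, []) (Fin, i, z)))"
proof -
  obtain h where h: "h \<in> outputs T (rep w)" "graph_iso h (rep z)" using mout[OF assms(1)] by (rule bexE)
  obtain P where P: "h = out_graph T (rep w) P \<and> (\<forall>i. P i \<subseteq> gV (rep w)) \<and> sat (rep w) (\<lambda>_. undefined) P (tdom T)"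
    using h(1) unfolding outputs_iff by (rule exE)
  have iso: "graph_iso (out_graph T (rep w) P) (rep z)" using h(2) P by simp
  let ?H = "out_graph T (rep w) P"
  obtain v \<gamma> N where path: "is_path ?H v \<gamma> N" and total: "path_total em0 em1 ?H v \<gamma> N = z"
    using tot[OF iso gE_out_graph_sub] by blast
  let ?n = "length (en w)"
  define bs where "bs = enc K (en w) (\<lambda>_. ?n) P"
  have lbs: "length bs = ?n" by (simp add: bs_def)
  have bsA: "bs ! i \<in> A \<times> Pow {c. c < K \<and> odd c}" if "i < ?n" for i
  proof -
    have "en w ! i \<in> A" using enA[OF assms(2)] that by auto
    then show ?thesis using that unfolding bs_def by (auto simp: mem_Times_iff snd_enc)
  qed
  have bsal: "set bs \<subseteq> alph A K"
  proof
    fix l assume "l \<in> set bs"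
    then obtain i where "i < ?n" "l = bs ! i" using lbs by (metis in_set_conv_nth)
    then show "l \<in> alph A K" using bsA[of i] by (auto simp: alph_def)
  qed
  \<comment> \<open>The index \<open>k\<close> is unique because \<open>v\<close> is injective;
    copies without a successor get the default triple.\<close>
  define nx where "nx i c = (if \<exists>k. Suc k < N \<and> v k = (i, c) then
     (let k = (SOME k. Suc k < N \<and> v k = (i, c)) in (sgn (int (fst (v (Suc k))) - int i), snd (v (Suc k)), \<gamma> k))
     else (0, 0, None))" for i c
  have nx_v: "nx (fst (v k)) (snd (v k)) = (sgn (int (fst (v (Suc k))) - int (fst (v k))), snd (v (Suc k)), \<gamma> k)"
    if "Suc k < N" for k
  proof -
    have ex: "\<exists>k'. Suc k' < N \<and> v k' = (fst (v k), snd (v k))" using that by auto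
    have "(SOME k'. Suc k' < N \<and> v k' = (fst (v k), snd (v k))) = k"
    proof (rule some_equality)
      fix k' assume "Suc k' < N \<and> v k' = (fst (v k), snd (v k))"
      then show "k' = k" using path that unfolding is_path_def by (auto dest: inj_onD)
    qed (use that in simp)
    then show ?thesis unfolding nx_def if_P[OF ex] by (simp add: Let_def)
  qed
  have nx_ok: "(c \<in> copies T \<longrightarrow> nx i c \<in> insert (0, 0, None) ({-1, 0, 1} \<times> copies T \<times> oealph T)) \<and>
          (c \<notin> copies T \<longrightarrow> nx i c = (0, 0, None))" for i c
  proof (cases "\<exists>k. Suc k < N \<and> v k = (i, c)")
    case True
    then obtain k where k: "Suc k < N" "v k = (i, c)" by blast
    have "(v k, \<gamma> k, v (Suc k)) \<in> gE ?H" using path k(1) unfolding is_path_def by blast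
    moreover obtain u' c' where u': "v (Suc k) = (u', c')" by (cases "v (Suc k)")
    ultimately have "((i, c), \<gamma> k, (u', c')) \<in> gE ?H" using k(2) by simp
    from gE_out_graphD[OF this] have "c \<in> copies T" "snd (v (Suc k)) \<in> copies T" "\<gamma> k \<in> oealph T"
      using u' by simp_all
    moreover have "sgn (x :: int) \<in> {-1, 0, 1}" for x by (simp add: sgn_if)
    ultimately show ?thesis using nx_v[OF k(1)] k(2) by simp
  next
    case False
    then have "nx i c = (0, 0, None)" unfolding nx_def by (rule if_not_P)
    then show ?thesis by simp
  qed
  define as where "as = map (\<lambda>i. Ann (bs ! i) (nf (take i bs)) (nf (drop (Suc i) bs)) (nx i)) [0..<?n]"
  have las: "length as = ?n" by (simp add: as_def)
  have as_nth: "as ! i = Ann (bs ! i) (nf (take i bs)) (nf (drop (Suc i) bs)) (nx i)" if "i < ?n" for i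
    using that by (simp add: as_def)
  have tkW: "take i bs \<in> W" "drop i bs \<in> W" for i
    using bsal set_take_subset[of i bs] set_drop_subset[of i bs] by auto
  have asA: "as \<in> lists Anns"
  proof -
    have "as ! i \<in> Anns" if "i < ?n" for i
      unfolding as_nth[OF that] by (rule AnnsI[OF bsA[OF that] tkW nx_ok])
    then show ?thesis using las by (auto simp: in_lists_conv_set in_set_conv_nth)
  qed
  have maps: "map aL as = bs" using lbs las by (intro nth_equalityI) (simp_all add: as_nth)
  have wsen: "map (\<lambda>a. fst (aL a)) as = en w"
    using las by (intro nth_equalityI) (simp_all add: as_nth bs_def)
  have "\<exists>i. (mstep dl tp b)\<^sup>*\<^sup>* (Chk None, 0, []) (Fin, i, z)" if tpb: "tape_ok as tp b" for tp b
  proof -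
    interpret R: path_run lab inc A T em0 em1 "en w" "rep w" P as tp b v \<gamma> N
      by unfold_locales
        (rule rep, rule asA, rule maps[unfolded bs_def], rule tape_okD(1)[OF tpb], erule tape_okD(2)[OF tpb],
         rule tape_okD(3)[OF tpb], rule tape_okD(4)[OF tpb], rule path)
    \<comment> \<open>Normalizing a part does not change the class of the whole, so exact normal
      forms pass the local checks.\<close>
    have nfs: "nf (nf u @ [x]) = nf (u @ [x])" "nf (x # nf u) = nf (x # u)" if "u \<in> W" for u x
      using nf_cong[OF ef_append[OF nf(2)[OF that] ef_refl, of "[x]"]]
        nf_cong[OF ef_append[OF ef_refl nf(2)[OF that], of "[x]"]] by simp_all
    have chain: R.chain
      unfolding R.chain_def
    proof (intro allI impI)
      fix i assume "i < length as"
      then have i: "i < ?n" using las by simp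
      show "okp (prev as i) (as ! i)"
      proof (cases i)
        case 0
        then show ?thesis using i by (simp add: as_nth)
      next
        case (Suc j)
        have "take (Suc j) bs = take j bs @ [bs ! j]" "drop (Suc j) bs = bs ! Suc j # drop (Suc (Suc j)) bs"
          using i Suc lbs by (simp_all add: take_Suc_conv_app_nth Cons_nth_drop_Suc)
        then show ?thesis using i Suc nfs(1)[OF tkW(1)[of j]] nfs(2)[OF tkW(2)[of "Suc (Suc j)"]]
          by (simp add: as_nth)
      qed
    qed
    have "aS (last as) = nf []" if "as \<noteq> []"
    proof -
      have "last as = as ! (?n - 1)" using that las by (simp add: last_conv_nth)
      moreover have "?n - 1 < ?n" using that las by (cases as) auto
      ultimately show ?thesis using lbs as_nth[of "?n - 1"] by simp
    qed
    then have "R.valid" unfolding R.valid_def using chain R.okend_iff[OF chain] P by simp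
    moreover have "aN (as ! fst (v k)) (snd (v k)) = (sgn (int (fst (v (Suc k))) - int (fst (v k))), snd (v (Suc k)), \<gamma> k)"
      if "Suc k < N" for k
    proof -
      obtain u c where uc: "v k = (u, c)" by (cases "v k")
      have "u < ?n" using R.vD[OF \<open>R.valid\<close> _ uc] that las by simp
      then show ?thesis using nx_v[OF that] uc by (simp add: as_nth)
    qed
    ultimately show ?thesis using R.complete total by simp
  qed
  then show ?thesis using asA wsen by blast
qed


text \<open>Positive codes keep the letter 0 free for the relabelled right marker.\<close>

definition code :: "ann \<Rightarrow> nat" where
  "code = (SOME f. inj_on f Anns \<and> (\<forall>x. 0 < f x))"

lemma code: "inj_on code Anns" "0 < code x"
proof -
  obtain f :: "ann \<Rightarrow> nat" where "inj_on f Anns"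
    using finite_imp_inj_to_nat_seg[OF finite_Anns] by blast
  then have "inj_on (\<lambda>x. Suc (f x)) Anns \<and> (\<forall>x. 0 < Suc (f x))" by (simp add: inj_on_def)
  then have "inj_on code Anns \<and> (\<forall>x. 0 < code x)" unfolding code_def
    by (rule someI[of "\<lambda>f. inj_on f Anns \<and> (\<forall>x. 0 < f x)"])
  then show "inj_on code Anns" "0 < code x" by simp_all
qed

text \<open>The letter 0, to which \<open>MREL\<close> relabels the right end marker, is read as an end marker.\<close>

fun dec :: "tsym \<Rightarrow> asym" where
  "dec LM = AL"
| "dec RM = AR"
| "dec (Sym x) = (if x = 0 then AR else AA (inv_into Anns code x))"

lemma dec_code: "x \<in> Anns \<Longrightarrow> dec (Sym (code x)) = AA x"
  using code by (simp add: inv_into_f_f)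

sublocale M: two_way "\<lambda>q x. dl q (dec x)" States "insert 0 (code ` Anns)" Outs "Chk None" Fin
proof unfold_locales
  show "finite States" by (rule finite_States)
  show "finite (insert 0 (code ` Anns))" using finite_Anns by simp
  show "finite Outs" by (rule finite_Outs)
  show "Chk None \<in> States" "Fin \<in> States" by (rule States_intros)+
  show "dl Fin (dec \<sigma>) = None" for \<sigma> by simp
  fix q \<sigma> q' \<alpha> e
  assume q: "q \<in> States" "\<sigma> \<in> {LM, RM} \<union> Sym ` insert 0 (code ` Anns)" "dl q (dec \<sigma>) = Some (q', \<alpha>, e)"
  have "dec \<sigma> \<in> {AL, AR} \<union> AA ` Anns"
    using q(2) dec_code by auto
  from dl_closed[OF q(1) this q(3)] show "q' \<in> States \<and> \<alpha> \<in> lists Outs \<and> e \<in> {-1, 0, 1}" .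
qed

lemma mstep_dec: "mstep (\<lambda>q x. dl q (dec x)) tp b = mstep dl (\<lambda>i. dec (tp i)) b"
  by (intro ext) (simp add: mstep_def)

lemma tape_ok_codes:
  assumes "as \<in> lists Anns" "u = map code as \<or> u = map code as @ [0]"
  shows "tape_ok as (\<lambda>i. dec (tape u i)) (int (length u) + 1)"
  unfolding tape_ok_def
proof (intro conjI allI impI)
  have l: "length u = length as \<or> length u = Suc (length as)" using assms(2) by auto
  show "dec (tape u 0) = AL" by (simp add: tape_def)
  show "dec (tape u (1 + int i)) = AA (as ! i)" if "i < length as" for i
  proof -
    have "u ! i = code (as ! i)" using assms(2) that by (auto simp: nth_append)
    moreover have "as ! i \<in> Anns" using assms(1) that by (simp add: in_lists_conv_set)
    moreover have "tape u (1 + int i) = Sym (u ! i)" using that l by (auto simp: tape_def)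
    ultimately show ?thesis using dec_code by simp
  qed
  show "dec (tape u (1 + int (length as))) = AR"
    using assms(2) by (auto simp: tape_def nth_append)
  show "1 + int (length as) \<le> int (length u) + 1" using l by auto
qed

lemma realized_iff:
  assumes "as \<in> lists Anns" "u = map code as \<or> u = map code as @ [0]" "map (\<lambda>a. fst (aL a)) as = en w" "w \<in> lists S1"
  shows "(u, z) \<in> realized M.gsm_of \<Longrightarrow> (w, z) \<in> m"
proof -
  assume "(u, z) \<in> realized M.gsm_of"
  then obtain i where "(mstep dl (\<lambda>i. dec (tape u i)) (int (length u) + 1))\<^sup>*\<^sup>* (Chk None, 0, []) (Fin, i, z)"
    unfolding M.realized_gsm_of mstep_dec by blast
  from run_m[OF assms(4,1,3) tape_ok_codes[OF assms(1,2)] this] show ?thesis .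
qed

lemma realizedI:
  assumes "(w, z) \<in> m" "w \<in> lists S1"
  shows "\<exists>as\<in>lists Anns. map (\<lambda>a. fst (aL a)) as = en w \<and>
    (map code as, z) \<in> realized M.gsm_of \<and> (map code as @ [0], z) \<in> realized M.gsm_of"
proof -
  obtain as where as: "as \<in> lists Anns" "map (\<lambda>a. fst (aL a)) as = en w"
    and run: "\<And>tp b. tape_ok as tp b \<Longrightarrow> \<exists>i. (mstep dl tp b)\<^sup>*\<^sup>* (Chk None, 0, []) (Fin, i, z)"
    using m_run[OF assms] by blast
  have "(u, z) \<in> realized M.gsm_of" if u: "u = map code as \<or> u = map code as @ [0]" for u
  proof -
    have "u \<in> lists (insert 0 (code ` Anns))" using u as(1) by auto
    then show ?thesis
      unfolding M.realized_gsm_of mstep_dec using run[OF tape_ok_codes[OF as(1) u]] by blast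
  qed
  then show ?thesis using as by blast
qed

end

section \<open>The two inclusions from logic to machines\<close>

lemma graph_over_nd: "w \<in> lists S \<Longrightarrow> graph_over (Some ` S) {None} (nd w)"
  by (auto simp: graph_over_def nd_def in_lists_conv_set)

lemma graph_over_ed: "w \<in> lists S \<Longrightarrow> graph_over {None} (Some ` S) (ed w)"
  by (auto simp: graph_over_def ed_def in_lists_conv_set)

lemma relabel_codes:
  assumes "list_all2 (\<lambda>a b. (a, b) \<in> R) w u" "\<And>a b. (a, b) \<in> R \<Longrightarrow> \<exists>x\<in>B. b = code x \<and> l x = p a"
  shows "\<exists>as\<in>lists B. u = map code as \<and> map l as = map p w"
  using assms(1)
proof (induction rule: list_all2_induct)
  case Nil
  then show ?case by (intro bexI[of _ "[]"]) simp_all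
next
  case (Cons a w b u)
  then obtain as where "as \<in> lists B" "u = map code as" "map l as = map p w" by blast
  moreover obtain x where "x \<in> B" "b = code x" "l x = p a" using assms(2) Cons by blast
  ultimately show ?case by (intro bexI[of _ "x # as"]) simp_all
qed

lemma NMSO_viaE:
  assumes "m \<in> NMSO_via rep NA EA"
  obtains S1 S2 T where "finite S1" "wf_trans T" "m \<subseteq> lists S1 \<times> lists S2"
    and "\<And>g h. graph_over (NA S1) (EA S1) (g :: nat graph) \<Longrightarrow> h \<in> outputs T g \<Longrightarrow>
       \<exists>w z. (w, z) \<in> m \<and> graph_iso g (rep w) \<and> graph_iso h (rep z)"
    and "\<And>w z. (w, z) \<in> m \<Longrightarrow> \<exists>h\<in>outputs T (rep w). graph_iso h (rep z)"
proof -
  obtain S1 S2 T where T: "finite S1" "wf_trans T" "m \<subseteq> lists S1 \<times> lists S2"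
    and 1: "\<forall>g :: nat graph. graph_over (NA S1) (EA S1) g \<longrightarrow>
            (\<forall>h\<in>outputs T g. \<exists>w z. (w, z) \<in> m \<and> graph_iso g (rep w) \<and> graph_iso h (rep z))"
    and 2: "\<forall>(w, z)\<in>m. \<exists>h\<in>outputs T (rep w). graph_iso h (rep z)"
    using assms unfolding NMSO_via_def mem_Collect_eq by (elim exE conjE)
  have 3: "\<exists>h\<in>outputs T (rep w). graph_iso h (rep z)" if "(w, z) \<in> m" for w z
    using bspec[OF 2 that] by simp
  show ?thesis by (rule that[OF T _ 3]) (use 1 in simp_all)
qed

theorem NMSO_nd_sub:
  assumes "m \<in> NMSO_nd"
  shows "m \<in> REL \<circ>\<^sub>F DGSM_eps"
proof -
  obtain S1 S2 T where T: "finite S1" "wf_trans T" "m \<subseteq> lists S1 \<times> lists S2"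
    and out: "\<And>g h. graph_over (Some ` S1) {None} (g :: nat graph) \<Longrightarrow> h \<in> outputs T g \<Longrightarrow>
       \<exists>w z. (w, z) \<in> m \<and> graph_iso g (nd w) \<and> graph_iso h (nd z)"
    and mout: "\<And>w z. (w, z) \<in> m \<Longrightarrow> \<exists>h\<in>outputs T (nd w). graph_iso h (nd z)"
    by (rule NMSO_viaE[OF assms[unfolded NMSO_nd_def]], rule that)
  interpret X: transducer id "\<lambda>_. None" "Some ` S1" T "\<lambda>\<sigma>. [the \<sigma>]" "\<lambda>\<gamma> \<sigma>. [the \<sigma>]" nd "map Some" S1 m
  proof (unfold_locales, goal_cases)
    case 1 show ?case using T(1) by simp
  next
    case 2 show ?case by (rule T(2))
  next
    case 3 show ?case by (rule word_graph_nd)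
  next
    case (4 w) then show ?case by auto
  next
    \<comment> \<open>The transduction yields a pair for some \<open>w'\<close> whose graph is
      isomorphic to that of \<open>w\<close>. Isomorphic representations belong to the same word, so
      \<open>w'\<close> is \<open>w\<close>.\<close>
    case (5 w h)
    from out[OF graph_over_nd[OF 5(1)] 5(2)] obtain w' z where
      z: "(w', z) \<in> m" "graph_iso (nd w) (nd w')" "graph_iso h (nd z)" by blast
    then show ?case using nd_iso_eq[OF z(2)] by blast
  next
    case (6 w z) then show ?case by (rule mout)
  next
    case (7 h z) then show ?case by (rule total_nd)
  qed
  \<comment> \<open>A letter may become the code of any annotation that carries it; the machine
    rejects inconsistent choices.\<close>
  define R where "R = {(a, b). a \<in> S1 \<and> (\<exists>x\<in>X.Anns. b = X.code x \<and> fst (aL x) = Some a)}"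
  have "R \<subseteq> S1 \<times> X.code ` X.Anns" unfolding R_def by blast
  then have finR: "finite R" using T(1) X.finite_Anns by (meson finite_SigmaI finite_imageI finite_subset)
  have "m = relabel R O realized X.M.gsm_of"
  proof (intro equalityI subsetI)
    fix p assume "p \<in> m"
    moreover obtain w z where p: "p = (w, z)" by (cases p)
    ultimately have wz: "(w, z) \<in> m" "w \<in> lists S1" using T(3) by auto
    obtain as where as: "as \<in> lists X.Anns" "map (\<lambda>a. fst (aL a)) as = map Some w"
      "(map X.code as, z) \<in> realized X.M.gsm_of" using X.realizedI[OF wz] by blast
    have "list_all2 (\<lambda>a b. (a, b) \<in> R) w (map X.code as)"
    proof (rule list_all2_all_nthI)
      show len: "length w = length (map X.code as)" using as(2) by (metis length_map)
      fix i assume i: "i < length w"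
      then have "fst (aL (as ! i)) = Some (w ! i)" using as(2) len by (metis length_map nth_map)
      moreover have "as ! i \<in> X.Anns" using as(1) i len by (simp add: in_lists_conv_set)
      moreover have "w ! i \<in> S1" using wz(2) i by (simp add: in_lists_conv_set)
      ultimately show "(w ! i, map X.code as ! i) \<in> R" using i len unfolding R_def by auto
    qed
    then show "p \<in> relabel R O realized X.M.gsm_of" using as(3) p unfolding relabel_def by blast
  next
    fix p assume "p \<in> relabel R O realized X.M.gsm_of"
    then obtain w u z where p: "p = (w, z)" "list_all2 (\<lambda>a b. (a, b) \<in> R) w u" "(u, z) \<in> realized X.M.gsm_of"
      unfolding relabel_def by blast
    have "w \<in> lists S1" using p(2) by (induction rule: list_all2_induct) (auto simp: R_def)
    moreover obtain as where as: "as \<in> lists X.Anns" "u = map X.code as" "map (\<lambda>a. fst (aL a)) as = map Some w"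
      using relabel_codes[OF p(2), of X.Anns X.code "\<lambda>a. fst (aL a)" Some] unfolding R_def by blast
    ultimately show "p \<in> m" using X.realized_iff[OF as(1) _ as(3)] as(2) p by blast
  qed
  moreover have "relabel R \<in> REL" using finR unfolding REL_def by blast
  moreover have "realized X.M.gsm_of \<in> DGSM_eps"
  proof -
    \<comment> \<open>The graph of the empty word has no nodes, so neither has any output graph, and
      only \<open>nd []\<close> has none.\<close>
    have "z = []" if z: "([], z) \<in> realized X.M.gsm_of" for z
    proof -
      have "([], z) \<in> m" by (rule X.realized_iff[of "[]"]) (use z in auto)
      then obtain h where h: "h \<in> outputs T (nd [])" "graph_iso h (nd z)" using mout by blast
      have "gV h = {}" using h(1) by (auto simp: outputs_def out_nodes_def nd_def)
      then have "gV (nd z) = {}" using h(2) unfolding graph_iso_def by (auto simp: bij_betw_def)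
      then show ?thesis by (simp add: nd_def)
    qed
    then show ?thesis using X.M.wf_gsm_of X.M.det_gsm_of unfolding DGSM_eps_def DGSM_def by blast
  qed
  ultimately show ?thesis unfolding fam_comp_def by blast
qed

theorem NMSO_ed_sub:
  assumes "m \<in> NMSO_ed"
  shows "m \<in> MREL \<circ>\<^sub>F DGSM"
proof -
  obtain S1 S2 T where T: "finite S1" "wf_trans T" "m \<subseteq> lists S1 \<times> lists S2"
    and out: "\<And>g h. graph_over {None} (Some ` S1) (g :: nat graph) \<Longrightarrow> h \<in> outputs T g \<Longrightarrow>
       \<exists>w z. (w, z) \<in> m \<and> graph_iso g (ed w) \<and> graph_iso h (ed z)"
    and mout: "\<And>w z. (w, z) \<in> m \<Longrightarrow> \<exists>h\<in>outputs T (ed w). graph_iso h (ed z)"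
    by (rule NMSO_viaE[OF assms[unfolded NMSO_ed_def]], rule that)
  interpret X: transducer "\<lambda>_. None" id "insert None (Some ` S1)" T "\<lambda>\<sigma>. []" "\<lambda>\<gamma> \<sigma>. [the \<gamma>]" ed "\<lambda>w. None # map Some w" S1 m
  proof (unfold_locales, goal_cases)
    case 1 show ?case using T(1) by simp
  next
    case 2 show ?case by (rule T(2))
  next
    case 3 show ?case by (rule word_graph_ed)
  next
    case (4 w) then show ?case by auto
  next
    case (5 w h)
    from out[OF graph_over_ed[OF 5(1)] 5(2)] obtain w' z where
      z: "(w', z) \<in> m" "graph_iso (ed w) (ed w')" "graph_iso h (ed z)" by blast
    then show ?case using ed_iso_eq[OF z(2)] by blast
  next
    case (6 w z) then show ?case by (rule mout)
  next
    case (7 h z) then show ?case by (rule total_ed)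
  qed
  \<comment> \<open>The left marker stands for the first node of the \<open>ed\<close> graph, whose
    letter is \<open>None\<close>.\<close>
  define dt :: "tsym \<Rightarrow> nat option" where "dt s = (case s of Sym a \<Rightarrow> Some a | _ \<Rightarrow> None)" for s
  define R0 where "R0 = {(s, b). s \<in> insert LM (Sym ` S1) \<and> (\<exists>x\<in>X.Anns. b = X.code x \<and> fst (aL x) = dt s)}"
  \<comment> \<open>The right marker has no node of its own and becomes the additional end letter
    0.\<close>
  define R where "R = insert (RM, 0) R0"
  have "R0 \<subseteq> insert LM (Sym ` S1) \<times> X.code ` X.Anns" unfolding R0_def by blast
  then have "finite R0" using T(1) X.finite_Anns by (meson finite_SigmaI finite_imageI finite_subset finite_insert)
  then have finR: "finite R" by (simp add: R_def)
  let ?mk = "\<lambda>w. [LM] @ map Sym w @ [RM]"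
  have "m = {(w, z). (?mk w, z) \<in> relabel R} O realized X.M.gsm_of"
  proof (intro equalityI subsetI)
    fix p assume "p \<in> m"
    moreover obtain w z where p: "p = (w, z)" by (cases p)
    ultimately have wz: "(w, z) \<in> m" "w \<in> lists S1" using T(3) by auto
    obtain as where as: "as \<in> lists X.Anns" "map (\<lambda>a. fst (aL a)) as = None # map Some w"
      "(map X.code as @ [0], z) \<in> realized X.M.gsm_of"
      by (rule bexE[OF X.realizedI[OF wz]], elim conjE, rule that)
    have "list_all2 (\<lambda>a b. (a, b) \<in> R) (LM # map Sym w) (map X.code as)"
    proof (rule list_all2_all_nthI)
      have eq: "map (\<lambda>a. fst (aL a)) as = map dt (LM # map Sym w)" using as(2) by (simp add: dt_def comp_def)
      show len: "length (LM # map Sym w) = length (map X.code as)" using eq by (metis length_map)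
      fix i assume i: "i < length (LM # map Sym w)"
      then have "fst (aL (as ! i)) = dt ((LM # map Sym w) ! i)" using eq len by (metis length_map nth_map)
      moreover have "as ! i \<in> X.Anns" using as(1) i len by (simp add: in_lists_conv_set)
      moreover have "(LM # map Sym w) ! i \<in> set (LM # map Sym w)" using i by (rule nth_mem)
      moreover have "set (LM # map Sym w) \<subseteq> insert LM (Sym ` S1)" using wz(2) by auto
      ultimately show "((LM # map Sym w) ! i, map X.code as ! i) \<in> R" using i len unfolding R_def R0_def by auto
    qed
    then have "list_all2 (\<lambda>a b. (a, b) \<in> R) ((LM # map Sym w) @ [RM]) (map X.code as @ [0])"
      by (rule list_all2_appendI) (simp add: R_def)
    then show "p \<in> {(w, z). (?mk w, z) \<in> relabel R} O realized X.M.gsm_of" using as(3) p unfolding relabel_def by auto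
  next
    fix p assume "p \<in> {(w, z). (?mk w, z) \<in> relabel R} O realized X.M.gsm_of"
    then obtain w u z where p: "p = (w, z)" "list_all2 (\<lambda>a b. (a, b) \<in> R) (?mk w) u" "(u, z) \<in> realized X.M.gsm_of"
      unfolding relabel_def by blast
    have "list_all2 (\<lambda>a b. (a, b) \<in> R) ((LM # map Sym w) @ [RM]) u" using p(2) by simp
    then obtain u1 u2 where u: "u = u1 @ u2" "list_all2 (\<lambda>a b. (a, b) \<in> R) (LM # map Sym w) u1"
       "list_all2 (\<lambda>a b. (a, b) \<in> R) [RM] u2"
      unfolding list_all2_append1 by blast
    have "u2 = [0]" using u(3) by (auto simp: list_all2_Cons1 R_def R0_def)
    have r: "list_all2 (\<lambda>a b. (a, b) \<in> R0) (LM # map Sym w) u1"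
      by (rule list.rel_mono_strong[OF u(2)]) (auto simp: R_def)
    have "set (LM # map Sym w) \<subseteq> insert LM (Sym ` S1)"
      using r unfolding list_all2_conv_all_nth set_conv_nth by (auto simp: R0_def)
    then have "w \<in> lists S1" by auto
    moreover obtain as where as: "as \<in> lists X.Anns" "u1 = map X.code as" "map (\<lambda>a. fst (aL a)) as = map dt (LM # map Sym w)"
      using relabel_codes[OF r, of X.Anns X.code "\<lambda>a. fst (aL a)" dt] unfolding R0_def by blast
    moreover have "map dt (LM # map Sym w) = None # map Some w" by (simp add: dt_def comp_def)
    ultimately show "p \<in> m" using X.realized_iff[OF as(1)] u(1) \<open>u2 = [0]\<close> p by metis
  qed
  moreover have "{(w, z). (?mk w, z) \<in> relabel R} \<in> MREL" using finR unfolding MREL_def by blast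
  moreover have "realized X.M.gsm_of \<in> DGSM"
    using X.M.wf_gsm_of X.M.det_gsm_of unfolding DGSM_def by blast
  ultimately show ?thesis unfolding fam_comp_def by blast
qed

section \<open>Computations that emit one letter per step\<close>

text \<open>For a deterministic gsm the chosen instruction is the only one of its state. The partial
  function makes the generic \<open>mstep\<close> applicable.\<close>

definition act :: "gsm \<Rightarrow> nat \<Rightarrow> tsym \<Rightarrow> (nat \<times> nat list \<times> int) option" where
  "act M p \<sigma> = (if \<exists>t\<in>instrs M. fst t = p then
     (case (SOME t. t \<in> instrs M \<and> fst t = p) of (_, \<sigma>', q1, \<alpha>1, e1, q0, \<alpha>0, e0) \<Rightarrow>
        Some (if \<sigma> = \<sigma>' then (q1, \<alpha>1, e1) else (q0, \<alpha>0, e0))) else None)"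

lemma act_instr:
  assumes "deterministic M" "(p, \<sigma>', q1, \<alpha>1, e1, q0, \<alpha>0, e0) \<in> instrs M"
  shows "act M p \<sigma> = Some (if \<sigma> = \<sigma>' then (q1, \<alpha>1, e1) else (q0, \<alpha>0, e0))"
proof -
  let ?t = "(p, \<sigma>', q1, \<alpha>1, e1, q0, \<alpha>0, e0)"
  have ex: "\<exists>t\<in>instrs M. fst t = p" by (rule bexI[OF _ assms(2)]) simp
  have "(SOME t. t \<in> instrs M \<and> fst t = p) = ?t"
  proof (rule some_equality)
    show "?t \<in> instrs M \<and> fst ?t = p" using assms(2) by simp
    fix t assume t: "t \<in> instrs M \<and> fst t = p"
    have "fst t = fst ?t" using t by simp
    then show "t = ?t" using assms(1)[unfolded deterministic_def] t assms(2) by (metis (no_types))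
  qed
  then show ?thesis unfolding act_def if_P[OF ex] by simp
qed

lemma act_instrD:
  assumes "act M p \<sigma> = Some x"
  shows "\<exists>\<sigma>' q1 \<alpha>1 e1 q0 \<alpha>0 e0. (p, \<sigma>', q1, \<alpha>1, e1, q0, \<alpha>0, e0) \<in> instrs M \<and>
     x = (if \<sigma> = \<sigma>' then (q1, \<alpha>1, e1) else (q0, \<alpha>0, e0))"
proof -
  have ex: "\<exists>t\<in>instrs M. fst t = p" using assms unfolding act_def by (metis option.distinct(1))
  define t where "t = (SOME t. t \<in> instrs M \<and> fst t = p)"
  have "\<exists>t. t \<in> instrs M \<and> fst t = p" using ex by (metis (no_types))
  then have t: "t \<in> instrs M \<and> fst t = p" unfolding t_def by (rule someI_ex)
  obtain p' r where "t = (p', r)" by (cases t)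
  moreover obtain \<sigma>' q1 \<alpha>1 e1 q0 \<alpha>0 e0 where "r = (\<sigma>', q1, \<alpha>1, e1, q0, \<alpha>0, e0)"
    by (cases r rule: prod_cases7)
  ultimately have tt: "t = (p', \<sigma>', q1, \<alpha>1, e1, q0, \<alpha>0, e0)" by simp
  have "x = (if \<sigma> = \<sigma>' then (q1, \<alpha>1, e1) else (q0, \<alpha>0, e0))"
    using assms unfolding act_def if_P[OF ex] t_def[symmetric] tt by simp
  moreover have "(p, \<sigma>', q1, \<alpha>1, e1, q0, \<alpha>0, e0) \<in> instrs M" using t unfolding tt by auto
  ultimately have "(p, \<sigma>', q1, \<alpha>1, e1, q0, \<alpha>0, e0) \<in> instrs M \<and> x = (if \<sigma> = \<sigma>' then (q1, \<alpha>1, e1) else (q0, \<alpha>0, e0))"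
    by (intro conjI)
  then show ?thesis by (intro exI)
qed

lemma gstep_act:
  assumes "deterministic M"
  shows "gstep M w = mstep (act M) (tape w) (int (length w) + 1)"
proof (intro ext iffI)
  fix c c' assume "gstep M w c c'"
  then obtain p i out \<sigma> q1 \<alpha>1 e1 q0 \<alpha>0 e0 q \<alpha> e where *:
    "c = (p, i, out)" "(p, \<sigma>, q1, \<alpha>1, e1, q0, \<alpha>0, e0) \<in> instrs M"
    "(q, \<alpha>, e) = (if tape w i = \<sigma> then (q1, \<alpha>1, e1) else (q0, \<alpha>0, e0))"
    "0 \<le> i + e" "i + e \<le> int (length w) + 1" "c' = (q, i + e, out @ \<alpha>)"
    unfolding gstep_def by (elim exE conjE)
  show "mstep (act M) (tape w) (int (length w) + 1) c c'"
    unfolding *(1,6) using act_instr[OF assms *(2), of "tape w i"] *(3-5)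
    by (intro mstepI[where \<alpha> = \<alpha> and e = e]) simp_all
next
  fix c c' assume m: "mstep (act M) (tape w) (int (length w) + 1) c c'"
  obtain q i out where c: "c = (q, i, out)" by (cases c)
  from m[unfolded c] obtain q' \<alpha> e where *: "act M q (tape w i) = Some (q', \<alpha>, e)" "c' = (q', i + e, out @ \<alpha>)"
    "0 \<le> i + e" "i + e \<le> int (length w) + 1" by (rule mstepE)
  from act_instrD[OF *(1)] obtain \<sigma>' q1 \<alpha>1 e1 q0 \<alpha>0 e0 where
    "(q, \<sigma>', q1, \<alpha>1, e1, q0, \<alpha>0, e0) \<in> instrs M"
    "(q', \<alpha>, e) = (if tape w i = \<sigma>' then (q1, \<alpha>1, e1) else (q0, \<alpha>0, e0))" by (elim exE conjE)
  from gstepI[OF this *(3,4)] show "gstep M w c c'" unfolding c *(2) .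
qed

lemma act_wf:
  assumes "wf_gsm M" "act M p \<sigma> = Some (q, \<alpha>, e)"
  shows "p \<in> states M" "q \<in> states M" "p \<noteq> qf M" "\<alpha> \<in> lists (outalph M)" "e \<in> {-1, 0, 1}"
proof -
  from act_instrD[OF assms(2)] obtain \<sigma>' q1 \<alpha>1 e1 q0 \<alpha>0 e0 where
    *: "(p, \<sigma>', q1, \<alpha>1, e1, q0, \<alpha>0, e0) \<in> instrs M"
    "(q, \<alpha>, e) = (if \<sigma> = \<sigma>' then (q1, \<alpha>1, e1) else (q0, \<alpha>0, e0))" by (elim exE conjE)
  have wf: "\<forall>t\<in>instrs M. case t of (p, \<sigma>, q1, \<alpha>1, e1, q0, \<alpha>0, e0) \<Rightarrow>
          p \<in> states M \<and> p \<noteq> qf M \<and> \<sigma> \<in> {LM, RM} \<union> Sym ` inalph M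
          \<and> q1 \<in> states M \<and> q0 \<in> states M \<and> \<alpha>1 \<in> lists (outalph M) \<and> \<alpha>0 \<in> lists (outalph M)
          \<and> e1 \<in> {-1, 0, 1} \<and> e0 \<in> {-1, 0, 1}"
    using assms(1) unfolding wf_gsm_def by (elim conjE)
  from bspec[OF wf *(1)] *(2)
  show "p \<in> states M" "q \<in> states M" "p \<noteq> qf M" "\<alpha> \<in> lists (outalph M)" "e \<in> {-1, 0, 1}"
    by (simp_all split: if_splits)
qed

text \<open>The sum bounds both alternative outputs of an instruction. It makes the counter of
  \<open>Emit\<close> range over a finite set.\<close>

definition outlen :: "gsm \<Rightarrow> nat" where
  "outlen M = Max (insert 0 ((\<lambda>(p, \<sigma>, q1, \<alpha>1, e1, q0, \<alpha>0, e0). length \<alpha>1 + length \<alpha>0) ` instrs M))"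

lemma act_outlen:
  assumes "wf_gsm M" "act M p \<sigma> = Some (q, \<alpha>, e)"
  shows "length \<alpha> \<le> outlen M"
proof -
  from act_instrD[OF assms(2)] obtain \<sigma>' q1 \<alpha>1 e1 q0 \<alpha>0 e0 where
    *: "(p, \<sigma>', q1, \<alpha>1, e1, q0, \<alpha>0, e0) \<in> instrs M"
    "(q, \<alpha>, e) = (if \<sigma> = \<sigma>' then (q1, \<alpha>1, e1) else (q0, \<alpha>0, e0))" by (elim exE conjE)
  have "finite (instrs M)" using assms(1) by (simp add: wf_gsm_def)
  then have "length \<alpha>1 + length \<alpha>0 \<le> outlen M"
    unfolding outlen_def using imageI[OF *(1), of "\<lambda>(p, \<sigma>, q1, \<alpha>1, e1, q0, \<alpha>0, e0). length \<alpha>1 + length \<alpha>0"]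
    by (intro Max_ge) simp_all
  then show ?thesis using *(2) by (simp split: if_splits)
qed

text \<open>The machine that emits one letter per step: \<open>Emit q r\<close> is state \<open>q\<close> after the first \<open>r\<close>
  letters of the output of its instruction.\<close>

datatype ust = Start | Emit nat nat

fun usucc :: "gsm \<Rightarrow> ust \<Rightarrow> tsym \<Rightarrow> (ust \<times> int) option" where
  "usucc M Start \<sigma> = Some (Emit (qin M) 0, 0)"
| "usucc M (Emit q r) \<sigma> = (case act M q \<sigma> of None \<Rightarrow> None
     | Some (q', \<alpha>, e) \<Rightarrow> Some (if r < length \<alpha> then (Emit q (Suc r), 0) else (Emit q' 0, e)))"

text \<open>\<open>ini\<close> is emitted by the initial step: nothing for \<open>nd\<close>, and
  for \<open>ed\<close> the dummy letter \<open>None\<close> of the first output node, since an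
  \<open>ed\<close> graph has one node more than the word has letters. The outer option tells
  whether a letter is emitted, the inner one belongs to the letters.\<close>

fun emit :: "gsm \<Rightarrow> nat option option \<Rightarrow> ust \<Rightarrow> tsym \<Rightarrow> nat option option" where
  "emit M ini Start \<sigma> = ini"
| "emit M ini (Emit q r) \<sigma> = (case act M q \<sigma> of None \<Rightarrow> None
     | Some (q', \<alpha>, e) \<Rightarrow> if r < length \<alpha> then Some (Some (\<alpha> ! r)) else None)"

definition olist :: "'a option \<Rightarrow> 'a list" where
  "olist x = (case x of None \<Rightarrow> [] | Some y \<Rightarrow> [y])"

definition umach where
  "umach M ini s \<sigma> = (case usucc M s \<sigma> of None \<Rightarrow> None | Some (s', e) \<Rightarrow> Some (s', olist (emit M ini s \<sigma>), e))"

lemma umach_sim: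
  assumes "act M q (tp i) = Some (q', \<alpha>, e)" "0 \<le> i" "i \<le> b" "0 \<le> i + e" "i + e \<le> b"
  shows "(mstep (umach M ini) tp b)\<^sup>*\<^sup>* (Emit q 0, i, zs) (Emit q' 0, i + e, zs @ map Some \<alpha>)"
proof -
  have "(mstep (umach M ini) tp b)\<^sup>*\<^sup>* (Emit q 0, i, zs) (Emit q r, i, zs @ map Some (take r \<alpha>))" if "r \<le> length \<alpha>" for r
    using that
  proof (induction r)
    case (Suc r)
    have "mstep (umach M ini) tp b (Emit q r, i, zs @ map Some (take r \<alpha>)) (Emit q (Suc r), i, zs @ map Some (take (Suc r) \<alpha>))"
      by (rule mstepI[where \<alpha> = "[Some (\<alpha> ! r)]" and e = 0])
        (use assms Suc.prems in \<open>simp_all add: umach_def olist_def take_Suc_conv_app_nth\<close>)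
    then show ?case using Suc by simp
  qed simp
  from this[of "length \<alpha>"]
  have "(mstep (umach M ini) tp b)\<^sup>*\<^sup>* (Emit q 0, i, zs) (Emit q (length \<alpha>), i, zs @ map Some \<alpha>)" by simp
  also have "mstep (umach M ini) tp b (Emit q (length \<alpha>), i, zs @ map Some \<alpha>) (Emit q' 0, i + e, zs @ map Some \<alpha>)"
    by (rule mstepI[where \<alpha> = "[]" and e = e]) (use assms in \<open>simp_all add: umach_def olist_def\<close>)
  finally show ?thesis .
qed

lemma mstep_range:
  assumes "(mstep \<delta> tp b)\<^sup>*\<^sup>* (q, i, z) (q', i', z')" "0 \<le> i" "i \<le> b"
  shows "0 \<le> i' \<and> i' \<le> b"
  using assms
proof (induction "(q', i', z')" arbitrary: q' i' z' rule: rtranclp_induct)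
  case (step c)
  then show ?case unfolding mstep_def by auto
qed simp

lemma umach_complete:
  assumes "(mstep (act M) tp b)\<^sup>*\<^sup>* (qin M, 0, []) (q, i, z)" "0 \<le> b"
  shows "(mstep (umach M ini) tp b)\<^sup>*\<^sup>* (Start, 0, []) (Emit q 0, i, olist ini @ map Some z)"
  using assms(1)
proof (induction "(q, i, z)" arbitrary: q i z rule: rtranclp_induct)
  case base
  have "mstep (umach M ini) tp b (Start, 0, []) (Emit (qin M) 0, 0, olist ini)"
    by (rule mstepI[where e = 0]) (use assms(2) in \<open>simp_all add: umach_def\<close>)
  then show ?case by simp
next
  case (step c)
  obtain q1 i1 z1 where c: "c = (q1, i1, z1)" by (cases c)
  from step.hyps(2)[unfolded c] obtain q' \<alpha> e where *: "act M q1 (tp i1) = Some (q', \<alpha>, e)"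
    "(q, i, z) = (q', i1 + e, z1 @ \<alpha>)" "0 \<le> i1 + e" "i1 + e \<le> b" by (rule mstepE)
  have "0 \<le> i1 \<and> i1 \<le> b" using mstep_range[OF step.hyps(1)[unfolded c]] assms(2) by simp
  then have "(mstep (umach M ini) tp b)\<^sup>*\<^sup>* (Emit q1 0, i1, olist ini @ map Some z1)
      (Emit q' 0, i1 + e, (olist ini @ map Some z1) @ map Some \<alpha>)"
    by (intro umach_sim) (use * in auto)
  with step.hyps(3)[OF c] show ?case using *(2) by (simp add: rtranclp_trans)
qed

text \<open>At counter 0 the invariant must not claim that an instruction exists, because the final
  state has none; hence the disjunction.\<close>

lemma umach_sound:
  assumes "(mstep (umach M ini) tp b)\<^sup>*\<^sup>* (Start, 0, []) (s, i, zs)"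
  shows "(s = Start \<and> i = 0 \<and> zs = []) \<or> (\<exists>q r z. s = Emit q r \<and> (mstep (act M) tp b)\<^sup>*\<^sup>* (qin M, 0, []) (q, i, z) \<and>
     (r = 0 \<and> zs = olist ini @ map Some z \<or> (\<exists>q' \<alpha> e. act M q (tp i) = Some (q', \<alpha>, e) \<and> r \<le> length \<alpha> \<and>
        zs = olist ini @ map Some (z @ take r \<alpha>))))"
  using assms
proof (induction "(s, i, zs)" arbitrary: s i zs rule: rtranclp_induct)
  case base
  then show ?case by simp
next
  case (step c)
  obtain s1 i1 z1 where c: "c = (s1, i1, z1)" by (cases c)
  from step.hyps(2)[unfolded c] obtain s' \<beta> d where *: "umach M ini s1 (tp i1) = Some (s', \<beta>, d)"
    "(s, i, zs) = (s', i1 + d, z1 @ \<beta>)" "0 \<le> i1 + d" "i1 + d \<le> b" by (rule mstepE)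
  note IH = step.hyps(3)[OF c]
  show ?case
  proof (cases s1)
    case Start
    then have "s = Emit (qin M) 0" "i = 0" "zs = olist ini" using IH * by (auto simp: umach_def)
    then show ?thesis by (intro disjI2 exI[of _ "qin M"] exI[of _ 0] exI[of _ "[]"]) simp
  next
    case (Emit q r)
    then obtain z where z: "(mstep (act M) tp b)\<^sup>*\<^sup>* (qin M, 0, []) (q, i1, z)"
      and d: "r = 0 \<and> z1 = olist ini @ map Some z \<or> (\<exists>q' \<alpha> e. act M q (tp i1) = Some (q', \<alpha>, e) \<and> r \<le> length \<alpha> \<and>
        z1 = olist ini @ map Some (z @ take r \<alpha>))" using IH by auto
    obtain q' \<alpha> e where a: "act M q (tp i1) = Some (q', \<alpha>, e)"
      using *(1) Emit by (auto simp: umach_def split: option.splits)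
    have z1: "r \<le> length \<alpha>" "z1 = olist ini @ map Some (z @ take r \<alpha>)" using d a by auto
    show ?thesis
    proof (cases "r < length \<alpha>")
      case True
      then have "s = Emit q (Suc r)" "i = i1" "zs = olist ini @ map Some (z @ take (Suc r) \<alpha>)"
        using * a Emit z1 by (auto simp: umach_def olist_def take_Suc_conv_app_nth)
      then show ?thesis using z a True by (intro disjI2 exI[of _ q] exI[of _ "Suc r"] exI[of _ z]) auto
    next
      case False
      then have eq: "s = Emit q' 0" "i = i1 + e" "zs = olist ini @ map Some (z @ \<alpha>)" "d = e"
        using * a Emit z1 by (auto simp: umach_def olist_def)
      have "mstep (act M) tp b (q, i1, z) (q', i1 + e, z @ \<alpha>)"
        by (rule mstepI[where \<alpha> = \<alpha> and e = e]) (use a * eq in simp_all)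
      then have "(mstep (act M) tp b)\<^sup>*\<^sup>* (qin M, 0, []) (q', i1 + e, z @ \<alpha>)" using z by simp
      then show ?thesis using eq by (intro disjI2 exI[of _ q'] exI[of _ 0] exI[of _ "z @ \<alpha>"]) simp
    qed
  qed
qed

lemma umach_iff:
  assumes "wf_gsm M" "0 \<le> b"
  shows "(\<exists>i. (mstep (umach M ini) tp b)\<^sup>*\<^sup>* (Start, 0, []) (Emit (qf M) 0, i, zs)) \<longleftrightarrow>
    (\<exists>i z. zs = olist ini @ map Some z \<and> (mstep (act M) tp b)\<^sup>*\<^sup>* (qin M, 0, []) (qf M, i, z))"
proof
  assume "\<exists>i. (mstep (umach M ini) tp b)\<^sup>*\<^sup>* (Start, 0, []) (Emit (qf M) 0, i, zs)"
  then obtain i where "(mstep (umach M ini) tp b)\<^sup>*\<^sup>* (Start, 0, []) (Emit (qf M) 0, i, zs)" by blast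
  from umach_sound[OF this] obtain z where z: "(mstep (act M) tp b)\<^sup>*\<^sup>* (qin M, 0, []) (qf M, i, z)"
    "zs = olist ini @ map Some z"
    using act_wf(3)[OF assms(1)] by auto
  then show "\<exists>i z. zs = olist ini @ map Some z \<and> (mstep (act M) tp b)\<^sup>*\<^sup>* (qin M, 0, []) (qf M, i, z)" by blast
next
  assume "\<exists>i z. zs = olist ini @ map Some z \<and> (mstep (act M) tp b)\<^sup>*\<^sup>* (qin M, 0, []) (qf M, i, z)"
  then show "\<exists>i. (mstep (umach M ini) tp b)\<^sup>*\<^sup>* (Start, 0, []) (Emit (qf M) 0, i, zs)"
    using umach_complete[OF _ assms(2)] by blast
qed

section \<open>Maximal runs of a deterministic relation and their emitting configurations\<close>

lemma adj_Nil [simp]: "adj [] = {}"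
  by (simp add: adj_def)

inductive det_run :: "('x \<Rightarrow> 'x \<Rightarrow> bool) \<Rightarrow> 'x list \<Rightarrow> bool" for \<rho> where
  det_run_last: "(\<And>y. \<not> \<rho> x y) \<Longrightarrow> det_run \<rho> [x]"
| det_run_Cons: "\<rho> x y \<Longrightarrow> det_run \<rho> (y # ks) \<Longrightarrow> det_run \<rho> (x # y # ks)"

text \<open>Only the configuration that is left has to be silent, so a silent path may end in an
  emitting configuration but cannot pass it.\<close>

definition silent :: "('x \<Rightarrow> 'x \<Rightarrow> bool) \<Rightarrow> ('x \<Rightarrow> 'l option) \<Rightarrow> 'x \<Rightarrow> 'x \<Rightarrow> bool" where
  "silent \<rho> em x y \<longleftrightarrow> em x = None \<and> \<rho> x y"

locale det_rel =
  fixes \<rho> :: "'x \<Rightarrow> 'x \<Rightarrow> bool" and em :: "'x \<Rightarrow> 'l option"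
  assumes det: "\<rho> x y \<Longrightarrow> \<rho> x y' \<Longrightarrow> y = y'"
begin

lemma det_run_reach: "det_run \<rho> ks \<Longrightarrow> \<rho>\<^sup>*\<^sup>* (hd ks) y \<longleftrightarrow> y \<in> set ks"
proof (induction rule: det_run.induct)
  case (det_run_last x)
  then show ?case by (auto elim: converse_rtranclpE)
next
  case (det_run_Cons x y' ks)
  have "\<rho>\<^sup>*\<^sup>* x y \<longleftrightarrow> y = x \<or> \<rho>\<^sup>*\<^sup>* y' y"
  proof
    assume "\<rho>\<^sup>*\<^sup>* x y"
    then show "y = x \<or> \<rho>\<^sup>*\<^sup>* y' y"
      by (cases rule: converse_rtranclpE) (use det[OF det_run_Cons.hyps(1)] in auto)
  next
    assume "y = x \<or> \<rho>\<^sup>*\<^sup>* y' y"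
    then show "\<rho>\<^sup>*\<^sup>* x y" using det_run_Cons.hyps(1) by (auto intro: converse_rtranclp_into_rtranclp)
  qed
  then show ?case using det_run_Cons.IH by simp
qed

lemma det_run_unique: "det_run \<rho> ks \<Longrightarrow> det_run \<rho> ks' \<Longrightarrow> hd ks = hd ks' \<Longrightarrow> ks = ks'"
proof (induction arbitrary: ks' rule: det_run.induct)
  case (det_run_last x)
  from det_run_last(2) show ?case using det_run_last(1,3) by cases auto
next
  case (det_run_Cons x y ks)
  from det_run_Cons(4) show ?case
  proof cases
    case (det_run_last x')
    then show ?thesis using det_run_Cons by auto
  next
    case (det_run_Cons x' y' ks'')
    then show ?thesis using det_run_Cons.hyps det_run_Cons.IH[of "y' # ks''"] det_run_Cons.prems det by auto
  qed
qed

lemma det_run_suffix: "det_run \<rho> ks \<Longrightarrow> x \<in> set ks \<Longrightarrow> \<exists>ks'. det_run \<rho> ks' \<and> hd ks' = x \<and> length ks' \<le> length ks"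
proof (induction rule: det_run.induct)
  case (det_run_last y)
  then show ?case by (auto intro!: exI[of _ "[y]"] det_run.det_run_last)
next
  case (det_run_Cons y y' ks)
  show ?case
  proof (cases "x = y")
    case True
    then show ?thesis using det_run.det_run_Cons[OF det_run_Cons.hyps] by (intro exI[of _ "y # y' # ks"]) simp
  next
    case False
    then show ?thesis using det_run_Cons by (auto intro: le_SucI)
  qed
qed

text \<open>If a configuration recurred, the run from its second visit on would be a shorter maximal
  run from the same configuration, contradicting uniqueness.\<close>

lemma det_run_distinct: "det_run \<rho> ks \<Longrightarrow> distinct ks"
proof (induction rule: det_run.induct)
  case (det_run_Cons x y ks)
  have "x \<notin> set (y # ks)"
  proof
    assume "x \<in> set (y # ks)"
    then obtain ks' where ks': "det_run \<rho> ks'" "hd ks' = x" "length ks' \<le> length (y # ks)"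
      using det_run_suffix[OF det_run_Cons.hyps(2)] by blast
    have "ks' = x # y # ks"
      by (rule det_run_unique[OF ks'(1) det_run.det_run_Cons[OF det_run_Cons.hyps]]) (simp add: ks'(2))
    then show False using ks'(3) by simp
  qed
  then show ?case using det_run_Cons.IH by simp
qed simp

lemma det_run_exists:
  assumes "\<rho>\<^sup>*\<^sup>* x t" "\<And>y. \<not> \<rho> t y"
  shows "\<exists>ks. det_run \<rho> ks \<and> hd ks = x \<and> last ks = t"
  using assms(1)
proof (induction rule: converse_rtranclp_induct)
  case base
  have "det_run \<rho> [t]" by (rule det_run_last) (rule assms(2))
  then show ?case by (intro exI[of _ "[t]"]) simp
next
  case (step x y)
  then obtain ks where ks: "det_run \<rho> ks" "hd ks = y" "last ks = t" by blast
  then obtain ks' where "ks = y # ks'" by (cases ks) (auto elim: det_run.cases)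
  then show ?case using ks step(1) by (intro exI[of _ "x # ks"]) (auto intro: det_run_Cons)
qed

abbreviation "emits \<equiv> filter (\<lambda>x. em x \<noteq> None)"

text \<open>Determinism leaves one way to go, and it ends at the first emitting configuration. This
  turns a reachability property, which is definable, into a property of the list of the run.\<close>

lemma silent_reach: "det_run \<rho> ks \<Longrightarrow> em y \<noteq> None \<Longrightarrow>
    (silent \<rho> em)\<^sup>*\<^sup>* (hd ks) y \<longleftrightarrow> emits ks \<noteq> [] \<and> y = hd (emits ks)"
proof (induction rule: det_run.induct)
  case (det_run_last x)
  then have "(silent \<rho> em)\<^sup>*\<^sup>* x y \<longleftrightarrow> x = y"
    by (auto simp: silent_def elim: converse_rtranclpE)
  then show ?case using det_run_last by auto
next
  case (det_run_Cons x y' ks)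
  show ?case
  proof (cases "em x")
    case None
    have "(silent \<rho> em)\<^sup>*\<^sup>* x y \<longleftrightarrow> (silent \<rho> em)\<^sup>*\<^sup>* y' y"
    proof
      assume "(silent \<rho> em)\<^sup>*\<^sup>* x y"
      then show "(silent \<rho> em)\<^sup>*\<^sup>* y' y"
        by (cases rule: converse_rtranclpE) (use None det_run_Cons det in \<open>auto simp: silent_def\<close>)
    next
      have "silent \<rho> em x y'" using None det_run_Cons by (simp add: silent_def)
      then show "(silent \<rho> em)\<^sup>*\<^sup>* y' y \<Longrightarrow> (silent \<rho> em)\<^sup>*\<^sup>* x y" by (rule converse_rtranclp_into_rtranclp)
    qed
    then show ?thesis using det_run_Cons None by simp
  next
    case (Some l)
    then have "(silent \<rho> em)\<^sup>*\<^sup>* x y \<longleftrightarrow> x = y"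
      by (auto simp: silent_def elim: converse_rtranclpE)
    then show ?thesis using Some by auto
  qed
qed

text \<open>One step out of an emitting configuration followed by silent steps arrives at the next
  emitting one. As the run has no repetitions, \<open>x\<close> occurs once and has only one
  neighbour to its right.\<close>

lemma emit_edges: "det_run \<rho> ks \<Longrightarrow> x \<in> set (emits ks) \<Longrightarrow> em y \<noteq> None \<Longrightarrow>
    (\<exists>x'. \<rho> x x' \<and> (silent \<rho> em)\<^sup>*\<^sup>* x' y) \<longleftrightarrow> (x, y) \<in> adj (emits ks)"
proof (induction rule: det_run.induct)
  case (det_run_last z)
  then show ?case by (auto simp: adj_def)
next
  case (det_run_Cons z z' ks)
  have dist: "z \<notin> set (z' # ks)"
    using det_run_distinct[OF det_run.det_run_Cons[OF det_run_Cons.hyps]] by simp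
  show ?case
  proof (cases "x = z")
    case True
    have z: "em z \<noteq> None" using det_run_Cons.prems(1) True unfolding set_filter by blast
    have "(\<exists>x'. \<rho> x x' \<and> (silent \<rho> em)\<^sup>*\<^sup>* x' y) \<longleftrightarrow> (silent \<rho> em)\<^sup>*\<^sup>* z' y"
      using True det_run_Cons.hyps(1) det by blast
    also have "\<dots> \<longleftrightarrow> emits (z' # ks) \<noteq> [] \<and> y = hd (emits (z' # ks))"
      using silent_reach[OF det_run_Cons.hyps(2) det_run_Cons.prems(2)] by simp
    also have "\<dots> \<longleftrightarrow> (x, y) \<in> adj (emits (z # z' # ks))"
    proof -
      have "(z, y) \<notin> adj (emits (z' # ks))"
      proof
        assume "(z, y) \<in> adj (emits (z' # ks))"
        then have "z \<in> set (emits (z' # ks))" unfolding adj_def using Suc_lessD nth_mem by blast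
        then show False using dist unfolding set_filter by blast
      qed
      moreover have "emits (z # z' # ks) = z # emits (z' # ks)" using z by simp
      ultimately show ?thesis using True by (simp add: adj_Cons del: filter.simps)
    qed
    finally show ?thesis .
  next
    case False
    then have x: "x \<in> set (emits (z' # ks))" using det_run_Cons.prems(1) unfolding set_filter by auto
    have "(x, y) \<in> adj (emits (z' # ks)) \<longleftrightarrow> (x, y) \<in> adj (emits (z # z' # ks))"
    proof (cases "em z")
      case None
      then show ?thesis by simp
    next
      case (Some l)
      then have "emits (z # z' # ks) = z # emits (z' # ks)" by simp
      then show ?thesis using False x by (auto simp: adj_Cons simp del: filter.simps)
    qed
    then show ?thesis using det_run_Cons.IH[OF x det_run_Cons.prems(2)] by simp
  qed
qed

end

section \<open>Invariance under graph isomorphism\<close>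

definition is_iso :: "('a \<Rightarrow> 'b) \<Rightarrow> 'a graph \<Rightarrow> 'b graph \<Rightarrow> bool" where
  "is_iso f g h \<longleftrightarrow> bij_betw f (gV g) (gV h) \<and> (\<forall>v\<in>gV g. glab h (f v) = glab g v)
     \<and> gE h = (\<lambda>(u, a, v). (f u, a, f v)) ` gE g"

lemma graph_iso_iff: "graph_iso g h \<longleftrightarrow> (\<exists>f. is_iso f g h)"
  unfolding graph_iso_def is_iso_def ..

text \<open>An isomorphism is constrained on nodes only, so edges can be reflected only if their
  endpoints are nodes.\<close>

definition closed_graph :: "'v graph \<Rightarrow> bool" where
  "closed_graph g \<longleftrightarrow> gE g \<subseteq> gV g \<times> UNIV \<times> gV g"

lemma closed_out_graph: "closed_graph (out_graph T g P)"
  unfolding closed_graph_def by (rule gE_out_graph_sub)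

lemma iso_edge:
  assumes "is_iso f g h" "closed_graph g" "u \<in> gV g" "v \<in> gV g"
  shows "(f u, a, f v) \<in> gE h \<longleftrightarrow> (u, a, v) \<in> gE g"
proof
  have inj: "inj_on f (gV g)" using assms(1) by (simp add: is_iso_def bij_betw_def)
  assume "(f u, a, f v) \<in> gE h"
  then obtain u' v' where e: "(u', a, v') \<in> gE g" "f u = f u'" "f v = f v'"
    using assms(1) by (auto simp: is_iso_def)
  then have "u' \<in> gV g" "v' \<in> gV g" using assms(2) by (auto simp: closed_graph_def)
  then have "u = u'" "v = v'" using e inj assms(3,4) by (auto dest: inj_onD)
  then show "(u, a, v) \<in> gE g" using e by simp
next
  assume "(u, a, v) \<in> gE g"
  then show "(f u, a, f v) \<in> gE h" using assms(1) by (force simp: is_iso_def)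
qed

text \<open>Set variables have to denote sets of nodes: \<open>f\<close> is injective there, which
  is what reflects membership.\<close>

lemma sat_iso:
  assumes "is_iso f g h" "closed_graph g" "\<forall>x\<in>fvn \<phi>. n x \<in> gV g" "\<forall>X. s X \<subseteq> gV g"
  shows "sat h (\<lambda>x. f (n x)) (\<lambda>X. f ` s X) \<phi> \<longleftrightarrow> sat g n s \<phi>"
  using assms(3,4)
proof (induction \<phi> arbitrary: n s)
  case (Lab \<sigma> x)
  then show ?case using assms(1) by (simp add: is_iso_def)
next
  case (Edg \<gamma> x y)
  then show ?case using iso_edge[OF assms(1,2)] by simp
next
  case (Eq x y)
  then show ?case using assms(1) by (auto simp: is_iso_def bij_betw_def dest: inj_onD)
next
  case (Mem x X)
  have inj: "inj_on f (gV g)" using assms(1) by (simp add: is_iso_def bij_betw_def)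
  have "n x \<in> gV g" "s X \<subseteq> gV g" using Mem by simp_all
  then have "f (n x) \<in> f ` s X \<longleftrightarrow> n x \<in> s X" by (rule inj_on_image_mem_iff[OF inj])
  then show ?case by simp
next
  case (Neg \<phi>)
  then show ?case by simp
next
  case (Conj \<phi> \<psi>)
  have "sat h (\<lambda>x. f (n x)) (\<lambda>X. f ` s X) \<phi> \<longleftrightarrow> sat g n s \<phi>" by (rule Conj.IH) (use Conj.prems in auto)
  moreover have "sat h (\<lambda>x. f (n x)) (\<lambda>X. f ` s X) \<psi> \<longleftrightarrow> sat g n s \<psi>" by (rule Conj.IH) (use Conj.prems in auto)
  ultimately show ?case by simp
next
  case (ExN x \<phi>)
  have V: "gV h = f ` gV g" using assms(1) by (simp add: is_iso_def bij_betw_def)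
  have "sat h ((\<lambda>y. f (n y))(x := f v)) (\<lambda>X. f ` s X) \<phi> \<longleftrightarrow> sat g (n(x := v)) s \<phi>" if "v \<in> gV g" for v
  proof -
    have "(\<lambda>y. f (n y))(x := f v) = (\<lambda>y. f ((n(x := v)) y))" by (rule HOL.ext) simp
    moreover have "sat h (\<lambda>y. f ((n(x := v)) y)) (\<lambda>X. f ` s X) \<phi> \<longleftrightarrow> sat g (n(x := v)) s \<phi>"
      by (rule ExN.IH) (use ExN.prems that in auto)
    ultimately show ?thesis by simp
  qed
  then show ?case unfolding sat.simps V by blast
next
  case (ExS X \<phi>)
  have V: "gV h = f ` gV g" using assms(1) by (simp add: is_iso_def bij_betw_def)
  have *: "sat h (\<lambda>x. f (n x)) ((\<lambda>Y. f ` s Y)(X := f ` S)) \<phi> \<longleftrightarrow> sat g n (s(X := S)) \<phi>" if "S \<subseteq> gV g" for S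
  proof -
    have "(\<lambda>Y. f ` s Y)(X := f ` S) = (\<lambda>Y. f ` (s(X := S)) Y)" by (rule HOL.ext) simp
    moreover have "sat h (\<lambda>x. f (n x)) (\<lambda>Y. f ` (s(X := S)) Y) \<phi> \<longleftrightarrow> sat g n (s(X := S)) \<phi>"
      by (rule ExS.IH) (use ExS.prems that in auto)
    ultimately show ?thesis by simp
  qed
  show ?case unfolding sat.simps V
  proof
    assume "\<exists>S\<subseteq>f ` gV g. sat h (\<lambda>x. f (n x)) ((\<lambda>X. f ` s X)(X := S)) \<phi>"
    then obtain S' where "S' \<subseteq> gV g" "sat h (\<lambda>x. f (n x)) ((\<lambda>X. f ` s X)(X := f ` S')) \<phi>"
      by (auto simp: subset_image_iff)
    then show "\<exists>S\<subseteq>gV g. sat g n (s(X := S)) \<phi>" using * by blast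
  next
    assume "\<exists>S\<subseteq>gV g. sat g n (s(X := S)) \<phi>"
    then show "\<exists>S\<subseteq>f ` gV g. sat h (\<lambda>x. f (n x)) ((\<lambda>X. f ` s X)(X := S)) \<phi>" using * by (meson image_mono)
  qed
qed

text \<open>Reduces an arbitrary input graph to the standard representation of a word, on which the
  machine formulas are analysed.\<close>

lemma outputs_iso:
  assumes "is_iso f g g'" "closed_graph g" "wf_trans T" "\<forall>X. P X \<subseteq> gV g"
  shows "is_iso (\<lambda>(u, c). (f u, c)) (out_graph T g P) (out_graph T g' (\<lambda>X. f ` P X))" (is ?iso)
    and "sat g' n' (\<lambda>X. f ` P X) (tdom T) \<longleftrightarrow> sat g n P (tdom T)"
proof -
  let ?P = "\<lambda>X. f ` P X" and ?F = "\<lambda>(u, c :: nat). (f u, c)"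
  have inj: "inj_on f (gV g)" and V: "gV g' = f ` gV g" using assms(1) by (simp_all add: is_iso_def bij_betw_def)
  have nd: "sat g' (\<lambda>_. f u) ?P (nodef T c \<sigma>) \<longleftrightarrow> sat g (\<lambda>_. u) P (nodef T c \<sigma>)"
    if "u \<in> gV g" for u c \<sigma>
    using sat_iso[OF assms(1,2), of "nodef T c \<sigma>" "\<lambda>_. u" P] that assms(4) by simp
  have N: "(f u, c) \<in> out_nodes T g' ?P \<longleftrightarrow> (u, c) \<in> out_nodes T g P" if "u \<in> gV g" for u c
    unfolding out_nodes_iff using nd[OF that] that V by simp
  have ed: "sat g' ((\<lambda>_. f u)(1 := f v)) ?P (edgef T c c' \<gamma>) \<longleftrightarrow> sat g ((\<lambda>_. u)(1 := v)) P (edgef T c c' \<gamma>)"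
    if "u \<in> gV g" "v \<in> gV g" for u v c c' \<gamma>
  proof -
    have eq: "(\<lambda>_. f u)(1 := f v) = (\<lambda>x. f (((\<lambda>_. u)(1 := v)) x))" by (rule HOL.ext) simp
    show ?thesis unfolding eq by (rule sat_iso[OF assms(1,2)]) (use that assms(4) in auto)
  qed
  have subV: "u \<in> gV g" if "(u, c) \<in> out_nodes T g P" for u c using that by (simp add: out_nodes_iff)
  have img: "out_nodes T g' ?P = ?F ` out_nodes T g P"
  proof (intro equalityI subsetI)
    fix p assume p: "p \<in> out_nodes T g' ?P"
    obtain u' c where uc: "p = (u', c)" by (cases p)
    have "u' \<in> gV g'" using p uc by (simp add: out_nodes_iff)
    then obtain u where u: "u \<in> gV g" "u' = f u" unfolding V by blast
    then have "(u, c) \<in> out_nodes T g P" using N p uc by blast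
    then show "p \<in> ?F ` out_nodes T g P" using uc u by force
  next
    fix p assume "p \<in> ?F ` out_nodes T g P"
    then show "p \<in> out_nodes T g' ?P" using N subV by auto
  qed
  have "inj_on ?F (out_nodes T g P)"
    using inj subV by (auto simp: inj_on_def)
  then have 1: "bij_betw ?F (gV (out_graph T g P)) (gV (out_graph T g' ?P))"
    using img by (simp add: bij_betw_def)
  have 2: "glab (out_graph T g' ?P) (?F p) = glab (out_graph T g P) p" if "p \<in> gV (out_graph T g P)" for p
  proof -
    obtain u c where uc: "p = (u, c)" by (cases p)
    have "u \<in> gV g" using that uc subV by simp
    then show ?thesis unfolding uc prod.case glab_out_graph using nd by simp
  qed
  have 3: "gE (out_graph T g' ?P) = (\<lambda>(p, a, q). (?F p, a, ?F q)) ` gE (out_graph T g P)"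
  proof (intro equalityI subsetI)
    fix e assume e: "e \<in> gE (out_graph T g' ?P)"
    obtain u' c a v' c' where eq: "e = ((u', c), a, (v', c'))" by (metis prod.exhaust)
    note E = e[unfolded eq gE_out_graph]
    then obtain p q where pq: "p \<in> out_nodes T g P" "q \<in> out_nodes T g P" "(u', c) = ?F p" "(v', c') = ?F q"
      unfolding img by blast
    obtain u v where uv: "p = (u, c)" "q = (v, c')" "u' = f u" "v' = f v" using pq(3,4) by (cases p; cases q) simp
    then have "((u, c), a, (v, c')) \<in> gE (out_graph T g P)"
      unfolding gE_out_graph using E ed[of u v] pq subV by auto
    then show "e \<in> (\<lambda>(p, a, q). (?F p, a, ?F q)) ` gE (out_graph T g P)"
      unfolding eq uv(3,4) by (rule rev_image_eqI) simp
  next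
    fix e assume "e \<in> (\<lambda>(p, a, q). (?F p, a, ?F q)) ` gE (out_graph T g P)"
    then obtain p a q where pq: "(p, a, q) \<in> gE (out_graph T g P)" "e = (?F p, a, ?F q)" by auto
    obtain u c v c' where eq: "p = (u, c)" "q = (v, c')" by (metis prod.exhaust)
    note E = pq(1)[unfolded eq gE_out_graph]
    then have "u \<in> gV g" "v \<in> gV g" using subV by auto
    then show "e \<in> gE (out_graph T g' ?P)"
      unfolding pq(2) eq prod.case gE_out_graph using E ed[of u v] N by simp
  qed
  show ?iso unfolding is_iso_def using 1 2 3 by blast
  show "sat g' n' ?P (tdom T) \<longleftrightarrow> sat g n P (tdom T)"
    using sat_iso[OF assms(1,2), of "tdom T" n P] assms(4) fvn_T(1)[OF assms(3)]
      tdom_env[OF assms(3), of g' n' ?P "\<lambda>x. f (n x)"] by simp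
qed

lemma graph_iso_trans: "graph_iso g h \<Longrightarrow> graph_iso h k \<Longrightarrow> graph_iso g k"
proof -
  assume "graph_iso g h" "graph_iso h k"
  then obtain f f' where f: "is_iso f g h" "is_iso f' h k" unfolding graph_iso_iff by blast
  have "is_iso (f' \<circ> f) g k"
    unfolding is_iso_def
  proof (intro conjI ballI)
    show "bij_betw (f' \<circ> f) (gV g) (gV k)" using f bij_betw_trans by (auto simp: is_iso_def)
    show "glab k ((f' \<circ> f) v) = glab g v" if "v \<in> gV g" for v
    proof -
      have "f v \<in> gV h" using f(1) that unfolding is_iso_def bij_betw_def by blast
      then show ?thesis using f that by (simp add: is_iso_def)
    qed
    have "gE k = (\<lambda>(u, a, v). (f' u, a, f' v)) ` (\<lambda>(u, a, v). (f u, a, f v)) ` gE g"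
      using f by (simp add: is_iso_def)
    then show "gE k = (\<lambda>(u, a, v). ((f' \<circ> f) u, a, (f' \<circ> f) v)) ` gE g"
      unfolding image_image by (simp add: case_prod_beta)
  qed
  then show ?thesis unfolding graph_iso_iff by blast
qed

lemma path_iso_word:
  assumes "is_path h v \<gamma> (length ws)" "word_graph lab inc ws r"
    "\<And>i. i < length ws \<Longrightarrow> glab h (v i) = lab (ws ! i)"
    "\<And>i. Suc i < length ws \<Longrightarrow> \<gamma> i = inc (ws ! Suc i)"
  shows "graph_iso h r"
proof -
  let ?n = "length ws"
  have V: "gV h = v ` {..<?n}" "inj_on v {..<?n}" and E: "gE h = {(v i, \<gamma> i, v (Suc i)) | i. Suc i < ?n}"
    using assms(1) by (auto simp: is_path_def)
  define f where "f = inv_into {..<?n} v"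
  have fv: "f (v i) = i" if "i < ?n" for i unfolding f_def using V(2) that by (simp add: inv_into_f_f)
  have "bij_betw f (gV h) {..<?n}" unfolding f_def unfolding V(1)
    by (rule bij_betw_inv_into[OF inj_on_imp_bij_betw[OF V(2)]])
  moreover have "gV r = {..<?n}" using assms(2) by (auto simp: word_graph_def)
  moreover have "glab r (f x) = glab h x" if "x \<in> gV h" for x
    using that V(1) fv assms(2,3) by (auto simp: word_graph_def)
  moreover have "gE r = (\<lambda>(u, a, v). (f u, a, f v)) ` gE h"
  proof -
    have "(\<lambda>(u, a, v). (f u, a, f v)) ` gE h = {(f (v i), \<gamma> i, f (v (Suc i))) | i. Suc i < ?n}"
      unfolding E setcompr_eq_image image_image by simp
    also have "\<dots> = {(i, inc (ws ! Suc i), Suc i) | i. Suc i < ?n}"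
      using fv assms(4) by (metis (no_types, lifting) Suc_lessD)
    finally show ?thesis using assms(2) by (simp add: word_graph_def)
  qed
  ultimately show ?thesis unfolding graph_iso_def by metis
qed

section \<open>Definable reachability and word graphs\<close>

text \<open>Conditions that do not depend on the graph, such as offsets and lengths of blocks, are
  decided when the formula is built.\<close>

definition ifF :: "bool \<Rightarrow> mso \<Rightarrow> mso" where
  "ifF c \<phi> = (if c then \<phi> else FF)"

lemma sat_ifF [simp]: "sat g n s (ifF c \<phi>) \<longleftrightarrow> c \<and> sat g n s \<phi>"
  by (simp add: ifF_def)

definition allS :: "nat list \<Rightarrow> mso \<Rightarrow> mso" where
  "allS Xs \<phi> = Neg (foldr ExS Xs (Neg \<phi>))"

lemma sat_exS: "sat g n s (foldr ExS Xs \<phi>) \<longleftrightarrow>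
    (\<exists>s'. (\<forall>X. X \<notin> set Xs \<longrightarrow> s' X = s X) \<and> (\<forall>X\<in>set Xs. s' X \<subseteq> gV g) \<and> sat g n s' \<phi>)"
proof (induction Xs arbitrary: s)
  case Nil
  have "(\<forall>X. s' X = s X) \<longleftrightarrow> s' = s" for s' by auto
  then show ?case by auto
next
  case (Cons X Xs)
  have "sat g n s (foldr ExS (X # Xs) \<phi>) \<longleftrightarrow> (\<exists>S\<subseteq>gV g. \<exists>s'. (\<forall>Y. Y \<notin> set Xs \<longrightarrow> s' Y = (s(X := S)) Y) \<and>
      (\<forall>Y\<in>set Xs. s' Y \<subseteq> gV g) \<and> sat g n s' \<phi>)"
    using Cons.IH by simp
  also have "\<dots> \<longleftrightarrow> (\<exists>s'. (\<forall>Y. Y \<notin> set (X # Xs) \<longrightarrow> s' Y = s Y) \<and> (\<forall>Y\<in>set (X # Xs). s' Y \<subseteq> gV g) \<and> sat g n s' \<phi>)"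
    (is "?L \<longleftrightarrow> ?R")
  proof
    assume ?L
    then obtain S s' where *: "S \<subseteq> gV g" "\<forall>Y. Y \<notin> set Xs \<longrightarrow> s' Y = (s(X := S)) Y"
      "\<forall>Y\<in>set Xs. s' Y \<subseteq> gV g" "sat g n s' \<phi>" by (elim exE conjE)
    have "s' X \<subseteq> gV g" using *(1-3) by (cases "X \<in> set Xs") simp_all
    moreover have "\<forall>Y. Y \<notin> set (X # Xs) \<longrightarrow> s' Y = s Y" using *(2) by simp
    ultimately have "(\<forall>Y. Y \<notin> set (X # Xs) \<longrightarrow> s' Y = s Y) \<and> (\<forall>Y\<in>set (X # Xs). s' Y \<subseteq> gV g) \<and> sat g n s' \<phi>"
      using *(3,4) by simp
    then show ?R by (rule exI[of _ s'])
  next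
    assume ?R
    then obtain s' where *: "\<forall>Y. Y \<notin> set (X # Xs) \<longrightarrow> s' Y = s Y" "\<forall>Y\<in>set (X # Xs). s' Y \<subseteq> gV g" "sat g n s' \<phi>"
      by (elim exE conjE)
    have "s' X \<subseteq> gV g" "\<forall>Y. Y \<notin> set Xs \<longrightarrow> s' Y = (s(X := s' X)) Y" "\<forall>Y\<in>set Xs. s' Y \<subseteq> gV g"
      using *(1,2) by simp_all
    then show ?L using *(3) by (intro exI[of _ "s' X"] conjI exI[of _ s'])
  qed
  finally show ?case .
qed

lemma fvn_exS: "fvn (foldr ExS Xs \<phi>) = fvn \<phi>" and fvs_exS: "fvs (foldr ExS Xs \<phi>) = fvs \<phi> - set Xs"
  by (induction Xs) auto

lemma sat_allS: "sat g n s (allS Xs \<phi>) \<longleftrightarrow>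
    (\<forall>s'. (\<forall>X. X \<notin> set Xs \<longrightarrow> s' X = s X) \<and> (\<forall>X\<in>set Xs. s' X \<subseteq> gV g) \<longrightarrow> sat g n s' \<phi>)"
  unfolding allS_def sat.simps sat_exS by (simp only: not_ex de_Morgan_conj not_not) (simp only: imp_conv_disj de_Morgan_conj disj_assoc)

lemma fvn_allS: "fvn (allS Xs \<phi>) = fvn \<phi>" and fvs_allS: "fvs (allS Xs \<phi>) = fvs \<phi> - set Xs"
  by (simp_all add: allS_def fvn_exS fvs_exS)

text \<open>Definable reachability: \<open>(u, c)\<close> reaches \<open>(v, d)\<close> iff \<open>v\<close> lies in the component \<open>d\<close> of every
  family of node sets, indexed by the finite set \<open>C\<close>, that is closed under steps and has \<open>u\<close> in
  component \<open>c\<close>.\<close>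

locale reach_formula =
  fixes C :: "'c set" and ixc :: "'c \<Rightarrow> nat" and np :: nat
  assumes finC: "finite C" and injC: "inj_on ixc C"
begin

text \<open>The quantified set variables start at \<open>np\<close>, above the parameters, so that
  no parameter is captured.\<close>

definition SV :: "'c \<Rightarrow> nat" where "SV c = np + ixc c"

definition closedF :: "('c \<Rightarrow> 'c \<Rightarrow> nat \<Rightarrow> nat \<Rightarrow> mso) \<Rightarrow> mso" where
  "closedF D = Neg (ExN 2 (ExN 3 (OrS (C \<times> C) (\<lambda>(d, d'). Conj (Mem 2 (SV d)) (Conj (D d d' 2 3) (Neg (Mem 3 (SV d'))))))))"

definition reachF :: "('c \<Rightarrow> 'c \<Rightarrow> nat \<Rightarrow> nat \<Rightarrow> mso) \<Rightarrow> 'c \<Rightarrow> 'c \<Rightarrow> nat \<Rightarrow> nat \<Rightarrow> mso" where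
  "reachF D c c' x y = allS (SOME xs. set xs = SV ` C) (Or (Neg (Conj (closedF D) (Mem x (SV c)))) (Mem y (SV c')))"

lemma set_SV: "set (SOME xs. set xs = SV ` C) = SV ` C"
  using finC by (intro some_list) simp

lemma SV_inj: "c \<in> C \<Longrightarrow> c' \<in> C \<Longrightarrow> SV c = SV c' \<longleftrightarrow> c = c'"
  using injC by (auto simp: SV_def inj_on_def)

lemma fvn_reachF:
  assumes "\<And>d d'. d \<in> C \<Longrightarrow> d' \<in> C \<Longrightarrow> fvn (D d d' 2 3) \<subseteq> {2, 3}"
  shows "fvn (reachF D c c' x y) \<subseteq> {x, y}"
proof -
  have "fvn (closedF D) = {}" unfolding closedF_def using finC assms by fastforce
  then show ?thesis by (simp add: reachF_def fvn_allS)
qed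

lemma fvs_reachF:
  assumes "\<And>d d'. d \<in> C \<Longrightarrow> d' \<in> C \<Longrightarrow> fvs (D d d' 2 3) \<subseteq> {..<np}" "c \<in> C" "c' \<in> C"
  shows "fvs (reachF D c c' x y) \<subseteq> {..<np}"
proof -
  have "fvs (closedF D) \<subseteq> SV ` C \<union> {..<np}" unfolding closedF_def using finC assms(1) by fastforce
  then show ?thesis using assms(2,3) by (auto simp: reachF_def fvs_allS set_SV)
qed

text \<open>\<open>D\<close> is evaluated inside the set quantifiers, so it has to define the step
  relation under every valuation that agrees with \<open>s\<close> below \<open>np\<close>.\<close>

lemma sat_reachF:
  fixes \<rho> :: "'v \<times> 'c \<Rightarrow> 'v \<times> 'c \<Rightarrow> bool"
  assumes D: "\<And>d d' n s'. \<lbrakk>d \<in> C; d' \<in> C; n 2 \<in> gV g; n 3 \<in> gV g; \<And>X. X < np \<Longrightarrow> s' X = s X\<rbrakk> \<Longrightarrow>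
      sat g n s' (D d d' 2 3) \<longleftrightarrow> \<rho> (n 2, d) (n 3, d')"
    and \<rho>: "\<And>u d v d'. \<rho> (u, d) (v, d') \<Longrightarrow> u \<in> gV g \<and> v \<in> gV g \<and> d \<in> C \<and> d' \<in> C"
    and c: "c \<in> C" "c' \<in> C" "n x \<in> gV g" "n y \<in> gV g"
  shows "sat g n s (reachF D c c' x y) \<longleftrightarrow> \<rho>\<^sup>*\<^sup>* (n x, c) (n y, c')"
proof -
  have np: "X \<notin> SV ` C" if "X < np" for X using that by (auto simp: SV_def)
  have closed: "sat g n' s' (closedF D) \<longleftrightarrow> (\<forall>u d v d'. \<rho> (u, d) (v, d') \<longrightarrow> u \<in> s' (SV d) \<longrightarrow> v \<in> s' (SV d'))"
    if s': "\<forall>X. X \<notin> SV ` C \<longrightarrow> s' X = s X" for n' s'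
  proof -
    have Ds: "sat g (n'(2 := u, 3 := v)) s' (D d d' 2 3) \<longleftrightarrow> \<rho> (u, d) (v, d')"
      if "u \<in> gV g" "v \<in> gV g" "d \<in> C" "d' \<in> C" for u v d d'
      using D[of d d' "n'(2 := u, 3 := v)" s'] that s' np by simp
    have "sat g n' s' (closedF D) \<longleftrightarrow> \<not> (\<exists>u\<in>gV g. \<exists>v\<in>gV g. \<exists>d\<in>C. \<exists>d'\<in>C. u \<in> s' (SV d) \<and>
        sat g (n'(2 := u, 3 := v)) s' (D d d' 2 3) \<and> v \<notin> s' (SV d'))"
      unfolding closedF_def using finC by simp
    also have "\<dots> \<longleftrightarrow> \<not> (\<exists>u\<in>gV g. \<exists>v\<in>gV g. \<exists>d\<in>C. \<exists>d'\<in>C. u \<in> s' (SV d) \<and> \<rho> (u, d) (v, d') \<and> v \<notin> s' (SV d'))"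
      using Ds by (intro arg_cong[where f = Not] bex_cong refl) simp
    also have "\<dots> \<longleftrightarrow> (\<forall>u d v d'. \<rho> (u, d) (v, d') \<longrightarrow> u \<in> s' (SV d) \<longrightarrow> v \<in> s' (SV d'))"
      using \<rho> by blast
    finally show ?thesis .
  qed
  have "sat g n s (reachF D c c' x y) \<longleftrightarrow> (\<forall>s'. (\<forall>X. X \<notin> SV ` C \<longrightarrow> s' X = s X) \<and> (\<forall>X\<in>SV ` C. s' X \<subseteq> gV g) \<longrightarrow>
      (\<forall>u d v d'. \<rho> (u, d) (v, d') \<longrightarrow> u \<in> s' (SV d) \<longrightarrow> v \<in> s' (SV d')) \<longrightarrow> n x \<in> s' (SV c) \<longrightarrow> n y \<in> s' (SV c'))"
    unfolding reachF_def sat_allS set_SV using closed by (intro all_cong) auto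
  also have "\<dots> \<longleftrightarrow> \<rho>\<^sup>*\<^sup>* (n x, c) (n y, c')"
  proof
    assume r: "\<rho>\<^sup>*\<^sup>* (n x, c) (n y, c')"
    show "\<forall>s'. (\<forall>X. X \<notin> SV ` C \<longrightarrow> s' X = s X) \<and> (\<forall>X\<in>SV ` C. s' X \<subseteq> gV g) \<longrightarrow>
      (\<forall>u d v d'. \<rho> (u, d) (v, d') \<longrightarrow> u \<in> s' (SV d) \<longrightarrow> v \<in> s' (SV d')) \<longrightarrow> n x \<in> s' (SV c) \<longrightarrow> n y \<in> s' (SV c')"
    proof (intro allI impI)
      fix s' assume a: "\<forall>u d v d'. \<rho> (u, d) (v, d') \<longrightarrow> u \<in> s' (SV d) \<longrightarrow> v \<in> s' (SV d')" "n x \<in> s' (SV c)"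
      have "fst p \<in> s' (SV (snd p))" if "\<rho>\<^sup>*\<^sup>* (n x, c) p" for p
        using that
      proof (induction rule: rtranclp_induct)
        case (step p q)
        then show ?case using a(1)[rule_format, of "fst p" "snd p" "fst q" "snd q"] by simp
      qed (use a(2) in simp)
      from this[OF r] show "n y \<in> s' (SV c')" by simp
    qed
  next
    \<comment> \<open>The least closed family: component \<open>d\<close> consists of the nodes that
      are reached together with \<open>d\<close>.\<close>
    let ?s = "\<lambda>X. if X \<in> SV ` C then {u \<in> gV g. \<rho>\<^sup>*\<^sup>* (n x, c) (u, inv_into C SV X)} else s X"
    have inv: "inv_into C SV (SV d) = d" if "d \<in> C" for d
      using that SV_inj by (intro inv_into_f_f) (auto simp: inj_on_def)
    assume "\<forall>s'. (\<forall>X. X \<notin> SV ` C \<longrightarrow> s' X = s X) \<and> (\<forall>X\<in>SV ` C. s' X \<subseteq> gV g) \<longrightarrow>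
      (\<forall>u d v d'. \<rho> (u, d) (v, d') \<longrightarrow> u \<in> s' (SV d) \<longrightarrow> v \<in> s' (SV d')) \<longrightarrow> n x \<in> s' (SV c) \<longrightarrow> n y \<in> s' (SV c')"
    from this[THEN spec, of ?s]
    have "(\<forall>u d v d'. \<rho> (u, d) (v, d') \<longrightarrow> u \<in> ?s (SV d) \<longrightarrow> v \<in> ?s (SV d')) \<longrightarrow> n x \<in> ?s (SV c) \<longrightarrow> n y \<in> ?s (SV c')"
      by auto
    moreover have "v \<in> ?s (SV d')" if "\<rho> (u, d) (v, d')" "u \<in> ?s (SV d)" for u d v d'
    proof -
      have m: "u \<in> gV g" "v \<in> gV g" "d \<in> C" "d' \<in> C" using \<rho>[OF that(1)] by simp_all
      then have "\<rho>\<^sup>*\<^sup>* (n x, c) (u, d)" using that(2) inv by simp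
      then have "\<rho>\<^sup>*\<^sup>* (n x, c) (v, d')" using that(1) by simp
      then show ?thesis using m inv by simp
    qed
    moreover have "n x \<in> ?s (SV c)" using c inv by simp
    ultimately have "n y \<in> ?s (SV c')" by blast
    then show "\<rho>\<^sup>*\<^sup>* (n x, c) (n y, c')" using c inv by simp
  qed
  finally show ?thesis .
qed

end

section \<open>An axiomatization of word graphs\<close>

definition edgeF :: "nat option set \<Rightarrow> nat \<Rightarrow> nat \<Rightarrow> mso" where
  "edgeF EA x y = OrS EA (\<lambda>\<gamma>. Edg \<gamma> x y)"

definition srcF :: "nat option set \<Rightarrow> nat \<Rightarrow> mso" where
  "srcF EA x = Neg (ExN 5 (edgeF EA 5 x))"

definition sinkF :: "nat option set \<Rightarrow> nat \<Rightarrow> mso" where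
  "sinkF EA x = Neg (ExN 5 (edgeF EA x 5))"

lemma fv_edgeF: "finite EA \<Longrightarrow> fvn (edgeF EA x y) \<subseteq> {x, y}" "finite EA \<Longrightarrow> fvs (edgeF EA x y) = {}"
  and fv_srcF: "finite EA \<Longrightarrow> fvn (srcF EA x) \<subseteq> {x}" "finite EA \<Longrightarrow> fvs (srcF EA x) = {}"
  and fv_sinkF: "finite EA \<Longrightarrow> fvn (sinkF EA x) \<subseteq> {x}" "finite EA \<Longrightarrow> fvs (sinkF EA x) = {}"
  by (auto simp: edgeF_def srcF_def sinkF_def)

text \<open>Axioms of nonempty labelled paths among finite graphs: edges are functional and
  injective, parallel edges have equal labels, and some node without predecessor lies in no proper
  subset closed under edges. Set variable 0 is bound here, so the parameter with this index is only
  shadowed.\<close>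

definition wordF :: "nat option set \<Rightarrow> mso" where
  "wordF EA = Conj (Conj
     (Neg (ExN 0 (ExN 1 (ExN 2 (Conj (Conj (edgeF EA 0 1) (edgeF EA 0 2)) (Neg (Eq 1 2)))))))
     (Neg (ExN 0 (ExN 1 (ExN 2 (Conj (Conj (edgeF EA 1 0) (edgeF EA 2 0)) (Neg (Eq 1 2))))))))
     (Conj (Neg (OrS {(\<gamma>, \<gamma>'). \<gamma> \<in> EA \<and> \<gamma>' \<in> EA \<and> \<gamma> \<noteq> \<gamma>'} (\<lambda>(\<gamma>, \<gamma>'). ExN 0 (ExN 1 (Conj (Edg \<gamma> 0 1) (Edg \<gamma>' 0 1))))))
     (ExN 0 (Conj (srcF EA 0) (Neg (ExS 0 (Conj (Conj (Mem 0 0)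
        (Neg (ExN 1 (ExN 2 (Conj (Mem 1 0) (Conj (edgeF EA 1 2) (Neg (Mem 2 0))))))))
        (ExN 3 (Neg (Mem 3 0)))))))))"

lemma finite_distinct_pairs: "finite EA \<Longrightarrow> finite {(\<gamma>, \<gamma>'). \<gamma> \<in> EA \<and> \<gamma>' \<in> EA \<and> \<gamma> \<noteq> \<gamma>'}"
  by (rule finite_subset[of _ "EA \<times> EA"]) auto

lemma fv_wordF:
  assumes "finite EA"
  shows "fvn (wordF EA) = {}" "fvs (wordF EA) = {}"
  using fv_edgeF[OF assms, of 0 1] fv_edgeF[OF assms, of 0 2] fv_edgeF[OF assms, of 1 0]
    fv_edgeF[OF assms, of 2 0] fv_edgeF[OF assms, of 1 2] fv_srcF[OF assms, of 0] finite_distinct_pairs[OF assms]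
  unfolding wordF_def by (simp_all, blast?)

lemma sat_edgeF:
  assumes "finite EA" "gE g \<subseteq> gV g \<times> EA \<times> gV g"
  shows "sat g n s (edgeF EA x y) \<longleftrightarrow> (\<exists>\<gamma>. (n x, \<gamma>, n y) \<in> gE g)"
  using assms by (auto simp: edgeF_def)

lemma sat_srcF:
  assumes "finite EA" "gE g \<subseteq> gV g \<times> EA \<times> gV g" "x \<noteq> 5"
  shows "sat g n s (srcF EA x) \<longleftrightarrow> \<not> (\<exists>u \<gamma>. (u, \<gamma>, n x) \<in> gE g)"
    "sat g n s (sinkF EA x) \<longleftrightarrow> \<not> (\<exists>u \<gamma>. (n x, \<gamma>, u) \<in> gE g)"
  using assms by (auto simp: srcF_def sinkF_def sat_edgeF[OF assms(1,2)])

lemma sat_wordF: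
  assumes "finite EA" "gE g \<subseteq> gV g \<times> EA \<times> gV g"
  defines "e \<equiv> \<lambda>x y. \<exists>\<gamma>. (x, \<gamma>, y) \<in> gE g"
  shows "sat g n s (wordF EA) \<longleftrightarrow> (\<forall>x y y'. e x y \<longrightarrow> e x y' \<longrightarrow> y = y') \<and> (\<forall>x x' y. e x y \<longrightarrow> e x' y \<longrightarrow> x = x')
    \<and> (\<forall>x y \<gamma> \<gamma>'. (x, \<gamma>, y) \<in> gE g \<longrightarrow> (x, \<gamma>', y) \<in> gE g \<longrightarrow> \<gamma> = \<gamma>')
    \<and> (\<exists>x\<in>gV g. (\<forall>z. \<not> e z x) \<and> (\<forall>Y\<subseteq>gV g. x \<in> Y \<longrightarrow> (\<forall>u v. e u v \<longrightarrow> u \<in> Y \<longrightarrow> v \<in> Y) \<longrightarrow> gV g \<subseteq> Y))"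
proof -
  have eV: "x \<in> gV g \<and> y \<in> gV g" if "e x y" for x y using that assms(2) by (auto simp: e_def)
  have ed: "sat g n s (edgeF EA x y) \<longleftrightarrow> e (n x) (n y)" for n s x y
    unfolding e_def by (rule sat_edgeF[OF assms(1,2)])
  have src: "sat g n s (srcF EA 0) \<longleftrightarrow> (\<forall>z. \<not> e z (n 0))" for n s
    using sat_srcF(1)[OF assms(1,2), of 0 n s] by (simp add: e_def)
  have 1: "sat g n s (Neg (ExN 0 (ExN 1 (ExN 2 (Conj (Conj (edgeF EA 0 1) (edgeF EA 0 2)) (Neg (Eq 1 2))))))) \<longleftrightarrow>
      (\<forall>x y y'. e x y \<longrightarrow> e x y' \<longrightarrow> y = y')" for n s
    using eV by (simp add: ed) blast
  have 2: "sat g n s (Neg (ExN 0 (ExN 1 (ExN 2 (Conj (Conj (edgeF EA 1 0) (edgeF EA 2 0)) (Neg (Eq 1 2))))))) \<longleftrightarrow>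
      (\<forall>x x' y. e x y \<longrightarrow> e x' y \<longrightarrow> x = x')" for n s
    using eV by (simp add: ed) blast
  have 3: "sat g n s (Neg (OrS {(\<gamma>, \<gamma>'). \<gamma> \<in> EA \<and> \<gamma>' \<in> EA \<and> \<gamma> \<noteq> \<gamma>'} (\<lambda>(\<gamma>, \<gamma>'). ExN 0 (ExN 1 (Conj (Edg \<gamma> 0 1) (Edg \<gamma>' 0 1)))))) \<longleftrightarrow>
      (\<forall>x y \<gamma> \<gamma>'. (x, \<gamma>, y) \<in> gE g \<longrightarrow> (x, \<gamma>', y) \<in> gE g \<longrightarrow> \<gamma> = \<gamma>')" for n s
    using assms(2) finite_distinct_pairs[OF assms(1)] by simp blast
  have 4: "sat g n s (ExN 0 (Conj (srcF EA 0) (Neg (ExS 0 (Conj (Conj (Mem 0 0)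
        (Neg (ExN 1 (ExN 2 (Conj (Mem 1 0) (Conj (edgeF EA 1 2) (Neg (Mem 2 0))))))))
        (ExN 3 (Neg (Mem 3 0)))))))) \<longleftrightarrow>
      (\<exists>x\<in>gV g. (\<forall>z. \<not> e z x) \<and> (\<forall>Y\<subseteq>gV g. x \<in> Y \<longrightarrow> (\<forall>u v. e u v \<longrightarrow> u \<in> Y \<longrightarrow> v \<in> Y) \<longrightarrow> gV g \<subseteq> Y))"
  proof -
    define cl where "cl Y \<longleftrightarrow> (\<forall>u v. e u v \<longrightarrow> u \<in> Y \<longrightarrow> v \<in> Y)" for Y
    have cl: "\<not> (\<exists>u\<in>gV g. \<exists>v\<in>gV g. u \<in> Y \<and> e u v \<and> v \<notin> Y) \<longleftrightarrow> cl Y" for Y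
      unfolding cl_def using eV by blast
    have sub: "(\<exists>v\<in>gV g. v \<notin> Y) \<longleftrightarrow> \<not> gV g \<subseteq> Y" for Y by blast
    define \<psi> where "\<psi> = Conj (Conj (Mem 0 0)
        (Neg (ExN 1 (ExN 2 (Conj (Mem 1 0) (Conj (edgeF EA 1 2) (Neg (Mem 2 0)))))))) (ExN 3 (Neg (Mem 3 0)))"
    have "sat g n s \<psi> \<longleftrightarrow> (n 0 \<in> s 0 \<and> \<not> (\<exists>u\<in>gV g. \<exists>v\<in>gV g. u \<in> s 0 \<and> e u v \<and> v \<notin> s 0)) \<and> (\<exists>v\<in>gV g. v \<notin> s 0)" for n s
      unfolding \<psi>_def by (simp only: sat.simps ed) simp
    then have psi: "sat g n s \<psi> \<longleftrightarrow> (n 0 \<in> s 0 \<and> cl (s 0)) \<and> \<not> gV g \<subseteq> s 0" for n s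
      unfolding cl sub .
    have "sat g n s (ExN 0 (Conj (srcF EA 0) (Neg (ExS 0 \<psi>)))) \<longleftrightarrow>
        (\<exists>x\<in>gV g. (\<forall>z. \<not> e z x) \<and> \<not> (\<exists>Y\<subseteq>gV g. (x \<in> Y \<and> cl Y) \<and> \<not> gV g \<subseteq> Y))"
      by (simp only: sat.simps src psi fun_upd_same)
    also have "\<dots> \<longleftrightarrow> (\<exists>x\<in>gV g. (\<forall>z. \<not> e z x) \<and> (\<forall>Y\<subseteq>gV g. x \<in> Y \<longrightarrow> cl Y \<longrightarrow> gV g \<subseteq> Y))"
      by (intro bex_cong refl conj_cong) blast
    finally show ?thesis unfolding \<psi>_def cl_def .
  qed
  show ?thesis unfolding wordF_def sat.simps(6) 1 2 3 4 by (simp only: conj_assoc)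
qed

text \<open>If every node had a successor, the successor map would be injective, hence onto by
  finiteness, although the source has no predecessor. So there is a sink, and the deterministic run
  from the source to it visits every node.\<close>

lemma wordF_path:
  assumes "finite EA" "gE g \<subseteq> gV g \<times> EA \<times> gV g" "finite (gV g)" "sat g n s (wordF EA)"
  shows "\<exists>v \<gamma> N. is_path g v \<gamma> N \<and> 0 < N"
proof -
  define e where "e x y \<longleftrightarrow> (\<exists>\<gamma>. (x, \<gamma>, y) \<in> gE g)" for x y
  have eV: "x \<in> gV g \<and> y \<in> gV g" if "e x y" for x y using that assms(2) by (auto simp: e_def)
  note ax = assms(4)[unfolded sat_wordF[OF assms(1,2)], folded e_def]
  note ax12 = conjunct1[OF ax] conjunct1[OF conjunct2[OF ax]] and ax' = conjunct2[OF conjunct2[OF ax]]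
  have ax1: "y = y'" if "e x y" "e x y'" for x y y' using that ax12(1) by simp
  have ax2: "x = x'" if "e x y" "e x' y" for x x' y using that ax12(2) by simp
  have ax3: "\<gamma> = \<gamma>'" if "(x, \<gamma>, y) \<in> gE g" "(x, \<gamma>', y) \<in> gE g" for x y \<gamma> \<gamma>'
    using that conjunct1[OF ax'] by simp
  obtain x where x: "x \<in> gV g" and x': "(\<forall>z. \<not> e z x) \<and>
      (\<forall>Y\<subseteq>gV g. x \<in> Y \<longrightarrow> (\<forall>u v. e u v \<longrightarrow> u \<in> Y \<longrightarrow> v \<in> Y) \<longrightarrow> gV g \<subseteq> Y)"
    using conjunct2[OF ax'] by (rule bexE)
  have x0: "\<not> e z x" for z using x' by simp
  have ax4: "gV g \<subseteq> Y" if "Y \<subseteq> gV g" "x \<in> Y" "\<And>u v. e u v \<Longrightarrow> u \<in> Y \<Longrightarrow> v \<in> Y" for Y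
    using conjunct2[OF x', rule_format, OF that(1,2)] that(3) by blast
  have reach: "gV g = {y. e\<^sup>*\<^sup>* x y}"
  proof
    have sub: "y \<in> gV g" if "e\<^sup>*\<^sup>* x y" for y
      using that by (induction rule: rtranclp_induct) (use x eV in auto)
    then show "{y. e\<^sup>*\<^sup>* x y} \<subseteq> gV g" by blast
    show "gV g \<subseteq> {y. e\<^sup>*\<^sup>* x y}" by (rule ax4) (use sub in auto)
  qed
  have "\<exists>t\<in>gV g. \<forall>y. \<not> e t y"
  proof (rule ccontr)
    assume "\<not> (\<exists>t\<in>gV g. \<forall>y. \<not> e t y)"
    then obtain f where f: "\<And>t. t \<in> gV g \<Longrightarrow> e t (f t)" by metis
    have "inj_on f (gV g)" using f ax2 by (metis inj_onI)
    moreover have "f ` gV g \<subseteq> gV g" using f eV by blast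
    ultimately have "f ` gV g = gV g" using assms(3) by (simp add: endo_inj_surj)
    then have "x \<in> f ` gV g" using x by simp
    then obtain z where "x = f z" "z \<in> gV g" by (rule imageE)
    then show False using f[of z] x0[of z] by simp
  qed
  then obtain t where t: "e\<^sup>*\<^sup>* x t" "\<And>y. \<not> e t y" unfolding reach by blast
  \<comment> \<open>With every node regarded as emitting, no step is silent, and
    \<open>emit_edges\<close> says that the edges are the adjacent pairs of the run.\<close>
  interpret det_rel e "\<lambda>_. Some ()" by unfold_locales (rule ax1)
  obtain ks where ks: "det_run e ks" "hd ks = x" using det_run_exists[OF t] by blast
  have V: "set ks = gV g" using det_run_reach[OF ks(1)] ks(2) reach by blast
  have dist: "distinct ks" by (rule det_run_distinct[OF ks(1)])
  have ne: "ks \<noteq> []" using V x by auto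
  have sil: "(silent e (\<lambda>_. Some ()))\<^sup>*\<^sup>* a b \<longleftrightarrow> a = b" for a b
    by (auto simp: silent_def elim: converse_rtranclpE)
  have E: "e a b \<longleftrightarrow> (a, b) \<in> adj ks" if "a \<in> gV g" for a b
    using emit_edges[OF ks(1), of a b] that V sil by simp
  define \<gamma> where "\<gamma> i = (THE c. (ks ! i, c, ks ! Suc i) \<in> gE g)" for i
  have g: "(ks ! i, c, ks ! Suc i) \<in> gE g \<longleftrightarrow> c = \<gamma> i" if "Suc i < length ks" for i c
  proof -
    have "(ks ! i, ks ! Suc i) \<in> adj ks" unfolding adj_def using that by blast
    moreover have "ks ! i \<in> gV g" using that V nth_mem[of i ks] by simp
    ultimately have "e (ks ! i) (ks ! Suc i)" using E by blast
    then obtain c' where c': "(ks ! i, c', ks ! Suc i) \<in> gE g" unfolding e_def by blast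
    then have "\<gamma> i = c'" unfolding \<gamma>_def using ax3 by blast
    then show ?thesis using c' ax3 by blast
  qed
  have "(a, c, b) \<in> gE g \<longleftrightarrow> (\<exists>i. a = ks ! i \<and> c = \<gamma> i \<and> b = ks ! Suc i \<and> Suc i < length ks)" for a c b
  proof
    assume ab: "(a, c, b) \<in> gE g"
    then have "e a b" unfolding e_def by blast
    then have "(a, b) \<in> adj ks" using E eV by blast
    then obtain i where "a = ks ! i" "b = ks ! Suc i" "Suc i < length ks" by (auto simp: adj_def)
    then show "\<exists>i. a = ks ! i \<and> c = \<gamma> i \<and> b = ks ! Suc i \<and> Suc i < length ks" using g ab by blast
  qed (use g in blast)
  then have "gE g = {(ks ! i, \<gamma> i, ks ! Suc i) | i. Suc i < length ks}" by auto
  moreover have "gV g = (!) ks ` {..<length ks}" unfolding V[symmetric] by (auto simp: in_set_conv_nth)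
  ultimately have "is_path g ((!) ks) \<gamma> (length ks)"
    using dist by (simp add: is_path_def inj_on_nth)
  then show ?thesis using ne by blast
qed

lemma sat_wordF_word:
  assumes "word_graph lab inc ws g" "ws \<noteq> []" "finite EA" "gE g \<subseteq> gV g \<times> EA \<times> gV g"
  shows "sat g n s (wordF EA)"
proof -
  have e: "(\<exists>\<gamma>. (x, \<gamma>, y) \<in> gE g) \<longleftrightarrow> y = Suc x \<and> y < length ws" for x y
    using assms(1) by (auto simp: word_graph_def)
  have V: "gV g = {0..<length ws}" using assms(1) by (simp add: word_graph_def)
  have cl: "gV g \<subseteq> Y" if "0 \<in> Y" "\<forall>u v. v = Suc u \<and> v < length ws \<longrightarrow> u \<in> Y \<longrightarrow> v \<in> Y" for Y
  proof -
    have "i < length ws \<longrightarrow> i \<in> Y" for i by (induction i) (use that in auto)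
    then show ?thesis using V by auto
  qed
  have "\<gamma> = \<gamma>'" if "(x, \<gamma>, y) \<in> gE g" "(x, \<gamma>', y) \<in> gE g" for x y \<gamma> \<gamma>'
    using that assms(1) by (auto simp: word_graph_def)
  then have 3: "\<forall>x y \<gamma> \<gamma>'. (x, \<gamma>, y) \<in> gE g \<longrightarrow> (x, \<gamma>', y) \<in> gE g \<longrightarrow> \<gamma> = \<gamma>'" by simp
  have 0: "0 \<in> gV g" using assms(2) V by simp
  show ?thesis
    unfolding sat_wordF[OF assms(3,4)] e
  proof (intro conjI 3)
    show "\<exists>x\<in>gV g. (\<forall>z. \<not> (x = Suc z \<and> x < length ws)) \<and> (\<forall>Y\<subseteq>gV g. x \<in> Y \<longrightarrow>
        (\<forall>u v. v = Suc u \<and> v < length ws \<longrightarrow> u \<in> Y \<longrightarrow> v \<in> Y) \<longrightarrow> gV g \<subseteq> Y)"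
    proof (rule bexI[OF _ 0], intro conjI allI impI)
      fix Y assume "0 \<in> Y" "\<forall>u v. v = Suc u \<and> v < length ws \<longrightarrow> u \<in> Y \<longrightarrow> v \<in> Y"
      then show "gV g \<subseteq> Y" by (rule cl)
    qed simp
  qed simp_all
qed

lemma wordF_nd:
  assumes "graph_over (Some ` S) {None} g" "finite S" "sat g n s (wordF {None})"
  shows "\<exists>w\<in>lists S. graph_iso g (nd w) \<and> w \<noteq> []"
proof -
  have g: "finite (gV g)" "gE g \<subseteq> gV g \<times> {None} \<times> gV g" "\<forall>v\<in>gV g. glab g v \<in> Some ` S"
    using assms(1) by (simp_all add: graph_over_def)
  obtain v \<gamma> N where p: "is_path g v \<gamma> N" "0 < N" using wordF_path[OF _ g(2,1) assms(3)] by blast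
  have vV: "v i \<in> gV g" if "i < N" for i using p that unfolding is_path_def by blast
  define w where "w = map (\<lambda>i. the (glab g (v i))) [0..<N]"
  have lab: "glab g (v i) = Some (w ! i) \<and> w ! i \<in> S" if "i < N" for i
    using g(3) vV[OF that] that unfolding w_def by fastforce
  have "graph_iso g (nd w)"
  proof (rule path_iso_word[OF _ word_graph_nd])
    show "is_path g v \<gamma> (length (map Some w))" using p(1) by (simp add: w_def)
    show "glab g (v i) = id (map Some w ! i)" if "i < length (map Some w)" for i
      using that lab[of i] by (simp add: w_def)
    show "\<gamma> i = None" if "Suc i < length (map Some w)" for i
    proof -
      have "Suc i < N" using that by (simp add: w_def)
      then have "(v i, \<gamma> i, v (Suc i)) \<in> gE g" using p(1) unfolding is_path_def by blast
      then show ?thesis using g(2) by blast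
    qed
  qed
  moreover have "w \<in> lists S" using lab by (auto simp: w_def in_lists_conv_set)
  moreover have "w \<noteq> []" using p(2) by (simp add: w_def)
  ultimately show ?thesis by blast
qed

lemma wordF_ed:
  assumes "graph_over {None} (Some ` S) g" "finite S" "sat g n s (wordF (Some ` S))"
  shows "\<exists>w\<in>lists S. graph_iso g (ed w)"
proof -
  have g: "finite (gV g)" "gE g \<subseteq> gV g \<times> Some ` S \<times> gV g" "\<forall>v\<in>gV g. glab g v = None"
    using assms(1) by (simp_all add: graph_over_def)
  obtain v \<gamma> N where p: "is_path g v \<gamma> N" "0 < N"
    using wordF_path[OF _ g(2,1) assms(3)] assms(2) by blast
  have vV: "v i \<in> gV g" if "i < N" for i using p that unfolding is_path_def by blast
  define w where "w = map (\<lambda>i. the (\<gamma> i)) [0..<N - 1]"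
  have lab: "\<gamma> i = Some (w ! i) \<and> w ! i \<in> S" if "Suc i < N" for i
  proof -
    have "(v i, \<gamma> i, v (Suc i)) \<in> gE g" using p(1) that unfolding is_path_def by blast
    then have "\<gamma> i \<in> Some ` S" using g(2) by blast
    then show ?thesis using that unfolding w_def by auto
  qed
  have len: "Suc (length w) = N" using p(2) by (simp add: w_def)
  have "graph_iso g (ed w)"
  proof (rule path_iso_word[OF _ word_graph_ed])
    show "is_path g v \<gamma> (length (None # map Some w))" using p(1) len by simp
    show "glab g (v i) = None" if "i < length (None # map Some w)" for i
      using that g(3) vV[of i] len by simp
    show "\<gamma> i = id ((None # map Some w) ! Suc i)" if "Suc i < length (None # map Some w)" for i
      using that lab[of i] len by simp
  qed
  moreover have "w \<in> lists S" using lab len by (auto simp: in_lists_conv_set in_set_conv_nth)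
  ultimately show ?thesis by blast
qed

section \<open>Tapes divided into blocks\<close>

text \<open>A head move by \<open>e\<close> in block coordinates, from cell \<open>k\<close> of
  block \<open>i\<close> to cell \<open>k'\<close> of block \<open>j\<close>: within a block, or
  across its right or left border.\<close>

definition offs :: "(nat \<Rightarrow> 'a list) \<Rightarrow> int \<Rightarrow> nat \<Rightarrow> nat \<Rightarrow> nat \<Rightarrow> nat \<Rightarrow> bool" where
  "offs bl e i k j k' \<longleftrightarrow> (i = j \<and> int k' = int k + e) \<or> (e = 1 \<and> j = Suc i \<and> Suc k = length (bl i) \<and> k' = 0)
     \<or> (e = -1 \<and> i = Suc j \<and> k = 0 \<and> Suc k' = length (bl j))"

definition off :: "(nat \<Rightarrow> 'a list) \<Rightarrow> nat \<Rightarrow> nat" where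
  "off bl i = length (concat (map bl [0..<i]))"

lemma off_0 [simp]: "off bl 0 = 0" and off_Suc [simp]: "off bl (Suc i) = off bl i + length (bl i)"
  by (simp_all add: off_def)

lemma off_mono: "i < j \<Longrightarrow> off bl i + length (bl i) \<le> off bl j"
proof (induction j)
  case (Suc j)
  then show ?case by (cases "i = j") auto
qed simp

text \<open>Blocks are nonempty, so between blocks that are not neighbours there is at least one
  cell, and a move by at most one cannot connect them.\<close>

lemma off_offs:
  assumes "\<And>i. i < N \<Longrightarrow> bl i \<noteq> []" "i < N" "j < N" "k < length (bl i)" "k' < length (bl j)" "e \<in> {-1, 0, 1}"
  shows "int (off bl j + k') = int (off bl i + k) + e \<longleftrightarrow> offs bl e i k j k'"
proof -
  have step: "off bl a + length (bl a) < off bl b" if "Suc a < b" "b < N" for a b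
  proof -
    have "off bl (Suc a) + length (bl (Suc a)) \<le> off bl b" by (rule off_mono[OF that(1)])
    moreover have "0 < length (bl (Suc a))" using assms(1)[of "Suc a"] that by simp
    ultimately show ?thesis unfolding off_Suc by linarith
  qed
  consider "i = j" | "j = Suc i" | "Suc i < j" | "i = Suc j" | "Suc j < i" by linarith
  then show ?thesis
  proof cases
    case 1
    then show ?thesis by (auto simp: offs_def)
  next
    case 2
    then show ?thesis using assms(4-6) by (auto simp: offs_def)
  next
    case 3
    then have "int (off bl j + k') \<noteq> int (off bl i + k) + e" using step[OF 3 assms(3)] assms(4-6) by auto
    then show ?thesis using 3 by (auto simp: offs_def)
  next
    case 4
    then show ?thesis using assms(4-6) by (auto simp: offs_def)
  next
    case 5
    then have "int (off bl j + k') \<noteq> int (off bl i + k) + e" using step[OF 5 assms(2)] assms(4-6) by auto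
    then show ?thesis using 5 by (auto simp: offs_def)
  qed
qed

lemma off_nth:
  "i < N \<Longrightarrow> k < length (bl i) \<Longrightarrow> off bl i + k < length (concat (map bl [0..<N])) \<and>
    concat (map bl [0..<N]) ! (off bl i + k) = bl i ! k"
proof (induction N)
  case (Suc N)
  show ?case
  proof (cases "i = N")
    case True
    then show ?thesis using Suc.prems by (simp add: off_def nth_append)
  next
    case False
    then show ?thesis using Suc by (simp add: nth_append)
  qed
qed simp

lemma off_surj: "p < length (concat (map bl [0..<N])) \<Longrightarrow> \<exists>i k. i < N \<and> k < length (bl i) \<and> p = off bl i + k"
proof (induction N)
  case (Suc N)
  show ?case
  proof (cases "p < length (concat (map bl [0..<N]))")
    case True
    then show ?thesis using Suc.IH by (meson less_SucI)
  next
    case False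
    then have "p - off bl N < length (bl N) \<and> p = off bl N + (p - off bl N)"
      using Suc.prems by (simp add: off_def)
    then show ?thesis by (intro exI[of _ N] exI[of _ "p - off bl N"]) simp
  qed
qed simp

text \<open>The tape of the gsm has more cells than the graph has nodes, so each node represents a
  nonempty block of cells; a local configuration is a state and an offset inside the block.\<close>

locale gsm_blocks =
  fixes M :: gsm and ini :: "nat option option" and EA :: "nat option set" and BS :: "tsym list set"
  assumes wfM: "wf_gsm M" and finBS: "finite BS" and BSne: "b \<in> BS \<Longrightarrow> b \<noteq> []" and finEA: "finite EA"
begin

definition US :: "ust set" where
  "US = insert Start ((\<lambda>(q, r). Emit q r) ` (states M \<times> {..outlen M}))"

text \<open>These local configurations become the copies of the transduction. A common bound on the
  offset makes them independent of the block at a node.\<close>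

definition C :: "(ust \<times> nat) set" where
  "C = US \<times> {..<Suc (Max (insert 0 (length ` BS)))}"

definition ixc :: "ust \<times> nat \<Rightarrow> nat" where "ixc = (SOME f. inj_on f C)"
text \<open>The parameter with index \<open>ixb b\<close> marks the nodes that carry block
  \<open>b\<close>.\<close>

definition ixb :: "tsym list \<Rightarrow> nat" where "ixb = (SOME f. inj_on f BS)"
definition np :: nat where "np = Suc (Max (insert 0 (ixb ` BS)))"

lemma finC: "finite C"
  using wfM by (simp add: C_def US_def wf_gsm_def)

lemma inj_ixc: "inj_on ixc C"
proof -
  have "\<exists>f :: ust \<times> nat \<Rightarrow> nat. inj_on f C" using finite_imp_inj_to_nat_seg[OF finC] by blast
  then show ?thesis unfolding ixc_def by (rule someI_ex)
qed

lemma inj_ixb: "inj_on ixb BS"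
proof -
  have "\<exists>f :: tsym list \<Rightarrow> nat. inj_on f BS" using finite_imp_inj_to_nat_seg[OF finBS] by blast
  then show ?thesis unfolding ixb_def by (rule someI_ex)
qed

lemma ixb_np: "b \<in> BS \<Longrightarrow> ixb b < np"
  using finBS by (simp add: np_def less_Suc_eq_le)

lemma US_C: "s \<in> US \<Longrightarrow> b \<in> BS \<Longrightarrow> k < length b \<Longrightarrow> (s, k) \<in> C"
proof -
  assume *: "s \<in> US" "b \<in> BS" "k < length b"
  have "length b \<le> Max (insert 0 (length ` BS))" using finBS *(2) by (intro Max_ge) auto
  then show ?thesis using * by (simp add: C_def)
qed

lemma usucc_US: "s \<in> US \<Longrightarrow> usucc M s \<sigma> = Some (s', e) \<Longrightarrow> s' \<in> US \<and> e \<in> {-1, 0, 1}"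
proof (cases s)
  case Start
  assume "usucc M s \<sigma> = Some (s', e)"
  then show ?thesis using Start wfM by (auto simp: US_def wf_gsm_def)
next
  case (Emit q r)
  assume u: "usucc M s \<sigma> = Some (s', e)"
  then obtain q' \<alpha> d where a: "act M q \<sigma> = Some (q', \<alpha>, d)" using Emit by (auto split: option.splits)
  have "Emit q (Suc r) \<in> US" if "r < length \<alpha>"
    using act_wf(1)[OF wfM a] act_outlen[OF wfM a] that by (force simp: US_def)
  moreover have "Emit q' 0 \<in> US" using act_wf(2)[OF wfM a] by (force simp: US_def)
  ultimately show ?thesis using u a act_wf(5)[OF wfM a] Emit by (auto split: if_splits)
qed

text \<open>\<open>offs\<close> between the blocks of two nodes: being neighbours becomes an edge,
  all else is a constant condition.\<close>

definition offF :: "int \<Rightarrow> nat \<Rightarrow> nat \<Rightarrow> nat \<Rightarrow> nat \<Rightarrow> nat \<Rightarrow> nat \<Rightarrow> mso" where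
  "offF e l k l' k' x y = Or (ifF (int k' = int k + e) (Eq x y))
     (Or (ifF (e = 1 \<and> Suc k = l \<and> k' = 0) (edgeF EA x y)) (ifF (e = -1 \<and> k = 0 \<and> Suc k' = l') (edgeF EA y x)))"

text \<open>\<open>Q\<close> selects the configurations that may be left; its two instances
  \<open>allQ\<close> and \<open>silQ\<close> give all steps and the silent steps.\<close>

definition stepF where
  "stepF Q c c' x y = OrS (BS \<times> BS) (\<lambda>(b, b'). ifF (snd c < length b \<and> snd c' < length b' \<and> Q c b)
     (Conj (Mem x (ixb b)) (Conj (Mem y (ixb b'))
       (case usucc M (fst c) (b ! snd c) of None \<Rightarrow> FF
        | Some (s', e) \<Rightarrow> ifF (s' = fst c') (offF e (length b) (snd c) (length b') (snd c') x y)))))"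

lemma fv_offF: "fvn (offF e l k l' k' x y) \<subseteq> {x, y}" "fvs (offF e l k l' k' x y) = {}"
  using fv_edgeF[OF finEA, of x y] fv_edgeF[OF finEA, of y x] by (auto simp: offF_def ifF_def)

lemma fv_stepF: "fvn (stepF Q c c' x y) \<subseteq> {x, y}" "fvs (stepF Q c c' x y) \<subseteq> {..<np}"
proof -
  let ?G = "\<lambda>(b, b'). ifF (snd c < length b \<and> snd c' < length b' \<and> Q c b)
     (Conj (Mem x (ixb b)) (Conj (Mem y (ixb b'))
       (case usucc M (fst c) (b ! snd c) of None \<Rightarrow> FF
        | Some (s', e) \<Rightarrow> ifF (s' = fst c') (offF e (length b) (snd c) (length b') (snd c') x y))))"
  have "fvn (?G p) \<subseteq> {x, y} \<and> fvs (?G p) \<subseteq> {..<np}" if p: "p \<in> BS \<times> BS" for p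
  proof -
    obtain b b' where b: "p = (b, b')" "b \<in> BS" "b' \<in> BS" using p by blast
    have "ixb b < np" "ixb b' < np" using ixb_np b by simp_all
    then show ?thesis
      unfolding b(1) ifF_def using fv_offF by (auto split: option.splits)
  qed
  then show "fvn (stepF Q c c' x y) \<subseteq> {x, y}" "fvs (stepF Q c c' x y) \<subseteq> {..<np}"
    unfolding stepF_def using finBS by (simp_all add: UN_subset_iff)
qed

end

text \<open>The parameter sets in \<open>s\<close> single out one block \<open>bl i\<close> at each
  node, and the concatenation of these blocks is the tape.\<close>

locale gsm_word = gsm_blocks +
  fixes lab inc :: "nat option \<Rightarrow> nat option" and ws :: "nat option list" and g :: "nat graph"
    and s :: "nat \<Rightarrow> nat set" and bl :: "nat \<Rightarrow> tsym list"
  assumes wg: "word_graph lab inc ws g" and gEA: "gE g \<subseteq> gV g \<times> EA \<times> gV g" and wne: "ws \<noteq> []"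
    and bl: "i < length ws \<Longrightarrow> bl i \<in> BS"
    and sbl: "i < length ws \<Longrightarrow> b \<in> BS \<Longrightarrow> i \<in> s (ixb b) \<longleftrightarrow> b = bl i"
begin

abbreviation N where "N \<equiv> length ws"

lemma gV: "gV g = {0..<N}" using wg by (simp add: word_graph_def)

lemma edge_iff: "sat g n s' (edgeF EA x y) \<longleftrightarrow> n y = Suc (n x) \<and> n y < N"
  unfolding sat_edgeF[OF finEA gEA] using wg by (auto simp: word_graph_def)

definition stp :: "(ust \<times> nat \<Rightarrow> tsym list \<Rightarrow> bool) \<Rightarrow> nat \<times> ust \<times> nat \<Rightarrow> nat \<times> ust \<times> nat \<Rightarrow> bool" where
  "stp Q p p' \<longleftrightarrow> (case (p, p') of ((i, c), (j, c')) \<Rightarrow> i < N \<and> j < N \<and> c \<in> C \<and> c' \<in> C \<and>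
     snd c < length (bl i) \<and> snd c' < length (bl j) \<and> Q c (bl i) \<and>
     (\<exists>e. usucc M (fst c) (bl i ! snd c) = Some (fst c', e) \<and> offs bl e i (snd c) j (snd c')))"

lemma sat_stepF:
  assumes "c \<in> C" "c' \<in> C" "n x < N" "n y < N" "\<And>X. X < np \<Longrightarrow> s' X = s X"
  shows "sat g n s' (stepF Q c c' x y) \<longleftrightarrow> stp Q (n x, c) (n y, c')"
proof -
  have mem: "n z \<in> s' (ixb b) \<longleftrightarrow> b = bl (n z)" if "n z < N" "b \<in> BS" for z b
    using assms(5)[OF ixb_np[OF that(2)]] sbl[OF that] by simp
  let ?P = "\<lambda>b b'. snd c < length b \<and> snd c' < length b' \<and> Q c b \<and>
      sat g n s' (case usucc M (fst c) (b ! snd c) of None \<Rightarrow> FF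
        | Some (s', e) \<Rightarrow> ifF (s' = fst c') (offF e (length b) (snd c) (length b') (snd c') x y))"
  have "sat g n s' (stepF Q c c' x y) \<longleftrightarrow> (\<exists>b\<in>BS. \<exists>b'\<in>BS. b = bl (n x) \<and> b' = bl (n y) \<and> ?P b b')"
    unfolding stepF_def using finBS mem[OF assms(3)] mem[OF assms(4)] by (simp, blast)
  also have "\<dots> \<longleftrightarrow> ?P (bl (n x)) (bl (n y))"
    using bl[OF assms(3)] bl[OF assms(4)] by blast
  also have "\<dots> \<longleftrightarrow> stp Q (n x, c) (n y, c')"
  proof -
    have "sat g n s' (offF e (length (bl (n x))) (snd c) (length (bl (n y))) (snd c') x y) \<longleftrightarrow>
        offs bl e (n x) (snd c) (n y) (snd c')" for e
      using assms(3,4) by (auto simp: offF_def offs_def edge_iff)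
    then show ?thesis unfolding stp_def using assms(1-4) by (auto split: option.splits)
  qed
  finally show ?thesis .
qed

abbreviation step1 where "step1 \<equiv> stp (\<lambda>_ _. True)"

definition em :: "nat \<times> ust \<times> nat \<Rightarrow> nat option option" where
  "em p = emit M ini (fst (snd p)) (bl (fst p) ! snd (snd p))"

lemma silent_stp: "stp (\<lambda>c b. emit M ini (fst c) (b ! snd c) = None) p p' \<longleftrightarrow> silent step1 em p p'"
  by (cases p; cases p') (auto simp: stp_def silent_def em_def)

lemma bl_ne: "i < N \<Longrightarrow> bl i \<noteq> []" using bl BSne by blast

abbreviation tp :: "int \<Rightarrow> tsym" where "tp p \<equiv> concat (map bl [0..<N]) ! nat p"
abbreviation bd :: int where "bd \<equiv> int (length (concat (map bl [0..<N]))) - 1"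

definition valid_pos :: "nat \<Rightarrow> nat \<Rightarrow> bool" where
  "valid_pos i k \<longleftrightarrow> i < N \<and> k < length (bl i)"

definition pos :: "nat \<Rightarrow> nat \<Rightarrow> int" where "pos i k = int (off bl i + k)"

lemma pos_range: "valid_pos i k \<Longrightarrow> 0 \<le> pos i k \<and> pos i k \<le> bd \<and> tp (pos i k) = bl i ! k"
  using off_nth[of i N k bl] unfolding valid_pos_def pos_def nat_int by linarith

lemma pos_surj: "0 \<le> p \<Longrightarrow> p \<le> bd \<Longrightarrow> \<exists>i k. valid_pos i k \<and> p = pos i k"
proof -
  assume "0 \<le> p" "p \<le> bd"
  then have "nat p < length (concat (map bl [0..<N]))" by linarith
  from off_surj[OF this] obtain i k where "i < N" "k < length (bl i)" "nat p = off bl i + k" by blast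
  then show ?thesis using \<open>0 \<le> p\<close> unfolding valid_pos_def pos_def by (intro exI[of _ i] exI[of _ k]) linarith
qed

lemma pos_offs: "valid_pos i k \<Longrightarrow> valid_pos j k' \<Longrightarrow> e \<in> {-1, 0, 1} \<Longrightarrow> pos j k' = pos i k + e \<longleftrightarrow> offs bl e i k j k'"
  unfolding valid_pos_def pos_def using off_offs[of N bl i j k k' e] bl_ne by blast

lemma step1_iff:
  assumes "valid_pos i k" "u \<in> US"
  shows "step1 (i, u, k) (j, u', k') \<longleftrightarrow> valid_pos j k' \<and> (\<exists>e. usucc M u (bl i ! k) = Some (u', e) \<and> pos j k' = pos i k + e)"
proof -
  have C1: "(u, k) \<in> C" using assms US_C bl unfolding valid_pos_def by blast
  have C2: "(u', k') \<in> C" if "valid_pos j k'" "usucc M u (bl i ! k) = Some (u', e)" for e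
    using US_C[of u' "bl j" k'] usucc_US[OF assms(2) that(2)] bl that(1) unfolding valid_pos_def by blast
  show ?thesis
  proof
    assume "step1 (i, u, k) (j, u', k')"
    then obtain e where e: "j < N" "k' < length (bl j)" "usucc M u (bl i ! k) = Some (u', e)" "offs bl e i k j k'"
      unfolding stp_def by auto
    then have v: "valid_pos j k'" by (simp add: valid_pos_def)
    then show "valid_pos j k' \<and> (\<exists>e. usucc M u (bl i ! k) = Some (u', e) \<and> pos j k' = pos i k + e)"
      using pos_offs[OF assms(1) v] usucc_US[OF assms(2) e(3)] e by blast
  next
    assume "valid_pos j k' \<and> (\<exists>e. usucc M u (bl i ! k) = Some (u', e) \<and> pos j k' = pos i k + e)"
    then obtain e where e: "valid_pos j k'" "usucc M u (bl i ! k) = Some (u', e)" "pos j k' = pos i k + e" by blast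
    then have "offs bl e i k j k'" using pos_offs[OF assms(1) e(1)] usucc_US[OF assms(2) e(2)] by blast
    then show "step1 (i, u, k) (j, u', k')"
      unfolding stp_def using C1 C2[OF e(1,2)] e(1,2) assms(1) by (auto simp: valid_pos_def)
  qed
qed

lemma mstep_iff:
  assumes "valid_pos i k"
  shows "mstep (umach M ini) tp bd (u, pos i k, zs) (u', p', zs') \<longleftrightarrow>
    (\<exists>e. usucc M u (bl i ! k) = Some (u', e) \<and> p' = pos i k + e \<and> 0 \<le> p' \<and> p' \<le> bd \<and> zs' = zs @ olist (em (i, u, k)))"
proof -
  have "tp (pos i k) = bl i ! k" using pos_range[OF assms] by simp
  then show ?thesis by (auto simp: mstep_def umach_def em_def split: option.splits)
qed

sublocale D: det_rel step1 em
proof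
  fix p p1 p2 assume st: "step1 p p1" "step1 p p2"
  obtain i u k where p: "p = (i, u, k)" by (metis prod.exhaust)
  obtain j1 u1 k1 where p1: "p1 = (j1, u1, k1)" by (metis prod.exhaust)
  obtain j2 u2 k2 where p2: "p2 = (j2, u2, k2)" by (metis prod.exhaust)
  have v: "valid_pos i k" "u \<in> US" using st(1) unfolding p p1 stp_def by (auto simp: valid_pos_def C_def)
  obtain e where e: "usucc M u (bl i ! k) = Some (u1, e)" "u1 = u2" "valid_pos j1 k1" "valid_pos j2 k2" "pos j1 k1 = pos j2 k2"
    using st unfolding p p1 p2 step1_iff[OF v] by auto
  \<comment> \<open>Equal tape positions have distance 0, so \<open>offs\<close> with displacement 0
    identifies the coordinates.\<close>
  then have "offs bl 0 j1 k1 j2 k2" using pos_offs[OF e(3,4), of 0] by simp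
  then show "p1 = p2" using e(2) by (simp add: offs_def p1 p2)
qed

abbreviation outs where "outs ks \<equiv> concat (map (\<lambda>p. olist (em p)) ks)"

text \<open>\<open>outs\<close> also counts the last configuration, which no step leaves, so it has
  to be silent.\<close>

lemma run_of_det:
  assumes "det_run step1 ks" "hd ks = (i, u, k)" "valid_pos i k" "u \<in> US" "last ks = (i', u', k')" "em (last ks) = None"
  shows "(mstep (umach M ini) tp bd)\<^sup>*\<^sup>* (u, pos i k, zs) (u', pos i' k', zs @ outs ks)"
  using assms
proof (induction arbitrary: i u k zs rule: det_run.induct)
  case (det_run_last x)
  then show ?case by (simp add: olist_def)
next
  case (det_run_Cons x y ks)
  obtain j v l where y: "y = (j, v, l)" by (metis prod.exhaust)
  have x: "x = (i, u, k)" using det_run_Cons.prems(1) by simp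
  obtain e where e: "valid_pos j l" "usucc M u (bl i ! k) = Some (v, e)" "pos j l = pos i k + e"
    using det_run_Cons.hyps(1) unfolding x y step1_iff[OF det_run_Cons.prems(2,3)] by blast
  have "v \<in> US" using usucc_US[OF det_run_Cons.prems(3) e(2)] by simp
  have "mstep (umach M ini) tp bd (u, pos i k, zs) (v, pos j l, zs @ olist (em x))"
    unfolding mstep_iff[OF det_run_Cons.prems(2)] x using e pos_range[OF e(1)] by simp
  moreover have "(mstep (umach M ini) tp bd)\<^sup>*\<^sup>* (v, pos j l, zs @ olist (em x)) (u', pos i' k', (zs @ olist (em x)) @ outs (y # ks))"
    by (rule det_run_Cons.IH) (use det_run_Cons.prems y e(1) \<open>v \<in> US\<close> in simp_all)
  ultimately show ?case by (simp add: converse_rtranclp_into_rtranclp)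
qed

text \<open>The final state has no instruction, so a run that ends there is maximal; every position
  within the bounds has block coordinates.\<close>

lemma det_of_run:
  assumes "(mstep (umach M ini) tp bd)\<^sup>*\<^sup>* (u, p, zs) (Emit (qf M) 0, p', zs')" "u \<in> US" "valid_pos i k" "p = pos i k"
  shows "\<exists>ks. det_run step1 ks \<and> hd ks = (i, u, k) \<and> fst (snd (last ks)) = Emit (qf M) 0 \<and> zs' = zs @ outs ks"
  using assms
proof (induction "(u, p, zs)" arbitrary: u p zs i k rule: converse_rtranclp_induct)
  case base
  have none: "act M (qf M) \<sigma> = None" for \<sigma> using act_wf(3)[OF wfM, of "qf M"] by (cases "act M (qf M) \<sigma>") auto
  have "\<not> step1 (i, Emit (qf M) 0, k) y" for y
    by (cases y) (simp add: stp_def none)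
  then have "det_run step1 [(i, Emit (qf M) 0, k)]" by (rule det_run_last)
  then show ?case by (intro exI[of _ "[(i, Emit (qf M) 0, k)]"]) (simp add: em_def none olist_def)
next
  case (step c)
  obtain v q zs1 where c: "c = (v, q, zs1)" by (metis prod.exhaust)
  obtain e where e: "usucc M u (bl i ! k) = Some (v, e)" "q = pos i k + e" "0 \<le> q" "q \<le> bd" "zs1 = zs @ olist (em (i, u, k))"
    using step.hyps(1) unfolding c step.prems(3) mstep_iff[OF step.prems(2)] by blast
  obtain j l where jl: "valid_pos j l" "q = pos j l" using pos_surj[OF e(3,4)] by blast
  have "v \<in> US" using usucc_US[OF step.prems(1) e(1)] by simp
  from step.hyps(3)[OF c this jl] obtain ks where
    ks: "det_run step1 ks" "hd ks = (j, v, l)" "fst (snd (last ks)) = Emit (qf M) 0" "zs' = zs1 @ outs ks" by blast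
  have "step1 (i, u, k) (j, v, l)" unfolding step1_iff[OF step.prems(2,1)] using jl e by auto
  moreover obtain ks' where "ks = (j, v, l) # ks'" using ks(1,2) by (cases ks) (auto elim: det_run.cases)
  ultimately show ?case using ks e(5) by (intro exI[of _ "(i, u, k) # ks"]) (auto intro: det_run_Cons)
qed

lemma outs_emits: "outs ks = map (\<lambda>p. the (em p)) (filter (\<lambda>p. em p \<noteq> None) ks)"
  by (induction ks) (auto simp: olist_def)

theorem run_iff:
  "(\<exists>p. (mstep (umach M ini) tp bd)\<^sup>*\<^sup>* (Start, 0, []) (Emit (qf M) 0, p, zs)) \<longleftrightarrow>
   (\<exists>ks. det_run step1 ks \<and> hd ks = (0, Start, 0) \<and> fst (snd (last ks)) = Emit (qf M) 0 \<and> zs = outs ks)"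
proof -
  have v: "valid_pos 0 0" "0 = pos 0 0" "Start \<in> US"
    using wne bl_ne[of 0] by (simp_all add: valid_pos_def pos_def US_def)
  have none: "act M (qf M) \<sigma> = None" for \<sigma> using act_wf(3)[OF wfM, of "qf M"] by (cases "act M (qf M) \<sigma>") auto
  show ?thesis
  proof
    assume "\<exists>p. (mstep (umach M ini) tp bd)\<^sup>*\<^sup>* (Start, 0, []) (Emit (qf M) 0, p, zs)"
    then show "\<exists>ks. det_run step1 ks \<and> hd ks = (0, Start, 0) \<and> fst (snd (last ks)) = Emit (qf M) 0 \<and> zs = outs ks"
      using det_of_run[OF _ v(3,1,2)] by fastforce
  next
    assume "\<exists>ks. det_run step1 ks \<and> hd ks = (0, Start, 0) \<and> fst (snd (last ks)) = Emit (qf M) 0 \<and> zs = outs ks"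
    then obtain ks where ks: "det_run step1 ks" "hd ks = (0, Start, 0)" "fst (snd (last ks)) = Emit (qf M) 0" "zs = outs ks" by blast
    obtain i' u' k' where l: "last ks = (i', u', k')" by (metis prod.exhaust)
    have "em (last ks) = None" using ks(3) l by (simp add: em_def none)
    from run_of_det[OF ks(1,2) v(1,3) l this, of "[]"] show "\<exists>p. (mstep (umach M ini) tp bd)\<^sup>*\<^sup>* (Start, 0, []) (Emit (qf M) 0, p, zs)"
      using ks(3,4) l v(2) by auto
  qed
qed

end

section \<open>The transduction of a deterministic gsm\<close>

lemma word_graph_edge:
  "word_graph lab inc ws g \<Longrightarrow> (u, \<gamma>, v) \<in> gE g \<longleftrightarrow> v = Suc u \<and> v < length ws \<and> \<gamma> = inc (ws ! v)"
  by (auto simp: word_graph_def)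

lemma word_graph_ends:
  assumes "word_graph lab inc ws g" "i < length ws"
  shows "(\<exists>u \<gamma>. (u, \<gamma>, i) \<in> gE g) \<longleftrightarrow> i \<noteq> 0" "(\<exists>u \<gamma>. (i, \<gamma>, u) \<in> gE g) \<longleftrightarrow> Suc i \<noteq> length ws"
  unfolding word_graph_edge[OF assms(1)] using assms(2) by (cases i, simp_all) linarith?

text \<open>A quadruple \<open>(f, l, a, b)\<close> in \<open>V\<close> allows block \<open>b\<close> at a node with letter \<open>a\<close> that is first
  iff \<open>f\<close> and last iff \<open>l\<close>. The empty graph has no node to carry a block; \<open>eps\<close> decides whether
  it belongs to the domain.\<close>

locale gsm_transduction = gsm_blocks +
  fixes lab inc :: "nat option \<Rightarrow> nat option" and NA2 EA2 :: "nat option set"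
    and V :: "(bool \<times> bool \<times> nat option \<times> tsym list) set" and eps :: bool
  assumes finV: "finite V" and VBS: "(f, l, a, b) \<in> V \<Longrightarrow> b \<in> BS"
    and finNA2: "finite NA2" and finEA2: "finite EA2"
begin

sublocale R: reach_formula C ixc np
  by unfold_locales (rule finC inj_ixc)+

section \<open>Formulas of the transduction\<close>

definition allQ :: "ust \<times> nat \<Rightarrow> tsym list \<Rightarrow> bool" where "allQ = (\<lambda>_ _. True)"
definition silQ :: "ust \<times> nat \<Rightarrow> tsym list \<Rightarrow> bool" where
  "silQ = (\<lambda>c b. emit M ini (fst c) (b ! snd c) = None)"

text \<open>Node variables are kept apart by number: 0 and 1 are the free variables of the
  transduction, 2 and 3 belong to \<open>closedF\<close>, 5 to \<open>srcF\<close> and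
  \<open>sinkF\<close>, while 4 and 6 are the auxiliary nodes of this formula and of
  \<open>edgeT\<close>.\<close>

definition visF :: "ust \<times> nat \<Rightarrow> nat \<Rightarrow> mso" where
  "visF c x = ExN 4 (Conj (srcF EA 4) (R.reachF (stepF allQ) (Start, 0) c 4 x))"

text \<open>What is emitted depends only on the state and the scanned symbol, which the block at the
  node determines. \<open>h\<close> is \<open>lab\<close> for node labels and \<open>inc\<close> for
  edge labels.\<close>

definition letterF :: "(nat option \<Rightarrow> nat option) \<Rightarrow> ust \<times> nat \<Rightarrow> nat option \<Rightarrow> nat \<Rightarrow> mso" where
  "letterF h c \<sigma> x = OrS BS (\<lambda>b. ifF (\<exists>l. emit M ini (fst c) (b ! snd c) = Some l \<and> h l = \<sigma>) (Mem x (ixb b)))"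

definition nodeT :: "ust \<times> nat \<Rightarrow> nat option \<Rightarrow> mso" where
  "nodeT c \<sigma> = Conj (visF c 0) (letterF lab c \<sigma> 0)"

text \<open>An edge leads to the next emitting configuration: one step, then silent steps. As in
  word graphs, its label comes from the letter at its target.\<close>

definition edgeT :: "ust \<times> nat \<Rightarrow> ust \<times> nat \<Rightarrow> nat option \<Rightarrow> mso" where
  "edgeT c c' \<gamma> = Conj (letterF inc c' \<gamma> 1)
     (ExN 6 (OrS C (\<lambda>d. Conj (stepF allQ c d 0 6) (R.reachF (stepF silQ) d c' 6 1))))"

definition flagF :: "bool \<Rightarrow> mso \<Rightarrow> mso" where "flagF f \<phi> = (if f then \<phi> else Neg \<phi>)"

lemma sat_flagF [simp]: "sat g n s (flagF f \<phi>) \<longleftrightarrow> sat g n s \<phi> = f"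
  and fv_flagF [simp]: "fvn (flagF f \<phi>) = fvn \<phi>" "fvs (flagF f \<phi>) = fvs \<phi>"
  by (simp_all add: flagF_def)

text \<open>A letter shows only in the label of its node and in the label of the incoming edge; the
  latter is compared only where there is such an edge.\<close>

definition blockF :: "bool \<times> bool \<times> nat option \<times> tsym list \<Rightarrow> mso" where
  "blockF = (\<lambda>(f, l, a, b). Conj (Conj (flagF f (srcF EA 0)) (flagF l (sinkF EA 0)))
     (Conj (Conj (Lab (lab a) 0) (Or (srcF EA 0) (ExN 5 (Edg (inc a) 5 0))))
       (Conj (Mem 0 (ixb b)) (AndS (BS - {b}) (\<lambda>b'. Neg (Mem 0 (ixb b')))))))"

definition validF :: mso where
  "validF = Neg (ExN 0 (Neg (OrS V blockF)))"

definition accF :: mso where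
  "accF = ExN 0 (OrS {c \<in> C. fst c = Emit (qf M) 0} (\<lambda>c. visF c 0))"

definition domT :: mso where
  "domT = Or (ifF eps (Neg (ExN 0 (Eq 0 0)))) (Conj (wordF EA) (Conj validF accF))"

definition TR :: mso_trans where
  "TR = \<lparr>tdom = domT, npar = np, copies = ixc ` C, nodef = (\<lambda>n. nodeT (inv_into C ixc n)),
     edgef = (\<lambda>n n'. edgeT (inv_into C ixc n) (inv_into C ixc n')), onalph = NA2, oealph = EA2\<rparr>"

lemma inv_ixc: "c \<in> C \<Longrightarrow> inv_into C ixc (ixc c) = c"
  using inj_ixc by simp

lemma Start_C: "BS \<noteq> {} \<Longrightarrow> (Start, 0) \<in> C"
  by (simp add: C_def US_def)

lemma fv_visF: "c \<in> C \<Longrightarrow> fvn (visF c x) \<subseteq> {x}" "c \<in> C \<Longrightarrow> fvs (visF c x) \<subseteq> {..<np}"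
proof -
  assume c: "c \<in> C"
  have S: "(Start, 0) \<in> C" by (simp add: C_def US_def)
  have "fvn (R.reachF (stepF allQ) (Start, 0) c 4 x) \<subseteq> {4, x}" by (rule R.fvn_reachF) (rule fv_stepF)
  then show "fvn (visF c x) \<subseteq> {x}" using fv_srcF[OF finEA, of 4] by (auto simp: visF_def)
  have "fvs (R.reachF (stepF allQ) (Start, 0) c 4 x) \<subseteq> {..<np}" by (rule R.fvs_reachF) (rule fv_stepF S c)+
  then show "fvs (visF c x) \<subseteq> {..<np}" using fv_srcF[OF finEA, of 4] by (auto simp: visF_def)
qed

lemma fv_letterF: "fvn (letterF h c \<sigma> x) \<subseteq> {x}" "fvs (letterF h c \<sigma> x) \<subseteq> {..<np}"
  using finBS ixb_np by (auto simp: letterF_def ifF_def split: if_splits)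

lemma fv_edgeT: "c' \<in> C \<Longrightarrow> fvn (edgeT c c' \<gamma>) \<subseteq> {0, 1}" "c' \<in> C \<Longrightarrow> fvs (edgeT c c' \<gamma>) \<subseteq> {..<np}"
proof -
  assume c: "c' \<in> C"
  have 1: "fvn (R.reachF (stepF silQ) d c' 6 1) \<subseteq> {6, 1}" for d by (rule R.fvn_reachF) (rule fv_stepF)
  have 2: "fvs (R.reachF (stepF silQ) d c' 6 1) \<subseteq> {..<np}" if "d \<in> C" for d
    by (rule R.fvs_reachF) (rule fv_stepF that c)+
  have 3: "fvn (OrS C (\<lambda>d. Conj (stepF allQ c d 0 6) (R.reachF (stepF silQ) d c' 6 1))) \<subseteq> {0, 1, 6}"
    "fvs (OrS C (\<lambda>d. Conj (stepF allQ c d 0 6) (R.reachF (stepF silQ) d c' 6 1))) \<subseteq> {..<np}"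
    using fv_stepF[of allQ c _ 0 6] 1 2 finC by (simp_all add: UN_subset_iff) blast
  show "fvn (edgeT c c' \<gamma>) \<subseteq> {0, 1}" "fvs (edgeT c c' \<gamma>) \<subseteq> {..<np}"
    using 3 fv_letterF[of inc c' \<gamma> 1] unfolding edgeT_def by auto
qed

lemma fv_domT: "fvn domT = {}" "fvs domT \<subseteq> {..<np}"
proof -
  have "fvn (blockF p) \<subseteq> {0} \<and> fvs (blockF p) \<subseteq> {..<np}" if "p \<in> V" for p
  proof -
    obtain f l a b where p: "p = (f, l, a, b)" by (metis prod.exhaust)
    have "ixb b < np" using that VBS ixb_np p by blast
    then show ?thesis using fv_srcF[OF finEA, of 0] fv_sinkF[OF finEA, of 0] finBS ixb_np
      by (auto simp: blockF_def p)
  qed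
  then have "fvn (OrS V blockF) \<subseteq> {0}" "fvs (OrS V blockF) \<subseteq> {..<np}"
    using finV by (simp_all add: UN_subset_iff)
  then have 1: "fvn validF = {}" "fvs validF \<subseteq> {..<np}" by (auto simp: validF_def)
  have f: "finite {c \<in> C. fst c = Emit (qf M) 0}" using finC by simp
  have "fvn (OrS {c \<in> C. fst c = Emit (qf M) 0} (\<lambda>c. visF c 0)) \<subseteq> {0}"
    unfolding fvn_OrS[OF f] by (rule UN_least, rule fv_visF(1)) simp
  moreover have "fvs (OrS {c \<in> C. fst c = Emit (qf M) 0} (\<lambda>c. visF c 0)) \<subseteq> {..<np}"
    unfolding fvs_OrS[OF f] by (rule UN_least, rule fv_visF(2)) simp
  ultimately have 2: "fvn accF = {}" "fvs accF \<subseteq> {..<np}"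
    by (auto simp: accF_def)
  show "fvn domT = {}" "fvs domT \<subseteq> {..<np}"
    using 1 2 fv_wordF[OF finEA] by (auto simp: domT_def ifF_def)
qed

lemma wf_TR: "wf_trans TR"
proof -
  have "fvn (nodeT c \<sigma>) \<subseteq> {0} \<and> fvs (nodeT c \<sigma>) \<subseteq> {..<np}" if "c \<in> C" for c \<sigma>
    using fv_visF[OF that, of 0] fv_letterF[of lab c \<sigma> 0] by (auto simp: nodeT_def)
  then show ?thesis
    unfolding wf_trans_def TR_def using fv_domT fv_edgeT finC finNA2 finEA2 by (simp add: inv_ixc)
qed

lemma sat_validF:
  assumes "word_graph lab inc ws g" "gE g \<subseteq> gV g \<times> EA \<times> gV g"
  shows "sat g n s validF \<longleftrightarrow> (\<forall>i<length ws. \<exists>a b. (i = 0, Suc i = length ws, a, b) \<in> V \<and>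
     lab a = lab (ws ! i) \<and> (i = 0 \<or> inc a = inc (ws ! i)) \<and> (\<forall>b'\<in>BS. i \<in> s (ixb b') \<longleftrightarrow> b' = b))"
proof -
  have gV: "gV g = {0..<length ws}" using assms(1) by (simp add: word_graph_def)
  have "sat g (n(0 := i)) s (blockF (f, l, a, b)) \<longleftrightarrow> (i = 0) = f \<and> (Suc i = length ws) = l \<and>
     lab a = lab (ws ! i) \<and> (i = 0 \<or> inc a = inc (ws ! i)) \<and> (\<forall>b'\<in>BS. i \<in> s (ixb b') \<longleftrightarrow> b' = b)"
    if i: "i < length ws" and V: "(f, l, a, b) \<in> V" for i f l a b
  proof -
    have src: "(\<exists>u \<gamma>. (u, \<gamma>, i) \<in> gE g) \<longleftrightarrow> i \<noteq> 0" "(\<exists>u \<gamma>. (i, \<gamma>, u) \<in> gE g) \<longleftrightarrow> Suc i \<noteq> length ws"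
      by (rule word_graph_ends[OF assms(1) i])+
    have s: "sat g (n(0 := i)) s (srcF EA 0) \<longleftrightarrow> i = 0" "sat g (n(0 := i)) s (sinkF EA 0) \<longleftrightarrow> Suc i = length ws"
      using sat_srcF[OF finEA assms(2), of 0 "n(0 := i)" s] src by simp_all
    have p: "(\<exists>v\<in>gV g. (v, inc a, i) \<in> gE g) \<longleftrightarrow> i \<noteq> 0 \<and> inc a = inc (ws ! i)"
      unfolding word_graph_edge[OF assms(1)] gV using i by (cases i) simp_all
    have l: "glab g i = lab (ws ! i)" using i assms(1) by (simp add: word_graph_def)
    have "sat g (n(0 := i)) s (blockF (f, l, a, b)) \<longleftrightarrow> ((i = 0) = f \<and> (Suc i = length ws) = l) \<and>
       (lab (ws ! i) = lab a \<and> (i = 0 \<or> (\<exists>v\<in>gV g. (v, inc a, i) \<in> gE g))) \<and>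
       (i \<in> s (ixb b) \<and> (\<forall>b'\<in>BS - {b}. i \<notin> s (ixb b')))"
      unfolding blockF_def using finBS by (simp add: s l)
    also have "\<dots> \<longleftrightarrow> (i = 0) = f \<and> (Suc i = length ws) = l \<and>
     lab a = lab (ws ! i) \<and> (i = 0 \<or> inc a = inc (ws ! i)) \<and> (\<forall>b'\<in>BS. i \<in> s (ixb b') \<longleftrightarrow> b' = b)"
      unfolding p using VBS[OF V] by auto
    finally show ?thesis .
  qed
  note blk = this
  have *: "sat g (n(0 := i)) s (OrS V blockF) \<longleftrightarrow> (\<exists>a b. (i = 0, Suc i = length ws, a, b) \<in> V \<and>
     lab a = lab (ws ! i) \<and> (i = 0 \<or> inc a = inc (ws ! i)) \<and> (\<forall>b'\<in>BS. i \<in> s (ixb b') \<longleftrightarrow> b' = b))"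
    if i: "i < length ws" for i
  proof -
    have "sat g (n(0 := i)) s (OrS V blockF) \<longleftrightarrow> (\<exists>f l a b. (f, l, a, b) \<in> V \<and> sat g (n(0 := i)) s (blockF (f, l, a, b)))"
      unfolding sat_OrS[OF finV] by (simp add: Bex_def)
    also have "\<dots> \<longleftrightarrow> (\<exists>f l a b. (f, l, a, b) \<in> V \<and> (i = 0) = f \<and> (Suc i = length ws) = l \<and>
       lab a = lab (ws ! i) \<and> (i = 0 \<or> inc a = inc (ws ! i)) \<and> (\<forall>b'\<in>BS. i \<in> s (ixb b') \<longleftrightarrow> b' = b))"
      by (intro iff_exI conj_cong refl blk[OF i])
    finally show ?thesis by simp
  qed
  have "sat g n s validF \<longleftrightarrow> (\<forall>i<length ws. sat g (n(0 := i)) s (OrS V blockF))"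
    unfolding validF_def by (auto simp: gV simp del: sat_OrS)
  then show ?thesis using * by simp
qed

end

section \<open>Semantics of the transduction on the graph of a word\<close>

locale transduction_word = gsm_transduction M ini EA BS lab inc NA2 EA2 V eps + gsm_word M ini EA BS lab inc ws g s bl
  for M ini EA BS lab inc NA2 EA2 V eps ws g s bl
begin

lemma BS_ne: "BS \<noteq> {}" using bl[of 0] wne by auto

lemma reach_sat:
  assumes "c \<in> C" "c' \<in> C" "n x < N" "n y < N"
  shows "sat g n s (R.reachF (stepF Q) c c' x y) \<longleftrightarrow> (stp Q)\<^sup>*\<^sup>* (n x, c) (n y, c')"
proof (rule R.sat_reachF[OF _ _ assms(1,2)])
  show "sat g n' s' (stepF Q d d' 2 3) \<longleftrightarrow> stp Q (n' 2, d) (n' 3, d')"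
    if "d \<in> C" "d' \<in> C" "n' 2 \<in> gV g" "n' 3 \<in> gV g" "\<And>X. X < np \<Longrightarrow> s' X = s X" for d d' n' s'
    by (rule sat_stepF) (use that gV in auto)
  show "u \<in> gV g \<and> v \<in> gV g \<and> d \<in> C \<and> d' \<in> C" if "stp Q (u, d) (v, d')" for u d v d'
    using that by (simp add: stp_def gV)
qed (use assms gV in auto)

lemma stp_range: "stp Q (u, c) (w, d) \<Longrightarrow> u < N \<and> w < N \<and> c \<in> C \<and> d \<in> C"
  by (simp add: stp_def)

lemma sil_eq: "stp silQ = silent step1 em"
  by (intro HOL.ext) (simp add: silQ_def silent_stp)

lemma vis_sat:
  assumes "c \<in> C" "n x < N" "x \<noteq> 4"
  shows "sat g n s (visF c x) \<longleftrightarrow> step1\<^sup>*\<^sup>* (0, Start, 0) (n x, c)"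
proof -
  have src: "sat g n' s (srcF EA 4) \<longleftrightarrow> n' 4 = 0" if "n' 4 < N" for n'
  proof -
    have "(\<exists>u \<gamma>. (u, \<gamma>, n' 4) \<in> gE g) \<longleftrightarrow> n' 4 \<noteq> 0"
      by (rule word_graph_ends(1)[OF wg that])
    then show ?thesis using sat_srcF(1)[OF finEA gEA, of 4 n' s] by simp
  qed
  have "sat g n s (visF c x) \<longleftrightarrow> (\<exists>v\<in>gV g. v = 0 \<and> sat g (n(4 := v)) s (R.reachF (stepF allQ) (Start, 0) c 4 x))"
    unfolding visF_def sat.simps using src gV by auto
  also have "\<dots> \<longleftrightarrow> sat g (n(4 := 0)) s (R.reachF (stepF allQ) (Start, 0) c 4 x)"
    using gV wne by auto
  also have "\<dots> \<longleftrightarrow> step1\<^sup>*\<^sup>* (0, Start, 0) (n x, c)"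
    using reach_sat[OF Start_C[OF BS_ne] assms(1), of "n(4 := 0)" 4 x allQ] assms wne by (simp add: allQ_def)
  finally show ?thesis .
qed

lemma reach_valid: "step1\<^sup>*\<^sup>* (0, Start, 0) (i, c) \<Longrightarrow> i < N \<and> c \<in> C"
proof -
  have "fst p < N \<and> snd p \<in> C" if "step1\<^sup>*\<^sup>* (0, Start, 0) p" for p
    using that
  proof (induction rule: rtranclp_induct)
    case base
    then show ?case using wne Start_C[OF BS_ne] by simp
  next
    case (step p q)
    then show ?case by (cases p; cases q) (simp add: stp_def)
  qed
  then show "step1\<^sup>*\<^sup>* (0, Start, 0) (i, c) \<Longrightarrow> i < N \<and> c \<in> C" by fastforce
qed

text \<open>The final state is stuck, so reaching it from the start means that the maximal run ends
  in it.\<close>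

lemma accF_iff: "sat g n s accF \<longleftrightarrow> (\<exists>ks. det_run step1 ks \<and> hd ks = (0, Start, 0) \<and> fst (snd (last ks)) = Emit (qf M) 0)"
proof -
  have none: "act M (qf M) \<sigma> = None" for \<sigma> using act_wf(3)[OF wfM, of "qf M"] by (cases "act M (qf M) \<sigma>") auto
  have f: "finite {c \<in> C. fst c = Emit (qf M) 0}" using finC by simp
  have "sat g n s accF \<longleftrightarrow> (\<exists>i<N. \<exists>c\<in>C. fst c = Emit (qf M) 0 \<and> step1\<^sup>*\<^sup>* (0, Start, 0) (i, c))"
  proof -
    have v: "sat g (n(0 := i)) s (visF c 0) \<longleftrightarrow> step1\<^sup>*\<^sup>* (0, Start, 0) (i, c)" if "i < N" "c \<in> C" for i c
      using vis_sat[OF that(2), of "n(0 := i)" 0] that(1) by simp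
    have "sat g n s accF \<longleftrightarrow> (\<exists>i\<in>gV g. \<exists>c\<in>{c \<in> C. fst c = Emit (qf M) 0}. step1\<^sup>*\<^sup>* (0, Start, 0) (i, c))"
      unfolding accF_def sat.simps(7) sat_OrS[OF f] by (intro bex_cong refl) (simp add: v gV)
    then show ?thesis by (auto simp: gV simp del: split_paired_Ex split_paired_All)
  qed
  also have "\<dots> \<longleftrightarrow> (\<exists>ks. det_run step1 ks \<and> hd ks = (0, Start, 0) \<and> fst (snd (last ks)) = Emit (qf M) 0)"
  proof
    assume "\<exists>i<N. \<exists>c\<in>C. fst c = Emit (qf M) 0 \<and> step1\<^sup>*\<^sup>* (0, Start, 0) (i, c)"
    then obtain i c where c: "fst c = Emit (qf M) 0" "step1\<^sup>*\<^sup>* (0, Start, 0) (i, c)" by blast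
    have "\<not> step1 (i, c) y" for y using c(1) by (cases y) (simp add: stp_def none)
    from D.det_run_exists[OF c(2) this] c(1)
    show "\<exists>ks. det_run step1 ks \<and> hd ks = (0, Start, 0) \<and> fst (snd (last ks)) = Emit (qf M) 0" by auto
  next
    assume "\<exists>ks. det_run step1 ks \<and> hd ks = (0, Start, 0) \<and> fst (snd (last ks)) = Emit (qf M) 0"
    then obtain ks where ks: "det_run step1 ks" "hd ks = (0, Start, 0)" "fst (snd (last ks)) = Emit (qf M) 0" by blast
    obtain i c where ic: "last ks = (i, c)" by (metis prod.exhaust)
    have "ks \<noteq> []" using ks(1) by (auto elim: det_run.cases)
    then have r: "step1\<^sup>*\<^sup>* (0, Start, 0) (i, c)" using D.det_run_reach[OF ks(1)] ks(2) ic by (metis last_in_set)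
    then have "i < N \<and> c \<in> C" by (rule reach_valid)
    then show "\<exists>i<N. \<exists>c\<in>C. fst c = Emit (qf M) 0 \<and> step1\<^sup>*\<^sup>* (0, Start, 0) (i, c)" using r ks(3) ic by auto
  qed
  finally show ?thesis .
qed

lemma letter_sat: "n x < N \<Longrightarrow> sat g n s (letterF h c \<sigma> x) \<longleftrightarrow> (\<exists>l. em (n x, c) = Some l \<and> h l = \<sigma>)"
  unfolding letterF_def using finBS sbl[of "n x"] bl[of "n x"] by (auto simp: em_def)

abbreviation H where "H \<equiv> out_graph TR g s"

text \<open>The letter of an output node is shown on its incoming edge only from the second node on,
  hence the shifted index in \<open>incs\<close>.\<close>

context
  fixes ks assumes run: "det_run step1 ks" "hd ks = (0, Start, 0)"
    and labs: "\<forall>i<length (D.emits ks). lab (the (em (D.emits ks ! i))) \<in> NA2"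
    and incs: "\<forall>i. Suc i < length (D.emits ks) \<longrightarrow> inc (the (em (D.emits ks ! Suc i))) \<in> EA2"
begin

definition E where "E = D.emits ks"

lemma set_E: "p \<in> set E \<longleftrightarrow> p \<in> set ks \<and> em p \<noteq> None"
  unfolding E_def set_filter by blast

lemmas labs' = labs[folded E_def] and incs' = incs[folded E_def]

lemma ks_reach: "(i, c) \<in> set ks \<longleftrightarrow> step1\<^sup>*\<^sup>* (0, Start, 0) (i, c)"
  using D.det_run_reach[OF run(1)] run(2) by simp

lemma ks_valid: "(i, c) \<in> set ks \<Longrightarrow> i < N \<and> c \<in> C"
  unfolding ks_reach by (rule reach_valid)

lemma node_sat:
  assumes "u < N" "c \<in> C"
  shows "sat g (\<lambda>_. u) s (nodef TR (ixc c) \<sigma>) \<longleftrightarrow> (u, c) \<in> set ks \<and> (\<exists>l. em (u, c) = Some l \<and> lab l = \<sigma>)"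
proof -
  have "nodef TR (ixc c) \<sigma> = nodeT c \<sigma>" using assms(2) by (simp add: TR_def inv_ixc)
  then show ?thesis
    using vis_sat[OF assms(2), of "\<lambda>_. u" 0] letter_sat[of "\<lambda>_. u" 0 lab c \<sigma>] assms(1)
    by (simp add: nodeT_def ks_reach)
qed

lemma E_lab: "p \<in> set E \<Longrightarrow> \<exists>l. em p = Some l \<and> lab l \<in> NA2"
proof -
  assume p: "p \<in> set E"
  then obtain i where "i < length E" "p = E ! i" by (auto simp: in_set_conv_nth)
  then have "lab (the (em p)) \<in> NA2" using labs' by blast
  then show ?thesis using p unfolding set_E by auto
qed

text \<open>An emitting configuration has one letter, so a visited one satisfies the node formula of
  exactly one label, and a silent one of none.\<close>

lemma nodes: "(u, c') \<in> gV H \<longleftrightarrow> (\<exists>c. c' = ixc c \<and> (u, c) \<in> set E)"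
proof
  assume "(u, c') \<in> gV H"
  then have uc: "u < N" "c' \<in> ixc ` C" "\<exists>\<sigma>. sat g (\<lambda>_. u) s (nodef TR c' \<sigma>)"
    using gV by (auto simp: out_nodes_iff TR_def)
  then obtain c where c: "c' = ixc c" "c \<in> C" by blast
  then have "(u, c) \<in> set E" using node_sat[OF uc(1) c(2)] uc(3) unfolding set_E by auto
  then show "\<exists>c. c' = ixc c \<and> (u, c) \<in> set E" using c(1) by blast
next
  assume "\<exists>c. c' = ixc c \<and> (u, c) \<in> set E"
  then obtain c where c: "c' = ixc c" "(u, c) \<in> set E" by blast
  obtain l where l: "em (u, c) = Some l" "lab l \<in> NA2" using E_lab[OF c(2)] by blast
  have uc: "u < N" "c \<in> C" "(u, c) \<in> set ks" using c(2) ks_valid unfolding set_E by blast+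
  have "\<exists>!\<sigma>. \<sigma> \<in> onalph TR \<and> sat g (\<lambda>_. u) s (nodef TR c' \<sigma>)"
    unfolding c(1) node_sat[OF uc(1,2)] using l uc(3) by (auto simp: TR_def)
  moreover have "u \<in> gV g" "c' \<in> copies TR" using uc c(1) gV by (auto simp: TR_def)
  ultimately show "(u, c') \<in> gV H" by (simp add: out_nodes_iff)
qed

lemma node_lab:
  assumes "(u, c) \<in> set E"
  shows "glab H (u, ixc c) = lab (the (em (u, c)))"
proof -
  obtain l where l: "em (u, c) = Some l" "lab l \<in> NA2" using E_lab[OF assms] by blast
  have uc: "u < N" "c \<in> C" "(u, c) \<in> set ks" using assms ks_valid unfolding set_E by blast+
  show ?thesis unfolding glab_out_graph node_sat[OF uc(1,2)]
    using l uc(3) by (intro the_equality) (auto simp: TR_def)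
qed

lemma edges:
  assumes "(u, c) \<in> set E" "(v, c') \<in> set E"
  shows "((u, ixc c), \<gamma>, (v, ixc c')) \<in> gE H \<longleftrightarrow>
    ((u, c), (v, c')) \<in> adj E \<and> \<gamma> \<in> EA2 \<and> \<gamma> = inc (the (em (v, c')))"
proof -
  have uc: "u < N" "c \<in> C" "v < N" "c' \<in> C" using assms ks_valid unfolding set_E by blast+
  obtain l where l: "em (v, c') = Some l" using E_lab[OF assms(2)] by blast
  let ?n = "(\<lambda>_. u)(1 := v)"
  have nodes': "(u, ixc c) \<in> out_nodes TR g s" "(v, ixc c') \<in> out_nodes TR g s"
    using nodes assms by (metis gV_out_graph)+
  have T: "edgef TR (ixc c) (ixc c') \<gamma> = edgeT c c' \<gamma>" using uc by (simp add: TR_def inv_ixc)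
  have "sat g (?n(6 := w)) s (Conj (stepF allQ c d 0 6) (R.reachF (stepF silQ) d c' 6 1)) \<longleftrightarrow>
      step1 (u, c) (w, d) \<and> (silent step1 em)\<^sup>*\<^sup>* (w, d) (v, c')" if "w < N" "d \<in> C" for w d
    using sat_stepF[OF uc(2) that(2), of "?n(6 := w)" 0 6 s allQ]
      reach_sat[OF that(2) uc(4), of "?n(6 := w)" 6 1 silQ] uc that by (simp add: sil_eq allQ_def)
  then have "sat g ?n s (ExN 6 (OrS C (\<lambda>d. Conj (stepF allQ c d 0 6) (R.reachF (stepF silQ) d c' 6 1)))) \<longleftrightarrow>
     (\<exists>w<N. \<exists>d\<in>C. step1 (u, c) (w, d) \<and> (silent step1 em)\<^sup>*\<^sup>* (w, d) (v, c'))"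
    unfolding sat.simps(7) sat_OrS[OF finC] gV by auto
  also have "\<dots> \<longleftrightarrow> (\<exists>p. step1 (u, c) p \<and> (silent step1 em)\<^sup>*\<^sup>* p (v, c'))"
    using stp_range by (metis surj_pair)
  also have "\<dots> \<longleftrightarrow> ((u, c), (v, c')) \<in> adj E"
    unfolding E_def by (rule D.emit_edges[OF run(1) assms(1)[unfolded E_def]]) (simp add: l)
  finally have "sat g ?n s (edgef TR (ixc c) (ixc c') \<gamma>) \<longleftrightarrow> inc l = \<gamma> \<and> ((u, c), (v, c')) \<in> adj E"
    unfolding T edgeT_def sat.simps(6) using letter_sat[of ?n 1 inc c' \<gamma>] uc(3) l by simp
  then show ?thesis unfolding gE_out_graph using nodes' l by (auto simp: TR_def)
qed

text \<open>The emitting configurations, in the order of the run, enumerate the output path; the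
  enumeration is injective because a maximal run repeats no configuration.\<close>

theorem out_iso:
  assumes "word_graph lab inc (map (\<lambda>p. the (em p)) E) r"
  shows "graph_iso H r"
proof -
  let ?v = "\<lambda>i. (fst (E ! i), ixc (snd (E ! i)))"
  let ?zs = "map (\<lambda>p. the (em p)) E"
  have dist: "distinct E" using D.det_run_distinct[OF run(1)] unfolding E_def by (rule distinct_filter)
  have EC: "snd p \<in> C" if "p \<in> set E" for p using that ks_valid[of "fst p" "snd p"] unfolding set_E by simp
  have inj: "inj_on ?v {..<length ?zs}"
  proof (rule inj_onI)
    fix i j assume ij: "i \<in> {..<length ?zs}" "j \<in> {..<length ?zs}" "?v i = ?v j"
    then have m: "E ! i \<in> set E" "E ! j \<in> set E" by simp_all
    then have "snd (E ! i) = snd (E ! j)" using ij(3) inj_onD[OF inj_ixc _ EC[OF m(1)] EC[OF m(2)]] by simp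
    then have "E ! i = E ! j" using ij(3) by (simp add: prod_eq_iff)
    then show "i = j" using dist ij(1,2) by (simp add: nth_eq_iff_index_eq)
  qed
  have V: "gV H = ?v ` {..<length ?zs}"
  proof (intro equalityI subsetI)
    fix p assume p: "p \<in> gV H"
    obtain u c' where "p = (u, c')" by (cases p)
    then obtain c where c: "p = (u, ixc c)" "(u, c) \<in> set E" using p nodes by blast
    then obtain i where "i < length E" "E ! i = (u, c)" by (metis in_set_conv_nth)
    then show "p \<in> ?v ` {..<length ?zs}" using c(1) by (intro image_eqI[of _ _ i]) simp_all
  next
    fix p assume "p \<in> ?v ` {..<length ?zs}"
    then obtain i where i: "i < length E" "p = ?v i" by auto
    then have "(fst (E ! i), snd (E ! i)) \<in> set E" by simp
    then show "p \<in> gV H" using nodes i(2) by blast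
  qed
  have ed: "(p, \<gamma>, q) \<in> gE H \<longleftrightarrow> (\<exists>i. p = ?v i \<and> \<gamma> = inc (?zs ! Suc i) \<and> q = ?v (Suc i) \<and> Suc i < length ?zs)" for p \<gamma> q
  proof
    assume e: "(p, \<gamma>, q) \<in> gE H"
    then have "p \<in> gV H" "q \<in> gV H" using gE_out_graph_sub by blast+
    then obtain u c v c' where pq: "p = (u, ixc c)" "q = (v, ixc c')" "(u, c) \<in> set E" "(v, c') \<in> set E"
      using nodes by (metis prod.exhaust)
    have a: "((u, c), (v, c')) \<in> adj E" "\<gamma> = inc (the (em (v, c')))"
      using e edges[OF pq(3,4)] unfolding pq(1,2) by blast+
    then obtain i where "(u, c) = E ! i" "(v, c') = E ! Suc i" "Suc i < length E" unfolding adj_def by blast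
    then show "\<exists>i. p = ?v i \<and> \<gamma> = inc (?zs ! Suc i) \<and> q = ?v (Suc i) \<and> Suc i < length ?zs"
      using pq(1,2) a(2) by (intro exI[of _ i]) (metis fst_conv length_map nth_map snd_conv)
  next
    assume "\<exists>i. p = ?v i \<and> \<gamma> = inc (?zs ! Suc i) \<and> q = ?v (Suc i) \<and> Suc i < length ?zs"
    then obtain i where i: "p = ?v i" "\<gamma> = inc (?zs ! Suc i)" "q = ?v (Suc i)" "Suc i < length E" by auto
    have m: "(fst (E ! i), snd (E ! i)) \<in> set E" "(fst (E ! Suc i), snd (E ! Suc i)) \<in> set E" using i(4) by simp_all
    have "(E ! i, E ! Suc i) \<in> adj E" using i(4) unfolding adj_def by blast
    then show "(p, \<gamma>, q) \<in> gE H"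
      unfolding i(1,3) edges[OF m] using incs' i(2,4) by simp
  qed
  have "gE H = {(?v i, inc (?zs ! Suc i), ?v (Suc i)) | i. Suc i < length ?zs}"
  proof (rule set_eqI)
    fix t :: "(nat \<times> nat) \<times> nat option \<times> nat \<times> nat"
    obtain p \<gamma> q where "t = (p, \<gamma>, q)" by (metis prod.exhaust)
    then show "t \<in> gE H \<longleftrightarrow> t \<in> {(?v i, inc (?zs ! Suc i), ?v (Suc i)) | i. Suc i < length ?zs}"
      using ed[of p \<gamma> q] by simp
  qed
  then have path: "is_path H ?v (\<lambda>i. inc (?zs ! Suc i)) (length ?zs)"
    unfolding is_path_def using V inj by blast
  show ?thesis
  proof (rule path_iso_word[OF path assms])
    show "glab H (?v i) = lab (?zs ! i)" if "i < length ?zs" for i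
      using node_lab[of "fst (E ! i)" "snd (E ! i)"] that by simp
  qed simp
qed

end

end

section \<open>Tapes of relabelled words as concatenations of blocks\<close>

lemma mstep_cong_run:
  assumes "(mstep \<delta> tp b)\<^sup>*\<^sup>* (q, 0, z) c" "0 \<le> b" "\<And>i. 0 \<le> i \<Longrightarrow> i \<le> b \<Longrightarrow> tp i = tp' i"
  shows "(mstep \<delta> tp' b)\<^sup>*\<^sup>* (q, 0, z) c"
  using assms(1)
proof (induction rule: rtranclp_induct)
  case (step c c')
  obtain q1 i1 z1 where c: "c = (q1, i1, z1)" by (metis prod.exhaust)
  have "0 \<le> i1 \<and> i1 \<le> b" by (rule mstep_range[OF step.hyps(1)[unfolded c]]) (use assms(2) in auto)
  then have "tp i1 = tp' i1" using assms(3) by blast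
  then have "mstep \<delta> tp' b c c'" using step.hyps(2) unfolding c mstep_def by auto
  then show ?case using step.IH by simp
qed simp

lemma tape_list: "0 \<le> i \<Longrightarrow> i \<le> int (length u) + 1 \<Longrightarrow> tape u i = (LM # map Sym u @ [RM]) ! nat i"
proof (cases "nat i")
  case 0
  assume "0 \<le> i"
  then show ?thesis using 0 by (simp add: tape_def)
next
  case (Suc j)
  assume i: "0 \<le> i" "i \<le> int (length u) + 1"
  then have "i = 1 + int j" "j \<le> length u" using Suc by linarith+
  then show ?thesis using Suc by (auto simp: tape_def nth_append)
qed

lemma gsm_runs:
  assumes "deterministic M"
  shows "(gstep M u)\<^sup>*\<^sup>* (q, 0, z) c \<longleftrightarrow>
    (mstep (act M) (\<lambda>i. (LM # map Sym u @ [RM]) ! nat i) (int (length (LM # map Sym u @ [RM])) - 1))\<^sup>*\<^sup>* (q, 0, z) c"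
proof -
  have b: "int (length (LM # map Sym u @ [RM])) - 1 = int (length u) + 1" by simp
  show ?thesis unfolding gstep_act[OF assms] b
    using mstep_cong_run[of "act M" "tape u" "int (length u) + 1" q z c "\<lambda>i. (LM # map Sym u @ [RM]) ! nat i"]
      mstep_cong_run[of "act M" "\<lambda>i. (LM # map Sym u @ [RM]) ! nat i" "int (length u) + 1" q z c "tape u"]
      tape_list[of _ u] by auto
qed

lemma act_run_out:
  assumes "wf_gsm M" "(mstep (act M) tp b)\<^sup>*\<^sup>* (q, i, []) (q', i', z)"
  shows "z \<in> lists (outalph M)"
  using assms(2)
proof (induction "(q', i', z)" arbitrary: q' i' z rule: rtranclp_induct)
  case (step c)
  obtain q1 i1 z1 where c: "c = (q1, i1, z1)" by (metis prod.exhaust)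
  from step.hyps(2)[unfolded c] obtain q2 \<alpha> e where *: "act M q1 (tp i1) = Some (q2, \<alpha>, e)"
    "(q', i', z) = (q2, i1 + e, z1 @ \<alpha>)" "0 \<le> i1 + e" "i1 + e \<le> b" by (rule mstepE)
  then show ?case using step.hyps(3)[OF c] act_wf(4)[OF assms(1) *(1)] by simp
qed simp

text \<open>The first block also holds the left marker, the last one \<open>ts\<close> and the right
  marker. For \<open>ed\<close>, \<open>ts\<close> is the letter that replaces the right marker
  before the machine adds its own; for \<open>nd\<close> it is empty. The new letter of the node
  makes every block nonempty.\<close>

definition blk :: "bool \<Rightarrow> bool \<Rightarrow> nat \<Rightarrow> nat list \<Rightarrow> tsym list" where
  "blk f l \<tau> ts = (if f then [LM] else []) @ [Sym \<tau>] @ (if l then map Sym ts @ [RM] else [])"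

lemma concat_blk:
  assumes "0 < length \<tau>s" "\<And>i. i < length \<tau>s \<Longrightarrow> bl i = blk (i = 0) (Suc i = length \<tau>s) (\<tau>s ! i) (ts i)"
  shows "concat (map bl [0..<length \<tau>s]) = LM # map Sym (\<tau>s @ ts (length \<tau>s - 1)) @ [RM]"
proof -
  have "concat (map bl [0..<k]) = (if k = 0 then [] else LM # map Sym (take k \<tau>s))" if "k < length \<tau>s" for k
    using that
  proof (induction k)
    case (Suc k)
    then show ?case using assms(2)[of k] by (simp add: blk_def take_Suc_conv_app_nth hd_conv_nth take_Suc)
  qed simp
  moreover obtain k where k: "length \<tau>s = Suc k" using assms(1) by (cases \<tau>s) auto
  moreover have "\<tau>s = take k \<tau>s @ [\<tau>s ! k]" using k by (simp flip: take_Suc_conv_app_nth)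
  then have "map Sym \<tau>s = map Sym (take k \<tau>s) @ [Sym (\<tau>s ! k)]" by (metis list.simps(8,9) map_append)
  ultimately show ?thesis using assms(2)[of k] by (cases "k = 0") (auto simp: blk_def)
qed

lemma empty_iso: "gV g = {} \<Longrightarrow> closed_graph g \<Longrightarrow> gV h = {} \<Longrightarrow> closed_graph h \<Longrightarrow> graph_iso g h"
  unfolding graph_iso_def closed_graph_def by (auto simp: bij_betw_def)

lemma closed_word_graph: "word_graph lab inc ws g \<Longrightarrow> closed_graph g"
  by (auto simp: word_graph_def closed_graph_def)

text \<open>A triple \<open>(f, a, \<tau>)\<close> in \<open>R1\<close> lets a node with letter
  \<open>a\<close>, which is first iff \<open>f\<close>, receive the letter \<open>\<tau>\<close>,
  and \<open>TS\<close> contains the words that may follow at the right end. Plain and marked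
  relabellings are both of this form.\<close>

locale relab_gsm =
  fixes M :: gsm and ini :: "nat option option" and lab inc :: "nat option \<Rightarrow> nat option"
    and EA NA2 EA2 :: "nat option set" and R1 :: "(bool \<times> nat option \<times> nat) set" and TS :: "nat list set" and eps :: bool
  assumes wfM: "wf_gsm M" and detM: "deterministic M"
    and fins: "finite EA" "finite NA2" "finite EA2" "finite R1" "finite TS"
    and alph: "\<And>z zs i. z \<in> lists (outalph M) \<Longrightarrow> zs = olist ini @ map Some z \<Longrightarrow> i < length zs \<Longrightarrow>
      lab (zs ! i) \<in> NA2 \<and> (0 < i \<longrightarrow> inc (zs ! i) \<in> EA2)"
begin

definition V where
  "V = (\<lambda>((f, a, \<tau>), l, ts). (f, l, a, blk f l \<tau> ts)) ` (R1 \<times> UNIV \<times> TS)"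

definition BS where "BS = (\<lambda>(f, l, a, b). b) ` V"

lemma V_iff: "(f, l, a, b) \<in> V \<longleftrightarrow> (\<exists>\<tau> ts. (f, a, \<tau>) \<in> R1 \<and> ts \<in> TS \<and> b = blk f l \<tau> ts)"
  unfolding V_def by force

sublocale G: gsm_transduction M ini EA BS lab inc NA2 EA2 V eps
proof
  show fV: "finite V" unfolding V_def using fins by simp
  then show "finite BS" unfolding BS_def by simp
  show "b \<noteq> []" if "b \<in> BS" for b using that by (auto simp: BS_def V_def blk_def)
  show "b \<in> BS" if "(f, l, a, b) \<in> V" for f l a b using that unfolding BS_def by force
qed (use wfM fins in auto)

definition rels :: "nat option list \<Rightarrow> nat list \<Rightarrow> bool" where
  "rels ws u \<longleftrightarrow> (\<exists>\<tau>s ts. ts \<in> TS \<and> length \<tau>s = length ws \<and> (\<forall>i<length ws. (i = 0, ws ! i, \<tau>s ! i) \<in> R1) \<and> u = \<tau>s @ ts)"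

definition runs :: "nat list \<Rightarrow> nat list \<Rightarrow> bool" where
  "runs u z \<longleftrightarrow> (\<exists>p. (gstep M u)\<^sup>*\<^sup>* (qin M, 0, []) (qf M, p, z))"

text \<open>The formulas see a letter only through \<open>lab\<close> and \<open>inc\<close>. Among
  the letters that \<open>R1\<close> allows, this has to determine it; at the first node, which has
  no incoming edge, \<open>lab\<close> alone.\<close>

definition letters_ok where
  "letters_ok ws \<longleftrightarrow> (\<forall>i<length ws. \<forall>a \<tau>. (i = 0, a, \<tau>) \<in> R1 \<longrightarrow> lab a = lab (ws ! i) \<longrightarrow>
     i = 0 \<or> inc a = inc (ws ! i) \<longrightarrow> a = ws ! i)"

lemma umach_runs:
  assumes "t = LM # map Sym u @ [RM]"
  shows "(\<exists>p. (mstep (umach M ini) (\<lambda>i. t ! nat i) (int (length t) - 1))\<^sup>*\<^sup>* (Start, 0, []) (Emit (qf M) 0, p, zs)) \<longleftrightarrow>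
    (\<exists>z. zs = olist ini @ map Some z \<and> runs u z)"
proof -
  have "0 \<le> int (length t) - 1" using assms by simp
  from umach_iff[OF wfM this] show ?thesis
    unfolding runs_def gsm_runs[OF detM] assms[symmetric] by blast
qed

lemma runs_out: "runs u z \<Longrightarrow> z \<in> lists (outalph M)"
  unfolding runs_def gsm_runs[OF detM] using act_run_out[OF wfM] by blast

theorem TR_word:
  assumes wg: "word_graph lab inc ws g" "gE g \<subseteq> gV g \<times> EA \<times> gV g" "ws \<noteq> []" "letters_ok ws"
    and valid: "sat g n P G.validF" "sat g n P G.accF"
  shows "\<exists>u z. rels ws u \<and> runs u z \<and>
    (\<forall>r. word_graph lab inc (olist ini @ map Some z) r \<longrightarrow> graph_iso (out_graph G.TR g P) r)"
proof -
  from valid(1)[unfolded G.sat_validF[OF wg(1,2)]]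
  have ex: "\<forall>i<length ws. \<exists>a b. (i = 0, Suc i = length ws, a, b) \<in> V \<and>
     lab a = lab (ws ! i) \<and> (i = 0 \<or> inc a = inc (ws ! i)) \<and> (\<forall>b'\<in>BS. i \<in> P (G.ixb b') \<longleftrightarrow> b' = b)" .
  have "\<forall>i. \<exists>b \<tau> ts. i < length ws \<longrightarrow> (i = 0, ws ! i, \<tau>) \<in> R1 \<and> ts \<in> TS \<and>
     b = blk (i = 0) (Suc i = length ws) \<tau> ts \<and> b \<in> BS \<and> (\<forall>b'\<in>BS. i \<in> P (G.ixb b') \<longleftrightarrow> b' = b)"
  proof
    fix i
    show "\<exists>b \<tau> ts. i < length ws \<longrightarrow> (i = 0, ws ! i, \<tau>) \<in> R1 \<and> ts \<in> TS \<and>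
     b = blk (i = 0) (Suc i = length ws) \<tau> ts \<and> b \<in> BS \<and> (\<forall>b'\<in>BS. i \<in> P (G.ixb b') \<longleftrightarrow> b' = b)"
    proof (cases "i < length ws")
      case True
      obtain a b where ab: "(i = 0, Suc i = length ws, a, b) \<in> V" "lab a = lab (ws ! i)"
        "i = 0 \<or> inc a = inc (ws ! i)" "\<forall>b'\<in>BS. i \<in> P (G.ixb b') \<longleftrightarrow> b' = b" using ex True by blast
      obtain \<tau> ts where ts: "(i = 0, a, \<tau>) \<in> R1" "ts \<in> TS" "b = blk (i = 0) (Suc i = length ws) \<tau> ts"
        using ab(1) unfolding V_iff by blast
      have "a = ws ! i" using wg(4) True ts(1) ab(2,3) unfolding letters_ok_def by blast
      then show ?thesis using ts ab(4) G.VBS[OF ab(1)] by blast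
    qed simp
  qed
  then obtain bl \<tau> ts where bl: "\<And>i. i < length ws \<Longrightarrow> (i = 0, ws ! i, \<tau> i) \<in> R1 \<and> ts i \<in> TS \<and>
     bl i = blk (i = 0) (Suc i = length ws) (\<tau> i) (ts i) \<and> bl i \<in> BS \<and> (\<forall>b'\<in>BS. i \<in> P (G.ixb b') \<longleftrightarrow> b' = bl i)"
    by metis
  have bB: "bl i \<in> BS" and bP: "b' \<in> BS \<Longrightarrow> i \<in> P (G.ixb b') \<longleftrightarrow> b' = bl i" if "i < length ws" for i b'
    using bl[OF that] by blast+
  interpret W: transduction_word M ini EA BS lab inc NA2 EA2 V eps ws g P bl
    by unfold_locales (simp_all add: wg(1-3) bB bP)
  obtain ks where ks: "det_run W.step1 ks" "hd ks = (0, Start, 0)" "fst (snd (last ks)) = Emit (qf M) 0"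
    using valid(2) unfolding W.accF_iff by blast
  let ?\<tau>s = "map \<tau> [0..<length ws]"
  let ?u = "?\<tau>s @ ts (length ws - 1)"
  have t: "concat (map bl [0..<length ws]) = LM # map Sym ?u @ [RM]"
    using concat_blk[of ?\<tau>s bl ts] bl wg(3) by simp
  have rels: "rels ws ?u"
    unfolding rels_def by (intro exI[of _ ?\<tau>s] exI[of _ "ts (length ws - 1)"]) (use bl wg(3) in auto)
  have "\<exists>p. (mstep (umach M ini) W.tp W.bd)\<^sup>*\<^sup>* (Start, 0, []) (Emit (qf M) 0, p, W.outs ks)"
    unfolding W.run_iff using ks by blast
  then obtain z where z: "W.outs ks = olist ini @ map Some z" "runs ?u z"
    unfolding umach_runs[OF t] by blast
  have em: "map (\<lambda>p. the (W.em p)) (W.D.emits ks) = olist ini @ map Some z"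
    using z(1) unfolding W.outs_emits .
  have le: "length (W.D.emits ks) = length (olist ini @ map Some z)" using em by (metis length_map)
  have nth: "the (W.em (W.D.emits ks ! i)) = (olist ini @ map Some z) ! i" if "i < length (W.D.emits ks)" for i
    using nth_map[OF that, of "\<lambda>p. the (W.em p)"] unfolding em by (rule sym)
  have lab: "\<forall>i<length (W.D.emits ks). lab (the (W.em (W.D.emits ks ! i))) \<in> NA2"
    "\<forall>i. Suc i < length (W.D.emits ks) \<longrightarrow> inc (the (W.em (W.D.emits ks ! Suc i))) \<in> EA2"
  proof -
    have "lab (the (W.em (W.D.emits ks ! i))) \<in> NA2 \<and> (0 < i \<longrightarrow> inc (the (W.em (W.D.emits ks ! i))) \<in> EA2)"
      if "i < length (W.D.emits ks)" for i
      unfolding nth[OF that] by (rule alph[OF runs_out[OF z(2)] refl that[unfolded le]])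
    then show "\<forall>i<length (W.D.emits ks). lab (the (W.em (W.D.emits ks ! i))) \<in> NA2"
      "\<forall>i. Suc i < length (W.D.emits ks) \<longrightarrow> inc (the (W.em (W.D.emits ks ! Suc i))) \<in> EA2" by blast+
  qed
  have "graph_iso (out_graph G.TR g P) r" if "word_graph lab inc (olist ini @ map Some z) r" for r
    by (rule W.out_iso[OF ks(1,2) lab]) (use that em in \<open>simp only: W.E_def[OF ks(1,2) lab]\<close>)
  then show ?thesis using rels z(2) by blast
qed

theorem TR_complete:
  assumes wg: "word_graph lab inc ws g" "gE g \<subseteq> gV g \<times> EA \<times> gV g" "ws \<noteq> []"
    and u: "rels ws u" "runs u z"
  shows "\<exists>h\<in>outputs G.TR g. \<forall>r. word_graph lab inc (olist ini @ map Some z) r \<longrightarrow> graph_iso h r"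
proof -
  obtain \<tau>s ts where ts: "ts \<in> TS" "length \<tau>s = length ws" "\<And>i. i < length ws \<Longrightarrow> (i = 0, ws ! i, \<tau>s ! i) \<in> R1" "u = \<tau>s @ ts"
    using u(1) unfolding rels_def by blast
  \<comment> \<open>The same \<open>ts\<close> is passed at every position; \<open>blk\<close>
    inserts it only into the last block.\<close>
  define bl where "bl i = blk (i = 0) (Suc i = length ws) (\<tau>s ! i) ts" for i
  have blV: "(i = 0, Suc i = length ws, ws ! i, bl i) \<in> V" if "i < length ws" for i
    unfolding V_iff bl_def using ts(1) ts(3)[OF that] by blast
  define P where "P X = {i. i < length ws \<and> X = G.ixb (bl i)}" for X
  have P: "i \<in> P (G.ixb b) \<longleftrightarrow> b = bl i" if "i < length ws" "b \<in> BS" for i b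
    using that G.inj_ixb G.VBS[OF blV[OF that(1)]] by (auto simp: P_def inj_on_def)
  interpret W: transduction_word M ini EA BS lab inc NA2 EA2 V eps ws g P bl
    by unfold_locales (simp_all add: wg(1-3) G.VBS[OF blV] P)
  have t: "concat (map bl [0..<length ws]) = LM # map Sym u @ [RM]"
    using concat_blk[of \<tau>s bl "\<lambda>_. ts"] wg(3) ts(2,4) by (simp add: bl_def)
  have "\<exists>p. (mstep (umach M ini) W.tp W.bd)\<^sup>*\<^sup>* (Start, 0, []) (Emit (qf M) 0, p, olist ini @ map Some z)"
    unfolding umach_runs[OF t] using u(2) by blast
  then obtain ks where ks: "det_run W.step1 ks" "hd ks = (0, Start, 0)" "fst (snd (last ks)) = Emit (qf M) 0"
    "olist ini @ map Some z = W.outs ks"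
    unfolding W.run_iff by blast
  have em: "map (\<lambda>p. the (W.em p)) (W.D.emits ks) = olist ini @ map Some z"
    using ks(4) unfolding W.outs_emits by simp
  have le: "length (W.D.emits ks) = length (olist ini @ map Some z)" using em by (metis length_map)
  have nth: "the (W.em (W.D.emits ks ! i)) = (olist ini @ map Some z) ! i" if "i < length (W.D.emits ks)" for i
    using nth_map[OF that, of "\<lambda>p. the (W.em p)"] unfolding em by (rule sym)
  have lab: "\<forall>i<length (W.D.emits ks). lab (the (W.em (W.D.emits ks ! i))) \<in> NA2"
    "\<forall>i. Suc i < length (W.D.emits ks) \<longrightarrow> inc (the (W.em (W.D.emits ks ! Suc i))) \<in> EA2"
  proof -
    have "lab (the (W.em (W.D.emits ks ! i))) \<in> NA2 \<and> (0 < i \<longrightarrow> inc (the (W.em (W.D.emits ks ! i))) \<in> EA2)"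
      if "i < length (W.D.emits ks)" for i
      unfolding nth[OF that] by (rule alph[OF runs_out[OF u(2)] refl that[unfolded le]])
    then show "\<forall>i<length (W.D.emits ks). lab (the (W.em (W.D.emits ks ! i))) \<in> NA2"
      "\<forall>i. Suc i < length (W.D.emits ks) \<longrightarrow> inc (the (W.em (W.D.emits ks ! Suc i))) \<in> EA2" by blast+
  qed
  have iso: "graph_iso (out_graph G.TR g P) r" if "word_graph lab inc (olist ini @ map Some z) r" for r
    by (rule W.out_iso[OF ks(1,2) lab]) (use that em in \<open>simp only: W.E_def[OF ks(1,2) lab]\<close>)
  have "sat g n P G.validF" for n
    unfolding G.sat_validF[OF wg(1,2)] using blV P by blast
  moreover have "sat g n P G.accF" for n unfolding W.accF_iff using ks by blast
  moreover have "sat g n P (wordF EA)" for n using sat_wordF_word[OF wg(1,3) fins(1) wg(2)] .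
  ultimately have "sat g (\<lambda>_. undefined) P (tdom G.TR)" by (simp add: G.TR_def G.domT_def)
  moreover have "\<forall>X. P X \<subseteq> gV g" unfolding W.gV P_def by auto
  ultimately have "out_graph G.TR g P \<in> outputs G.TR g"
    unfolding outputs_def mem_Collect_eq by (intro exI[of _ P] conjI refl)
  then show ?thesis using iso by blast
qed

end

text \<open>\<open>m_iff\<close> describes \<open>m\<close> wherever the input graph has a node. The
  empty graph, which arises only when \<open>ini\<close> is \<open>None\<close>, is governed by the
  two conditions on \<open>eps\<close> and the empty word.\<close>

locale relab_transducer = relab_gsm +
  fixes rep :: "nat list \<Rightarrow> nat graph" and NA :: "nat option set" and S1 :: "nat set" and m :: "(nat list \<times> nat list) set"
  assumes rep: "word_graph lab inc (olist ini @ map Some w) (rep w)"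
    and repE: "w \<in> lists S1 \<Longrightarrow> gE (rep w) \<subseteq> gV (rep w) \<times> EA \<times> gV (rep w)"
    and wordg: "\<And>(g :: nat graph) n s. graph_over NA EA g \<Longrightarrow> sat g n s (wordF EA) \<Longrightarrow>
       \<exists>w\<in>lists S1. graph_iso g (rep w) \<and> olist ini @ map Some w \<noteq> []"
    and lett: "w \<in> lists S1 \<Longrightarrow> letters_ok (olist ini @ map Some w)"
    and m_iff: "olist ini @ map Some w \<noteq> [] \<Longrightarrow> (w, z) \<in> m \<longleftrightarrow>
       w \<in> lists S1 \<and> (\<exists>u. rels (olist ini @ map Some w) u \<and> runs u z)"
    and eps_iff: "eps \<longleftrightarrow> ini = None \<and> ([], []) \<in> m"
    and eps_out: "ini = None \<Longrightarrow> ([], z) \<in> m \<Longrightarrow> z = []"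
begin

lemma rep_empty: "ini = None \<Longrightarrow> gV (rep []) = {} \<and> closed_graph (rep [])"
  using rep[of "[]"] closed_word_graph[OF rep] by (simp add: word_graph_def olist_def)

lemma out_graph_empty: "gV g = {} \<Longrightarrow> gV (out_graph G.TR g P) = {}"
  by (auto simp: out_nodes_def)

theorem outputs_sound:
  fixes g :: "nat graph"
  assumes g: "graph_over NA EA g" and h: "h \<in> outputs G.TR g"
  shows "\<exists>w z. (w, z) \<in> m \<and> graph_iso g (rep w) \<and> graph_iso h (rep z)"
proof -
  obtain P where P: "h = out_graph G.TR g P" "\<forall>i. P i \<subseteq> gV g" "sat g (\<lambda>_. undefined) P (tdom G.TR)"
    using h unfolding outputs_def mem_Collect_eq by (elim exE conjE)
  have cl: "closed_graph g" using g by (auto simp: graph_over_def closed_graph_def)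
  have dom: "sat g (\<lambda>_. undefined) P G.domT" using P(3) by (simp add: G.TR_def)
  then consider "eps" "gV g = {}" | "sat g (\<lambda>_. undefined) P (wordF EA)"
    unfolding G.domT_def by auto
  then show ?thesis
  proof cases
    case 1
    have e: "ini = None" "([], []) \<in> m" using eps_iff 1(1) by simp_all
    have "graph_iso g (rep [])" by (rule empty_iso[OF 1(2) cl]) (use rep_empty[OF e(1)] in simp_all)
    moreover have "graph_iso h (rep [])" unfolding P(1)
      by (rule empty_iso[OF out_graph_empty[OF 1(2)] closed_out_graph]) (use rep_empty[OF e(1)] in simp_all)
    ultimately show ?thesis using e(2) by blast
  next
    case 2
    from wordg[OF g 2] obtain w where w: "w \<in> lists S1" "graph_iso g (rep w)" "olist ini @ map Some w \<noteq> []" by blast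
    obtain f where f: "is_iso f g (rep w)" using w(2) unfolding graph_iso_iff by blast
    \<comment> \<open>The parameters are moved along the isomorphism to the standard graph of
      \<open>w\<close>, where \<open>TR_word\<close> applies.\<close>
    let ?P = "\<lambda>X. f ` P X"
    note iso = outputs_iso[OF f cl G.wf_TR P(2)]
    have "sat (rep w) (\<lambda>_. undefined) ?P (tdom G.TR)" using iso(2) P(3) by blast
    moreover have "gV (rep w) \<noteq> {}" using rep[of w] w(3) by (auto simp: word_graph_def)
    ultimately have "sat (rep w) (\<lambda>_. undefined) ?P G.validF" "sat (rep w) (\<lambda>_. undefined) ?P G.accF"
      by (auto simp: G.TR_def G.domT_def)
    from TR_word[OF rep repE[OF w(1)] w(3) lett[OF w(1)] this] obtain u z where
      u: "rels (olist ini @ map Some w) u" "runs u z" and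
      r: "\<And>r. word_graph lab inc (olist ini @ map Some z) r \<Longrightarrow> graph_iso (out_graph G.TR (rep w) ?P) r" by blast
    have "(w, z) \<in> m" using m_iff[OF w(3)] w(1) u by blast
    moreover have "graph_iso h (out_graph G.TR (rep w) ?P)" unfolding P(1) graph_iso_iff using iso(1) by blast
    ultimately show ?thesis using w(2) r[OF rep] graph_iso_trans by blast
  qed
qed

theorem outputs_complete:
  assumes "(w, z) \<in> m"
  shows "\<exists>h\<in>outputs G.TR (rep w). graph_iso h (rep z)"
proof (cases "olist ini @ map Some w = []")
  case False
  then obtain u where u: "w \<in> lists S1" "rels (olist ini @ map Some w) u" "runs u z"
    using m_iff[OF False] assms by blast
  from TR_complete[OF rep repE[OF u(1)] False u(2,3)] rep show ?thesis by blast
next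
  case True
  then have w: "w = []" "ini = None" by (auto simp: olist_def split: option.splits)
  then have z: "z = []" "eps" using eps_out eps_iff assms by blast+
  note e = rep_empty[OF w(2)]
  have "sat (rep []) (\<lambda>_. undefined) (\<lambda>_. {}) G.domT"
    unfolding G.domT_def using z(2) e by simp
  moreover have "tdom G.TR = G.domT" by (simp add: G.TR_def)
  ultimately have dom: "sat (rep []) (\<lambda>_. undefined) (\<lambda>_. {}) (tdom G.TR)" by (simp only:)
  have "out_graph G.TR (rep []) (\<lambda>_. {}) \<in> outputs G.TR (rep [])"
    unfolding outputs_def mem_Collect_eq
    by (intro exI[of _ "\<lambda>_. {}"] conjI refl dom) simp
  moreover have "graph_iso (out_graph G.TR (rep []) (\<lambda>_. {})) (rep [])"
    by (rule empty_iso[OF out_graph_empty closed_out_graph]) (use e in simp_all)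
  ultimately show ?thesis unfolding w(1) z(1) by blast
qed

end

section \<open>The two inclusions from machines to logic\<close>

lemma realized_runs:
  assumes "wf_gsm M"
  shows "(u, z) \<in> realized M \<longleftrightarrow> u \<in> lists (inalph M) \<and> (\<exists>p. (gstep M u)\<^sup>*\<^sup>* (qin M, 0, []) (qf M, p, z))"
  by (simp add: realized_def)

theorem NMSO_nd_sup:
  assumes "m \<in> REL \<circ>\<^sub>F DGSM_eps"
  shows "m \<in> NMSO_nd"
proof -
  obtain R M where R: "finite (R :: (nat \<times> nat) set)" and M: "wf_gsm M" "deterministic M"
    and eps: "\<And>z. ([], z) \<in> realized M \<Longrightarrow> z = []" and m: "m = relabel R O realized M"
    using assms unfolding fam_comp_def REL_def DGSM_eps_def DGSM_def by auto
  \<comment> \<open>\<open>realized\<close> admits only inputs over \<open>inalph M\<close>, so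
    letters outside this alphabet are removed from the relabelling.\<close>
  let ?R = "{(a, \<tau>). (a, \<tau>) \<in> R \<and> \<tau> \<in> inalph M}"
  define R1 where "R1 = (\<lambda>(f, a, \<tau>). (f :: bool, Some a, \<tau>)) ` (UNIV \<times> ?R)"
  have R1: "(f, a, \<tau>) \<in> R1 \<longleftrightarrow> (\<exists>a'. a = Some a' \<and> (a', \<tau>) \<in> R \<and> \<tau> \<in> inalph M)" for f a \<tau>
    unfolding R1_def by force
  have finR: "finite ?R" by (rule finite_subset[OF _ R]) blast
  have fins: "finite (outalph M)" using M(1) by (simp add: wf_gsm_def)
  \<comment> \<open>Nothing is emitted at the start and nothing is inserted before the right marker;
    the empty graph is in the domain iff the empty word is mapped to itself.\<close>
  interpret X: relab_gsm M None id "\<lambda>_. None" "{None}" "Some ` outalph M" "{None}" R1 "{[]}" "([], []) \<in> m"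
  proof
    show "finite R1" unfolding R1_def using finR by simp
    show "id (zs ! i) \<in> Some ` outalph M \<and> (0 < i \<longrightarrow> None \<in> {None})"
      if "z \<in> lists (outalph M)" "zs = olist None @ map Some z" "i < length zs" for z zs i
      using that by (auto simp: olist_def in_lists_conv_set)
  qed (use M fins in simp_all)
  have rels: "X.rels (map Some w) u \<longleftrightarrow> (w, u) \<in> relabel R \<and> u \<in> lists (inalph M)" for w u
    unfolding X.rels_def relabel_def list_all2_conv_all_nth R1 in_lists_conv_set all_set_conv_all_nth by auto
  define S1 where "S1 = fst ` R"
  have S1: "finite S1" unfolding S1_def using R by simp
  have rel_S1: "w \<in> lists S1" if "(w, u) \<in> relabel R" for w u
    using that unfolding relabel_def S1_def by (force simp: list_all2_conv_all_nth in_lists_conv_set in_set_conv_nth)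
  have m_runs: "(w, z) \<in> m \<longleftrightarrow> (\<exists>u. X.rels (map Some w) u \<and> X.runs u z)" for w z
  proof -
    have "(w, z) \<in> m \<longleftrightarrow> (\<exists>u. (w, u) \<in> relabel R \<and> (u, z) \<in> realized M)" unfolding m by blast
    then show ?thesis unfolding rels X.runs_def realized_runs[OF M(1)] by blast
  qed
  interpret Y: relab_transducer M None id "\<lambda>_. None" "{None}" "Some ` outalph M" "{None}" R1 "{[]}" "([], []) \<in> m"
    nd "Some ` S1" S1 m
  proof
    show "word_graph id (\<lambda>_. None) (olist None @ map Some w) (nd w)" for w
      using word_graph_nd by (simp add: olist_def)
    show "gE (nd w) \<subseteq> gV (nd w) \<times> {None} \<times> gV (nd w)" for w by (auto simp: nd_def)
    show "\<exists>w\<in>lists S1. graph_iso g (nd w) \<and> olist None @ map Some w \<noteq> []"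
      if "graph_over (Some ` S1) {None} g" "sat g n s (wordF {None})" for g :: "nat graph" and n s
      using wordF_nd[OF that(1) S1 that(2)] by (simp add: olist_def)
    show "X.letters_ok (olist None @ map Some w)" for w
      by (simp add: X.letters_ok_def)
    show "(w, z) \<in> m \<longleftrightarrow> w \<in> lists S1 \<and> (\<exists>u. X.rels (olist None @ map Some w) u \<and> X.runs u z)" for w z
    proof -
      have "olist None @ map Some w = map Some w" by (simp add: olist_def)
      then show ?thesis using m_runs rels rel_S1 by metis
    qed
    \<comment> \<open>The empty word is relabelled only to itself, so this is the restriction that
      defines \<open>DGSM_eps\<close>.\<close>
    show "z = []" if "([], z) \<in> m" for z
      using that eps unfolding m relabel_def by auto
  qed simp
  have "m \<subseteq> lists S1 \<times> lists (outalph M)"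
  proof
    fix p assume p: "p \<in> m"
    obtain w z where wz: "p = (w, z)" by (cases p)
    then show "p \<in> lists S1 \<times> lists (outalph M)"
      using p m_runs[of w z] rels rel_S1 X.runs_out by blast
  qed
  then show ?thesis
    unfolding NMSO_nd_def NMSO_via_def mem_Collect_eq
    using S1 fins X.G.wf_TR Y.outputs_sound Y.outputs_complete
    by (intro exI[of _ S1] exI[of _ "outalph M"] exI[of _ X.G.TR]) (auto simp: X.G.TR_def)
qed

theorem NMSO_ed_sup:
  assumes "m \<in> MREL \<circ>\<^sub>F DGSM"
  shows "m \<in> NMSO_ed"
proof -
  obtain R M where R: "finite (R :: (tsym \<times> nat) set)" and M: "wf_gsm M" "deterministic M"
    and m: "m = {(w, z). ([LM] @ map Sym w @ [RM], z) \<in> relabel R} O realized M"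
    using assms unfolding fam_comp_def MREL_def DGSM_def by auto
  let ?R = "{(s, \<tau>). (s, \<tau>) \<in> R \<and> \<tau> \<in> inalph M}"
  have finR: "finite ?R" by (rule finite_subset[OF _ R]) blast
  define dt :: "tsym \<Rightarrow> nat option" where "dt s = (case s of Sym a \<Rightarrow> Some a | _ \<Rightarrow> None)" for s
  \<comment> \<open>The replacement of the left marker becomes the new letter of the first node,
    which carries \<open>None\<close>.\<close>
  define R1 where "R1 = (\<lambda>(s, \<tau>). (s = LM, dt s, \<tau>)) ` {(s, \<tau>). (s, \<tau>) \<in> ?R \<and> s \<noteq> RM}"
  \<comment> \<open>The replacement of the right marker has no node of its own and is appended to
    the last block.\<close>
  define TS where "TS = (\<lambda>(s, \<tau>). [\<tau>]) ` {(s, \<tau>). (s, \<tau>) \<in> ?R \<and> s = RM}"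
  define S1 where "S1 = (\<lambda>(s, \<tau>). the (dt s)) ` R"
  have R1_True: "(True, a, \<tau>) \<in> R1 \<longleftrightarrow> a = None \<and> (LM, \<tau>) \<in> ?R" for a \<tau>
    unfolding R1_def dt_def by force
  have R1_False: "(False, a, \<tau>) \<in> R1 \<longleftrightarrow> (\<exists>a'. a = Some a' \<and> (Sym a', \<tau>) \<in> ?R)" for a \<tau>
  proof
    assume "(False, a, \<tau>) \<in> R1"
    then obtain s where "(s, \<tau>) \<in> ?R" "s \<noteq> RM" "s \<noteq> LM" "a = dt s" unfolding R1_def by auto
    then show "\<exists>a'. a = Some a' \<and> (Sym a', \<tau>) \<in> ?R" by (cases s) (auto simp: dt_def)
  next
    assume "\<exists>a'. a = Some a' \<and> (Sym a', \<tau>) \<in> ?R"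
    then show "(False, a, \<tau>) \<in> R1" unfolding R1_def dt_def by force
  qed
  have TS: "ts \<in> TS \<longleftrightarrow> (\<exists>\<tau>. ts = [\<tau>] \<and> (RM, \<tau>) \<in> ?R)" for ts
    unfolding TS_def by force
  have S1: "finite S1" unfolding S1_def using R by simp
  have fins: "finite (outalph M)" using M(1) by (simp add: wf_gsm_def)
  \<comment> \<open>The initial letter \<open>None\<close> accounts for the first output node, which
    no letter of the output reaches; the empty graph is excluded since every \<open>ed\<close> graph
    has a node.\<close>
  interpret X: relab_gsm M "Some None" "\<lambda>_. None" id "Some ` S1" "{None}" "Some ` outalph M" R1 TS False
  proof
    have "finite {(s, \<tau>). (s, \<tau>) \<in> ?R \<and> s \<noteq> RM}" by (rule finite_subset[OF _ R]) blast
    then show "finite R1" unfolding R1_def by (rule finite_imageI)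
    have "finite {(s, \<tau>). (s, \<tau>) \<in> ?R \<and> s = RM}" by (rule finite_subset[OF _ R]) blast
    then show "finite TS" unfolding TS_def by (rule finite_imageI)
    show "None \<in> {None} \<and> (0 < i \<longrightarrow> id (zs ! i) \<in> Some ` outalph M)"
      if "z \<in> lists (outalph M)" "zs = olist (Some None) @ map Some z" "i < length zs" for z zs i
      using that by (cases i) (auto simp: olist_def in_lists_conv_set)
  qed (use M fins S1 in simp_all)
  have rels: "X.rels (None # map Some w) u \<longleftrightarrow> ([LM] @ map Sym w @ [RM], u) \<in> relabel R \<and> u \<in> lists (inalph M)" for w u
  proof -
    let ?ss = "LM # map Sym w"
    have *: "(i = 0, (None # map Some w) ! i, \<tau>) \<in> R1 \<longleftrightarrow> (?ss ! i, \<tau>) \<in> ?R" if "i < length ?ss" for i \<tau>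
      using that by (cases i) (simp_all add: R1_True R1_False)
    have "X.rels (None # map Some w) u \<longleftrightarrow> (\<exists>\<tau>s \<tau>. (RM, \<tau>) \<in> ?R \<and> list_all2 (\<lambda>s \<tau>. (s, \<tau>) \<in> ?R) ?ss \<tau>s \<and> u = \<tau>s @ [\<tau>])"
    proof
      assume "X.rels (None # map Some w) u"
      then obtain \<tau>s \<tau> where "(RM, \<tau>) \<in> ?R" "length \<tau>s = length (None # map Some w)" "u = \<tau>s @ [\<tau>]"
        "\<forall>i<length (None # map Some w). (i = 0, (None # map Some w) ! i, \<tau>s ! i) \<in> R1"
        unfolding X.rels_def TS by blast
      then show "\<exists>\<tau>s \<tau>. (RM, \<tau>) \<in> ?R \<and> list_all2 (\<lambda>s \<tau>. (s, \<tau>) \<in> ?R) ?ss \<tau>s \<and> u = \<tau>s @ [\<tau>]"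
        using * by (intro exI[of _ \<tau>s] exI[of _ \<tau>]) (simp add: list_all2_conv_all_nth)
    next
      assume "\<exists>\<tau>s \<tau>. (RM, \<tau>) \<in> ?R \<and> list_all2 (\<lambda>s \<tau>. (s, \<tau>) \<in> ?R) ?ss \<tau>s \<and> u = \<tau>s @ [\<tau>]"
      then obtain \<tau>s \<tau> where "(RM, \<tau>) \<in> ?R" "list_all2 (\<lambda>s \<tau>. (s, \<tau>) \<in> ?R) ?ss \<tau>s" "u = \<tau>s @ [\<tau>]" by blast
      then show "X.rels (None # map Some w) u"
        unfolding X.rels_def TS using * by (intro exI[of _ \<tau>s] exI[of _ "[\<tau>]"]) (simp add: list_all2_conv_all_nth)
    qed
    also have "\<dots> \<longleftrightarrow> list_all2 (\<lambda>s \<tau>. (s, \<tau>) \<in> ?R) (?ss @ [RM]) u"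
    proof
      assume "\<exists>\<tau>s \<tau>. (RM, \<tau>) \<in> ?R \<and> list_all2 (\<lambda>s \<tau>. (s, \<tau>) \<in> ?R) ?ss \<tau>s \<and> u = \<tau>s @ [\<tau>]"
      then obtain \<tau>s \<tau> where "(RM, \<tau>) \<in> ?R" "list_all2 (\<lambda>s \<tau>. (s, \<tau>) \<in> ?R) ?ss \<tau>s" "u = \<tau>s @ [\<tau>]" by blast
      then show "list_all2 (\<lambda>s \<tau>. (s, \<tau>) \<in> ?R) (?ss @ [RM]) u"
        unfolding \<open>u = \<tau>s @ [\<tau>]\<close> by (intro list_all2_appendI) simp_all
    next
      assume "list_all2 (\<lambda>s \<tau>. (s, \<tau>) \<in> ?R) (?ss @ [RM]) u"
      then obtain \<tau>s ts where u: "u = \<tau>s @ ts" "list_all2 (\<lambda>s \<tau>. (s, \<tau>) \<in> ?R) ?ss \<tau>s" "list_all2 (\<lambda>s \<tau>. (s, \<tau>) \<in> ?R) [RM] ts"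
        unfolding list_all2_append1[of _ ?ss] by blast
      moreover obtain \<tau> where "ts = [\<tau>]" "(RM, \<tau>) \<in> ?R" using u(3) by (auto simp: list_all2_Cons1)
      ultimately show "\<exists>\<tau>s \<tau>. (RM, \<tau>) \<in> ?R \<and> list_all2 (\<lambda>s \<tau>. (s, \<tau>) \<in> ?R) ?ss \<tau>s \<and> u = \<tau>s @ [\<tau>]" by blast
    qed
    also have "\<dots> \<longleftrightarrow> list_all2 (\<lambda>s \<tau>. (s, \<tau>) \<in> R) (?ss @ [RM]) u \<and> u \<in> lists (inalph M)"
      unfolding list_all2_conv_all_nth in_lists_conv_set all_set_conv_all_nth by auto
    finally show ?thesis by (simp add: relabel_def)
  qed
  have rel_S1: "w \<in> lists S1" if "([LM] @ map Sym w @ [RM], u) \<in> relabel R" for w u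
  proof -
    have "list_all2 (\<lambda>s \<tau>. (s, \<tau>) \<in> R) ([LM] @ map Sym w @ [RM]) u" using that by (simp add: relabel_def)
    then have "\<forall>s\<in>set ([LM] @ map Sym w @ [RM]). \<exists>\<tau>. (s, \<tau>) \<in> R"
      by (induction rule: list_all2_induct) auto
    then have "\<forall>a\<in>set w. \<exists>\<tau>. (Sym a, \<tau>) \<in> R" by simp
    then show ?thesis unfolding S1_def in_lists_conv_set by (force simp: dt_def)
  qed
  have m_runs: "(w, z) \<in> m \<longleftrightarrow> (\<exists>u. X.rels (None # map Some w) u \<and> X.runs u z)" for w z
  proof -
    have "(w, z) \<in> m \<longleftrightarrow> (\<exists>u. ([LM] @ map Sym w @ [RM], u) \<in> relabel R \<and> (u, z) \<in> realized M)" unfolding m by auto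
    then show ?thesis unfolding rels X.runs_def realized_runs[OF M(1)] by blast
  qed
  interpret Y: relab_transducer M "Some None" "\<lambda>_. None" id "Some ` S1" "{None}" "Some ` outalph M" R1 TS False
    ed "{None}" S1 m
  proof
    show "word_graph (\<lambda>_. None) id (olist (Some None) @ map Some w) (ed w)" for w
      using word_graph_ed by (simp add: olist_def)
    show "gE (ed w) \<subseteq> gV (ed w) \<times> Some ` S1 \<times> gV (ed w)" if "w \<in> lists S1" for w
      using that by (auto simp: ed_def in_lists_conv_set)
    show "\<exists>w\<in>lists S1. graph_iso g (ed w) \<and> olist (Some None) @ map Some w \<noteq> []"
      if "graph_over {None} (Some ` S1) g" "sat g n s (wordF (Some ` S1))" for g :: "nat graph" and n s
      using wordF_ed[OF that(1) S1 that(2)] by (simp add: olist_def)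
    show "X.letters_ok (olist (Some None) @ map Some w)" for w
      unfolding X.letters_ok_def olist_def by (auto simp: R1_True)
    show "(w, z) \<in> m \<longleftrightarrow> w \<in> lists S1 \<and> (\<exists>u. X.rels (olist (Some None) @ map Some w) u \<and> X.runs u z)" for w z
    proof -
      have "olist (Some None) @ map Some w = None # map Some w" by (simp add: olist_def)
      then show ?thesis using m_runs rels rel_S1 by metis
    qed
  qed simp_all
  have "m \<subseteq> lists S1 \<times> lists (outalph M)"
  proof
    fix p assume p: "p \<in> m"
    obtain w z where wz: "p = (w, z)" by (cases p)
    then show "p \<in> lists S1 \<times> lists (outalph M)"
      using p m_runs[of w z] rels rel_S1 X.runs_out by blast
  qed
  then show ?thesis
    unfolding NMSO_ed_def NMSO_via_def mem_Collect_eq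
    using S1 fins X.G.wf_TR Y.outputs_sound Y.outputs_complete
    by (intro exI[of _ S1] exI[of _ "outalph M"] exI[of _ X.G.TR]) (auto simp: X.G.TR_def)
qed

theorem theorem5p8:
  shows "NMSO_ed = MREL \<circ>\<^sub>F DGSM \<and> NMSO_nd = REL \<circ>\<^sub>F DGSM_eps"
proof
  show "NMSO_ed = MREL \<circ>\<^sub>F DGSM" using NMSO_ed_sub NMSO_ed_sup by blast
  show "NMSO_nd = REL \<circ>\<^sub>F DGSM_eps" using NMSO_nd_sub NMSO_nd_sup by blast
qed

end
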